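(* For every finite time $T>0$ and every $\varepsilon>0$ there is a constant $C_T>0$ (which may depend on $\varepsilon$), independent of $j$, $k$ and $\phi^{(k+1)}$, such that for all $k\geqslant 1$, all $1\leqslant j\leqslant k$ and all $\phi^{(k+1)}$ (functions of $(\mathbf{y}_{k+1},\mathbf{y}_{k+1}')\in\mathbb{R}^{k+1}\times\mathbb{R}^{k+1}$, independent of time), $$\left\|R_\varepsilon^{(k)}B_{j,k+1}U^{(k+1)}(\tau)\phi^{(k+1)}\right\|_{L_T^2L^2_{\mathbf{y},\mathbf{y}'}}\leqslant C_T\left\|R_\varepsilon^{(k+1)}\phi^{(k+1)}\right\|_{L^2_{\mathbf{y},\mathbf{y}'}} .$$ This estimate is optimal in the sense that it fails (no finite constant works for all $\phi^{(k+1)}$) whenever $T=\infty$ (for any $\varepsilon\geqslant 0$) or $\varepsilon=0$ (including for finite $T$).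
   Context: All variables $y_j,y_j'$ are in $\mathbb{R}$; $\mathbf{y}_k=(y_1,\dots,y_k)$, $\mathbf{y}_k'=(y_1',\dots,y_k')$; $\langle\partial\rangle=(1-\partial^2)^{1/2}$. Define $$U^{(k)}(\tau)=\prod_{j=1}^k e^{i\tau\partial_{y_j}^2}e^{-i\tau\partial_{y_j'}^2},\qquad R_\varepsilon^{(k)}=\prod_{j=1}^k\langle\partial_{y_j}\rangle^\varepsilon\langle\partial_{y_j'}\rangle^\varepsilon .$$ The collision operator is $B_{j,k+1}u^{(k+1)}=\operatorname{Tr}_{k+1}\left[\delta(y_j-y_{k+1}),u^{(k+1)}\right]$, i.e. on kernels $$(B_{j,k+1}u^{(k+1)})(\mathbf{y}_k;\mathbf{y}_k')=u^{(k+1)}(\mathbf{y}_k,y_j;\mathbf{y}_k',y_j)-u^{(k+1)}(\mathbf{y}_k,y_j';\mathbf{y}_k',y_j').$$ $L_T^2$ denotes $L^2$ in the time variable $\tau\in[0,T]$ ($\tau\in[0,\infty)$ if $T=\infty$), and $L^2_{\mathbf{y},\mathbf{y}'}$ denotes $L^2$ in all the spatial variables. *)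

theory Defs
  imports "HOL-Analysis.Analysis"
begin

text \<open>
  The number of particles is quantified inside the statement (the constant must not depend on it),
  so the point \<open>(y\<^sub>1,\<dots>,y\<^sub>n; y'\<^sub>1,\<dots>,y'\<^sub>n)\<close> is a pair of functions on \<open>{1..n}\<close>, in the extensional
  representation used by the product measure \<open>Pi\<^sub>M\<close>.
\<close>

type_synonym point = "(nat \<Rightarrow> real) \<times> (nat \<Rightarrow> real)"
type_synonym kernel = "point \<Rightarrow> complex"

definition config :: "nat \<Rightarrow> point measure" where
  "config n = Pi\<^sub>M {1..n} (\<lambda>_. lborel) \<Otimes>\<^sub>M Pi\<^sub>M {1..n} (\<lambda>_. lborel)"


subsection \<open>Schwartz functions\<close>

text \<open>\<open>Inl i\<close> is the coordinate \<open>y\<^sub>i\<close> and \<open>Inr i\<close> is the coordinate \<open>y'\<^sub>i\<close>.\<close>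

fun coord :: "nat + nat \<Rightarrow> point \<Rightarrow> real" where
  "coord (Inl i) (y, y') = y i"
| "coord (Inr i) (y, y') = y' i"

fun upd :: "nat + nat \<Rightarrow> real \<Rightarrow> point \<Rightarrow> point" where
  "upd (Inl i) t (y, y') = (y(i := t), y')"
| "upd (Inr i) t (y, y') = (y, y'(i := t))"

definition partial_deriv :: "nat + nat \<Rightarrow> kernel \<Rightarrow> kernel" where
  "partial_deriv c \<phi> p = vector_derivative (\<lambda>t. \<phi> (upd c t p)) (at (coord c p))"

text \<open>
  Smoothness is expressed by the existence of all iterated partial derivatives; together with the
  bounds on all of them this makes every one of them Lipschitz, hence continuous.
\<close>

definition schwartz :: "nat \<Rightarrow> kernel \<Rightarrow> bool" where
  "schwartz n \<phi> \<longleftrightarrow>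
     (\<forall>cs \<in> lists ({1..n} <+> {1..n}).
        (\<forall>c \<in> {1..n} <+> {1..n}. \<forall>p \<in> space (config n).
           (\<lambda>t. foldr partial_deriv cs \<phi> (upd c t p)) differentiable at (coord c p)) \<and>
        (\<forall>N::nat. \<exists>A::real. \<forall>p \<in> space (config n).
           (1 + (\<Sum>c \<in> {1..n} <+> {1..n}. (coord c p)\<^sup>2)) ^ N * norm (foldr partial_deriv cs \<phi> p) \<le> A))"


subsection \<open>Fourier multipliers\<close>

fun pairing :: "nat \<Rightarrow> point \<Rightarrow> point \<Rightarrow> real" where
  "pairing n (\<xi>, \<xi>') (y, y') = (\<Sum>i=1..n. \<xi> i * y i) + (\<Sum>i=1..n. \<xi>' i * y' i)"

definition fourier :: "nat \<Rightarrow> kernel \<Rightarrow> kernel" where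
  "fourier n \<phi> q = (LINT p|config n. cis (- pairing n q p) * \<phi> p)"

definition inverse_fourier :: "nat \<Rightarrow> kernel \<Rightarrow> kernel" where
  "inverse_fourier n h p = of_real (1 / (2 * pi) ^ (2 * n)) * (LINT q|config n. cis (pairing n q p) * h q)"

definition multiplier :: "nat \<Rightarrow> kernel \<Rightarrow> kernel \<Rightarrow> kernel" where
  "multiplier n m \<phi> = inverse_fourier n (\<lambda>q. m q * fourier n \<phi> q)"

definition japanese :: "real \<Rightarrow> real" where
  "japanese x = sqrt (1 + x\<^sup>2)"

text \<open>
  With this convention \<open>\<partial>\<close> has symbol \<open>\<i> \<xi>\<close>, so \<open>\<langle>\<partial>\<rangle>\<close> has symbol \<open>japanese \<xi>\<close> and
  \<open>exp (\<i> \<tau> \<partial>\<^sup>2)\<close> has symbol \<open>cis (- \<tau> * \<xi>\<^sup>2)\<close>.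
\<close>

fun U_symbol :: "nat \<Rightarrow> real \<Rightarrow> point \<Rightarrow> complex" where
  "U_symbol n \<tau> (\<xi>, \<xi>') = (\<Prod>i=1..n. cis (- \<tau> * (\<xi> i)\<^sup>2) * cis (\<tau> * (\<xi>' i)\<^sup>2))"

fun R_symbol :: "nat \<Rightarrow> real \<Rightarrow> point \<Rightarrow> complex" where
  "R_symbol n \<epsilon> (\<xi>, \<xi>') = of_real (\<Prod>i=1..n. japanese (\<xi> i) powr \<epsilon> * japanese (\<xi>' i) powr \<epsilon>)"

definition U :: "nat \<Rightarrow> real \<Rightarrow> kernel \<Rightarrow> kernel" where
  "U n \<tau> = multiplier n (U_symbol n \<tau>)"

definition R :: "nat \<Rightarrow> real \<Rightarrow> kernel \<Rightarrow> kernel" where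
  "R n \<epsilon> = multiplier n (R_symbol n \<epsilon>)"


subsection \<open>The collision operator\<close>

text \<open>\<open>collision j k\<close> is \<open>B\<^bsub>j,k+1\<^esub>\<close>; it maps kernels of \<open>k + 1\<close> particles to kernels of \<open>k\<close> particles.\<close>

fun collision :: "nat \<Rightarrow> nat \<Rightarrow> kernel \<Rightarrow> kernel" where
  "collision j k u (y, y') =
     u (y(Suc k := y j), y'(Suc k := y j)) - u (y(Suc k := y' j), y'(Suc k := y' j))"

definition RBU :: "real \<Rightarrow> nat \<Rightarrow> nat \<Rightarrow> kernel \<Rightarrow> real \<Rightarrow> kernel" where
  "RBU \<epsilon> j k \<phi> \<tau> = R k \<epsilon> (collision j k (U (Suc k) \<tau> \<phi>))"


subsection \<open>Norms\<close>

definition ennsqrt :: "ennreal \<Rightarrow> ennreal" where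
  "ennsqrt x = (if x = \<infinity> then \<infinity> else ennreal (sqrt (enn2real x)))"

definition L2norm :: "nat \<Rightarrow> kernel \<Rightarrow> ennreal" where
  "L2norm n f = ennsqrt (\<integral>\<^sup>+p. (ennreal (norm (f p)))\<^sup>2 \<partial>config n)"

definition L2L2norm :: "ereal \<Rightarrow> nat \<Rightarrow> (real \<Rightarrow> kernel) \<Rightarrow> ennreal" where
  "L2L2norm T n F = ennsqrt (\<integral>\<^sup>+\<tau>\<in>{\<tau>. 0 \<le> \<tau> \<and> ereal \<tau> \<le> T}. (L2norm n (F \<tau>))\<^sup>2 \<partial>lborel)"


subsection \<open>General data\<close>

text \<open>
  For small \<open>\<epsilon>\<close> the restriction to the diagonal in the collision operator is not defined
  pointwise for every \<open>\<phi>\<close> with \<open>R \<phi>\<close> in \<open>L\<^sup>2\<close>.  As usual the operators are defined on Schwartz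
  functions and extended by density: \<open>R_rel \<epsilon> n \<phi> g\<close> says that \<open>\<phi>\<close> and \<open>g\<close> are in \<open>L\<^sup>2\<close> and
  \<open>R \<phi> = g\<close> (the closure in \<open>L\<^sup>2\<close> of \<open>R\<close> on Schwartz functions), and \<open>RBU_rel T \<epsilon> j k \<phi> g F\<close>
  that \<open>F\<close> is the continuous extension of \<open>R B U\<close> at such a \<open>\<phi>\<close>.
\<close>

definition square_integrable :: "nat \<Rightarrow> kernel \<Rightarrow> bool" where
  "square_integrable n f \<longleftrightarrow> f \<in> borel_measurable (config n) \<and> L2norm n f < \<infinity>"

definition approximates :: "real \<Rightarrow> nat \<Rightarrow> (nat \<Rightarrow> kernel) \<Rightarrow> kernel \<Rightarrow> kernel \<Rightarrow> bool" where
  "approximates \<epsilon> n f \<phi> g \<longleftrightarrow>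
     (\<forall>m. schwartz n (f m)) \<and>
     (\<lambda>m. L2norm n (\<lambda>p. f m p - \<phi> p)) \<longlonglongrightarrow> 0 \<and>
     (\<lambda>m. L2norm n (\<lambda>p. R n \<epsilon> (f m) p - g p)) \<longlonglongrightarrow> 0"

definition R_rel :: "real \<Rightarrow> nat \<Rightarrow> kernel \<Rightarrow> kernel \<Rightarrow> bool" where
  "R_rel \<epsilon> n \<phi> g \<longleftrightarrow>
     square_integrable n \<phi> \<and> square_integrable n g \<and> (\<exists>f. approximates \<epsilon> n f \<phi> g)"

definition RBU_rel :: "ereal \<Rightarrow> real \<Rightarrow> nat \<Rightarrow> nat \<Rightarrow> kernel \<Rightarrow> kernel \<Rightarrow> (real \<Rightarrow> kernel) \<Rightarrow> bool" where
  "RBU_rel T \<epsilon> j k \<phi> g F \<longleftrightarrow>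
     (\<lambda>(\<tau>, p). F \<tau> p) \<in> borel_measurable (lborel \<Otimes>\<^sub>M config k) \<and>
     L2L2norm T k F < \<infinity> \<and>
     (\<forall>f. approximates \<epsilon> (Suc k) f \<phi> g \<longrightarrow>
        (\<lambda>m. L2L2norm T k (\<lambda>\<tau> p. RBU \<epsilon> j k (f m) \<tau> p - F \<tau> p)) \<longlonglongrightarrow> 0)"

end

theory Submission
  imports Defs "HOL-Probability.Probability"
begin

text \<open>
  On the Fourier side each of the two terms of the collision operator integrates over the two
  frequencies \<open>\<eta>, \<eta>'\<close> of the contracted particle while the output frequency \<open>n = a + \<eta> + \<eta>'\<close> is kept fixed.
  With \<open>p = a - n\<close>, \<open>r = \<eta> - n\<close> the phase is \<open>a\<^sup>2 + \<eta>\<^sup>2 - \<eta>'\<^sup>2 = n\<^sup>2 - 2 p r\<close>.  Dominating the indicator of \<open>[0, T]\<close> by a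
  Gaussian and applying the Schur test, the estimate reduces to a bound, uniform in \<open>n\<close> and \<open>C\<close>, for the
  integral of \<open>exp (- T\<^sup>2 (C + 2 p r)\<^sup>2 / 2)\<close> against the quotient of the Sobolev weights.  For \<open>\<bar>r\<bar> \<ge> 1\<close> the
  integral in \<open>p\<close> gains \<open>1 / \<bar>r\<bar>\<close>, the weights supply an extra negative power of \<open>\<langle>r\<rangle>\<close> or \<open>\<langle>n + r\<rangle>\<close>, and
  the region \<open>\<bar>p\<bar> \<ge> 1\<close> is symmetric.

  The hyperbolic scaling \<open>(p, r) \<mapsto> (\<lambda> p, r / \<lambda>)\<close> preserves the phase.  Without a gain of derivatives, or
  with unlimited time, adding \<open>L\<close> dyadic rescalings of a Gaussian therefore multiplies the square of the left-hand
  side by about \<open>L\<^sup>2\<close> but the square of the right-hand side only by about \<open>L\<close>.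
\<close>

text \<open>A sharp time cutoff would leave a kernel of modulus
  \<open>\<bar>sin (T s / 2) / s\<bar>\<close>, which is not integrable in s; the Gaussian has a
  positive transform with rapid decay, so absolute values may be taken at once. For fixed output
  frequency the weights of all variables outside the contraction are equal on both sides and cancel,
  and Plancherel leaves no power of 2\<pi> depending on k: this is why one constant serves every k.

  At \<epsilon> = 0 the obstacle is the logarithmic divergence of the integral of 1 / |r|, which any
  positive power of \<open>japanese\<close> repairs. The counterexample exhibits the same divergence
  as L equivalent dyadic scales. Since the collision operator is a difference, the lower bound also
  has to exclude cancellation: the scaling that preserves the phase of the first term does not
  preserve that of the second, whose value on the same data stays bounded in L. For positive
  \<epsilon> and infinite time the data are Gaussians with a large coefficient S, concentrated at
  low frequencies where their decay absorbs the weights; the price is a time interval of length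
  about S.\<close>

abbreviation leb :: "'i set \<Rightarrow> ('i \<Rightarrow> real) measure" where
  "leb I \<equiv> Pi\<^sub>M I (\<lambda>_. lborel)"

interpretation leb: product_sigma_finite "\<lambda>_::'i. lborel :: real measure"
  by standard

lemma space_leb: "space (leb I) = extensional I"
  by (simp add: space_PiM PiE_UNIV_domain extensional_def PiE_def)

section \<open>Lebesgue measure on finite products: affine maps, Gaussians, continuity,
  weights\<close>

subsection \<open>Affine changes of variables\<close>

lemma emeasure_lborel_affine:
  fixes s a :: real
  assumes "s \<noteq> 0" "A \<in> sets lborel"
  shows "ennreal \<bar>s\<bar> * emeasure lborel {t. a + s * t \<in> A} = emeasure lborel A"
proof -
  have [measurable]: "A \<in> sets borel" using assms by simp
  have "emeasure lborel A = emeasure (density (distr lborel borel (\<lambda>x. a + s * x)) (\<lambda>_. ennreal \<bar>s\<bar>)) A"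
    using lborel_real_affine[OF assms(1), of a] by simp
  also have "\<dots> = ennreal \<bar>s\<bar> * emeasure (distr lborel borel (\<lambda>x. a + s * x)) A"
    by (subst emeasure_density_const) auto
  also have "emeasure (distr lborel borel (\<lambda>x. a + s * x)) A = emeasure lborel {t. a + s * t \<in> A}"
    by (subst emeasure_distr) (auto simp: vimage_def)
  finally show ?thesis by simp
qed

text \<open>A product measure is determined by its values on boxes, and an affine map acts on a box
  one side at a time, each side contributing |s|. Translations serve the difference quotients and
  the shear, dilations the approximate identity.\<close>

lemma leb_affine:
  fixes s :: real
  assumes I: "finite I" and s: "s \<noteq> 0"
  shows "density (distr (leb I) (leb I) (\<lambda>x. \<lambda>i\<in>I. a i + s * x i)) (\<lambda>_. ennreal (\<bar>s\<bar> ^ card I)) = leb I"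
proof (rule leb.PiM_eqI[OF I])
  fix A :: "'a \<Rightarrow> real set" assume A: "\<And>i. i \<in> I \<Longrightarrow> A i \<in> sets lborel"
  have m: "(\<lambda>x. \<lambda>i\<in>I. a i + s * x i) \<in> leb I \<rightarrow>\<^sub>M leb I"
    by measurable
  have P: "Pi\<^sub>E I A \<in> sets (leb I)" using A I by (intro sets_PiM_I_finite) auto
  have "emeasure (density (distr (leb I) (leb I) (\<lambda>x. \<lambda>i\<in>I. a i + s * x i)) (\<lambda>_. ennreal (\<bar>s\<bar> ^ card I))) (Pi\<^sub>E I A)
    = ennreal (\<bar>s\<bar> ^ card I) * emeasure (leb I) ((\<lambda>x. \<lambda>i\<in>I. a i + s * x i) -` (Pi\<^sub>E I A) \<inter> space (leb I))"
    using P by (simp add: emeasure_density_const emeasure_distr[OF m])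
  also have "(\<lambda>x. \<lambda>i\<in>I. a i + s * x i) -` (Pi\<^sub>E I A) \<inter> space (leb I) = Pi\<^sub>E I (\<lambda>i. {t. a i + s * t \<in> A i})"
    by (auto simp: space_leb PiE_iff extensional_def)
  also have "emeasure (leb I) \<dots> = (\<Prod>i\<in>I. emeasure lborel {t. a i + s * t \<in> A i})"
  proof (rule leb.emeasure_PiM[OF I])
    fix i assume "i \<in> I"
    then have [measurable]: "A i \<in> sets borel" using A by simp
    show "{t. a i + s * t \<in> A i} \<in> sets lborel" by simp
  qed
  also have "ennreal (\<bar>s\<bar> ^ card I) * \<dots> = (\<Prod>i\<in>I. ennreal \<bar>s\<bar> * emeasure lborel {t. a i + s * t \<in> A i})"
    by (simp add: prod.distrib ennreal_power)
  also have "\<dots> = (\<Prod>i\<in>I. emeasure lborel (A i))"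
    using A by (intro prod.cong refl emeasure_lborel_affine[OF s]) auto
  finally show "emeasure (density (distr (leb I) (leb I) (\<lambda>x. \<lambda>i\<in>I. a i + s * x i)) (\<lambda>_. ennreal (\<bar>s\<bar> ^ card I))) (Pi\<^sub>E I A)
    = (\<Prod>i\<in>I. emeasure lborel (A i))" .
qed simp

lemma nn_integral_leb_affine:
  fixes s :: real
  assumes I: "finite I" "s \<noteq> 0" and [measurable]: "f \<in> borel_measurable (leb I)"
  shows "(\<integral>\<^sup>+x. f x \<partial>leb I) = ennreal (\<bar>s\<bar> ^ card I) * (\<integral>\<^sup>+x. f (\<lambda>i\<in>I. a i + s * x i) \<partial>leb I)"
  by (subst leb_affine[OF I, of a, symmetric])
     (simp add: nn_integral_density nn_integral_distr nn_integral_cmult)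

lemma
  fixes s :: real and f :: "_ \<Rightarrow> 'b :: {banach, second_countable_topology}"
  assumes I: "finite I" "s \<noteq> 0" and [measurable]: "f \<in> borel_measurable (leb I)"
  shows integral_leb_affine: "(\<integral>x. f x \<partial>leb I) = \<bar>s\<bar> ^ card I *\<^sub>R (\<integral>x. f (\<lambda>i\<in>I. a i + s * x i) \<partial>leb I)"
    and integrable_leb_affine: "integrable (leb I) f \<longleftrightarrow> integrable (leb I) (\<lambda>x. f (\<lambda>i\<in>I. a i + s * x i))"
proof -
  show "(\<integral>x. f x \<partial>leb I) = \<bar>s\<bar> ^ card I *\<^sub>R (\<integral>x. f (\<lambda>i\<in>I. a i + s * x i) \<partial>leb I)"
    by (subst leb_affine[OF I, of a, symmetric])
       (simp add: integral_density integral_distr)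
  have "integrable (leb I) (\<lambda>x. \<bar>s\<bar> ^ card I *\<^sub>R g x) \<longleftrightarrow> integrable (leb I) g" for g :: "_ \<Rightarrow> 'b"
    using I integrable_scaleR_right[of "inverse (\<bar>s\<bar> ^ card I)" "leb I" "\<lambda>x. \<bar>s\<bar> ^ card I *\<^sub>R g x"]
    by auto
  then show "integrable (leb I) f \<longleftrightarrow> integrable (leb I) (\<lambda>x. f (\<lambda>i\<in>I. a i + s * x i))"
    using I by (subst leb_affine[OF I, of a, symmetric])
       (simp add: integrable_density integrable_distr_eq)
qed

subsection \<open>Gaussian integrals\<close>

text \<open>Rescaling by \<open>sqrt (2 * \<alpha>)\<close> reduces the integral to the
  characteristic function of the standard normal law. All Gaussian integrals below, real or
  oscillating, descend from this one.\<close>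

lemma gaussian_fourier:
  fixes \<alpha> t :: real
  assumes "0 < \<alpha>"
  shows "has_bochner_integral lborel (\<lambda>x. cis (t * x) * of_real (exp (- \<alpha> * x\<^sup>2)))
           (of_real (sqrt (pi / \<alpha>) * exp (- t\<^sup>2 / (4 * \<alpha>))))"
proof -
  define c where "c = sqrt (2 * \<alpha>)"
  have c: "c > 0" "c\<^sup>2 = 2 * \<alpha>" using assms by (auto simp: c_def)
  define u where "u = t / c"
  have i1: "integrable lborel (\<lambda>x. cis (u * x) * of_real (std_normal_density x))"
    by (rule Bochner_Integration.integrable_bound[where f=std_normal_density])
       (auto simp: norm_mult cis_conv_exp)
  have v1: "(\<integral>x. cis (u * x) * of_real (std_normal_density x) \<partial>lborel) = of_real (exp (- u\<^sup>2 / 2))"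
    using fun_cong[OF char_std_normal_distribution, of u]
    by (simp add: char_def integral_density cis_conv_exp scaleR_conv_of_real mult_ac)
  have h1: "has_bochner_integral lborel (\<lambda>x. cis (u * x) * of_real (std_normal_density x)) (of_real (exp (- u\<^sup>2 / 2)))"
    using i1 v1 by (simp add: has_bochner_integral_iff)
  have h2: "has_bochner_integral lborel (\<lambda>x. cis (u * (0 + c * x)) * of_real (std_normal_density (0 + c * x)))
      (of_real (exp (- u\<^sup>2 / 2)) /\<^sub>R \<bar>c\<bar>)"
    using h1 c by (subst lborel_has_bochner_integral_real_affine_iff[of c, symmetric]) auto
  have e: "cis (u * (0 + c * x)) * of_real (std_normal_density (0 + c * x)) * of_real (sqrt (2 * pi))
     = cis (t * x) * of_real (exp (- \<alpha> * x\<^sup>2))" for x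
    using c by (simp add: std_normal_density_def u_def power_mult_distrib)
  have "exp (- u\<^sup>2 / 2) / c * sqrt (2 * pi) = sqrt (pi / \<alpha>) * exp (- t\<^sup>2 / (4 * \<alpha>))"
    using c assms by (simp add: u_def power_divide c_def real_sqrt_mult real_sqrt_divide field_simps)
  then have v: "(of_real (exp (- u\<^sup>2 / 2)) /\<^sub>R \<bar>c\<bar>) * of_real (sqrt (2 * pi)) =
      (of_real (sqrt (pi / \<alpha>) * exp (- t\<^sup>2 / (4 * \<alpha>))) :: complex)"
    using c by (simp add: scaleR_conv_of_real divide_simps flip: of_real_mult of_real_divide of_real_inverse)
  show ?thesis
    using has_bochner_integral_mult_left[OF h2, of "of_real (sqrt (2 * pi))"] unfolding e v by simp
qed

lemma gaussian_integral:
  fixes \<alpha> :: real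
  assumes "0 < \<alpha>"
  shows "has_bochner_integral lborel (\<lambda>x. exp (- \<alpha> * x\<^sup>2)) (sqrt (pi / \<alpha>))"
  using has_bochner_integral_Re[OF gaussian_fourier[OF assms, of 0]]
  by simp

lemma nn_integral_gaussian:
  fixes \<alpha> :: real
  assumes "0 < \<alpha>"
  shows "(\<integral>\<^sup>+x. ennreal (exp (- \<alpha> * x\<^sup>2)) \<partial>lborel) = ennreal (sqrt (pi / \<alpha>))"
  using gaussian_integral[OF assms]
  by (simp add: nn_integral_eq_integral has_bochner_integral_iff)

lemma leb_sigma_finite: "finite I \<Longrightarrow> sigma_finite_measure (leb I)"
  by (rule leb.sigma_finite)

lemma leb_pair_sigma_finite: "finite I \<Longrightarrow> finite J \<Longrightarrow> pair_sigma_finite (leb I) (leb J)"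
  by (simp add: pair_sigma_finite_def leb_sigma_finite)

lemma leb_component_measurable: "i \<in> I \<Longrightarrow> (\<lambda>x. x i) \<in> borel_measurable (leb I)"
  using measurable_component_singleton[of i I "\<lambda>_. lborel"] by simp

subsection \<open>Sequentially continuous functions\<close>

text \<open>Continuity is phrased through sequences of extensional functions: these are the points
  carrying the product measure, and sequences are what dominated convergence handles.\<close>

definition seqcont :: "'i set \<Rightarrow> (('i \<Rightarrow> real) \<Rightarrow> 'b::topological_space) \<Rightarrow> bool" where
  "seqcont I f \<longleftrightarrow> (\<forall>X x. (\<forall>m::nat. X m \<in> extensional I) \<longrightarrow> x \<in> extensional I \<longrightarrow>
     (\<forall>i\<in>I. (\<lambda>m. X m i) \<longlonglongrightarrow> x i) \<longrightarrow> (\<lambda>m. f (X m)) \<longlonglongrightarrow> f x)"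

lemma seqcontI:
  assumes "\<And>X x. (\<And>m::nat. X m \<in> extensional I) \<Longrightarrow> x \<in> extensional I \<Longrightarrow>
     (\<And>i. i \<in> I \<Longrightarrow> (\<lambda>m. X m i) \<longlonglongrightarrow> x i) \<Longrightarrow> (\<lambda>m. f (X m)) \<longlonglongrightarrow> f x"
  shows "seqcont I f"
  using assms unfolding seqcont_def by blast

lemma seqcontD:
  assumes "seqcont I f" "\<And>m::nat. X m \<in> extensional I" "x \<in> extensional I"
     "\<And>i. i \<in> I \<Longrightarrow> (\<lambda>m. X m i) \<longlonglongrightarrow> x i"
  shows "(\<lambda>m. f (X m)) \<longlonglongrightarrow> f x"
  using assms unfolding seqcont_def by blast

text \<open>Composition with the restriction to \<open>I\<close> extends f to the full function
  space, where sequential continuity is continuity; for a countable index type the Borel sets of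
  that space are those of the product sigma-algebra.\<close>

lemma seqcont_measurable:
  fixes f :: "('i::countable \<Rightarrow> real) \<Rightarrow> 'b::topological_space"
  assumes f: "seqcont I f"
  shows "f \<in> borel_measurable (leb I)"
proof -
  define F where "F x = f (restrict x I)" for x
  have "continuous_on UNIV F"
  proof (rule continuous_on_sequentiallyI)
    fix u :: "nat \<Rightarrow> 'i \<Rightarrow> real" and a assume u: "u \<longlonglongrightarrow> a"
    have "(\<lambda>m. u m i) \<longlonglongrightarrow> a i" for i
      using continuous_on_tendsto_compose[OF continuous_on_product_coordinates[of i] u] by simp
    then show "(\<lambda>n. F (u n)) \<longlonglongrightarrow> F a"
      unfolding F_def by (intro seqcontD[OF f]) auto
  qed
  then have "F \<in> borel_measurable borel"
    by (rule borel_measurable_continuous_onI)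
  then have F: "F \<in> borel_measurable (Pi\<^sub>M UNIV (\<lambda>_. borel))"
    using measurable_cong_sets[OF sets_PiM_equal_borel refl] by blast
  have "(\<lambda>x i. if i \<in> I then x i else undefined) \<in> leb I \<rightarrow>\<^sub>M Pi\<^sub>M UNIV (\<lambda>_. borel)"
  proof (rule measurable_PiM_single')
    fix i :: 'i
    show "(\<lambda>x. if i \<in> I then x i else undefined) \<in> borel_measurable (leb I)"
      by (cases "i \<in> I") auto
  qed auto
  from measurable_compose[OF this F]
  have "(\<lambda>x. F (\<lambda>i. if i \<in> I then x i else undefined)) \<in> borel_measurable (leb I)" .
  also have "?this \<longleftrightarrow> f \<in> borel_measurable (leb I)"
  proof (rule measurable_cong)
    fix x assume "x \<in> space (leb I)"
    then have "restrict (\<lambda>i. if i \<in> I then x i else undefined) I = x"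
      by (auto simp: space_leb extensional_def)
    then show "F (\<lambda>i. if i \<in> I then x i else undefined) = f x"
      by (simp add: F_def)
  qed
  finally show ?thesis .
qed

lemma seqcont_coord: "i \<in> I \<Longrightarrow> seqcont I (\<lambda>x. x i)"
  by (rule seqcontI) simp

lemma seqcont_compose: "seqcont I f \<Longrightarrow> (\<And>y. isCont g y) \<Longrightarrow> seqcont I (\<lambda>x. g (f x))"
  by (rule seqcontI, rule isCont_tendsto_compose[where g=g]) (auto intro: seqcontD)

lemma seqcont_diff:
  fixes f g :: "_ \<Rightarrow> 'b::topological_group_add"
  shows "seqcont I f \<Longrightarrow> seqcont I g \<Longrightarrow> seqcont I (\<lambda>x. f x - g x)"
  by (intro seqcontI tendsto_intros) (blast intro: seqcontD)+

lemma seqcont_mult: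
  fixes f g :: "_ \<Rightarrow> 'b::real_normed_algebra"
  shows "seqcont I f \<Longrightarrow> seqcont I g \<Longrightarrow> seqcont I (\<lambda>x. f x * g x)"
  by (intro seqcontI tendsto_intros) (blast intro: seqcontD)+

lemma seqcont_prod:
  fixes f :: "_ \<Rightarrow> _ \<Rightarrow> 'b::{real_normed_algebra,comm_ring_1}"
  shows "(\<And>i. i \<in> J \<Longrightarrow> seqcont I (f i)) \<Longrightarrow> seqcont I (\<lambda>x. \<Prod>i\<in>J. f i x)"
  by (intro seqcontI tendsto_prod) (blast intro: seqcontD)+

subsection \<open>Polynomial weights\<close>

text \<open>The square of the Euclidean bracket. Being polynomial, it is the symbol of 1 minus the
  Laplacian, which is how decay of Fourier transforms is obtained.\<close>

definition wgt :: "'i set \<Rightarrow> ('i \<Rightarrow> real) \<Rightarrow> real" where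
  "wgt I x = 1 + (\<Sum>c\<in>I. (x c)\<^sup>2)"

lemma wgt_ge1: "1 \<le> wgt I x"
  by (simp add: wgt_def sum_nonneg)

lemma wgt_pos [simp]: "0 < wgt I x" "wgt I x \<noteq> 0" "0 \<le> wgt I x"
  using wgt_ge1[of I x] by auto

lemma coord_le_wgt: "finite I \<Longrightarrow> c \<in> I \<Longrightarrow> 1 + (x c)\<^sup>2 \<le> wgt I x"
  using member_le_sum[of c I "\<lambda>c. (x c)\<^sup>2"] by (simp add: wgt_def)

lemma abs_coord_le_wgt: "finite I \<Longrightarrow> c \<in> I \<Longrightarrow> \<bar>x c\<bar> \<le> wgt I x"
proof -
  assume "finite I" "c \<in> I"
  then have "1 + (x c)\<^sup>2 \<le> wgt I x" by (rule coord_le_wgt)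
  moreover have "\<bar>x c\<bar> \<le> 1 + (x c)\<^sup>2"
    using sum_squares_bound[of "\<bar>x c\<bar>" 1] by simp
  ultimately show ?thesis by simp
qed

lemma wgt_measurable [measurable]: "wgt I \<in> borel_measurable (leb I)"
  unfolding wgt_def[abs_def]
  by (intro borel_measurable_add borel_measurable_const borel_measurable_sum borel_measurable_power leb_component_measurable)

lemma integrable_inverse_1_plus: "integrable lborel (\<lambda>x::real. inverse (1 + x\<^sup>2))"
  using integrable_inverse_1_plus_square
  by (simp add: set_integrable_def)

text \<open>Each factor \<open>1 + (x i)\<^sup>2\<close> is at most \<open>wgt I x\<close>, so
  already the power \<open>card I\<close> is dominated by a product of one-dimensional integrable
  functions.\<close>

lemma integrable_wgt:
  assumes I: "finite I" and N: "card I \<le> N"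
  shows "integrable (leb I) (\<lambda>x. inverse (wgt I x ^ N))"
proof (rule Bochner_Integration.integrable_bound)
  show "integrable (leb I) (\<lambda>x. \<Prod>i\<in>I. inverse (1 + (x i)\<^sup>2))"
    by (intro leb.product_integrable_prod I integrable_inverse_1_plus)
  show "AE x in leb I. norm (inverse (wgt I x ^ N)) \<le> norm (\<Prod>i\<in>I. inverse (1 + (x i)\<^sup>2))"
  proof (rule AE_I2)
    fix x
    have "(\<Prod>i\<in>I. 1 + (x i)\<^sup>2) \<le> (\<Prod>i\<in>I. wgt I x)"
      by (rule prod_mono) (auto simp: coord_le_wgt I add_nonneg_nonneg)
    also have "\<dots> \<le> wgt I x ^ N"
      using N wgt_ge1[of I x] by (simp add: power_increasing)
    finally have "inverse (wgt I x ^ N) \<le> inverse (\<Prod>i\<in>I. 1 + (x i)\<^sup>2)"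
      by (rule le_imp_inverse_le) (auto intro!: prod_pos add_pos_nonneg)
    then show "norm (inverse (wgt I x ^ N)) \<le> norm (\<Prod>i\<in>I. inverse (1 + (x i)\<^sup>2))"
      by (simp add: prod_inversef[symmetric] abs_prod)
  qed
qed measurable

section \<open>The Fourier transform with inversion and Plancherel\<close>

subsection \<open>The Fourier transform\<close>

definition ip :: "'i set \<Rightarrow> ('i \<Rightarrow> real) \<Rightarrow> ('i \<Rightarrow> real) \<Rightarrow> real" where
  "ip I q x = (\<Sum>i\<in>I. q i * x i)"

definition ft :: "'i set \<Rightarrow> (('i \<Rightarrow> real) \<Rightarrow> complex) \<Rightarrow> ('i \<Rightarrow> real) \<Rightarrow> complex" where
  "ft I f q = (\<integral>x. cis (- ip I q x) * f x \<partial>leb I)"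

text \<open>No power of 2\<pi> is included; the factors reappear in \<open>fourier_inversion\<close>
  and \<open>plancherel\<close>.\<close>

definition ift :: "'i set \<Rightarrow> (('i \<Rightarrow> real) \<Rightarrow> complex) \<Rightarrow> ('i \<Rightarrow> real) \<Rightarrow> complex" where
  "ift I f x = (\<integral>q. cis (ip I q x) * f q \<partial>leb I)"

lemma borel_measurable_cis [measurable]: "cis \<in> borel_measurable borel"
  by (intro borel_measurable_continuous_onI continuous_intros)

lemma ip_measurable [measurable]:
  "(\<lambda>x. ip I q x) \<in> borel_measurable (leb I)" "(\<lambda>q. ip I q x) \<in> borel_measurable (leb I)"
  "(\<lambda>(q, x). ip I q x) \<in> borel_measurable (leb I \<Otimes>\<^sub>M leb I)"
proof -
  have 1: "(\<lambda>(q, x). ip I q x) \<in> borel_measurable (leb I \<Otimes>\<^sub>M leb I)"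
    unfolding ip_def case_prod_beta
    by (intro borel_measurable_sum borel_measurable_times measurable_compose[OF measurable_fst leb_component_measurable]
      measurable_compose[OF measurable_snd leb_component_measurable])
  then show "(\<lambda>(q, x). ip I q x) \<in> borel_measurable (leb I \<Otimes>\<^sub>M leb I)" .
  show "(\<lambda>x. ip I q x) \<in> borel_measurable (leb I)" "(\<lambda>q. ip I q x) \<in> borel_measurable (leb I)"
    unfolding ip_def by (intro borel_measurable_sum borel_measurable_times leb_component_measurable borel_measurable_const; assumption)+
qed

lemma integrable_cis_mult:
  assumes "integrable M f" "g \<in> borel_measurable M"
  shows "integrable M (\<lambda>x. cis (g x) * f x)"
proof (rule Bochner_Integration.integrable_bound[OF assms(1)])
  note [measurable] = assms(2) borel_measurable_integrable[OF assms(1)]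
  show "(\<lambda>x. cis (g x) * f x) \<in> borel_measurable M" by measurable
qed (simp add: norm_mult)

lemma ift_measurable:
  assumes "finite I" and [measurable]: "f \<in> borel_measurable (leb I)"
  shows "ift I f \<in> borel_measurable (leb I)"
proof -
  interpret sigma_finite_measure "leb I" by (rule leb_sigma_finite[OF assms(1)])
  have [measurable]: "(\<lambda>(x, q). ip I q x) \<in> borel_measurable (leb I \<Otimes>\<^sub>M leb I)"
    using measurable_compose[OF measurable_pair_swap' ip_measurable(3)[of I]] by (simp add: case_prod_beta)
  show ?thesis unfolding ift_def by measurable
qed

lemma norm_integral_cis_le:
  "norm (\<integral>x. cis (g x) * f x \<partial>M) \<le> (\<integral>x. norm (f x) \<partial>M)"
  using integral_norm_bound[of M "\<lambda>x. cis (g x) * f x"] by (simp add: norm_mult)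

lemma norm_ift_le: "norm (ift I f x) \<le> (\<integral>q. norm (f q) \<partial>leb I)"
  unfolding ift_def by (rule norm_integral_cis_le)

lemma norm_ft_le: "norm (ft I f x) \<le> (\<integral>q. norm (f q) \<partial>leb I)"
  unfolding ft_def by (rule norm_integral_cis_le)

lemma integrable_pair_cis_mult:
  fixes f g :: "_ \<Rightarrow> complex"
  assumes M: "pair_sigma_finite M1 M2"
    and f: "integrable M1 f" and g: "integrable M2 g"
    and \<theta>: "case_prod \<theta> \<in> borel_measurable (M1 \<Otimes>\<^sub>M M2)"
  shows "integrable (M1 \<Otimes>\<^sub>M M2) (\<lambda>(x, y). cis (\<theta> x y) * (f x * g y))"
proof -
  interpret pair_sigma_finite M1 M2 by fact
  note [measurable] = \<theta> borel_measurable_integrable[OF f] borel_measurable_integrable[OF g]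
  show ?thesis
  proof (rule Fubini_integrable)
    show "integrable M1 (\<lambda>x. \<integral>y. norm (case (x, y) of (x, y) \<Rightarrow> cis (\<theta> x y) * (f x * g y)) \<partial>M2)"
      using f by (simp add: norm_mult)
    show "AE x in M1. integrable M2 (\<lambda>y. case (x, y) of (x, y) \<Rightarrow> cis (\<theta> x y) * (f x * g y))"
    proof (rule AE_I2)
      fix x assume "x \<in> space M1"
      then have [measurable]: "\<theta> x \<in> borel_measurable M2"
        using measurable_Pair2[OF \<theta>] by simp
      show "integrable M2 (\<lambda>y. case (x, y) of (x, y) \<Rightarrow> cis (\<theta> x y) * (f x * g y))"
        using g by (auto intro!: integrable_cis_mult)
    qed
  qed measurable
qed

text \<open>The oscillating factor has modulus one and f, g are integrable separately, so Fubini
  applies. The phase is left general: it is the Fourier pairing in Plancherel and time against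
  frequency phase in the Schur test.\<close>

lemma integral_swap_cis:
  fixes f g :: "_ \<Rightarrow> complex"
  assumes M: "pair_sigma_finite M1 M2"
    and f: "integrable M1 f" and g: "integrable M2 g"
    and \<theta>: "case_prod \<theta> \<in> borel_measurable (M1 \<Otimes>\<^sub>M M2)"
  shows "(\<integral>x. f x * (\<integral>y. cis (\<theta> x y) * g y \<partial>M2) \<partial>M1) = (\<integral>y. g y * (\<integral>x. cis (\<theta> x y) * f x \<partial>M1) \<partial>M2)"
proof -
  interpret pair_sigma_finite M1 M2 by fact
  have "(\<integral>x. f x * (\<integral>y. cis (\<theta> x y) * g y \<partial>M2) \<partial>M1) = (\<integral>x. (\<integral>y. cis (\<theta> x y) * (f x * g y) \<partial>M2) \<partial>M1)"
    by (simp add: mult.left_commute flip: integral_mult_right_zero)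
  also have "\<dots> = (\<integral>y. (\<integral>x. cis (\<theta> x y) * (f x * g y) \<partial>M1) \<partial>M2)"
    by (rule Fubini_integral[symmetric]) (rule integrable_pair_cis_mult[OF assms])
  also have "\<dots> = (\<integral>y. g y * (\<integral>x. cis (\<theta> x y) * f x \<partial>M1) \<partial>M2)"
    by (simp add: mult_ac flip: integral_mult_right_zero)
  finally show ?thesis .
qed

subsection \<open>Fourier inversion and Plancherel\<close>

definition gau :: "'i set \<Rightarrow> real \<Rightarrow> ('i \<Rightarrow> real) \<Rightarrow> real" where
  "gau I \<delta> x = exp (- (\<delta>\<^sup>2 / 2) * (\<Sum>i\<in>I. (x i)\<^sup>2))"

lemma gau_bounds: "0 < gau I \<delta> x" "gau I \<delta> x \<le> 1"
  by (auto simp: gau_def sum_nonneg)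

lemma gau_measurable [measurable]: "gau I \<delta> \<in> borel_measurable (leb I)"
proof -
  have [measurable]: "(\<lambda>x. \<Sum>i\<in>I. (x i)\<^sup>2) \<in> borel_measurable (leb I)"
    by (intro borel_measurable_sum borel_measurable_power leb_component_measurable)
  show ?thesis unfolding gau_def[abs_def] by measurable
qed

lemma borel_measurable_cnj: "cnj \<in> borel_measurable borel"
  by (intro borel_measurable_continuous_onI continuous_intros)

lemma cis_sum: "cis (\<Sum>i\<in>I. f i) = (\<Prod>i\<in>I. cis (f i))"
  by (induction I rule: infinite_finite_induct) (auto simp flip: cis_mult)

lemma gau_ft:
  assumes I: "finite I" and \<delta>: "0 < \<delta>"
  shows "integrable (leb I) (\<lambda>x. cis (ip I v x) * of_real (gau I \<delta> x))"
    and "(\<integral>x. cis (ip I v x) * of_real (gau I \<delta> x) \<partial>leb I) =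
      of_real ((sqrt (2 * pi) / \<delta>) ^ card I * exp (- (\<Sum>i\<in>I. (v i)\<^sup>2) / (2 * \<delta>\<^sup>2)))"
proof -
  let ?g = "\<lambda>i t. cis (v i * t) * of_real (exp (- (\<delta>\<^sup>2 / 2) * t\<^sup>2)) :: complex"
  have eq: "cis (ip I v x) * of_real (gau I \<delta> x) = (\<Prod>i\<in>I. ?g i (x i))" for x
    using I by (simp add: ip_def gau_def cis_sum prod.distrib sum_distrib_left exp_sum flip: of_real_prod sum_negf)
  have g: "has_bochner_integral lborel (?g i) (of_real (sqrt (2 * pi) / \<delta> * exp (- (v i)\<^sup>2 / (2 * \<delta>\<^sup>2))))" for i
    using gaussian_fourier[of "\<delta>\<^sup>2 / 2" "v i"] \<delta> by (simp add: real_sqrt_divide mult.commute[of pi])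
  show "integrable (leb I) (\<lambda>x. cis (ip I v x) * of_real (gau I \<delta> x))"
    unfolding eq using g by (intro leb.product_integrable_prod I) (auto simp: has_bochner_integral_iff)
  have "(\<integral>x. cis (ip I v x) * of_real (gau I \<delta> x) \<partial>leb I) = (\<Prod>i\<in>I. integral\<^sup>L lborel (?g i))"
    unfolding eq using g by (intro leb.product_integral_prod I) (auto simp: has_bochner_integral_iff)
  also have "\<dots> = (\<Prod>i\<in>I. of_real (sqrt (2 * pi) / \<delta> * exp (- (v i)\<^sup>2 / (2 * \<delta>\<^sup>2))))"
    using g by (intro prod.cong refl) (auto simp: has_bochner_integral_iff)
  also have "\<dots> = of_real ((sqrt (2 * pi) / \<delta>) ^ card I * exp (- (\<Sum>i\<in>I. (v i)\<^sup>2) / (2 * \<delta>\<^sup>2)))"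
  proof -
    have "(\<Prod>i\<in>I. exp (- (v i)\<^sup>2 / (2 * \<delta>\<^sup>2))) = exp (- (\<Sum>i\<in>I. (v i)\<^sup>2) / (2 * \<delta>\<^sup>2))"
      using I by (simp add: exp_sum sum_divide_distrib flip: sum_negf)
    then show ?thesis by (simp only: of_real_prod[symmetric] prod.distrib prod_constant)
  qed
  finally show "(\<integral>x. cis (ip I v x) * of_real (gau I \<delta> x) \<partial>leb I) =
      of_real ((sqrt (2 * pi) / \<delta>) ^ card I * exp (- (\<Sum>i\<in>I. (v i)\<^sup>2) / (2 * \<delta>\<^sup>2)))" .
qed

lemma integrable_gau:
  assumes "finite I" "0 < \<delta>"
  shows "integrable (leb I) (\<lambda>x. complex_of_real (gau I \<delta> x))" "integrable (leb I) (gau I \<delta>)"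
    and "(\<integral>x. gau I \<delta> x \<partial>leb I) = (sqrt (2 * pi) / \<delta>) ^ card I"
proof -
  have z: "cis (ip I (\<lambda>_. 0) x) = 1" for x by (simp add: ip_def)
  show i: "integrable (leb I) (\<lambda>x. complex_of_real (gau I \<delta> x))"
    using gau_ft(1)[OF assms, of "\<lambda>_. 0"] by (simp add: z)
  from integrable_Re[OF this] show "integrable (leb I) (gau I \<delta>)" by simp
  have "(\<integral>x. complex_of_real (gau I \<delta> x) \<partial>leb I) = complex_of_real ((sqrt (2 * pi) / \<delta>) ^ card I)"
    using gau_ft(2)[OF assms, of "\<lambda>_. 0"] by (simp add: z)
  then show "(\<integral>x. gau I \<delta> x \<partial>leb I) = (sqrt (2 * pi) / \<delta>) ^ card I"
    by (metis integral_complex_of_real of_real_eq_iff)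
qed

text \<open>Diagonal restrictions and collision integrals are only shown to be continuous and
  rapidly decreasing, without derivatives. This class contains them; continuity serves the
  approximate identity and boundedness provides its majorant.\<close>

definition nice :: "'i set \<Rightarrow> (('i \<Rightarrow> real) \<Rightarrow> complex) \<Rightarrow> bool" where
  "nice I w \<longleftrightarrow> integrable (leb I) w \<and> seqcont I w \<and> (\<exists>B. \<forall>x\<in>extensional I. norm (w x) \<le> B)"

lemma ip_diff: "ip I y x - ip I q x = ip I (\<lambda>i. y i - q i) x"
  by (simp add: ip_def sum_subtractf left_diff_distrib)

text \<open>The cutoff makes the double integral absolutely convergent. After the exchange the inner
  integral is a Gaussian of width \<delta> centred at q, and the substitution y = q + \<delta> z
  moves \<delta> into the argument of w.\<close>

lemma gau_regularisation:
  assumes I: "finite I" and \<delta>: "0 < \<delta>" and w: "integrable (leb I) w"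
  shows "(\<integral>x. cis (- ip I q x) * of_real (gau I \<delta> x) * ift I w x \<partial>leb I) =
     of_real (sqrt (2 * pi) ^ card I) * (\<integral>z. w (\<lambda>i\<in>I. q i + \<delta> * z i) * of_real (gau I 1 z) \<partial>leb I)"
proof -
  have g: "integrable (leb I) (\<lambda>x. cis (- ip I q x) * of_real (gau I \<delta> x))"
    by (intro integrable_cis_mult integrable_gau I \<delta>) measurable
  have m: "(\<lambda>(x, y). ip I y x) \<in> borel_measurable (leb I \<Otimes>\<^sub>M leb I)"
    using measurable_compose[OF measurable_pair_swap' ip_measurable(3)[of I]] by (simp add: case_prod_beta)
  have "(\<integral>x. cis (- ip I q x) * of_real (gau I \<delta> x) * ift I w x \<partial>leb I)
      = (\<integral>y. w y * (\<integral>x. cis (ip I y x) * (cis (- ip I q x) * of_real (gau I \<delta> x)) \<partial>leb I) \<partial>leb I)"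
    unfolding ift_def by (rule integral_swap_cis[OF leb_pair_sigma_finite[OF I I] g w m])
  also have "\<dots> = (\<integral>y. w y * (\<integral>x. cis (ip I (\<lambda>i. y i - q i) x) * of_real (gau I \<delta> x) \<partial>leb I) \<partial>leb I)"
    by (simp add: cis_mult ip_diff flip: mult.assoc)
  also have "\<dots> = (\<integral>y. w y * of_real ((sqrt (2 * pi) / \<delta>) ^ card I * exp (- (\<Sum>i\<in>I. (y i - q i)\<^sup>2) / (2 * \<delta>\<^sup>2))) \<partial>leb I)"
    by (simp add: gau_ft(2)[OF I \<delta>])
  also have "\<dots> = \<bar>\<delta>\<bar> ^ card I *\<^sub>R (\<integral>z. w (\<lambda>i\<in>I. q i + \<delta> * z i) *
      of_real ((sqrt (2 * pi) / \<delta>) ^ card I * exp (- (\<Sum>i\<in>I. ((\<lambda>i\<in>I. q i + \<delta> * z i) i - q i)\<^sup>2) / (2 * \<delta>\<^sup>2))) \<partial>leb I)"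
  proof (rule integral_leb_affine)
    have [measurable]: "(\<lambda>y. \<Sum>i\<in>I. (y i - q i)\<^sup>2) \<in> borel_measurable (leb I)"
      by (intro borel_measurable_sum borel_measurable_power borel_measurable_diff leb_component_measurable borel_measurable_const)
    note [measurable] = borel_measurable_integrable[OF w]
    show "(\<lambda>y. w y * of_real ((sqrt (2 * pi) / \<delta>) ^ card I * exp (- (\<Sum>i\<in>I. (y i - q i)\<^sup>2) / (2 * \<delta>\<^sup>2))))
      \<in> borel_measurable (leb I)" by measurable
  qed (use I \<delta> in auto)
  also have "(\<lambda>z. w (\<lambda>i\<in>I. q i + \<delta> * z i) *
      of_real ((sqrt (2 * pi) / \<delta>) ^ card I * exp (- (\<Sum>i\<in>I. ((\<lambda>i\<in>I. q i + \<delta> * z i) i - q i)\<^sup>2) / (2 * \<delta>\<^sup>2)))) =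
    (\<lambda>z. of_real ((sqrt (2 * pi) / \<delta>) ^ card I) * (w (\<lambda>i\<in>I. q i + \<delta> * z i) * of_real (gau I 1 z)))"
  proof
    fix z
    have "(\<Sum>i\<in>I. ((\<lambda>i\<in>I. q i + \<delta> * z i) i - q i)\<^sup>2) = \<delta>\<^sup>2 * (\<Sum>i\<in>I. (z i)\<^sup>2)"
      by (simp add: power_mult_distrib sum_distrib_left)
    then show "w (\<lambda>i\<in>I. q i + \<delta> * z i) *
      of_real ((sqrt (2 * pi) / \<delta>) ^ card I * exp (- (\<Sum>i\<in>I. ((\<lambda>i\<in>I. q i + \<delta> * z i) i - q i)\<^sup>2) / (2 * \<delta>\<^sup>2))) =
      of_real ((sqrt (2 * pi) / \<delta>) ^ card I) * (w (\<lambda>i\<in>I. q i + \<delta> * z i) * of_real (gau I 1 z))"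
      using \<delta> by (simp add: gau_def)
  qed
  also have "\<bar>\<delta>\<bar> ^ card I *\<^sub>R (\<integral>z. of_real ((sqrt (2 * pi) / \<delta>) ^ card I) * (w (\<lambda>i\<in>I. q i + \<delta> * z i) * of_real (gau I 1 z)) \<partial>leb I)
     = of_real (sqrt (2 * pi) ^ card I) * (\<integral>z. w (\<lambda>i\<in>I. q i + \<delta> * z i) * of_real (gau I 1 z) \<partial>leb I)"
    using \<delta> by (simp add: scaleR_conv_of_real power_divide)
  finally show ?thesis .
qed

lemma sqrt_power_mult_self: "sqrt (2 * pi) ^ n * sqrt (2 * pi) ^ n = (2 * pi) ^ n"
  unfolding power_mult_distrib[symmetric, of "sqrt (2 * pi)"] by (subst real_sqrt_mult_self) simp

text \<open>One factor \<open>sqrt (2 * pi)\<close> per variable is the prefactor, the other is the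
  mass of \<open>gau I 1\<close>. The second claim is uniform in \<delta> and becomes the majorant
  in the proof of Plancherel.\<close>

lemma gau_regularisation_limit:
  fixes w :: "('i::countable \<Rightarrow> real) \<Rightarrow> complex"
  assumes I: "finite I" and w: "seqcont I w" and B: "\<And>x. x \<in> extensional I \<Longrightarrow> norm (w x) \<le> B" and q: "q \<in> extensional I"
  shows "(\<lambda>m. of_real (sqrt (2 * pi) ^ card I) * (\<integral>z. w (\<lambda>i\<in>I. q i + (1 / Suc m) * z i) * of_real (gau I 1 z) \<partial>leb I))
     \<longlonglongrightarrow> of_real ((2 * pi) ^ card I) * w q"
    and "norm (of_real (sqrt (2 * pi) ^ card I) * (\<integral>z. w (\<lambda>i\<in>I. q i + \<delta> * z i) * of_real (gau I 1 z) \<partial>leb I))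
     \<le> (2 * pi) ^ card I * B"
proof -
  note [measurable] = seqcont_measurable[OF w]
  have B0: "B \<ge> 0" using B[OF q] norm_ge_zero[of "w q"] by linarith
  have m: "(\<lambda>z. w (\<lambda>i\<in>I. q i + \<delta> * z i) * of_real (gau I 1 z)) \<in> borel_measurable (leb I)" for \<delta>
    by measurable
  have bd: "norm (w (\<lambda>i\<in>I. q i + \<delta> * z i) * of_real (gau I 1 z)) \<le> B * gau I 1 z" for \<delta> z
    using B[of "\<lambda>i\<in>I. q i + \<delta> * z i"] gau_bounds[of I 1 z] by (simp add: norm_mult mult_right_mono)
  have int: "integrable (leb I) (\<lambda>z. B * gau I 1 z)" using integrable_gau(2)[OF I, of 1] by simp
  have lim: "(\<lambda>m. \<integral>z. w (\<lambda>i\<in>I. q i + (1 / Suc m) * z i) * of_real (gau I 1 z) \<partial>leb I)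
     \<longlonglongrightarrow> (\<integral>z. w q * of_real (gau I 1 z) \<partial>leb I)"
  proof (rule integral_dominated_convergence[OF _ m int])
    show "AE z in leb I. (\<lambda>m. w (\<lambda>i\<in>I. q i + (1 / Suc m) * z i) * of_real (gau I 1 z)) \<longlonglongrightarrow> w q * of_real (gau I 1 z)"
    proof (intro AE_I2 tendsto_mult tendsto_const seqcontD[OF w] q)
      fix z i assume "i \<in> I"
      have "(\<lambda>m. q i + (1 / Suc m) * z i) \<longlonglongrightarrow> q i + 0 * z i"
        by (intro tendsto_intros LIMSEQ_Suc[OF lim_1_over_n])
      then show "(\<lambda>m. (\<lambda>i\<in>I. q i + (1 / Suc m) * z i) i) \<longlonglongrightarrow> q i" using \<open>i \<in> I\<close> by simp
    qed simp
    show "AE z in leb I. norm (w (\<lambda>i\<in>I. q i + (1 / Suc m) * z i) * of_real (gau I 1 z)) \<le> B * gau I 1 z" for m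
      using bd by (intro AE_I2)
  qed measurable
  have "(\<integral>z. w q * of_real (gau I 1 z) \<partial>leb I) = w q * of_real (\<integral>z. gau I 1 z \<partial>leb I)"
    by simp
  then have eq: "(\<integral>z. w q * of_real (gau I 1 z) \<partial>leb I) = w q * of_real (sqrt (2 * pi) ^ card I)"
    using integrable_gau(3)[OF I, of 1] by simp
  note tendsto_mult[OF tendsto_const lim[unfolded eq], of "of_real (sqrt (2 * pi) ^ card I)"]
  moreover have "of_real (sqrt (2 * pi) ^ card I) * (w q * of_real (sqrt (2 * pi) ^ card I)) = of_real ((2 * pi) ^ card I) * w q"
  proof -
    have "sqrt (2 * pi) ^ card I * sqrt (2 * pi) ^ card I = (2 * pi) ^ card I"
      by (rule sqrt_power_mult_self)
    moreover have "of_real a * (w q * of_real a) = of_real (a * a) * w q" for a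
      by (simp add: mult_ac)
    ultimately show ?thesis by (simp only:)
  qed
  ultimately show "(\<lambda>m. of_real (sqrt (2 * pi) ^ card I) * (\<integral>z. w (\<lambda>i\<in>I. q i + (1 / Suc m) * z i) * of_real (gau I 1 z) \<partial>leb I))
     \<longlonglongrightarrow> of_real ((2 * pi) ^ card I) * w q" by (simp only:)
  have "norm (\<integral>z. w (\<lambda>i\<in>I. q i + \<delta> * z i) * of_real (gau I 1 z) \<partial>leb I) \<le> (\<integral>z. B * gau I 1 z \<partial>leb I)"
  proof (rule order.trans[OF integral_norm_bound Bochner_Integration.integral_mono[OF _ int]])
    show "integrable (leb I) (\<lambda>z. norm (w (\<lambda>i\<in>I. q i + \<delta> * z i) * of_real (gau I 1 z)))"
      by (rule integrable_norm, rule Bochner_Integration.integrable_bound[OF int m])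
         (use bd B0 gau_bounds(1)[of I 1] in \<open>auto simp: less_imp_le abs_mult\<close>)
  qed (rule bd)
  also have "\<dots> = sqrt (2 * pi) ^ card I * B" using integrable_gau[OF I, of 1] by simp
  finally have "norm (\<integral>z. w (\<lambda>i\<in>I. q i + \<delta> * z i) * of_real (gau I 1 z) \<partial>leb I) \<le> sqrt (2 * pi) ^ card I * B" .
  then have "sqrt (2 * pi) ^ card I * norm (\<integral>z. w (\<lambda>i\<in>I. q i + \<delta> * z i) * of_real (gau I 1 z) \<partial>leb I)
     \<le> sqrt (2 * pi) ^ card I * (sqrt (2 * pi) ^ card I * B)"
    by (rule mult_left_mono) simp
  also have "\<dots> = (2 * pi) ^ card I * B"
    by (simp only: sqrt_power_mult_self[symmetric] mult.assoc)
  finally show "norm (of_real (sqrt (2 * pi) ^ card I) * (\<integral>z. w (\<lambda>i\<in>I. q i + \<delta> * z i) * of_real (gau I 1 z) \<partial>leb I))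
     \<le> (2 * pi) ^ card I * B" by (simp add: norm_mult norm_power)
qed

lemma gau_tendsto: "(\<lambda>m. gau I (1 / Suc m) x) \<longlonglongrightarrow> 1"
proof -
  have "(\<lambda>m. exp (- ((1 / Suc m)\<^sup>2 / 2) * (\<Sum>i\<in>I. (x i)\<^sup>2))) \<longlonglongrightarrow> exp (- (0\<^sup>2 / 2) * (\<Sum>i\<in>I. (x i)\<^sup>2))"
    by (intro tendsto_intros LIMSEQ_Suc[OF lim_1_over_n]) simp
  then show ?thesis by (simp add: gau_def)
qed

lemma gau_mono: "m \<le> n \<Longrightarrow> gau I (1 / Suc m) x \<le> gau I (1 / Suc n) x"
  unfolding gau_def
  by (auto intro!: mult_right_mono sum_nonneg divide_right_mono power_mono frac_le)

text \<open>The cutoff is removed on the left by dominated convergence, which is where integrability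
  of the transform enters, and acts on the right as an approximate identity.\<close>

theorem fourier_inversion:
  fixes w :: "('i::countable \<Rightarrow> real) \<Rightarrow> complex"
  assumes I: "finite I" and w: "nice I w" and G: "integrable (leb I) (ift I w)" and q: "q \<in> extensional I"
  shows "ft I (ift I w) q = of_real ((2 * pi) ^ card I) * w q"
proof -
  obtain B where B: "\<And>x. x \<in> extensional I \<Longrightarrow> norm (w x) \<le> B" using w by (auto simp: nice_def)
  have wi: "integrable (leb I) w" and wc: "seqcont I w" using w by (auto simp: nice_def)
  note [measurable] = borel_measurable_integrable[OF G]
  have "(\<lambda>m. \<integral>x. cis (- ip I q x) * of_real (gau I (1 / Suc m) x) * ift I w x \<partial>leb I)
     \<longlonglongrightarrow> (\<integral>x. cis (- ip I q x) * ift I w x \<partial>leb I)"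
  proof (rule integral_dominated_convergence[OF _ _ integrable_norm[OF G]])
    show "AE x in leb I. (\<lambda>m. cis (- ip I q x) * of_real (gau I (1 / Suc m) x) * ift I w x) \<longlonglongrightarrow> cis (- ip I q x) * ift I w x"
    proof (rule AE_I2)
      fix x
      have "(\<lambda>m. cis (- ip I q x) * of_real (gau I (1 / Suc m) x) * ift I w x) \<longlonglongrightarrow> cis (- ip I q x) * of_real 1 * ift I w x"
        by (intro tendsto_intros gau_tendsto)
      then show "(\<lambda>m. cis (- ip I q x) * of_real (gau I (1 / Suc m) x) * ift I w x) \<longlonglongrightarrow> cis (- ip I q x) * ift I w x" by simp
    qed
    show "AE x in leb I. norm (cis (- ip I q x) * of_real (gau I (1 / Suc m) x) * ift I w x) \<le> norm (ift I w x)" for m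
      using gau_bounds[of I "1 / Suc m"] by (auto simp: norm_mult less_imp_le intro!: AE_I2 mult_left_le_one_le)
  qed measurable
  then have "(\<lambda>m. of_real (sqrt (2 * pi) ^ card I) * (\<integral>z. w (\<lambda>i\<in>I. q i + (1 / Suc m) * z i) * of_real (gau I 1 z) \<partial>leb I))
     \<longlonglongrightarrow> (\<integral>x. cis (- ip I q x) * ift I w x \<partial>leb I)"
    by (subst (asm) gau_regularisation[OF I _ wi]) auto
  from LIMSEQ_unique[OF this gau_regularisation_limit(1)[OF I wc B q]]
  show ?thesis by (simp add: ft_def)
qed

text \<open>The transform of a nice function may fail to be integrable, so its square is first
  weighted by the cutoff. The weighted identity passes to the limit by monotone convergence on the
  left, the cutoffs increasing to 1, and by dominated convergence on the right.\<close>

theorem plancherel: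
  fixes w :: "('i::countable \<Rightarrow> real) \<Rightarrow> complex"
  assumes I: "finite I" and w: "nice I w"
  shows "(\<integral>\<^sup>+x. (ennreal (norm (ift I w x)))\<^sup>2 \<partial>leb I) = ennreal ((2 * pi) ^ card I) * (\<integral>\<^sup>+q. (ennreal (norm (w q)))\<^sup>2 \<partial>leb I)"
proof -
  obtain B where B: "\<And>x. x \<in> extensional I \<Longrightarrow> norm (w x) \<le> B" using w by (auto simp: nice_def)
  have wi: "integrable (leb I) w" and wc: "seqcont I w" using w by (auto simp: nice_def)
  define A where "A = (\<integral>q. norm (w q) \<partial>leb I)"
  have A: "norm (ift I w x) \<le> A" for x unfolding A_def by (rule norm_ift_le)
  note [measurable] = borel_measurable_integrable[OF wi] ift_measurable[OF I borel_measurable_integrable[OF wi]]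
  let ?S = "\<lambda>m q. of_real (sqrt (2 * pi) ^ card I) * (\<integral>z. w (\<lambda>i\<in>I. q i + (1 / Suc m) * z i) * of_real (gau I 1 z) \<partial>leb I)"
  have w2: "integrable (leb I) (\<lambda>q. (norm (w q))\<^sup>2)"
  proof (rule Bochner_Integration.integrable_bound[OF integrable_mult_right[OF integrable_norm[OF wi], of B]])
    show "AE x in leb I. norm ((norm (w x))\<^sup>2) \<le> norm (B * norm (w x))"
    proof (rule AE_I2)
      fix x assume "x \<in> space (leb I)"
      then have "norm (w x) * norm (w x) \<le> \<bar>B\<bar> * norm (w x)"
        using B[of x] by (intro mult_right_mono) (auto simp: space_leb)
      then show "norm ((norm (w x))\<^sup>2) \<le> norm (B * norm (w x))"
        by (simp add: power2_eq_square abs_mult)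
    qed
  qed measurable
  have cnj_ift: "cnj (ift I w x) = (\<integral>q. cis (- ip I q x) * cnj (w q) \<partial>leb I)" for x
  proof -
    have "(\<integral>q. cis (- ip I q x) * cnj (w q) \<partial>leb I) = (\<integral>q. cnj (cis (ip I q x) * w q) \<partial>leb I)"
      by (simp add: cis_cnj del: Bochner_Integration.integral_cnj)
    with Bochner_Integration.integral_cnj[of "leb I" "\<lambda>q. cis (ip I q x) * w q"] show ?thesis unfolding ift_def by simp
  qed
  \<comment> \<open>One factor of the squared modulus is expanded as an integral; exchanging the
    order produces the regularised inversion \<open>?S m\<close> of w.\<close>
  have key: "(\<integral>x. gau I (1 / Suc m) x * (norm (ift I w x))\<^sup>2 \<partial>leb I) = Re (\<integral>q. cnj (w q) * ?S m q \<partial>leb I)" for m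
  proof -
    let ?f = "\<lambda>x. of_real (gau I (1 / Suc m) x) * ift I w x"
    have f: "integrable (leb I) ?f"
    proof (rule Bochner_Integration.integrable_bound[OF integrable_mult_right[OF integrable_gau(2)[OF I, of "1 / Suc m"], of A]])
      show "AE x in leb I. norm (?f x) \<le> norm (A * gau I (1 / Suc m) x)"
        using gau_bounds[of I "1 / Suc m"] A
        by (auto simp: norm_mult abs_mult less_imp_le mult.commute intro!: AE_I2 mult_left_mono order.trans[OF _ abs_ge_self])
    qed (measurable; simp)+
    have "(\<integral>x. of_real (gau I (1 / Suc m) x * (norm (ift I w x))\<^sup>2) \<partial>leb I) =
      (\<integral>x. ?f x * (\<integral>q. cis (- ip I q x) * cnj (w q) \<partial>leb I) \<partial>leb I)"
      using cnj_ift by (simp only: complex_norm_square of_real_mult mult.assoc)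
    also have "\<dots> = (\<integral>q. cnj (w q) * (\<integral>x. cis (- ip I q x) * ?f x \<partial>leb I) \<partial>leb I)"
    proof (rule integral_swap_cis[OF leb_pair_sigma_finite[OF I I] f])
      have "(\<lambda>(x, y). ip I y x) \<in> borel_measurable (leb I \<Otimes>\<^sub>M leb I)"
        using measurable_compose[OF measurable_pair_swap' ip_measurable(3)[of I]] by (simp add: case_prod_beta)
      then show "(\<lambda>(x, y). - ip I y x) \<in> borel_measurable (leb I \<Otimes>\<^sub>M leb I)"
        by (simp add: case_prod_beta)
    qed (use wi in simp)
    also have "\<dots> = (\<integral>q. cnj (w q) * ?S m q \<partial>leb I)"
      using gau_regularisation[OF I _ wi, of "1 / Suc m"] by (simp add: mult.assoc)
    finally show ?thesis by (metis Re_complex_of_real integral_complex_of_real)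
  qed
  have "(\<lambda>m. \<integral>q. cnj (w q) * ?S m q \<partial>leb I) \<longlonglongrightarrow> (\<integral>q. cnj (w q) * (of_real ((2 * pi) ^ card I) * w q) \<partial>leb I)"
  proof (rule integral_dominated_convergence[where w="\<lambda>q. norm (w q) * ((2 * pi) ^ card I * B)"])
    show "integrable (leb I) (\<lambda>q. norm (w q) * ((2 * pi) ^ card I * B))" using wi by simp
    show "AE q in leb I. (\<lambda>m. cnj (w q) * ?S m q) \<longlonglongrightarrow> cnj (w q) * (of_real ((2 * pi) ^ card I) * w q)"
      by (intro AE_I2 tendsto_mult tendsto_const gau_regularisation_limit(1)[OF I wc B]) (auto simp: space_leb)
    show "AE q in leb I. norm (cnj (w q) * ?S m q) \<le> norm (w q) * ((2 * pi) ^ card I * B)" for m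
      unfolding norm_mult[of "cnj _"] complex_mod_cnj
      by (intro AE_I2 mult_left_mono gau_regularisation_limit(2)[OF I wc B]) (auto simp: space_leb)
    show "(\<lambda>q. cnj (w q) * ?S m q) \<in> borel_measurable (leb I)" for m
    proof -
      interpret sigma_finite_measure "leb I" by (rule leb_sigma_finite[OF I])
      have "(\<lambda>(q, z). \<lambda>i\<in>I. q i + (1 / Suc m) * z i) \<in> leb I \<Otimes>\<^sub>M leb I \<rightarrow>\<^sub>M leb I"
        by measurable
      then have [measurable]: "(\<lambda>(q, z). w (\<lambda>i\<in>I. q i + (1 / Suc m) * z i)) \<in> borel_measurable (leb I \<Otimes>\<^sub>M leb I)"
        using measurable_compose[of _ _ "leb I" w borel] by (simp add: case_prod_beta)
      have "(\<lambda>q. \<integral>z. w (\<lambda>i\<in>I. q i + (1 / Suc m) * z i) * of_real (gau I 1 z) \<partial>leb I) \<in> borel_measurable (leb I)"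
        by (rule borel_measurable_lebesgue_integral) measurable
      then show ?thesis
        by (intro borel_measurable_times measurable_compose[OF borel_measurable_integrable[OF wi] borel_measurable_cnj] borel_measurable_const)
    qed
    show "(\<lambda>q. cnj (w q) * (of_real ((2 * pi) ^ card I) * w q)) \<in> borel_measurable (leb I)"
      by (intro borel_measurable_times measurable_compose[OF borel_measurable_integrable[OF wi] borel_measurable_cnj]
        borel_measurable_const borel_measurable_integrable[OF wi])
  qed
  moreover have "cnj (w q) * (of_real ((2 * pi) ^ card I) * w q) = of_real ((2 * pi) ^ card I * (norm (w q))\<^sup>2)" for q
    by (simp only: of_real_mult complex_norm_square mult_ac)
  ultimately have "(\<lambda>m. \<integral>q. cnj (w q) * ?S m q \<partial>leb I) \<longlonglongrightarrow> (\<integral>q. of_real ((2 * pi) ^ card I * (norm (w q))\<^sup>2) \<partial>leb I)"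
    by (simp only:)
  from tendsto_Re[OF this] have lim: "(\<lambda>m. \<integral>x. gau I (1 / Suc m) x * (norm (ift I w x))\<^sup>2 \<partial>leb I)
      \<longlonglongrightarrow> Re (\<integral>q. of_real ((2 * pi) ^ card I * (norm (w q))\<^sup>2) \<partial>leb I)"
    by (simp only: key)
  have e: "(\<integral>\<^sup>+x. ennreal (gau I (1 / Suc m) x * (norm (ift I w x))\<^sup>2) \<partial>leb I) = ennreal (\<integral>x. gau I (1 / Suc m) x * (norm (ift I w x))\<^sup>2 \<partial>leb I)" for m
  proof (rule nn_integral_eq_integral)
    show "integrable (leb I) (\<lambda>x. gau I (1 / Suc m) x * (norm (ift I w x))\<^sup>2)"
    proof (rule Bochner_Integration.integrable_bound[OF integrable_mult_right[OF integrable_gau(2)[OF I, of "1 / Suc m"], of "A\<^sup>2"]])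
      show "AE x in leb I. norm (gau I (1 / Suc m) x * (norm (ift I w x))\<^sup>2) \<le> norm (A\<^sup>2 * gau I (1 / Suc m) x)"
        using gau_bounds[of I "1 / Suc m"] A
        by (auto simp: abs_mult less_imp_le mult.commute intro!: AE_I2 mult_left_mono power_mono)
    qed (measurable; simp)+
  qed (intro AE_I2 mult_nonneg_nonneg less_imp_le[OF gau_bounds(1)] zero_le_power2)
  have "(\<integral>\<^sup>+x. (SUP m. ennreal (gau I (1 / Suc m) x * (norm (ift I w x))\<^sup>2)) \<partial>leb I) =
      (SUP m. \<integral>\<^sup>+x. ennreal (gau I (1 / Suc m) x * (norm (ift I w x))\<^sup>2) \<partial>leb I)"
    by (rule nn_integral_monotone_convergence_SUP)
       (auto simp: incseq_def le_fun_def simp del: of_nat_Suc intro!: ennreal_leI mult_right_mono gau_mono)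
  moreover have "(SUP m. ennreal (gau I (1 / Suc m) x * (norm (ift I w x))\<^sup>2)) = (ennreal (norm (ift I w x)))\<^sup>2" for x
  proof (rule LIMSEQ_unique[OF LIMSEQ_SUP])
    show "incseq (\<lambda>m. ennreal (gau I (1 / Suc m) x * (norm (ift I w x))\<^sup>2))"
      by (auto simp: incseq_def simp del: of_nat_Suc intro!: ennreal_leI mult_right_mono gau_mono)
    have "(\<lambda>m. gau I (1 / Suc m) x * (norm (ift I w x))\<^sup>2) \<longlonglongrightarrow> 1 * (norm (ift I w x))\<^sup>2"
      by (intro tendsto_intros gau_tendsto)
    then show "(\<lambda>m. ennreal (gau I (1 / Suc m) x * (norm (ift I w x))\<^sup>2)) \<longlonglongrightarrow> (ennreal (norm (ift I w x)))\<^sup>2"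
      by (simp add: ennreal_power)
  qed
  moreover have "(SUP m. \<integral>\<^sup>+x. ennreal (gau I (1 / Suc m) x * (norm (ift I w x))\<^sup>2) \<partial>leb I)
     = ennreal (Re (\<integral>q. of_real ((2 * pi) ^ card I * (norm (w q))\<^sup>2) \<partial>leb I))"
  proof (rule LIMSEQ_unique[OF LIMSEQ_SUP])
    show "incseq (\<lambda>m. \<integral>\<^sup>+x. ennreal (gau I (1 / Suc m) x * (norm (ift I w x))\<^sup>2) \<partial>leb I)"
      by (auto simp: incseq_def simp del: of_nat_Suc intro!: nn_integral_mono ennreal_leI mult_right_mono gau_mono)
    show "(\<lambda>m. \<integral>\<^sup>+x. ennreal (gau I (1 / Suc m) x * (norm (ift I w x))\<^sup>2) \<partial>leb I)
      \<longlonglongrightarrow> ennreal (Re (\<integral>q. of_real ((2 * pi) ^ card I * (norm (w q))\<^sup>2) \<partial>leb I))"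
      unfolding e by (rule tendsto_ennrealI[OF lim])
  qed
  moreover have "Re (\<integral>q. of_real ((2 * pi) ^ card I * (norm (w q))\<^sup>2) \<partial>leb I) = (2 * pi) ^ card I * (\<integral>q. (norm (w q))\<^sup>2 \<partial>leb I)"
    using integral_complex_of_real[of "leb I" "\<lambda>q. (2 * pi) ^ card I * (norm (w q))\<^sup>2"] by simp
  moreover have "(\<integral>\<^sup>+q. (ennreal (norm (w q)))\<^sup>2 \<partial>leb I) = ennreal (\<integral>q. (norm (w q))\<^sup>2 \<partial>leb I)"
    using nn_integral_eq_integral[OF w2] by (simp add: ennreal_power)
  ultimately show ?thesis by (simp add: ennreal_mult)
qed

section \<open>The Schwartz space and its stability\<close>

subsection \<open>Schwartz functions as a coinductive predicate\<close>

text \<open>Integrals depending on a parameter are differentiated by dominated convergence, which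
  speaks of sequences of difference quotients.\<close>

lemma has_vector_derivative_iff_sequentially:
  fixes f :: "real \<Rightarrow> 'b::real_normed_vector"
  shows "(f has_vector_derivative D) (at x) \<longleftrightarrow>
    (\<forall>X. (\<forall>m. X m \<noteq> x) \<longrightarrow> X \<longlonglongrightarrow> x \<longrightarrow> (\<lambda>m. (f (X m) - f x) /\<^sub>R (X m - x)) \<longlonglongrightarrow> D)"
proof -
  have e: "norm (f y - f x - (y - x) *\<^sub>R D) / norm (y - x) = norm ((f y - f x) /\<^sub>R (y - x) - D)" if "y \<noteq> x" for y
  proof -
    have "f y - f x - (y - x) *\<^sub>R D = (y - x) *\<^sub>R ((f y - f x) /\<^sub>R (y - x) - D)"
      using that by (simp add: scaleR_diff_right)
    then show ?thesis using that by simp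
  qed
  have "(f has_vector_derivative D) (at x) \<longleftrightarrow>
      ((\<lambda>y. norm (f y - f x - (y - x) *\<^sub>R D) / norm (y - x)) \<longlongrightarrow> 0) (at x)"
    by (simp add: has_vector_derivative_def has_derivative_iff_norm bounded_linear_scaleR_left)
  also have "\<dots> \<longleftrightarrow> ((\<lambda>y. norm ((f y - f x) /\<^sub>R (y - x) - D)) \<longlongrightarrow> 0) (at x)"
    using e by (intro tendsto_cong) (auto simp: eventually_at_filter)
  also have "\<dots> \<longleftrightarrow> ((\<lambda>y. (f y - f x) /\<^sub>R (y - x)) \<longlongrightarrow> D) (at x)"
    by (simp add: tendsto_norm_zero_iff LIM_zero_iff)
  finally show ?thesis by (simp add: tendsto_at_iff_sequentially comp_def)
qed

lemma norm_diff_le_of_vector_derivative: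
  fixes f :: "real \<Rightarrow> 'b::real_normed_vector"
  assumes "\<And>u. u \<in> closed_segment s t \<Longrightarrow> (f has_vector_derivative g u) (at u)"
    and "\<And>u. u \<in> closed_segment s t \<Longrightarrow> norm (g u) \<le> A"
  shows "norm (f s - f t) \<le> A * \<bar>s - t\<bar>"
proof -
  have "norm (f s - f t) \<le> A * norm (s - t)"
  proof (rule differentiable_bound[where S="closed_segment s t" and f'="\<lambda>u h. h *\<^sub>R g u"])
    show "onorm (\<lambda>h. h *\<^sub>R g u) \<le> A" if "u \<in> closed_segment s t" for u
      using assms(2)[OF that] onorm_scaleR_left[OF bounded_linear_ident, of "g u"] by (simp add: onorm_id)
    show "(f has_derivative (\<lambda>h. h *\<^sub>R g u)) (at u within closed_segment s t)" if "u \<in> closed_segment s t" for u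
      using assms(1)[OF that] by (auto simp: has_vector_derivative_def intro: has_derivative_at_withinI)
  qed auto
  then show ?thesis by simp
qed

definition rapid :: "'i set \<Rightarrow> (('i \<Rightarrow> real) \<Rightarrow> complex) \<Rightarrow> bool" where
  "rapid I f \<longleftrightarrow> (\<forall>N. \<exists>A. \<forall>x\<in>extensional I. wgt I x ^ N * norm (f x) \<le> A)"

definition pder :: "'i set \<Rightarrow> 'i \<Rightarrow> (('i \<Rightarrow> real) \<Rightarrow> complex) \<Rightarrow> (('i \<Rightarrow> real) \<Rightarrow> complex) \<Rightarrow> bool" where
  "pder I c f g \<longleftrightarrow> (\<forall>x\<in>extensional I. ((\<lambda>t. f (x(c := t))) has_vector_derivative g x) (at (x c)))"

text \<open>The largest class of rapidly decreasing functions containing a partial derivative of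
  each member in each direction. A closure property is then proved by exhibiting a family stable
  under differentiation, without multi-indices or Leibniz formulas.\<close>

coinductive sch :: "'i set \<Rightarrow> (('i \<Rightarrow> real) \<Rightarrow> complex) \<Rightarrow> bool" for I where
  schI: "rapid I f \<Longrightarrow> \<forall>c\<in>I. \<exists>g. sch I g \<and> pder I c f g \<Longrightarrow> sch I f"

lemma sch_rapid: "sch I f \<Longrightarrow> rapid I f"
  by (erule sch.cases) auto

lemma sch_pder:
  assumes "sch I f" "c \<in> I"
  obtains g where "sch I g" "pder I c f g"
proof -
  from assms(1) have "\<forall>c\<in>I. \<exists>g. sch I g \<and> pder I c f g" by cases
  with assms(2) that show ?thesis by blast
qed

lemma sch_coinduct:
  assumes "P f" "\<And>f. P f \<Longrightarrow> rapid I f" "\<And>f c. P f \<Longrightarrow> c \<in> I \<Longrightarrow> \<exists>g. P g \<and> pder I c f g"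
  shows "sch I f"
  using assms(1) by (coinduct rule: sch.coinduct) (use assms(2,3) in blast)

lemma pderD:
  assumes "pder I c f g" "x \<in> extensional I" "c \<in> I"
  shows "((\<lambda>u. f (x(c := u))) has_vector_derivative g (x(c := t))) (at t)"
proof -
  have "x(c := t) \<in> extensional I" using assms by (auto simp: extensional_def)
  then show ?thesis using assms(1) by (fastforce simp: pder_def)
qed

lemma rapidE:
  assumes "rapid I f"
  obtains A where "A > 0" "\<And>x. x \<in> extensional I \<Longrightarrow> wgt I x ^ N * norm (f x) \<le> A"
    "\<And>x. x \<in> extensional I \<Longrightarrow> norm (f x) \<le> A * inverse (wgt I x ^ N)"
proof -
  obtain A where A: "\<And>x. x \<in> extensional I \<Longrightarrow> wgt I x ^ N * norm (f x) \<le> A"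
    using assms unfolding rapid_def by blast
  have A': "wgt I x ^ N * norm (f x) \<le> \<bar>A\<bar> + 1" if "x \<in> extensional I" for x
    using A[OF that] by linarith
  moreover have "norm (f x) \<le> (\<bar>A\<bar> + 1) * inverse (wgt I x ^ N)" if "x \<in> extensional I" for x
  proof -
    have "norm (f x) = (wgt I x ^ N * norm (f x)) * inverse (wgt I x ^ N)" by simp
    also have "\<dots> \<le> (\<bar>A\<bar> + 1) * inverse (wgt I x ^ N)"
      using A'[OF that] by (intro mult_right_mono) auto
    finally show ?thesis .
  qed
  ultimately show ?thesis using that[of "\<bar>A\<bar> + 1"] by auto
qed

lemma rapid_bounded:
  assumes "rapid I f"
  obtains A where "A > 0" "\<And>x. x \<in> extensional I \<Longrightarrow> norm (f x) \<le> A"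
  using rapidE[OF assms, of 0] by auto

text \<open>The two points are joined by changing one coordinate at a time, with the mean value
  bound on each axis-parallel segment. Bounded partial derivatives thus give joint
  continuity.\<close>

lemma lipschitz_of_pder:
  fixes f :: "('i \<Rightarrow> real) \<Rightarrow> complex"
  assumes pd: "\<And>c. c \<in> I \<Longrightarrow> pder I c f (g c)"
    and A: "\<And>c x. c \<in> I \<Longrightarrow> x \<in> extensional I \<Longrightarrow> norm (g c x) \<le> A c"
    and S: "finite S" "S \<subseteq> I"
  shows "x \<in> extensional I \<Longrightarrow> y \<in> extensional I \<Longrightarrow> (\<And>i. i \<in> I - S \<Longrightarrow> x i = y i) \<Longrightarrow>
     norm (f x - f y) \<le> (\<Sum>c\<in>S. A c * \<bar>x c - y c\<bar>)"
  using S
proof (induction S arbitrary: x rule: finite_induct)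
  case empty
  then have "x = y" by (intro extensionalityI[of x I y]) auto
  then show ?case by simp
next
  case (insert c S)
  let ?z = "x(c := y c)"
  have c: "c \<in> I" using insert by auto
  have z: "?z \<in> extensional I" using c insert.prems(1) by (auto simp: extensional_def)
  have "norm (f (x(c := x c)) - f (x(c := y c))) \<le> A c * \<bar>x c - y c\<bar>"
  proof (rule norm_diff_le_of_vector_derivative)
    fix u assume "u \<in> closed_segment (x c) (y c)"
    show "((\<lambda>u. f (x(c := u))) has_vector_derivative g c (x(c := u))) (at u)"
      by (rule pderD[OF pd[OF c] insert.prems(1) c])
    show "norm (g c (x(c := u))) \<le> A c"
      using c insert.prems(1) by (intro A) (auto simp: extensional_def)
  qed
  moreover have "norm (f ?z - f y) \<le> (\<Sum>d\<in>S. A d * \<bar>?z d - y d\<bar>)"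
    by (rule insert.IH[OF z insert.prems(2)]) (use insert.prems in auto)
  moreover have "(\<Sum>d\<in>S. A d * \<bar>?z d - y d\<bar>) = (\<Sum>d\<in>S. A d * \<bar>x d - y d\<bar>)"
    using insert.hyps by (intro sum.cong) auto
  moreover have "norm (f x - f y) \<le> norm (f x - f ?z) + norm (f ?z - f y)"
    using norm_triangle_ineq[of "f x - f ?z" "f ?z - f y"] by simp
  ultimately show ?case using insert.hyps by simp
qed

lemma sch_seqcont:
  assumes I: "finite I" and f: "sch I f"
  shows "seqcont I f"
proof -
  have "\<exists>g A. pder I c f g \<and> (\<forall>x\<in>extensional I. norm (g x) \<le> A)" if "c \<in> I" for c
    using sch_pder[OF f that] rapid_bounded[OF sch_rapid] by metis
  then obtain g A where g: "\<And>c. c \<in> I \<Longrightarrow> pder I c f (g c)"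
    "\<And>c x. c \<in> I \<Longrightarrow> x \<in> extensional I \<Longrightarrow> norm (g c x) \<le> A c" by metis
  show ?thesis
  proof (rule seqcontI)
    fix X :: "nat \<Rightarrow> 'a \<Rightarrow> real" and x :: "'a \<Rightarrow> real" assume X: "\<And>m. X m \<in> extensional I" "x \<in> extensional I" "\<And>i. i \<in> I \<Longrightarrow> (\<lambda>m. X m i) \<longlonglongrightarrow> x i"
    have "(\<lambda>m. \<Sum>c\<in>I. A c * \<bar>X m c - x c\<bar>) \<longlonglongrightarrow> (\<Sum>c\<in>I. A c * \<bar>x c - x c\<bar>)"
      by (intro tendsto_intros X)
    then have l: "(\<lambda>m. \<Sum>c\<in>I. A c * \<bar>X m c - x c\<bar>) \<longlonglongrightarrow> 0" by simp
    have "(\<lambda>m. f (X m) - f x) \<longlonglongrightarrow> 0"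
      by (rule Lim_null_comparison[OF always_eventually l])
         (use lipschitz_of_pder[OF g I order.refl X(1,2)] in auto)
    then show "(\<lambda>m. f (X m)) \<longlonglongrightarrow> f x" by (simp add: LIM_zero_iff)
  qed
qed

lemma sch_measurable:
  fixes f :: "('i::countable \<Rightarrow> real) \<Rightarrow> complex"
  shows "finite I \<Longrightarrow> sch I f \<Longrightarrow> f \<in> borel_measurable (leb I)"
  by (intro seqcont_measurable sch_seqcont)

lemma rapid_integrable:
  assumes I: "finite I" and f: "rapid I f" and [measurable]: "f \<in> borel_measurable (leb I)"
  shows "integrable (leb I) (\<lambda>x. wgt I x ^ N * norm (f x))" "integrable (leb I) f"
proof -
  obtain A where A: "A > 0" "\<And>x. x \<in> extensional I \<Longrightarrow> wgt I x ^ (N + card I) * norm (f x) \<le> A"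
    using rapidE[OF f, of "N + card I"] by metis
  have "wgt I x ^ N * norm (f x) \<le> A * inverse (wgt I x ^ card I)" if "x \<in> extensional I" for x
  proof -
    have "wgt I x ^ N * norm (f x) = (wgt I x ^ (N + card I) * norm (f x)) * inverse (wgt I x ^ card I)"
      by (simp add: power_add)
    also have "\<dots> \<le> A * inverse (wgt I x ^ card I)"
      using A(2)[OF that] by (intro mult_right_mono) auto
    finally show ?thesis .
  qed
  then show i: "integrable (leb I) (\<lambda>x. wgt I x ^ N * norm (f x))"
    by (intro Bochner_Integration.integrable_bound[OF integrable_mult_right[OF integrable_wgt[OF I order.refl], of A]])
       (auto simp: space_leb abs_mult less_imp_le[OF A(1)] intro!: AE_I2)
  show "integrable (leb I) f"
  proof (rule Bochner_Integration.integrable_bound[OF i])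
    have "1 * norm (f x) \<le> wgt I x ^ N * norm (f x)" for x
      by (intro mult_right_mono one_le_power wgt_ge1) auto
    then show "AE x in leb I. norm (f x) \<le> norm (wgt I x ^ N * norm (f x))"
      by (auto simp: abs_mult intro!: AE_I2)
  qed measurable
qed

lemma rapid_nice:
  fixes f :: "('i::countable \<Rightarrow> real) \<Rightarrow> complex"
  assumes "finite I" "rapid I f" "seqcont I f"
  shows "nice I f"
  using assms rapid_integrable(2)[OF assms(1,2) seqcont_measurable[OF assms(3)]] rapid_bounded[OF assms(2)]
  unfolding nice_def by metis

lemma sch_nice:
  fixes f :: "('i::countable \<Rightarrow> real) \<Rightarrow> complex"
  shows "finite I \<Longrightarrow> sch I f \<Longrightarrow> nice I f"
  by (intro rapid_nice sch_rapid sch_seqcont)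

lemma sch_integrable:
  fixes f :: "('i::countable \<Rightarrow> real) \<Rightarrow> complex"
  shows "finite I \<Longrightarrow> sch I f \<Longrightarrow> integrable (leb I) f"
  using sch_nice by (auto simp: nice_def)

subsection \<open>Closure properties of Schwartz functions\<close>

lemma rapid_add: "rapid I f \<Longrightarrow> rapid I g \<Longrightarrow> rapid I (\<lambda>x. f x + g x)"
  unfolding rapid_def
proof
  fix N assume *: "\<forall>N. \<exists>A. \<forall>x\<in>extensional I. wgt I x ^ N * norm (f x) \<le> A"
    "\<forall>N. \<exists>A. \<forall>x\<in>extensional I. wgt I x ^ N * norm (g x) \<le> A"
  then obtain A B where AB: "\<forall>x\<in>extensional I. wgt I x ^ N * norm (f x) \<le> A"
    "\<forall>x\<in>extensional I. wgt I x ^ N * norm (g x) \<le> B" by metis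
  have "wgt I x ^ N * norm (f x + g x) \<le> A + B" if "x \<in> extensional I" for x
  proof -
    have "wgt I x ^ N * norm (f x + g x) \<le> wgt I x ^ N * (norm (f x) + norm (g x))"
      by (intro mult_left_mono norm_triangle_ineq) simp
    also have "\<dots> \<le> A + B" using AB that by (simp add: distrib_left add_mono)
    finally show ?thesis .
  qed
  then show "\<exists>A. \<forall>x\<in>extensional I. wgt I x ^ N * norm (f x + g x) \<le> A" by blast
qed

lemma rapid_poly_bound:
  assumes f: "rapid I f" and b: "\<And>x. x \<in> extensional I \<Longrightarrow> norm (h x) \<le> B * wgt I x ^ M * norm (f x)"
  shows "rapid I h"
  unfolding rapid_def
proof
  fix N
  obtain A where A: "\<And>x. x \<in> extensional I \<Longrightarrow> wgt I x ^ (N + M) * norm (f x) \<le> A"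
    using rapidE[OF f, of "N + M"] by metis
  have "wgt I x ^ N * norm (h x) \<le> \<bar>B\<bar> * A" if x: "x \<in> extensional I" for x
  proof -
    have "wgt I x ^ N * norm (h x) \<le> wgt I x ^ N * (\<bar>B\<bar> * wgt I x ^ M * norm (f x))"
      by (intro mult_left_mono order.trans[OF b[OF x]] mult_right_mono) auto
    also have "\<dots> = \<bar>B\<bar> * (wgt I x ^ (N + M) * norm (f x))" by (simp add: power_add)
    also have "\<dots> \<le> \<bar>B\<bar> * A" by (intro mult_left_mono A x) simp
    finally show ?thesis .
  qed
  then show "\<exists>A. \<forall>x\<in>extensional I. wgt I x ^ N * norm (h x) \<le> A" by blast
qed

lemma sch_add:
  assumes "sch I f" "sch I g"
  shows "sch I (\<lambda>x. f x + g x)"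
proof (rule sch_coinduct[where P="\<lambda>h. \<exists>a b. sch I a \<and> sch I b \<and> h = (\<lambda>x. a x + b x)"])
  show "\<exists>a b. sch I a \<and> sch I b \<and> (\<lambda>x. f x + g x) = (\<lambda>x. a x + b x)" using assms by blast
next
  fix h assume "\<exists>a b. sch I a \<and> sch I b \<and> h = (\<lambda>x. a x + b x)"
  then obtain a b where ab: "sch I a" "sch I b" and h: "h = (\<lambda>x. a x + b x)" by blast
  show "rapid I h" unfolding h by (intro rapid_add sch_rapid ab)
  fix c assume c: "c \<in> I"
  obtain a' b' where "sch I a'" "pder I c a a'" "sch I b'" "pder I c b b'"
    using sch_pder[OF ab(1) c] sch_pder[OF ab(2) c] by metis
  then show "\<exists>g. (\<exists>a b. sch I a \<and> sch I b \<and> g = (\<lambda>x. a x + b x)) \<and> pder I c h g"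
    by (intro exI[of _ "\<lambda>x. a' x + b' x"])
       (auto simp: pder_def h intro!: has_vector_derivative_add)
qed

lemma sch_const_mult:
  assumes "sch I f"
  shows "sch I (\<lambda>x. k * f x)"
proof (rule sch_coinduct[where P="\<lambda>h. \<exists>a. sch I a \<and> h = (\<lambda>x. k * a x)"])
  show "\<exists>a. sch I a \<and> (\<lambda>x. k * f x) = (\<lambda>x. k * a x)" using assms by blast
next
  fix h assume "\<exists>a. sch I a \<and> h = (\<lambda>x. k * a x)"
  then obtain a where a: "sch I a" and h: "h = (\<lambda>x. k * a x)" by blast
  show "rapid I h" unfolding h
    by (rule rapid_poly_bound[OF sch_rapid[OF a], where B="norm k" and M=0]) (simp add: norm_mult)
  fix c assume c: "c \<in> I"
  obtain a' where "sch I a'" "pder I c a a'" using sch_pder[OF a c] by metis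
  then show "\<exists>g. (\<exists>a. sch I a \<and> g = (\<lambda>x. k * a x)) \<and> pder I c h g"
    by (intro exI[of _ "\<lambda>x. k * a' x"])
       (auto simp: pder_def h intro!: has_vector_derivative_mult_right)
qed

lemma sch_diff: "sch I f \<Longrightarrow> sch I g \<Longrightarrow> sch I (\<lambda>x. f x - g x)"
  using sch_add[of I f "\<lambda>x. - 1 * g x"] sch_const_mult[of I g "- 1"] by simp

lemma has_vector_derivative_coord:
  "((\<lambda>t. complex_of_real ((x(c := t)) d)) has_vector_derivative (if d = c then 1 else 0)) (at s)"
  by (auto intro!: derivative_eq_intros)

text \<open>The product rule leaves a term without the factor \<open>x d\<close>, so the stable
  family carries an additional Schwartz summand b.\<close>

lemma sch_coord_mult:
  assumes "finite I" "d \<in> I" "sch I f"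
  shows "sch I (\<lambda>x. of_real (x d) * f x)"
proof (rule sch_coinduct[where P="\<lambda>h. \<exists>a b. sch I a \<and> sch I b \<and> h = (\<lambda>x. of_real (x d) * a x + b x)"])
  have "sch I (\<lambda>x. 0)" using sch_const_mult[OF assms(3), of 0] by simp
  then show "\<exists>a b. sch I a \<and> sch I b \<and> (\<lambda>x. of_real (x d) * f x) = (\<lambda>x. of_real (x d) * a x + b x)"
    using assms(3) by (intro exI[of _ f] exI[of _ "\<lambda>x. 0"]) auto
next
  fix h :: "('a \<Rightarrow> real) \<Rightarrow> complex" assume "\<exists>a b. sch I a \<and> sch I b \<and> h = (\<lambda>x. of_real (x d) * a x + b x)"
  then obtain a b where ab: "sch I a" "sch I b" and h: "h = (\<lambda>x. of_real (x d) * a x + b x)" by blast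
  have "rapid I (\<lambda>x. of_real (x d) * a x)"
    by (rule rapid_poly_bound[OF sch_rapid[OF ab(1)], where B=1 and M=1])
       (auto simp: norm_mult intro!: mult_right_mono abs_coord_le_wgt assms)
  then show "rapid I h" unfolding h using sch_rapid[OF ab(2)] by (rule rapid_add)
  fix c assume c: "c \<in> I"
  obtain a' b' where g: "sch I a'" "pder I c a a'" "sch I b'" "pder I c b b'"
    using sch_pder[OF ab(1) c] sch_pder[OF ab(2) c] by metis
  let ?k = "if d = c then 1 else 0 :: complex"
  have "pder I c h (\<lambda>x. of_real (x d) * a' x + (?k * a x + b' x))"
    unfolding pder_def h
  proof
    fix x :: "'a \<Rightarrow> real" assume x: "x \<in> extensional I"
    have "((\<lambda>t. of_real ((x(c := t)) d) * a (x(c := t)) + b (x(c := t))) has_vector_derivative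
       of_real ((x(c := x c)) d) * a' x + ?k * a (x(c := x c)) + b' x) (at (x c))"
      using g x by (intro has_vector_derivative_add has_vector_derivative_mult has_vector_derivative_coord) (auto simp: pder_def)
    then show "((\<lambda>t. of_real ((x(c := t)) d) * a (x(c := t)) + b (x(c := t))) has_vector_derivative
       of_real (x d) * a' x + (?k * a x + b' x)) (at (x c))" by (simp add: add.assoc)
  qed
  moreover have "sch I (\<lambda>x. ?k * a x + b' x)" by (intro sch_add sch_const_mult g ab)
  ultimately show "\<exists>g. (\<exists>a b. sch I a \<and> sch I b \<and> g = (\<lambda>x. of_real (x d) * a x + b x)) \<and> pder I c h g"
    using g(1) by (intro exI[of _ "\<lambda>x. of_real (x d) * a' x + (?k * a x + b' x)"]) blast
qed

text \<open>Each derivative of the phase brings down a linear factor, absorbed by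
  \<open>sch_coord_mult\<close>, while a unimodular factor leaves the decay unchanged. On the
  Fourier side this is the stability of Schwartz functions under the free evolution.\<close>

lemma sch_unimodular_quadratic:
  fixes \<sigma> :: "'i \<Rightarrow> real"
  assumes I: "finite I" and f: "sch I f"
  shows "sch I (\<lambda>x. cis (\<Sum>i\<in>I. \<sigma> i * (x i)\<^sup>2) * f x)"
proof (rule sch_coinduct[where P="\<lambda>h. \<exists>a. sch I a \<and> h = (\<lambda>x. cis (\<Sum>i\<in>I. \<sigma> i * (x i)\<^sup>2) * a x)"])
  show "\<exists>a. sch I a \<and> (\<lambda>x. cis (\<Sum>i\<in>I. \<sigma> i * (x i)\<^sup>2) * f x) = (\<lambda>x. cis (\<Sum>i\<in>I. \<sigma> i * (x i)\<^sup>2) * a x)"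
    using f by blast
next
  fix h :: "('i \<Rightarrow> real) \<Rightarrow> complex" assume "\<exists>a. sch I a \<and> h = (\<lambda>x. cis (\<Sum>i\<in>I. \<sigma> i * (x i)\<^sup>2) * a x)"
  then obtain a where a: "sch I a" and h: "h = (\<lambda>x. cis (\<Sum>i\<in>I. \<sigma> i * (x i)\<^sup>2) * a x)" by blast
  show "rapid I h" unfolding h
    by (rule rapid_poly_bound[OF sch_rapid[OF a], where B=1 and M=0]) (simp add: norm_mult)
  fix c assume c: "c \<in> I"
  obtain a' where a': "sch I a'" "pder I c a a'" using sch_pder[OF a c] by metis
  let ?e = "\<lambda>x. cis (\<Sum>i\<in>I. \<sigma> i * (x i)\<^sup>2)"
  let ?b = "\<lambda>x. (2 * \<i> * \<sigma> c) * (of_real (x c) * a x) + a' x"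
  have "pder I c h (\<lambda>x. ?e x * ?b x)"
    unfolding pder_def h
  proof
    fix x :: "'i \<Rightarrow> real" assume x: "x \<in> extensional I"
    have s: "(\<Sum>i\<in>I. \<sigma> i * ((x(c := t)) i)\<^sup>2) = \<sigma> c * t\<^sup>2 + (\<Sum>i\<in>I - {c}. \<sigma> i * (x i)\<^sup>2)" for t
      using I c by (subst sum.remove[of I c]) auto
    have "((\<lambda>t. ?e (x(c := t))) has_vector_derivative (2 * \<sigma> c * x c) *\<^sub>R (\<i> * ?e (x(c := x c)))) (at (x c))"
      unfolding s has_vector_derivative_def by (auto intro!: derivative_eq_intros)
    then have "((\<lambda>t. ?e (x(c := t)) * a (x(c := t))) has_vector_derivative
       ?e (x(c := x c)) * a' x + (2 * \<sigma> c * x c) *\<^sub>R (\<i> * ?e (x(c := x c))) * a (x(c := x c))) (at (x c))"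
      using a' x by (intro has_vector_derivative_mult) (auto simp: pder_def)
    then show "((\<lambda>t. ?e (x(c := t)) * a (x(c := t))) has_vector_derivative ?e x * ?b x) (at (x c))"
      by (simp add: scaleR_conv_of_real algebra_simps)
  qed
  moreover have "sch I ?b" by (intro sch_add sch_const_mult sch_coord_mult a a' I c)
  ultimately show "\<exists>g. (\<exists>a. sch I a \<and> g = (\<lambda>x. ?e x * a x)) \<and> pder I c h g"
    by blast
qed

lemma ip_update:
  assumes "finite I" "c \<in> I"
  shows "ip I q (x(c := t)) = ip I q x + q c * (t - x c)" "ip I (q(c := t)) x = ip I q x + (t - q c) * x c"
proof -
  have "(\<Sum>i\<in>I - {c}. q i * (x(c := t)) i) = (\<Sum>i\<in>I - {c}. q i * x i)"
    "(\<Sum>i\<in>I - {c}. (q(c := t)) i * x i) = (\<Sum>i\<in>I - {c}. q i * x i)"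
    by (auto intro!: sum.cong)
  then show "ip I q (x(c := t)) = ip I q x + q c * (t - x c)" "ip I (q(c := t)) x = ip I q x + (t - q c) * x c"
    using assms unfolding ip_def by (simp_all add: sum.remove[of I c] algebra_simps)
qed

lemma wgt_update:
  assumes "finite I" "c \<in> I"
  shows "wgt I (x(c := t)) = wgt I x + t\<^sup>2 - (x c)\<^sup>2"
proof -
  have "(\<Sum>i\<in>I - {c}. ((x(c := t)) i)\<^sup>2) = (\<Sum>i\<in>I - {c}. (x i)\<^sup>2)"
    by (auto intro!: sum.cong)
  then show ?thesis using assms unfolding wgt_def by (simp add: sum.remove[of I c])
qed

text \<open>Rests on \<open>(x c)\<^sup>2 \<le> 2 * t\<^sup>2 + 2\<close>. It lets a difference
  quotient with step at most 1 inherit the decay of the derivative along its whole segment.\<close>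

lemma wgt_shift:
  assumes I: "finite I" "c \<in> I" and t: "\<bar>t - x c\<bar> \<le> 1"
  shows "wgt I x \<le> 3 * wgt I (x(c := t))"
proof -
  have "(x c)\<^sup>2 = 2 * t\<^sup>2 + 2 * (t - x c)\<^sup>2 - (2 * t - x c)\<^sup>2"
    by (simp add: power2_eq_square algebra_simps)
  also have "\<dots> \<le> 2 * t\<^sup>2 + 2 * 1 - 0"
    using t by (intro diff_mono add_mono mult_left_mono) (auto simp: abs_square_le_1)
  finally have 1: "(x c)\<^sup>2 \<le> 2 * t\<^sup>2 + 2" by simp
  have 2: "1 + (x c)\<^sup>2 \<le> wgt I x" by (rule coord_le_wgt[OF I])
  have "0 \<le> t\<^sup>2" by simp
  with 1 2 show ?thesis unfolding wgt_update[OF I] distrib_left right_diff_distrib by linarith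
qed

lemma cis_lipschitz: "norm (cis a - cis b) \<le> \<bar>a - b\<bar>"
proof -
  have "norm (cis a - cis b) \<le> 1 * \<bar>a - b\<bar>"
    by (rule norm_diff_le_of_vector_derivative[where g="\<lambda>u. \<i> * cis u"])
       (auto simp: has_vector_derivative_def norm_mult intro!: derivative_eq_intros)
  then show ?thesis by simp
qed

text \<open>Obtained by differentiating the translation rule \<open>ft (f(\<cdot> + h e\<^sub>c)) = cis (h q\<^sub>c) ft f\<close> at \<open>h = 0\<close>.\<close>

lemma ft_pder:
  fixes f g :: "('i::countable \<Rightarrow> real) \<Rightarrow> complex"
  assumes I: "finite I" and c: "c \<in> I" and f: "sch I f" and g: "sch I g" and fg: "pder I c f g"
  shows "ft I g q = \<i> * of_real (q c) * ft I f q"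
proof -
  define h where "h m = 1 / real (Suc m)" for m
  have h: "0 < h m" "h m \<le> 1" "h \<longlonglongrightarrow> 0" for m
    using LIMSEQ_Suc[OF lim_1_over_n[where 'a=real]] by (auto simp: h_def[abs_def])
  define D where "D m x = (f (x(c := x c + h m)) - f x) /\<^sub>R h m" for m x
  define N where "N = card I"
  obtain A where A: "A > 0" "\<And>x. x \<in> extensional I \<Longrightarrow> norm (g x) \<le> A * inverse (wgt I x ^ N)"
    using rapidE[OF sch_rapid[OF g], of N] by metis
  have f_meas [measurable]: "f \<in> borel_measurable (leb I)" and g_meas [measurable]: "g \<in> borel_measurable (leb I)"
    using sch_measurable[OF I] f g by auto
  have fi: "integrable (leb I) (\<lambda>x. cis (- ip I q x) * f x)"
    by (intro integrable_cis_mult sch_integrable I f) measurable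
  have upd: "(\<lambda>i\<in>I. (if i = c then h m else 0) + 1 * x i) = x(c := x c + h m)" if "x \<in> space (leb I)" for x m
    using that c by (auto simp: space_leb extensional_def)
  have shift_meas [measurable]: "(\<lambda>x. f (x(c := x c + h m))) \<in> borel_measurable (leb I)" for m
  proof -
    have "(\<lambda>x. f (\<lambda>i\<in>I. (if i = c then h m else 0) + 1 * x i)) \<in> borel_measurable (leb I)"
      by (rule measurable_compose[OF _ f_meas]) measurable
    also have "?this \<longleftrightarrow> ?thesis"
      by (rule measurable_cong) (simp only: upd)
    finally show ?thesis .
  qed
  have ip_shift: "ip I q (x(c := x c + h m)) = ip I q x + q c * h m" for x m
    by (simp add: ip_update[OF I c])
  have cis_shift: "cis (- ip I q x) * f (x(c := x c + h m)) = cis (q c * h m) * (cis (- ip I q (x(c := x c + h m))) * f (x(c := x c + h m)))" for x m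
    by (simp add: ip_shift cis_mult flip: mult.assoc)
  have bochner: "integrable (leb I) (\<lambda>x. cis (- ip I q (x(c := x c + h m))) * f (x(c := x c + h m)))"
    "(\<integral>x. cis (- ip I q (x(c := x c + h m))) * f (x(c := x c + h m)) \<partial>leb I) = ft I f q" for m
  proof -
    let ?F = "\<lambda>x. cis (- ip I q x) * f x"
    have "integrable (leb I) (\<lambda>x. ?F (\<lambda>i\<in>I. (if i = c then h m else 0) + 1 * x i))"
      using fi by (subst (asm) integrable_leb_affine[OF I, of 1 _ "\<lambda>i. if i = c then h m else 0"]) auto
    then show "integrable (leb I) (\<lambda>x. cis (- ip I q (x(c := x c + h m))) * f (x(c := x c + h m)))"
      by (rule Bochner_Integration.integrable_cong[OF refl, THEN iffD1, rotated]) (simp only: upd)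
    have "ft I f q = \<bar>1\<bar> ^ card I *\<^sub>R (\<integral>x. ?F (\<lambda>i\<in>I. (if i = c then h m else 0) + 1 * x i) \<partial>leb I)"
      unfolding ft_def by (rule integral_leb_affine[OF I]) auto
    also have "(\<integral>x. ?F (\<lambda>i\<in>I. (if i = c then h m else 0) + 1 * x i) \<partial>leb I) = (\<integral>x. ?F (x(c := x c + h m)) \<partial>leb I)"
      by (rule Bochner_Integration.integral_cong) (simp_all only: upd)
    finally show "(\<integral>x. cis (- ip I q (x(c := x c + h m))) * f (x(c := x c + h m)) \<partial>leb I) = ft I f q" by simp
  qed
  \<comment> \<open>The mean value bound gives a majorant independent of the step;
    \<open>3 ^ N\<close> is the loss of \<open>wgt_shift\<close> along the segment.\<close>
  have lim1: "(\<lambda>m. \<integral>x. cis (- ip I q x) * D m x \<partial>leb I) \<longlonglongrightarrow> (\<integral>x. cis (- ip I q x) * g x \<partial>leb I)"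
  proof (rule integral_dominated_convergence[where w="\<lambda>x. A * 3 ^ N * inverse (wgt I x ^ N)"])
    show "integrable (leb I) (\<lambda>x. A * 3 ^ N * inverse (wgt I x ^ N))"
      by (intro integrable_mult_right integrable_wgt I) (simp add: N_def)
    show "AE x in leb I. (\<lambda>m. cis (- ip I q x) * D m x) \<longlonglongrightarrow> cis (- ip I q x) * g x"
    proof (intro AE_I2 tendsto_mult tendsto_const)
      fix x assume "x \<in> space (leb I)"
      then have "((\<lambda>t. f (x(c := t))) has_vector_derivative g x) (at (x c))"
        using fg by (auto simp: pder_def space_leb)
      moreover have "(\<lambda>m. x c + h m) \<longlonglongrightarrow> x c" using tendsto_add[OF tendsto_const h(3), of "x c"] by simp
      moreover have "x c + h m \<noteq> x c" for m using h(1)[of m] by simp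
      ultimately have "(\<lambda>m. (f (x(c := x c + h m)) - f (x(c := x c))) /\<^sub>R ((x c + h m) - x c)) \<longlonglongrightarrow> g x"
        unfolding has_vector_derivative_iff_sequentially by (elim allE[of _ "\<lambda>m. x c + h m"]) simp
      then show "(\<lambda>m. D m x) \<longlonglongrightarrow> g x" by (simp add: D_def)
    qed
    show "AE x in leb I. norm (cis (- ip I q x) * D m x) \<le> A * 3 ^ N * inverse (wgt I x ^ N)" for m
    proof (rule AE_I2)
      fix x assume "x \<in> space (leb I)"
      then have x: "x \<in> extensional I" by (simp add: space_leb)
      have "norm (f (x(c := x c + h m)) - f (x(c := x c))) \<le> A * 3 ^ N * inverse (wgt I x ^ N) * \<bar>(x c + h m) - x c\<bar>"
      proof (rule norm_diff_le_of_vector_derivative)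
        fix u assume u: "u \<in> closed_segment (x c + h m) (x c)"
        then have u': "\<bar>u - x c\<bar> \<le> 1" using h(1,2)[of m] by (auto simp: closed_segment_eq_real_ivl)
        show "((\<lambda>u. f (x(c := u))) has_vector_derivative g (x(c := u))) (at u)"
          by (rule pderD[OF fg x c])
        have "norm (g (x(c := u))) \<le> A * inverse (wgt I (x(c := u)) ^ N)"
          using x c by (intro A) (auto simp: extensional_def)
        also have "wgt I x ^ N \<le> 3 ^ N * wgt I (x(c := u)) ^ N"
          using power_mono[OF wgt_shift[OF I c, of u x, OF u'], of N] by (simp add: power_mult_distrib)
        then have "inverse (wgt I (x(c := u)) ^ N) \<le> 3 ^ N * inverse (wgt I x ^ N)"
          by (simp add: field_simps)
        finally show "norm (g (x(c := u))) \<le> A * 3 ^ N * inverse (wgt I x ^ N)"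
          using A(1) by (simp add: mult.assoc)
      qed
      then show "norm (cis (- ip I q x) * D m x) \<le> A * 3 ^ N * inverse (wgt I x ^ N)"
        using h(1)[of m] by (simp add: D_def norm_mult divide_simps)
    qed
    show "(\<lambda>x. cis (- ip I q x) * D m x) \<in> borel_measurable (leb I)" for m
      unfolding D_def by measurable
  qed measurable
  have eq: "(\<integral>x. cis (- ip I q x) * D m x \<partial>leb I) = ((cis (q c * h m) - cis (q c * 0)) /\<^sub>R (h m - 0)) * ft I f q" for m
  proof -
    have "(\<integral>x. cis (- ip I q x) * D m x \<partial>leb I) =
       (\<integral>x. (cis (q c * h m) * (cis (- ip I q (x(c := x c + h m))) * f (x(c := x c + h m))) - cis (- ip I q x) * f x) /\<^sub>R h m \<partial>leb I)"
      unfolding D_def by (simp only: cis_shift[symmetric] mult_scaleR_right right_diff_distrib)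
    also have "\<dots> = (cis (q c * h m) * ft I f q - ft I f q) /\<^sub>R h m"
      using fi bochner[of m] by (simp add: ft_def)
    finally show ?thesis by (simp add: left_diff_distrib)
  qed
  have lim2: "(\<lambda>m. ((cis (q c * h m) - cis (q c * 0)) /\<^sub>R (h m - 0)) * ft I f q) \<longlonglongrightarrow> (q c *\<^sub>R (\<i> * cis (q c * 0))) * ft I f q"
  proof (intro tendsto_mult tendsto_const)
    have "((\<lambda>t. cis (q c * t)) has_vector_derivative q c *\<^sub>R (\<i> * cis (q c * 0))) (at 0)"
      by (auto simp: has_vector_derivative_def intro!: derivative_eq_intros)
    then show "(\<lambda>m. (cis (q c * h m) - cis (q c * 0)) /\<^sub>R (h m - 0)) \<longlonglongrightarrow> q c *\<^sub>R (\<i> * cis (q c * 0))"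
      using h(1,3) unfolding has_vector_derivative_iff_sequentially
      by (elim allE[of _ h]) (auto simp: less_imp_neq[THEN not_sym])
  qed
  from LIMSEQ_unique[OF lim1[unfolded eq] lim2] show ?thesis by (simp add: ft_def scaleR_conv_of_real mult_ac)
qed

text \<open>Differentiation under the integral sign: the Lipschitz bound for \<open>cis\<close>
  gives the majorant |x_c| |f(x)|, integrable by rapid decay.\<close>

lemma pder_ft:
  fixes f :: "('i::countable \<Rightarrow> real) \<Rightarrow> complex"
  assumes I: "finite I" and c: "c \<in> I" and f: "sch I f"
  shows "pder I c (ft I f) (ft I (\<lambda>x. - \<i> * (of_real (x c) * f x)))"
  unfolding pder_def has_vector_derivative_iff_sequentially
proof (intro ballI allI impI)
  fix q :: "'i \<Rightarrow> real" and X :: "nat \<Rightarrow> real" assume X: "\<forall>m. X m \<noteq> q c" "X \<longlonglongrightarrow> q c"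
  have [measurable]: "f \<in> borel_measurable (leb I)" "(\<lambda>x. x c) \<in> borel_measurable (leb I)"
    using sch_measurable[OF I f] leb_component_measurable[OF c] by auto
  have fi: "integrable (leb I) (\<lambda>x. cis (- ip I p x) * f x)" for p
    by (intro integrable_cis_mult sch_integrable I f) measurable
  have lim: "(\<lambda>m. \<integral>x. ((cis (- ip I (q(c := X m)) x) - cis (- ip I (q(c := q c)) x)) /\<^sub>R (X m - q c)) * f x \<partial>leb I)
     \<longlonglongrightarrow> (\<integral>x. ((- x c) *\<^sub>R (\<i> * cis (- ip I (q(c := q c)) x))) * f x \<partial>leb I)"
  proof (rule integral_dominated_convergence[where w="\<lambda>x. wgt I x ^ 1 * norm (f x)"])
    show "integrable (leb I) (\<lambda>x. wgt I x ^ 1 * norm (f x))"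
      by (rule rapid_integrable[OF I sch_rapid[OF f]]) measurable
    show "AE x in leb I. (\<lambda>m. ((cis (- ip I (q(c := X m)) x) - cis (- ip I (q(c := q c)) x)) /\<^sub>R (X m - q c)) * f x)
       \<longlonglongrightarrow> ((- x c) *\<^sub>R (\<i> * cis (- ip I (q(c := q c)) x))) * f x"
    proof (intro AE_I2 tendsto_mult tendsto_const)
      fix x
      have "((\<lambda>t. cis (- ip I (q(c := t)) x)) has_vector_derivative (- x c) *\<^sub>R (\<i> * cis (- ip I (q(c := q c)) x))) (at (q c))"
        unfolding ip_update[OF I c]
        by (auto simp: has_vector_derivative_def intro!: derivative_eq_intros)
      then show "(\<lambda>m. (cis (- ip I (q(c := X m)) x) - cis (- ip I (q(c := q c)) x)) /\<^sub>R (X m - q c)) \<longlonglongrightarrow> (- x c) *\<^sub>R (\<i> * cis (- ip I (q(c := q c)) x))"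
        using X unfolding has_vector_derivative_iff_sequentially by blast
    qed
    show "AE x in leb I. norm (((cis (- ip I (q(c := X m)) x) - cis (- ip I (q(c := q c)) x)) /\<^sub>R (X m - q c)) * f x) \<le> wgt I x ^ 1 * norm (f x)" for m
    proof (rule AE_I2)
      fix x
      have "norm (cis (- ip I (q(c := X m)) x) - cis (- ip I (q(c := q c)) x)) \<le> \<bar>x c\<bar> * \<bar>X m - q c\<bar>"
        by (rule order.trans[OF cis_lipschitz]) (simp add: ip_update[OF I c] abs_mult mult.commute)
      also have "\<dots> \<le> wgt I x * \<bar>X m - q c\<bar>" by (intro mult_right_mono abs_coord_le_wgt I c) simp
      finally have "norm ((cis (- ip I (q(c := X m)) x) - cis (- ip I (q(c := q c)) x)) /\<^sub>R (X m - q c)) \<le> wgt I x"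
        using X(1) by (simp add: divide_simps)
      then show "norm (((cis (- ip I (q(c := X m)) x) - cis (- ip I (q(c := q c)) x)) /\<^sub>R (X m - q c)) * f x) \<le> wgt I x ^ 1 * norm (f x)"
        by (simp only: norm_mult power_one_right mult_right_mono norm_ge_zero)
    qed
  qed measurable
  have eq1: "(\<integral>x. ((cis (- ip I (q(c := X m)) x) - cis (- ip I (q(c := q c)) x)) /\<^sub>R (X m - q c)) * f x \<partial>leb I)
     = (ft I f (q(c := X m)) - ft I f (q(c := q c))) /\<^sub>R (X m - q c)" for m
    unfolding ft_def using fi by (simp add: left_diff_distrib)
  have eq2: "(\<integral>x. ((- x c) *\<^sub>R (\<i> * cis (- ip I (q(c := q c)) x))) * f x \<partial>leb I) = ft I (\<lambda>x. - \<i> * (of_real (x c) * f x)) q"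
    unfolding ft_def by (simp add: scaleR_conv_of_real mult_ac)
  show "(\<lambda>m. (ft I f (q(c := X m)) - ft I f (q(c := q c))) /\<^sub>R (X m - q c)) \<longlonglongrightarrow> ft I (\<lambda>x. - \<i> * (of_real (x c) * f x)) q"
    using lim unfolding eq1 eq2 .
qed

lemma ft_add:
  fixes f g :: "('i::countable \<Rightarrow> real) \<Rightarrow> complex"
  assumes I: "finite I" and "sch I f" "sch I g"
  shows "ft I (\<lambda>x. f x + g x) q = ft I f q + ft I g q"
proof -
  have "integrable (leb I) (\<lambda>x. cis (- ip I q x) * f x)" "integrable (leb I) (\<lambda>x. cis (- ip I q x) * g x)"
    by (rule integrable_cis_mult[OF sch_integrable[OF I]], fact, measurable)+
  then show ?thesis by (simp add: ft_def distrib_left)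
qed

lemma ft_const_mult: "ft I (\<lambda>x. k * f x) q = k * ft I f q"
  by (simp add: ft_def mult.left_commute)

text \<open>The witness is f minus the sum of its second derivatives, built one coordinate at a
  time, since two derivatives in direction c multiply the transform by
  \<open>- (q c)\<^sup>2\<close>. Iteration in \<open>rapid_ft\<close> yields decay of every
  order.\<close>

lemma wgt_mult_ft:
  fixes f :: "('i::countable \<Rightarrow> real) \<Rightarrow> complex"
  assumes I: "finite I" and f: "sch I f"
  shows "\<exists>b. sch I b \<and> (\<forall>q. of_real (wgt I q) * ft I f q = ft I b q)"
proof -
  have "\<exists>b. sch I b \<and> (\<forall>q. of_real (\<Sum>c\<in>S. (q c)\<^sup>2) * ft I f q = ft I b q)" if "finite S" "S \<subseteq> I" for S
    using that
  proof (induction S rule: finite_induct)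
    case empty
    have "sch I (\<lambda>x. 0 * f x)" "\<forall>q. ft I (\<lambda>x. 0 * f x) q = 0" by (intro sch_const_mult f) (simp add: ft_def)
    then show ?case by force
  next
    case (insert c S)
    then have c: "c \<in> I" by simp
    from insert obtain b where b: "sch I b" "\<And>q. of_real (\<Sum>c\<in>S. (q c)\<^sup>2) * ft I f q = ft I b q" by auto
    obtain f1 where f1: "sch I f1" "pder I c f f1" by (rule sch_pder[OF f c])
    obtain f2 where f2: "sch I f2" "pder I c f1 f2" by (rule sch_pder[OF f1(1) c])
    have "of_real (\<Sum>d\<in>insert c S. (q d)\<^sup>2) * ft I f q = ft I (\<lambda>x. b x - f2 x) q" for q
    proof -
      have "ft I f2 q = \<i> * of_real (q c) * (\<i> * of_real (q c) * ft I f q)"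
        using ft_pder[OF I c f1(1) f2] ft_pder[OF I c f f1] by simp
      then have 1: "ft I f2 q = - (of_real ((q c)\<^sup>2) * ft I f q)"
        by (simp add: power2_eq_square algebra_simps)
      have "ft I (\<lambda>x. b x + (- 1) * f2 x) q = ft I b q + (- 1) * ft I f2 q"
        by (subst ft_add[OF I b(1) sch_const_mult[OF f2(1)]]) (simp only: ft_const_mult)
      then have "ft I (\<lambda>x. b x - f2 x) q = ft I b q - ft I f2 q" by simp
      also have "\<dots> = of_real (\<Sum>d\<in>insert c S. (q d)\<^sup>2) * ft I f q"
        unfolding 1 b(2)[symmetric] using insert.hyps by (simp add: distrib_right)
      finally show ?thesis by simp
    qed
    moreover have "sch I (\<lambda>x. b x - f2 x)" by (intro sch_diff b f2)
    ultimately show ?case by blast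
  qed
  from this[OF I order.refl] obtain b where b: "sch I b" "\<And>q. of_real (\<Sum>c\<in>I. (q c)\<^sup>2) * ft I f q = ft I b q" by blast
  have "of_real (wgt I q) * ft I f q = ft I (\<lambda>x. f x + b x) q" for q
    unfolding wgt_def ft_add[OF I f b(1)] b(2)[symmetric] by (simp add: distrib_right)
  then show ?thesis using sch_add[OF f b(1)] by blast
qed

lemma rapid_ft:
  fixes f :: "('i::countable \<Rightarrow> real) \<Rightarrow> complex"
  assumes I: "finite I" and f: "sch I f"
  shows "rapid I (ft I f)"
  unfolding rapid_def
proof
  fix N
  have "\<exists>b. sch I b \<and> (\<forall>q. of_real (wgt I q ^ N) * ft I f q = ft I b q)"
  proof (induction N)
    case 0
    then show ?case using f by auto
  next
    case (Suc N)
    then obtain b where b: "sch I b" "\<And>q. of_real (wgt I q ^ N) * ft I f q = ft I b q" by blast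
    obtain b' where b': "sch I b'" "\<And>q. of_real (wgt I q) * ft I b q = ft I b' q"
      using wgt_mult_ft[OF I b(1)] by blast
    have "of_real (wgt I q ^ Suc N) * ft I f q = ft I b' q" for q
      unfolding b'(2)[symmetric] b(2)[symmetric] by simp
    then show ?case using b'(1) by blast
  qed
  then obtain b where b: "sch I b" "\<And>q. of_real (wgt I q ^ N) * ft I f q = ft I b q" by blast
  have "wgt I q ^ N * norm (ft I f q) \<le> (\<integral>x. norm (b x) \<partial>leb I)" for q
  proof -
    have "wgt I q ^ N * norm (ft I f q) = norm (of_real (wgt I q ^ N) * ft I f q)"
      by (simp add: norm_mult norm_power)
    also have "\<dots> = norm (ft I b q)" by (simp only: b)
    also have "\<dots> \<le> (\<integral>x. norm (b x) \<partial>leb I)" by (rule norm_ft_le)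
    finally show ?thesis .
  qed
  then show "\<exists>A. \<forall>x\<in>extensional I. wgt I x ^ N * norm (ft I f x) \<le> A" by blast
qed

lemma sch_ft:
  fixes f :: "('i::countable \<Rightarrow> real) \<Rightarrow> complex"
  assumes I: "finite I" and f: "sch I f"
  shows "sch I (ft I f)"
proof (rule sch_coinduct[where P="\<lambda>h. \<exists>a. sch I a \<and> h = ft I a"])
  show "\<exists>a. sch I a \<and> ft I f = ft I a" using f by blast
next
  fix h assume "\<exists>a. sch I a \<and> h = ft I a"
  then obtain a where a: "sch I a" and h: "h = ft I a" by blast
  show "rapid I h" unfolding h by (rule rapid_ft[OF I a])
  fix c assume c: "c \<in> I"
  have "sch I (\<lambda>x. - \<i> * (of_real (x c) * a x))" by (intro sch_const_mult sch_coord_mult I c a)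
  then show "\<exists>g. (\<exists>a. sch I a \<and> g = ft I a) \<and> pder I c h g"
    using pder_ft[OF I c a] unfolding h by blast
qed

lemma pder_reflect:
  assumes "pder I c f g" "c \<in> I"
  shows "pder I c (\<lambda>x. f (\<lambda>i\<in>I. - x i)) (\<lambda>x. - g (\<lambda>i\<in>I. - x i))"
  unfolding pder_def
proof
  fix x :: "'a \<Rightarrow> real" assume x: "x \<in> extensional I"
  let ?y = "\<lambda>i\<in>I. - x i"
  have "((\<lambda>u. f (?y(c := u))) has_vector_derivative g (?y(c := - x c))) (at (- x c))"
    by (rule pderD[OF assms(1) _ assms(2)]) simp
  moreover have "?y(c := - x c) = ?y" using assms(2) by auto
  ultimately have "((\<lambda>u. f (?y(c := u))) has_vector_derivative g ?y) (at (- x c))" by simp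
  then have "((\<lambda>u. f (?y(c := u))) \<circ> uminus has_vector_derivative (- 1) *\<^sub>R g ?y) (at (x c))"
    by (intro vector_diff_chain_at) (auto intro!: derivative_eq_intros)
  moreover have "(\<lambda>u. f (?y(c := u))) \<circ> uminus = (\<lambda>t. f (\<lambda>i\<in>I. - (x(c := t)) i))"
    using assms(2) by (auto simp: fun_eq_iff intro!: arg_cong[where f=f])
  ultimately show "((\<lambda>t. f (\<lambda>i\<in>I. - (x(c := t)) i)) has_vector_derivative - g ?y) (at (x c))" by simp
qed

lemma wgt_reflect: "wgt I (\<lambda>i\<in>I. - x i) = wgt I x"
  by (simp add: wgt_def)

lemma sch_reflect:
  assumes f: "sch I f"
  shows "sch I (\<lambda>x. f (\<lambda>i\<in>I. - x i))"
proof (rule sch_coinduct[where P="\<lambda>h. \<exists>a. sch I a \<and> h = (\<lambda>x. a (\<lambda>i\<in>I. - x i))"])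
  show "\<exists>a. sch I a \<and> (\<lambda>x. f (\<lambda>i\<in>I. - x i)) = (\<lambda>x. a (\<lambda>i\<in>I. - x i))" using f by blast
next
  fix h :: "('a \<Rightarrow> real) \<Rightarrow> complex" assume "\<exists>a. sch I a \<and> h = (\<lambda>x. a (\<lambda>i\<in>I. - x i))"
  then obtain a where a: "sch I a" and h: "h = (\<lambda>x. a (\<lambda>i\<in>I. - x i))" by blast
  show "rapid I h" unfolding h rapid_def
  proof
    fix N
    obtain A where "\<And>x. x \<in> extensional I \<Longrightarrow> wgt I x ^ N * norm (a x) \<le> A"
      using rapidE[OF sch_rapid[OF a], of N] by metis
    from this[of "\<lambda>i\<in>I. - x i" for x] show "\<exists>A. \<forall>x\<in>extensional I. wgt I x ^ N * norm (a (\<lambda>i\<in>I. - x i)) \<le> A"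
      unfolding wgt_reflect by (metis restrict_extensional)
  qed
  fix c assume c: "c \<in> I"
  obtain b where b: "sch I b" "pder I c a b" by (rule sch_pder[OF a c])
  have "pder I c h (\<lambda>x. - b (\<lambda>i\<in>I. - x i))" unfolding h by (rule pder_reflect[OF b(2) c])
  moreover have "sch I (\<lambda>x. - b x)" using sch_const_mult[OF b(1), of "- 1"] by simp
  ultimately show "\<exists>g. (\<exists>a. sch I a \<and> g = (\<lambda>x. a (\<lambda>i\<in>I. - x i))) \<and> pder I c h g" by blast
qed

lemma ift_eq_ft_reflect: "ift I f x = ft I f (\<lambda>i\<in>I. - x i)"
  unfolding ift_def ft_def ip_def by (simp add: sum_negf mult.commute)

lemma sch_ift:
  fixes f :: "('i::countable \<Rightarrow> real) \<Rightarrow> complex"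
  shows "finite I \<Longrightarrow> sch I f \<Longrightarrow> sch I (ift I f)"
  unfolding ift_eq_ft_reflect[abs_def] by (intro sch_reflect sch_ft)

subsection \<open>Gaussians are Schwartz functions\<close>

text \<open>Complex polynomials as functions: the prefactors that arise when a Gaussian is
  differentiated repeatedly.\<close>

inductive polyfun :: "'i set \<Rightarrow> (('i \<Rightarrow> real) \<Rightarrow> complex) \<Rightarrow> bool" for I where
  polyfun_const: "polyfun I (\<lambda>_. k)"
| polyfun_coord: "c \<in> I \<Longrightarrow> polyfun I (\<lambda>x. of_real (x c))"
| polyfun_add: "polyfun I f \<Longrightarrow> polyfun I g \<Longrightarrow> polyfun I (\<lambda>x. f x + g x)"
| polyfun_mult: "polyfun I f \<Longrightarrow> polyfun I g \<Longrightarrow> polyfun I (\<lambda>x. f x * g x)"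

lemma polyfun_sum: "(\<And>i. i \<in> S \<Longrightarrow> polyfun I (f i)) \<Longrightarrow> polyfun I (\<lambda>x. \<Sum>i\<in>S. f i x)"
  by (induction S rule: infinite_finite_induct) (auto intro: polyfun.intros)

lemma polyfun_power2: "polyfun I f \<Longrightarrow> polyfun I (\<lambda>x. (f x)\<^sup>2)"
  unfolding power2_eq_square by (rule polyfun_mult)

lemma polyfun_growth:
  assumes "finite I" "polyfun I f"
  shows "\<exists>B M. \<forall>x. norm (f x) \<le> B * wgt I x ^ M"
  using assms(2)
proof induction
  case (polyfun_const k)
  show ?case by (rule exI[of _ "norm k"], rule exI[of _ 0]) simp
next
  case (polyfun_coord c)
  show ?case by (rule exI[of _ 1], rule exI[of _ 1]) (simp add: abs_coord_le_wgt assms(1) polyfun_coord)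
next
  case (polyfun_add f g)
  then obtain B M B' M' where *: "\<And>x. norm (f x) \<le> B * wgt I x ^ M" "\<And>x. norm (g x) \<le> B' * wgt I x ^ M'" by blast
  have "norm (f x + g x) \<le> (\<bar>B\<bar> + \<bar>B'\<bar>) * wgt I x ^ (M + M')" for x
  proof -
    have "B * wgt I x ^ M \<le> \<bar>B\<bar> * wgt I x ^ (M + M')" "B' * wgt I x ^ M' \<le> \<bar>B'\<bar> * wgt I x ^ (M + M')"
      by (auto intro!: mult_mono power_increasing wgt_ge1)
    then show ?thesis
      using *(1)[of x] *(2)[of x] norm_triangle_ineq[of "f x" "g x"] unfolding distrib_right by linarith
  qed
  then show ?case by blast
next
  case (polyfun_mult f g)
  then obtain B M B' M' where *: "\<And>x. norm (f x) \<le> B * wgt I x ^ M" "\<And>x. norm (g x) \<le> B' * wgt I x ^ M'" by blast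
  have "norm (f x * g x) \<le> (B * B') * wgt I x ^ (M + M')" for x
    unfolding norm_mult power_add using mult_mono'[OF *(1)[of x] *(2)[of x]] by (simp add: mult_ac)
  then show ?case by blast
qed

lemma polyfun_pder:
  assumes "polyfun I f"
  shows "\<exists>g. polyfun I g \<and> pder I c f g"
  using assms
proof induction
  case (polyfun_const k)
  show ?case by (rule exI[of _ "\<lambda>_. 0"]) (auto simp: pder_def intro: polyfun.intros)
next
  case (polyfun_coord d)
  show ?case
    by (rule exI[of _ "\<lambda>_. if d = c then 1 else 0"])
       (auto simp: pder_def intro: polyfun.intros has_vector_derivative_coord[of _ _ d, simplified] intro!: derivative_eq_intros)
next
  case (polyfun_add f g)
  then obtain f' g' where "polyfun I f'" "pder I c f f'" "polyfun I g'" "pder I c g g'" by blast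
  then show ?case
    by (intro exI[of _ "\<lambda>x. f' x + g' x"]) (auto simp: pder_def intro: polyfun.intros has_vector_derivative_add)
next
  case (polyfun_mult f g)
  then obtain f' g' where *: "polyfun I f'" "pder I c f f'" "polyfun I g'" "pder I c g g'" by blast
  have "pder I c (\<lambda>x. f x * g x) (\<lambda>x. f x * g' x + f' x * g x)"
    unfolding pder_def
  proof
    fix x :: "'a \<Rightarrow> real" assume x: "x \<in> extensional I"
    have "((\<lambda>t. f (x(c := t)) * g (x(c := t))) has_vector_derivative f (x(c := x c)) * g' x + f' x * g (x(c := x c))) (at (x c))"
      using * x by (intro has_vector_derivative_mult) (auto simp: pder_def)
    then show "((\<lambda>t. f (x(c := t)) * g (x(c := t))) has_vector_derivative f x * g' x + f' x * g x) (at (x c))" by simp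
  qed
  with * polyfun_mult.hyps show ?case
    by (intro exI[of _ "\<lambda>x. f x * g' x + f' x * g x"]) (auto intro: polyfun.intros)
qed

text \<open>Take 1 + x \<le> exp x at x = \<kappa> w / (K + 1) and raise to the power K + 1, which
  turns the exponential into exp(\<kappa> w) exactly. The bound is uniform in w.\<close>

lemma power_exp_bound:
  fixes \<kappa> w :: real
  assumes "\<kappa> > 0" "w \<ge> 0"
  shows "w ^ K * exp (- \<kappa> * w) \<le> (real (Suc K) / \<kappa> + 1) ^ Suc K"
proof -
  have K: "w ^ K \<le> (w + 1) ^ Suc K"
  proof -
    have "w ^ K \<le> (w + 1) ^ K" using assms by (intro power_mono) auto
    also have "\<dots> \<le> (w + 1) ^ Suc K" using assms by (intro power_increasing) auto
    finally show ?thesis .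
  qed
  define S where "S = real (Suc K)"
  then have S: "S > 0" by simp
  have "(S / \<kappa> + 1) * (1 + \<kappa> * w / S) = S / \<kappa> + w + 1 + \<kappa> * w / S"
    using assms S by (simp add: field_simps)
  moreover have "0 \<le> S / \<kappa>" "0 \<le> \<kappa> * w / S" using assms S by auto
  ultimately have "w + 1 \<le> (S / \<kappa> + 1) * (1 + \<kappa> * w / S)"
    by linarith
  also have "\<dots> \<le> (S / \<kappa> + 1) * exp (\<kappa> * w / S)"
    using assms S by (intro mult_left_mono exp_ge_add_one_self) (auto simp: add_nonneg_nonneg)
  finally have "(w + 1) ^ Suc K \<le> ((S / \<kappa> + 1) * exp (\<kappa> * w / S)) ^ Suc K"
    using assms by (intro power_mono) auto
  also have "\<dots> = (S / \<kappa> + 1) ^ Suc K * exp (\<kappa> * w / S) ^ Suc K"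
    by (rule power_mult_distrib)
  also have "exp (\<kappa> * w / S) ^ Suc K = exp (\<kappa> * w)"
    by (subst exp_of_nat_mult[symmetric]) (use S in \<open>simp add: S_def\<close>)
  finally have "w ^ K \<le> (S / \<kappa> + 1) ^ Suc K * exp (\<kappa> * w)" using K by linarith
  then have "w ^ K * exp (- \<kappa> * w) \<le> (S / \<kappa> + 1) ^ Suc K * exp (\<kappa> * w) * exp (- \<kappa> * w)"
    by (intro mult_right_mono) auto
  then show ?thesis by (simp add: mult.assoc S_def flip: exp_add)
qed

text \<open>Products of a polynomial with exp(-Q) form a family stable under differentiation, and
  coercivity of Re Q turns the exponential into decay faster than any power of
  \<open>wgt\<close>.\<close>

lemma sch_gaussian:
  assumes I: "finite I" and Q: "polyfun I Q" and \<kappa>: "\<kappa> > 0"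
    and pos: "\<And>x. x \<in> extensional I \<Longrightarrow> \<kappa> * (\<Sum>i\<in>I. (x i)\<^sup>2) \<le> Re (Q x)"
  shows "sch I (\<lambda>x. exp (- Q x))"
proof (rule sch_coinduct[where P="\<lambda>h. \<exists>p. polyfun I p \<and> h = (\<lambda>x. p x * exp (- Q x))"])
  show "\<exists>p. polyfun I p \<and> (\<lambda>x. exp (- Q x)) = (\<lambda>x. p x * exp (- Q x))"
    by (intro exI[of _ "\<lambda>_. 1"]) (auto intro: polyfun.intros)
next
  fix h :: "('a \<Rightarrow> real) \<Rightarrow> complex" assume "\<exists>p. polyfun I p \<and> h = (\<lambda>x. p x * exp (- Q x))"
  then obtain p where p: "polyfun I p" and h: "h = (\<lambda>x. p x * exp (- Q x))" by blast
  obtain B M where BM: "\<And>x. norm (p x) \<le> B * wgt I x ^ M" using polyfun_growth[OF I p] by blast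
  show "rapid I h" unfolding rapid_def
  proof
    fix N
    have "wgt I x ^ N * norm (h x) \<le> \<bar>B\<bar> * (exp \<kappa> * (real (Suc (N + M)) / \<kappa> + 1) ^ Suc (N + M))" if x: "x \<in> extensional I" for x
    proof -
      have "exp (- Re (Q x)) \<le> exp \<kappa> * exp (- \<kappa> * wgt I x)"
        using pos[OF x] by (simp add: wgt_def algebra_simps flip: exp_add)
      then have "wgt I x ^ N * norm (h x) \<le> wgt I x ^ N * ((\<bar>B\<bar> * wgt I x ^ M) * (exp \<kappa> * exp (- \<kappa> * wgt I x)))"
        unfolding h norm_mult norm_exp_eq_Re
        by (intro mult_left_mono mult_mono order.trans[OF BM]) (auto intro!: mult_right_mono)
      also have "\<dots> = \<bar>B\<bar> * (exp \<kappa> * (wgt I x ^ (N + M) * exp (- \<kappa> * wgt I x)))"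
        by (simp add: power_add mult_ac)
      also have "\<dots> \<le> \<bar>B\<bar> * (exp \<kappa> * (real (Suc (N + M)) / \<kappa> + 1) ^ Suc (N + M))"
        by (intro mult_left_mono power_exp_bound \<kappa>) auto
      finally show ?thesis .
    qed
    then show "\<exists>A. \<forall>x\<in>extensional I. wgt I x ^ N * norm (h x) \<le> A" by blast
  qed
  fix c assume c: "c \<in> I"
  obtain p' Q' where *: "polyfun I p'" "pder I c p p'" "polyfun I Q'" "pder I c Q Q'"
    using polyfun_pder[OF p] polyfun_pder[OF Q] by metis
  let ?r = "\<lambda>x. p x * (- 1 * Q' x) + p' x"
  have "pder I c h (\<lambda>x. ?r x * exp (- Q x))"
    unfolding pder_def h
  proof
    fix x :: "'a \<Rightarrow> real" assume x: "x \<in> extensional I"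
    have "((\<lambda>z. exp (- z)) \<circ> (\<lambda>t. Q (x(c := t))) has_vector_derivative Q' x * (- exp (- Q (x(c := x c))))) (at (x c))"
      using * x by (intro field_vector_diff_chain_at) (auto simp: pder_def intro!: derivative_eq_intros)
    then have "((\<lambda>t. exp (- Q (x(c := t)))) has_vector_derivative Q' x * (- exp (- Q (x(c := x c))))) (at (x c))"
      by (simp add: comp_def)
    then have "((\<lambda>t. p (x(c := t)) * exp (- Q (x(c := t)))) has_vector_derivative
      p (x(c := x c)) * (Q' x * (- exp (- Q (x(c := x c))))) + p' x * exp (- Q (x(c := x c)))) (at (x c))"
      using * x by (intro has_vector_derivative_mult) (auto simp: pder_def)
    then show "((\<lambda>t. p (x(c := t)) * exp (- Q (x(c := t)))) has_vector_derivative ?r x * exp (- Q x)) (at (x c))"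
      by (simp add: algebra_simps)
  qed
  moreover have "polyfun I ?r" by (intro polyfun.intros p *)
  ultimately show "\<exists>g. (\<exists>p. polyfun I p \<and> g = (\<lambda>x. p x * exp (- Q x))) \<and> pder I c h g" by blast
qed

section \<open>The collision as a fibre integral in frequency\<close>

subsection \<open>Restriction to a diagonal on the Fourier side\<close>

lemma integrable_pair_mult:
  fixes f g :: "_ \<Rightarrow> real"
  assumes "pair_sigma_finite M1 M2" "integrable M1 f" "integrable M2 g"
  shows "integrable (M1 \<Otimes>\<^sub>M M2) (\<lambda>(x, y). f x * g y)"
proof -
  have "integrable (M1 \<Otimes>\<^sub>M M2) (\<lambda>(x, y). cis 0 * (complex_of_real (f x) * complex_of_real (g y)))"
    by (rule integrable_pair_cis_mult[OF assms(1)]) (use assms in auto)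
  from integrable_Re[OF this] show ?thesis by (simp add: split_def)
qed

abbreviation lborel2 :: "(real \<times> real) measure" where
  "lborel2 \<equiv> lborel \<Otimes>\<^sub>M lborel"

lemma lborel2_pair_sigma_finite: "pair_sigma_finite lborel (lborel :: real measure)"
  by (simp add: pair_sigma_finite_def sigma_finite_lborel)

lemma sigma_finite_lborel2: "sigma_finite_measure lborel2"
  by (rule sigma_finite_pair_measure) (rule sigma_finite_lborel)+

definition decay2 :: "real \<times> real \<Rightarrow> real" where
  "decay2 z = inverse (1 + (fst z)\<^sup>2) * inverse (1 + (snd z)\<^sup>2)"

lemma integrable_decay2: "integrable lborel2 decay2"
  using integrable_pair_mult[OF lborel2_pair_sigma_finite integrable_inverse_1_plus integrable_inverse_1_plus]
  by (simp add: decay2_def[abs_def] split_def)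

lemma decay2_nonneg: "0 \<le> decay2 z"
  by (simp add: decay2_def)

text \<open>The variable c survives the contraction, d and e belong to the contracted particle. With
  abstract indices one argument serves both terms of the collision operator, in which primed and
  unprimed variables exchange roles.\<close>

locale contraction =
  fixes I :: "'i::countable set" and c d e :: 'i
  assumes I: "finite I" and c: "c \<in> I" and d: "d \<notin> I" and e: "e \<notin> I" and de: "d \<noteq> e"
begin

abbreviation J :: "'i set" where "J \<equiv> insert d (insert e I)"

text \<open>The point of frequency space over the output frequency \<open>q\<close> at which \<open>d\<close> and \<open>e\<close> carry the frequencies \<open>z\<close>.\<close>

definition shear :: "('i \<Rightarrow> real) \<times> real \<times> real \<Rightarrow> 'i \<Rightarrow> real" where
  "shear = (\<lambda>(q, z). q(c := q c - fst z - snd z, d := fst z, e := snd z))"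

definition diag :: "('i \<Rightarrow> real) \<Rightarrow> 'i \<Rightarrow> real" where
  "diag x = x(d := x c, e := x c)"

text \<open>The Fourier counterpart of \<open>diag\<close>: restricting to the diagonal integrates
  over all triples of frequencies with a given sum.\<close>

definition coll :: "(('i \<Rightarrow> real) \<Rightarrow> complex) \<Rightarrow> ('i \<Rightarrow> real) \<Rightarrow> complex" where
  "coll h q = (\<integral>z. h (shear (q, z)) \<partial>lborel2)"

lemma finite_J: "finite J" using I by simp

lemma cd: "c \<noteq> d" "c \<noteq> e" using c d e by auto

lemma shear_extensional: "q \<in> extensional I \<Longrightarrow> shear (q, z) \<in> extensional J"
  using c by (auto simp: shear_def extensional_def)

lemma diag_extensional: "x \<in> extensional I \<Longrightarrow> diag x \<in> extensional J"
  by (auto simp: diag_def extensional_def)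

lemma shear_simps:
  "shear (q, z) c = q c - fst z - snd z" "shear (q, z) d = fst z" "shear (q, z) e = snd z"
  "i \<noteq> c \<Longrightarrow> i \<noteq> d \<Longrightarrow> i \<noteq> e \<Longrightarrow> shear (q, z) i = q i"
  using cd de by (auto simp: shear_def)

lemma shear_other: "i \<in> I \<Longrightarrow> i \<noteq> c \<Longrightarrow> shear (q, z) i = q i"
  using d e by (intro shear_simps) auto

lemma sum_J: "(\<Sum>i\<in>J. f i) = f d + f e + f c + (\<Sum>i\<in>I - {c}. f i)" for f :: "'i \<Rightarrow> 'a::comm_monoid_add"
  using I c d e de by (simp add: sum.remove[of I c] add.assoc)

lemma prod_J: "(\<Prod>i\<in>J. f i) = f d * f e * f c * (\<Prod>i\<in>I - {c}. f i)" for f :: "'i \<Rightarrow> 'a::comm_monoid_mult"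
  using I c d e de by (simp add: prod.remove[of I c] mult.assoc)

lemma sum_J_shear:
  "(\<Sum>i\<in>J. f i (shear (q, z) i)) = f d (fst z) + f e (snd z) + f c (q c - fst z - snd z) + (\<Sum>i\<in>I - {c}. f i (q i))"
  for f :: "'i \<Rightarrow> real \<Rightarrow> 'a::comm_monoid_add"
proof -
  have "(\<Sum>i\<in>I - {c}. f i (shear (q, z) i)) = (\<Sum>i\<in>I - {c}. f i (q i))"
    using d e by (intro sum.cong refl arg_cong2[where f=f] shear_simps) auto
  then show ?thesis by (simp add: sum_J shear_simps)
qed

lemma prod_J_shear:
  "(\<Prod>i\<in>J. f i (shear (q, z) i)) = f d (fst z) * f e (snd z) * f c (q c - fst z - snd z) * (\<Prod>i\<in>I - {c}. f i (q i))"
  for f :: "'i \<Rightarrow> real \<Rightarrow> 'a::comm_monoid_mult"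
proof -
  have "(\<Prod>i\<in>I - {c}. f i (shear (q, z) i)) = (\<Prod>i\<in>I - {c}. f i (q i))"
    using d e by (intro prod.cong refl arg_cong2[where f=f] shear_simps) auto
  then show ?thesis by (simp add: prod_J shear_simps)
qed

lemma shear_measurable [measurable]: "shear \<in> leb I \<Otimes>\<^sub>M lborel2 \<rightarrow>\<^sub>M leb J"
proof (rule measurable_PiM_single')
  fix i assume i: "i \<in> J"
  have m: "(\<lambda>w. fst w i) \<in> borel_measurable (leb I \<Otimes>\<^sub>M lborel2)" if "i \<in> I" for i
    by (rule measurable_compose[OF measurable_fst leb_component_measurable[OF that]])
  have m1: "(\<lambda>w. fst (snd w)) \<in> borel_measurable (leb I \<Otimes>\<^sub>M lborel2)" "(\<lambda>w. snd (snd w)) \<in> borel_measurable (leb I \<Otimes>\<^sub>M lborel2)"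
    by measurable
  consider "i = c" | "i = d" | "i = e" | "i \<noteq> c" "i \<noteq> d" "i \<noteq> e" "i \<in> I" using i by blast
  then have "(\<lambda>w. shear w i) \<in> borel_measurable (leb I \<Otimes>\<^sub>M lborel2)"
  proof cases
    case 1
    have "(\<lambda>w. fst w c - fst (snd w) - snd (snd w)) \<in> borel_measurable (leb I \<Otimes>\<^sub>M lborel2)"
      by (intro borel_measurable_diff m m1 c)
    then show ?thesis using 1 cd by (simp add: shear_def case_prod_beta)
  next
    case 2
    then show ?thesis using m1 de by (simp add: shear_def case_prod_beta)
  next
    case 3
    then show ?thesis using m1 by (simp add: shear_def case_prod_beta)
  next
    case 4
    then show ?thesis using m[of i] by (simp add: shear_def case_prod_beta)
  qed
  then show "(\<lambda>w. shear w i) \<in> leb I \<Otimes>\<^sub>M lborel2 \<rightarrow>\<^sub>M lborel" by simp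
next
  show "shear \<in> space (leb I \<Otimes>\<^sub>M lborel2) \<rightarrow> J \<rightarrow>\<^sub>E space lborel"
    using shear_extensional by (auto simp: space_pair_measure space_leb PiE_def Pi_def)
qed

lemma shear_measurable2: "q \<in> space (leb I) \<Longrightarrow> (\<lambda>z. shear (q, z)) \<in> lborel2 \<rightarrow>\<^sub>M leb J"
  using measurable_Pair2[OF shear_measurable] .

lemma measurable_upd2:
  assumes "f \<in> N \<rightarrow>\<^sub>M leb I" "g \<in> borel_measurable N" "h \<in> borel_measurable N"
  shows "(\<lambda>w. (f w)(e := g w, d := h w)) \<in> N \<rightarrow>\<^sub>M leb J"
  using assms by (intro measurable_fun_upd[where J="insert e I"] measurable_fun_upd[where J=I]) auto

text \<open>For fixed z the shear translates the coordinate c and has unit Jacobian; once this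
  translation is undone, e and d are adjoined as independent coordinates, one at a time.\<close>

lemma distr_shear: "distr (leb I \<Otimes>\<^sub>M lborel2) (leb J) shear = leb J"
proof (rule measure_eqI)
  fix A assume "A \<in> sets (distr (leb I \<Otimes>\<^sub>M lborel2) (leb J) shear)"
  then have A [measurable]: "A \<in> sets (leb J)" by simp
  interpret pair_sigma_finite "leb I" lborel2
    by (simp add: pair_sigma_finite_def leb_sigma_finite I sigma_finite_lborel2)
  let ?f = "indicator A :: _ \<Rightarrow> ennreal"
  have [measurable]: "(\<lambda>w. ?f (shear w)) \<in> borel_measurable (leb I \<Otimes>\<^sub>M lborel2)" by measurable
  have "emeasure (distr (leb I \<Otimes>\<^sub>M lborel2) (leb J) shear) A = (\<integral>\<^sup>+w. ?f (shear w) \<partial>(leb I \<Otimes>\<^sub>M lborel2))"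
    by (subst nn_integral_distr[symmetric, OF shear_measurable]) auto
  also have "\<dots> = (\<integral>\<^sup>+z. (\<integral>\<^sup>+q. ?f (shear (q, z)) \<partial>leb I) \<partial>lborel2)"
    by (rule nn_integral_snd[symmetric]) measurable
  also have "\<dots> = (\<integral>\<^sup>+z. (\<integral>\<^sup>+q. ?f (q(e := snd z, d := fst z)) \<partial>leb I) \<partial>lborel2)"
  proof (rule nn_integral_cong)
    fix z :: "real \<times> real"
    let ?g = "\<lambda>q. ?f (q(e := snd z, d := fst z))"
    have m: "(\<lambda>q. q(e := snd z, d := fst z)) \<in> leb I \<rightarrow>\<^sub>M leb J"
      by (intro measurable_upd2) auto
    have gm: "?g \<in> borel_measurable (leb I)"
      using measurable_compose[OF m borel_measurable_indicator[OF A]] by simp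
    have "(\<integral>\<^sup>+q. ?g q \<partial>leb I) = (\<integral>\<^sup>+q. ?g (\<lambda>i\<in>I. (if i = c then - fst z - snd z else 0) + 1 * q i) \<partial>leb I)"
      by (subst nn_integral_leb_affine[OF I _ gm, of 1 "\<lambda>i. if i = c then - fst z - snd z else 0"]) auto
    also have "\<dots> = (\<integral>\<^sup>+q. ?f (shear (q, z)) \<partial>leb I)"
    proof (rule nn_integral_cong)
      fix q assume "q \<in> space (leb I)"
      then have "(\<lambda>i\<in>I. (if i = c then - fst z - snd z else 0) + 1 * q i)(e := snd z, d := fst z) = shear (q, z)"
        using c cd de by (auto simp: shear_def fun_eq_iff space_leb extensional_def)
      then show "?g (\<lambda>i\<in>I. (if i = c then - fst z - snd z else 0) + 1 * q i) = ?f (shear (q, z))"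
        by simp
    qed
    finally show "(\<integral>\<^sup>+q. ?f (shear (q, z)) \<partial>leb I) = (\<integral>\<^sup>+q. ?g q \<partial>leb I)" by simp
  qed
  also have "\<dots> = (\<integral>\<^sup>+a. \<integral>\<^sup>+b. (\<integral>\<^sup>+q. ?f (q(e := b, d := a)) \<partial>leb I) \<partial>lborel \<partial>lborel)"
  proof -
    have "(\<lambda>w. (fst w)(e := snd (snd w), d := fst (snd w))) \<in> leb I \<Otimes>\<^sub>M lborel2 \<rightarrow>\<^sub>M leb J"
      by (intro measurable_upd2) measurable
    from measurable_compose[OF this borel_measurable_indicator[OF A]]
    have m: "(\<lambda>w. ?f ((fst w)(e := snd (snd w), d := fst (snd w)))) \<in> borel_measurable (leb I \<Otimes>\<^sub>M lborel2)" .
    have "(\<lambda>(z, q). ?f (q(e := snd z, d := fst z))) \<in> borel_measurable (lborel2 \<Otimes>\<^sub>M leb I)"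
      using measurable_compose[OF measurable_pair_swap' m] by (simp add: case_prod_beta)
    then have "(\<lambda>z. \<integral>\<^sup>+q. ?f (q(e := snd z, d := fst z)) \<partial>leb I) \<in> borel_measurable lborel2"
      by (rule sigma_finite_measure.borel_measurable_nn_integral[OF leb_sigma_finite[OF I]])
    from lborel.nn_integral_fst[OF this, symmetric] show ?thesis by simp
  qed
  also have "\<dots> = (\<integral>\<^sup>+a. \<integral>\<^sup>+x. ?f (x(d := a)) \<partial>leb (insert e I) \<partial>lborel)"
  proof (rule nn_integral_cong)
    fix a :: real
    have "(\<lambda>q. q(d := a)) \<in> leb (insert e I) \<rightarrow>\<^sub>M leb J"
      by (rule measurable_fun_upd[where J="insert e I"]) auto
    from measurable_compose[OF this borel_measurable_indicator[OF A]]
    have "(\<lambda>x. ?f (x(d := a))) \<in> borel_measurable (leb (insert e I))" .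
    from leb.product_nn_integral_insert_rev[OF I e this]
    show "(\<integral>\<^sup>+b. (\<integral>\<^sup>+q. ?f (q(e := b, d := a)) \<partial>leb I) \<partial>lborel) = (\<integral>\<^sup>+x. ?f (x(d := a)) \<partial>leb (insert e I))"
      by simp
  qed
  also have "\<dots> = (\<integral>\<^sup>+x. ?f x \<partial>leb J)"
    by (rule leb.product_nn_integral_insert_rev[symmetric]) (use I d de in auto)
  also have "\<dots> = emeasure (leb J) A" by simp
  finally show "emeasure (distr (leb I \<Otimes>\<^sub>M lborel2) (leb J) shear) A = emeasure (leb J) A" .
qed simp

lemma nn_integral_shear:
  assumes [measurable]: "f \<in> borel_measurable (leb J)"
  shows "(\<integral>\<^sup>+q. \<integral>\<^sup>+z. f (shear (q, z)) \<partial>lborel2 \<partial>leb I) = (\<integral>\<^sup>+x. f x \<partial>leb J)"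
proof -
  have "(\<integral>\<^sup>+x. f x \<partial>leb J) = (\<integral>\<^sup>+w. f (shear w) \<partial>(leb I \<Otimes>\<^sub>M lborel2))"
    by (subst distr_shear[symmetric]) (simp add: nn_integral_distr)
  also have "\<dots> = (\<integral>\<^sup>+q. \<integral>\<^sup>+z. f (shear (q, z)) \<partial>lborel2 \<partial>leb I)"
    by (rule sigma_finite_measure.nn_integral_fst[OF sigma_finite_lborel2, symmetric]) measurable
  finally show ?thesis by simp
qed

text \<open>The entries c, d, e of a sheared frequency add up to \<open>q c\<close>, and
  \<open>diag x\<close> takes the same value in these three slots, so z drops out of the
  pairing.\<close>

lemma ip_shear_diag: "ip J (shear (q, z)) (diag x) = ip I q x"
proof -
  have "(\<Sum>i\<in>I - {c}. q i * diag x i) = (\<Sum>i\<in>I - {c}. q i * x i)"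
    using d e by (intro sum.cong refl) (auto simp: diag_def)
  then have "ip J (shear (q, z)) (diag x) = fst z * x c + snd z * x c + (q c - fst z - snd z) * x c + (\<Sum>i\<in>I - {c}. q i * x i)"
    unfolding ip_def using sum_J_shear[of "\<lambda>i t. t * diag x i" q z] de cd by (simp add: diag_def)
  also have "\<dots> = ip I q x"
    unfolding ip_def using I c by (simp add: sum.remove[of I c] algebra_simps)
  finally show ?thesis .
qed

text \<open>In shear coordinates the phase is independent of z, so the z-integral acts on h alone
  and becomes \<open>coll h\<close>.\<close>

lemma ift_diag:
  assumes h: "integrable (leb J) h"
  shows "ift J h (diag x) = ift I (coll h) x"
proof -
  interpret pair_sigma_finite "leb I" lborel2
    by (simp add: pair_sigma_finite_def leb_sigma_finite I sigma_finite_lborel2)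
  let ?F = "\<lambda>y. cis (ip J y (diag x)) * h y"
  have F: "integrable (leb J) ?F"
    by (intro integrable_cis_mult h) measurable
  note [measurable] = borel_measurable_integrable[OF F]
  have "integrable (distr (leb I \<Otimes>\<^sub>M lborel2) (leb J) shear) ?F"
    using F by (simp add: distr_shear)
  then have iF: "integrable (leb I \<Otimes>\<^sub>M lborel2) (\<lambda>w. ?F (shear w))"
    by (subst (asm) integrable_distr_eq) auto
  have "ift J h (diag x) = (\<integral>w. ?F (shear w) \<partial>(leb I \<Otimes>\<^sub>M lborel2))"
    unfolding ift_def by (subst distr_shear[symmetric]) (simp add: integral_distr)
  also have "\<dots> = (\<integral>q. \<integral>z. ?F (shear (q, z)) \<partial>lborel2 \<partial>leb I)"
    by (rule integral_fst'[symmetric]) (rule iF)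
  also have "\<dots> = ift I (coll h) x"
    unfolding ift_def coll_def ip_shear_diag by simp
  finally show ?thesis .
qed

lemma wgt_shear:
  "wgt I q \<le> 3 * wgt J (shear (q, z))" "1 + (fst z)\<^sup>2 \<le> wgt J (shear (q, z))" "1 + (snd z)\<^sup>2 \<le> wgt J (shear (q, z))"
proof -
  show "1 + (fst z)\<^sup>2 \<le> wgt J (shear (q, z))"
    using coord_le_wgt[OF finite_J, of d "shear (q, z)"] by (simp add: shear_simps)
  show "1 + (snd z)\<^sup>2 \<le> wgt J (shear (q, z))"
    using coord_le_wgt[OF finite_J, of e "shear (q, z)"] by (simp add: shear_simps)
  define u v w where "u = q c - fst z - snd z" and "v = fst z" and "w = snd z"
  have "q c = u + v + w" by (simp add: u_def v_def w_def)
  \<comment> \<open>The sum-of-squares form of (u + v + w)^2 \<le> 3 (u^2 + v^2 + w^2), the source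
    of the factor 3.\<close>
  have "3 * (u\<^sup>2 + v\<^sup>2 + w\<^sup>2) - (u + v + w)\<^sup>2 = (u - v)\<^sup>2 + (u - w)\<^sup>2 + (v - w)\<^sup>2"
    by (simp add: power2_eq_square algebra_simps)
  moreover have "0 \<le> (u - v)\<^sup>2 + (u - w)\<^sup>2 + (v - w)\<^sup>2" by simp
  ultimately have "(q c)\<^sup>2 \<le> 3 * (u\<^sup>2 + v\<^sup>2 + w\<^sup>2)" unfolding \<open>q c = u + v + w\<close> by linarith
  moreover have "0 \<le> (\<Sum>i\<in>I - {c}. (q i)\<^sup>2)" by (simp add: sum_nonneg)
  moreover have "wgt I q = 1 + (q c)\<^sup>2 + (\<Sum>i\<in>I - {c}. (q i)\<^sup>2)"
    using I c by (simp add: wgt_def sum.remove[of I c])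
  moreover have "wgt J (shear (q, z)) = 1 + v\<^sup>2 + w\<^sup>2 + u\<^sup>2 + (\<Sum>i\<in>I - {c}. (q i)\<^sup>2)"
    using sum_J_shear[of "\<lambda>i t. t\<^sup>2" q z] by (simp add: wgt_def u_def v_def w_def)
  ultimately show "wgt I q \<le> 3 * wgt J (shear (q, z))" by simp
qed

text \<open>Of the N + 2 powers of decay of h, two pay for the integrable majorant
  \<open>decay2\<close> in z and N for the weight at q. The constant is uniform in q, as the
  dominated convergence in \<open>seqcont_coll\<close> requires.\<close>

lemma shear_decay:
  assumes h: "rapid J h"
  obtains A where "A > 0" "\<And>q z. q \<in> extensional I \<Longrightarrow> wgt I q ^ N * norm (h (shear (q, z))) \<le> A * decay2 z"
proof -
  obtain A where A: "A > 0" "\<And>x. x \<in> extensional J \<Longrightarrow> wgt J x ^ (N + 2) * norm (h x) \<le> A"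
    using rapidE[OF h, of "N + 2"] by metis
  have "wgt I q ^ N * norm (h (shear (q, z))) \<le> (3 ^ N * A) * decay2 z" if q: "q \<in> extensional I" for q z
  proof -
    let ?W = "wgt J (shear (q, z))" and ?v = "1 + (fst z)\<^sup>2" and ?w = "1 + (snd z)\<^sup>2"
    have pos: "?v > 0" "?w > 0" by (auto intro: add_pos_nonneg)
    have "wgt I q ^ N * (?v * ?w) \<le> (3 * ?W) ^ N * (?W * ?W)"
      by (intro mult_mono power_mono wgt_shear) (auto simp: less_imp_le[OF pos(1)] less_imp_le[OF pos(2)])
    also have "\<dots> = 3 ^ N * ?W ^ (N + 2)"
      by (simp add: power_mult_distrib power_add power2_eq_square)
    finally have "wgt I q ^ N * (?v * ?w) * norm (h (shear (q, z))) \<le> 3 ^ N * ?W ^ (N + 2) * norm (h (shear (q, z)))"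
      by (rule mult_right_mono) simp
    also have "\<dots> \<le> 3 ^ N * A"
      using A(2)[OF shear_extensional[OF q], of z] by (simp add: mult.assoc del: power_Suc)
    finally have "wgt I q ^ N * norm (h (shear (q, z))) * (?v * ?w) \<le> 3 ^ N * A" by (simp add: mult_ac)
    then have "wgt I q ^ N * norm (h (shear (q, z))) \<le> (3 ^ N * A) / (?v * ?w)"
      using pos by (subst pos_le_divide_eq) auto
    then show ?thesis by (simp add: decay2_def divide_inverse)
  qed
  then show ?thesis using that[of "3 ^ N * A"] A(1) by simp
qed

lemma shear_integrable:
  assumes h: "rapid J h" and [measurable]: "h \<in> borel_measurable (leb J)" and q: "q \<in> extensional I"
  shows "integrable lborel2 (\<lambda>z. h (shear (q, z)))"
proof -
  obtain A where A: "A > 0" "\<And>q z. q \<in> extensional I \<Longrightarrow> wgt I q ^ 0 * norm (h (shear (q, z))) \<le> A * decay2 z"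
    using shear_decay[OF h] by metis
  have [measurable]: "(\<lambda>z. shear (q, z)) \<in> lborel2 \<rightarrow>\<^sub>M leb J"
    by (rule shear_measurable2) (simp add: space_leb q)
  show ?thesis
  proof (rule Bochner_Integration.integrable_bound[OF integrable_mult_right[OF integrable_decay2, of A]])
    show "AE z in lborel2. norm (h (shear (q, z))) \<le> norm (A * decay2 z)"
      using A(2)[OF q] A(1) decay2_nonneg by (auto intro!: AE_I2 simp: abs_mult)
  qed measurable
qed

lemma rapid_coll:
  assumes h: "rapid J h" and m: "h \<in> borel_measurable (leb J)"
  shows "rapid I (coll h)"
  unfolding rapid_def
proof
  fix N
  obtain A where A: "A > 0" "\<And>q z. q \<in> extensional I \<Longrightarrow> wgt I q ^ N * norm (h (shear (q, z))) \<le> A * decay2 z"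
    using shear_decay[OF h] by metis
  have "wgt I q ^ N * norm (coll h q) \<le> (\<integral>z. A * decay2 z \<partial>lborel2)" if q: "q \<in> extensional I" for q
  proof -
    have "wgt I q ^ N * norm (coll h q) \<le> wgt I q ^ N * (\<integral>z. norm (h (shear (q, z))) \<partial>lborel2)"
      unfolding coll_def by (intro mult_left_mono integral_norm_bound) simp
    also have "\<dots> = (\<integral>z. wgt I q ^ N * norm (h (shear (q, z))) \<partial>lborel2)" by simp
    also have "\<dots> \<le> (\<integral>z. A * decay2 z \<partial>lborel2)"
      by (intro Bochner_Integration.integral_mono integrable_mult_right integrable_decay2 integrable_norm shear_integrable[OF h m q] A q)
    finally show ?thesis .
  qed
  then show "\<exists>A. \<forall>q\<in>extensional I. wgt I q ^ N * norm (coll h q) \<le> A" by blast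
qed

lemma seqcont_coll:
  assumes h: "rapid J h" and hc: "seqcont J h"
  shows "seqcont I (coll h)"
proof (rule seqcontI)
  note m [measurable] = seqcont_measurable[OF hc]
  fix X :: "nat \<Rightarrow> 'i \<Rightarrow> real" and q :: "'i \<Rightarrow> real"
  assume X: "\<And>m. X m \<in> extensional I" and q: "q \<in> extensional I" and lim: "\<And>i. i \<in> I \<Longrightarrow> (\<lambda>m. X m i) \<longlonglongrightarrow> q i"
  obtain A where A: "A > 0" "\<And>q z. q \<in> extensional I \<Longrightarrow> wgt I q ^ 0 * norm (h (shear (q, z))) \<le> A * decay2 z"
    using shear_decay[OF h] by metis
  have sm: "(\<lambda>z. h (shear (p, z))) \<in> borel_measurable lborel2" if "p \<in> extensional I" for p
    by (rule measurable_compose[OF shear_measurable2 m]) (simp add: space_leb that)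
  show "(\<lambda>m. coll h (X m)) \<longlonglongrightarrow> coll h q"
    unfolding coll_def
  proof (rule integral_dominated_convergence[where w="\<lambda>z. A * decay2 z"])
    show "AE z in lborel2. (\<lambda>m. h (shear (X m, z))) \<longlonglongrightarrow> h (shear (q, z))"
    proof (intro AE_I2 seqcontD[OF hc] shear_extensional X q)
      fix z i assume i: "i \<in> J"
      consider "i = c" | "i = d" | "i = e" | "i \<noteq> c" "i \<noteq> d" "i \<noteq> e" "i \<in> I" using i by blast
      then show "(\<lambda>m. shear (X m, z) i) \<longlonglongrightarrow> shear (q, z) i"
        by cases (auto simp: shear_simps intro!: tendsto_intros lim c)
    qed
    show "AE z in lborel2. norm (h (shear (X m, z))) \<le> A * decay2 z" for m
      using A(2)[OF X] by (auto intro!: AE_I2)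
  qed (auto intro!: sm X q integrable_mult_right integrable_decay2)
qed

lemma coll_diff:
  assumes "rapid J f" "f \<in> borel_measurable (leb J)" "rapid J g" "g \<in> borel_measurable (leb J)" "q \<in> extensional I"
  shows "coll (\<lambda>x. f x - g x) q = coll f q - coll g q"
  unfolding coll_def using shear_integrable assms by simp

lemma sch_diag:
  assumes u: "sch J u"
  shows "rapid I (\<lambda>x. u (diag x))" "seqcont I (\<lambda>x. u (diag x))"
proof -
  have w: "wgt I x \<le> wgt J (diag x)" for x
  proof -
    have "(\<Sum>i\<in>I - {c}. (diag x i)\<^sup>2) = (\<Sum>i\<in>I - {c}. (x i)\<^sup>2)"
      using d e by (intro sum.cong refl) (auto simp: diag_def)
    then have "wgt J (diag x) = wgt I x + 2 * (x c)\<^sup>2"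
      using I c de cd unfolding wgt_def sum_J by (simp add: diag_def sum.remove[of I c])
    then show ?thesis by simp
  qed
  show "rapid I (\<lambda>x. u (diag x))"
    unfolding rapid_def
  proof
    fix N
    obtain A where A: "\<And>x. x \<in> extensional J \<Longrightarrow> wgt J x ^ N * norm (u x) \<le> A"
      using rapidE[OF sch_rapid[OF u], of N] by metis
    have "wgt I x ^ N * norm (u (diag x)) \<le> A" if "x \<in> extensional I" for x
    proof -
      have "wgt I x ^ N * norm (u (diag x)) \<le> wgt J (diag x) ^ N * norm (u (diag x))"
        by (intro mult_right_mono power_mono w) auto
      also have "\<dots> \<le> A" by (intro A diag_extensional that)
      finally show ?thesis .
    qed
    then show "\<exists>A. \<forall>x\<in>extensional I. wgt I x ^ N * norm (u (diag x)) \<le> A" by blast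
  qed
  show "seqcont I (\<lambda>x. u (diag x))"
  proof (rule seqcontI)
    fix X :: "nat \<Rightarrow> 'i \<Rightarrow> real" and q :: "'i \<Rightarrow> real"
    assume X: "\<And>m. X m \<in> extensional I" and q: "q \<in> extensional I" and lim: "\<And>i. i \<in> I \<Longrightarrow> (\<lambda>m. X m i) \<longlonglongrightarrow> q i"
    show "(\<lambda>m. u (diag (X m))) \<longlonglongrightarrow> u (diag q)"
      by (rule seqcontD[OF sch_seqcont[OF finite_J u]])
         (auto simp: diag_def intro!: diag_extensional[unfolded diag_def] X q lim c)
  qed
qed

text \<open>By \<open>ift_diag\<close> the restricted function is itself an inverse transform, that
  of \<open>coll h\<close>. As the diagonal restriction of a Schwartz function it is integrable, so
  inversion applies.\<close>

lemma ft_diag: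
  assumes h: "sch J h" and q: "q \<in> extensional I"
  shows "ft I (\<lambda>x. ift J h (diag x)) q = of_real ((2 * pi) ^ card I) * coll h q"
proof -
  have D: "(\<lambda>x. ift J h (diag x)) = ift I (coll h)"
    using ift_diag[OF sch_integrable[OF finite_J h]] by auto
  have "nice I (\<lambda>x. ift J h (diag x))"
    by (intro rapid_nice I sch_diag sch_ift finite_J h)
  then have "integrable (leb I) (ift I (coll h))" unfolding D by (simp add: nice_def)
  moreover have "nice I (coll h)"
    by (intro rapid_nice I rapid_coll seqcont_coll sch_rapid h sch_measurable finite_J sch_seqcont)
  ultimately show ?thesis unfolding D by (intro fourier_inversion I q)
qed

end

section \<open>The weighted space-time estimate on each fibre\<close>

subsection \<open>A Schur test for oscillatory integrals on a time interval\<close>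

lemma gaussian_time_fourier:
  assumes T: "0 < (T::real)"
  shows "has_bochner_integral lborel (\<lambda>\<tau>. cis (s * \<tau>) * of_real (exp (- (1 / (2 * T\<^sup>2)) * \<tau>\<^sup>2)))
     (of_real (T * sqrt (2 * pi) * exp (- (T\<^sup>2 / 2) * s\<^sup>2)))"
proof -
  have 1: "sqrt (pi / (1 / (2 * T\<^sup>2))) = T * sqrt (2 * pi)"
    using T by (simp add: real_sqrt_mult mult.commute)
  have 2: "- s\<^sup>2 / (4 * (1 / (2 * T\<^sup>2))) = - (T\<^sup>2 / 2) * s\<^sup>2" by simp
  show ?thesis
    using gaussian_fourier[of "1 / (2 * T\<^sup>2)" s] T unfolding 1 2 by simp
qed

text \<open>A TT* argument with the Gaussian \<open>g\<close> as cutoff: expanding the square and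
  integrating in time gives the positive symmetric kernel \<open>E\<close>, whose size is measured
  by the weighted Schur condition. The weight m is left free; later it is a quotient of Sobolev
  weights.\<close>

lemma schur_oscillatory:
  fixes H :: "'a \<Rightarrow> complex" and P m :: "'a \<Rightarrow> real"
  assumes M: "sigma_finite_measure M" and T: "0 < T" and H: "integrable M H"
    and P [measurable]: "P \<in> borel_measurable M" and m [measurable]: "m \<in> borel_measurable M"
    and m_pos: "\<And>\<omega>. 0 < m \<omega>"
    and K: "\<And>\<omega>. (\<integral>\<^sup>+\<omega>'. ennreal (exp (- (T\<^sup>2 / 2) * (P \<omega> - P \<omega>')\<^sup>2) / (m \<omega>')\<^sup>2) \<partial>M) \<le> ennreal K"
  shows "(\<integral>\<^sup>+\<tau>. (ennreal (norm (\<integral>\<omega>. cis (\<tau> * P \<omega>) * H \<omega> \<partial>M)))\<^sup>2 * indicator {0..T} \<tau> \<partial>lborel)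
    \<le> ennreal (exp (1 / 2) * (T * sqrt (2 * pi))) * (ennreal K * (\<integral>\<^sup>+\<omega>. ennreal ((norm (H \<omega>) * m \<omega>)\<^sup>2) \<partial>M))"
proof -
  interpret sigma_finite_measure M by fact
  have pair: "pair_sigma_finite lborel M" "pair_sigma_finite M M" "pair_sigma_finite M (lborel :: real measure)"
    using M by (auto simp: pair_sigma_finite_def sigma_finite_lborel)
  note [measurable] = borel_measurable_integrable[OF H] borel_measurable_cnj
  define A where "A \<tau> = (\<integral>\<omega>. cis (\<tau> * P \<omega>) * H \<omega> \<partial>M)" for \<tau>
  define g where "g \<tau> = exp (- (1 / (2 * T\<^sup>2)) * \<tau>\<^sup>2)" for \<tau>
  define c0 where "c0 = T * sqrt (2 * pi)"
  have c0: "0 < c0" using T by (simp add: c0_def)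
  define E where "E \<omega> \<omega>' = exp (- (T\<^sup>2 / 2) * (P \<omega> - P \<omega>')\<^sup>2)" for \<omega> \<omega>'
  have E: "0 < E \<omega> \<omega>'" "E \<omega> \<omega>' \<le> 1" "E \<omega> \<omega>' = E \<omega>' \<omega>" for \<omega> \<omega>'
    by (auto simp: E_def power2_commute)
  have E_meas [measurable]: "(\<lambda>(x, y). E x y) \<in> borel_measurable (M \<Otimes>\<^sub>M M)"
    unfolding E_def by measurable
  have g: "0 < g \<tau>" for \<tau> by (simp add: g_def)
  have gi: "integrable lborel (\<lambda>\<tau>. complex_of_real (g \<tau>))"
    using gaussian_time_fourier[OF T, of 0] by (simp add: g_def has_bochner_integral_iff)
  then have gi': "integrable lborel g" using integrable_Re by force
  have [measurable]: "g \<in> borel_measurable borel" unfolding g_def by measurable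
  have A_meas [measurable]: "A \<in> borel_measurable borel"
  proof -
    have "A \<in> borel_measurable lborel" unfolding A_def by measurable
    then show ?thesis by simp
  qed
  define S where "S = (\<integral>\<omega>. norm (H \<omega>) \<partial>M)"
  have AS: "norm (A \<tau>) \<le> S" for \<tau> unfolding A_def S_def by (rule norm_integral_cis_le)
  have S0: "0 \<le> S" using AS[of 0] norm_ge_zero order.trans by blast
  have gA: "g \<tau> * norm (A \<tau>) \<le> S * g \<tau>" for \<tau>
    using mult_right_mono[OF AS[of \<tau>] less_imp_le[OF g[of \<tau>]]] by (simp add: mult.commute)
  have gAi: "integrable lborel (\<lambda>\<tau>. of_real (g \<tau>) * A \<tau>)"
    by (rule Bochner_Integration.integrable_bound[OF integrable_mult_right[OF gi', of S]])
       (use gA S0 less_imp_le[OF g] in \<open>auto simp: norm_mult abs_mult intro!: AE_I2\<close>)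
  have gA2i: "integrable lborel (\<lambda>\<tau>. g \<tau> * (norm (A \<tau>))\<^sup>2)"
    by (rule Bochner_Integration.integrable_bound[OF integrable_mult_right[OF gi', of "S\<^sup>2"]])
       (use AS S0 less_imp_le[OF g] in \<open>auto simp: norm_mult abs_mult mult.commute intro!: AE_I2 mult_left_mono power_mono\<close>)
  \<comment> \<open>The time integral of the cutoff against a phase difference is explicit and
    yields the kernel \<open>c0 * E\<close>.\<close>
  have inner: "(\<integral>\<tau>. cis (\<tau> * - P \<omega>') * (of_real (g \<tau>) * A \<tau>) \<partial>lborel) = (\<integral>\<omega>. H \<omega> * of_real (c0 * E \<omega> \<omega>') \<partial>M)" for \<omega>'
  proof -
    have "(\<integral>\<tau>. cis (\<tau> * - P \<omega>') * (of_real (g \<tau>) * A \<tau>) \<partial>lborel) =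
      (\<integral>\<tau>. (cis (\<tau> * - P \<omega>') * of_real (g \<tau>)) * (\<integral>\<omega>. cis (\<tau> * P \<omega>) * H \<omega> \<partial>M) \<partial>lborel)"
      by (simp add: A_def mult.assoc)
    also have "\<dots> = (\<integral>\<omega>. H \<omega> * (\<integral>\<tau>. cis (\<tau> * P \<omega>) * (cis (\<tau> * - P \<omega>') * of_real (g \<tau>)) \<partial>lborel) \<partial>M)"
      by (rule integral_swap_cis[OF pair(1) _ H]) (auto intro!: integrable_cis_mult gi)
    also have "\<dots> = (\<integral>\<omega>. H \<omega> * of_real (c0 * E \<omega> \<omega>') \<partial>M)"
    proof (rule Bochner_Integration.integral_cong[OF refl])
      fix \<omega>
      have "(\<integral>\<tau>. cis (\<tau> * P \<omega>) * (cis (\<tau> * - P \<omega>') * of_real (g \<tau>)) \<partial>lborel) = (\<integral>\<tau>. cis ((P \<omega> - P \<omega>') * \<tau>) * of_real (g \<tau>) \<partial>lborel)"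
        by (simp add: cis_mult algebra_simps flip: mult.assoc)
      also have "\<dots> = of_real (c0 * E \<omega> \<omega>')"
        using gaussian_time_fourier[OF T, of "P \<omega> - P \<omega>'"] unfolding has_bochner_integral_iff g_def c0_def E_def by blast
      finally show "H \<omega> * (\<integral>\<tau>. cis (\<tau> * P \<omega>) * (cis (\<tau> * - P \<omega>') * of_real (g \<tau>)) \<partial>lborel) = H \<omega> * of_real (c0 * E \<omega> \<omega>')"
        by simp
    qed
    finally show ?thesis .
  qed
  have cnjA: "cnj (A \<tau>) = (\<integral>\<omega>. cis (\<tau> * - P \<omega>) * cnj (H \<omega>) \<partial>M)" for \<tau>
  proof -
    have "(\<integral>\<omega>. cis (\<tau> * - P \<omega>) * cnj (H \<omega>) \<partial>M) = (\<integral>\<omega>. cnj (cis (\<tau> * P \<omega>) * H \<omega>) \<partial>M)"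
      by (simp add: cis_cnj del: Bochner_Integration.integral_cnj)
    with Bochner_Integration.integral_cnj[of M "\<lambda>\<omega>. cis (\<tau> * P \<omega>) * H \<omega>"] show ?thesis
      unfolding A_def by simp
  qed
  define Z where "Z \<omega>' = (\<integral>\<omega>. H \<omega> * of_real (c0 * E \<omega> \<omega>') \<partial>M)" for \<omega>'
  have "(\<integral>\<tau>. complex_of_real (g \<tau> * (norm (A \<tau>))\<^sup>2) \<partial>lborel) =
      (\<integral>\<tau>. (of_real (g \<tau>) * A \<tau>) * (\<integral>\<omega>. cis (\<tau> * - P \<omega>) * cnj (H \<omega>) \<partial>M) \<partial>lborel)"
    using cnjA by (simp only: complex_norm_square of_real_mult mult.assoc)
  also have "\<dots> = (\<integral>\<omega>'. cnj (H \<omega>') * (\<integral>\<tau>. cis (\<tau> * - P \<omega>') * (of_real (g \<tau>) * A \<tau>) \<partial>lborel) \<partial>M)"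
    by (rule integral_swap_cis[OF pair(1) gAi]) (use H in auto)
  also have "\<dots> = (\<integral>\<omega>'. cnj (H \<omega>') * Z \<omega>' \<partial>M)" by (simp only: inner Z_def)
  finally have eq: "(\<integral>\<tau>. g \<tau> * (norm (A \<tau>))\<^sup>2 \<partial>lborel) = Re (\<integral>\<omega>'. cnj (H \<omega>') * Z \<omega>' \<partial>M)"
    by (metis Re_complex_of_real integral_complex_of_real)
  have HEn: "norm (H \<omega> * of_real (c0 * E \<omega> \<omega>')) = c0 * (norm (H \<omega>) * E \<omega> \<omega>')" for \<omega> \<omega>'
    using E(1)[of \<omega> \<omega>'] c0 by (simp add: norm_mult)
  have HEb: "norm (H \<omega> * of_real (c0 * E \<omega> \<omega>')) \<le> c0 * norm (H \<omega>)" for \<omega> \<omega>'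
    unfolding HEn using E(1,2)[of \<omega> \<omega>'] c0 by (intro mult_left_mono mult_right_le_one_le) auto
  have HEi: "integrable M (\<lambda>\<omega>. H \<omega> * of_real (c0 * E \<omega> \<omega>'))" if "\<omega>' \<in> space M" for \<omega>'
  proof (rule Bochner_Integration.integrable_bound[OF integrable_mult_right[OF integrable_norm[OF H], of c0]])
    have "(\<lambda>\<omega>. E \<omega> \<omega>') \<in> borel_measurable M" unfolding E_def by measurable
    then show "(\<lambda>\<omega>. H \<omega> * of_real (c0 * E \<omega> \<omega>')) \<in> borel_measurable M" by measurable
    show "AE \<omega> in M. norm (H \<omega> * of_real (c0 * E \<omega> \<omega>')) \<le> norm (c0 * norm (H \<omega>))"
      using order.trans[OF HEb abs_ge_self] by (simp only: real_norm_def AE_I2)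
  qed
  have HE_meas: "(\<lambda>(\<omega>', \<omega>). H \<omega> * of_real (c0 * E \<omega> \<omega>')) \<in> borel_measurable (M \<Otimes>\<^sub>M M)"
    unfolding E_def by measurable
  have Z_meas [measurable]: "Z \<in> borel_measurable M"
    unfolding Z_def by (rule borel_measurable_lebesgue_integral) (rule HE_meas)
  have Zn: "ennreal (norm (Z \<omega>')) \<le> (\<integral>\<^sup>+\<omega>. ennreal (c0 * (norm (H \<omega>) * E \<omega> \<omega>')) \<partial>M)" if "\<omega>' \<in> space M" for \<omega>'
    using integral_norm_bound_ennreal[OF HEi[OF that]] unfolding HEn Z_def .
  have Zb: "norm (Z \<omega>') \<le> c0 * S" if "\<omega>' \<in> space M" for \<omega>'
  proof -
    have "norm (Z \<omega>') \<le> (\<integral>\<omega>. norm (H \<omega> * of_real (c0 * E \<omega> \<omega>')) \<partial>M)"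
      unfolding Z_def by (rule integral_norm_bound)
    also have "\<dots> \<le> (\<integral>\<omega>. c0 * norm (H \<omega>) \<partial>M)"
      by (intro Bochner_Integration.integral_mono integrable_norm HEi that integrable_mult_right H HEb)
    finally show ?thesis by (simp add: S_def)
  qed
  have HZi: "integrable M (\<lambda>\<omega>'. cnj (H \<omega>') * Z \<omega>')"
  proof (rule Bochner_Integration.integrable_bound[OF integrable_mult_right[OF integrable_norm[OF H], of "c0 * S"]])
    show "AE \<omega>' in M. norm (cnj (H \<omega>') * Z \<omega>') \<le> norm (c0 * S * norm (H \<omega>'))"
    proof (rule AE_I2)
      fix \<omega>' assume "\<omega>' \<in> space M"
      from mult_right_mono[OF Zb[OF this], of "norm (H \<omega>')"]
      show "norm (cnj (H \<omega>') * Z \<omega>') \<le> norm (c0 * S * norm (H \<omega>'))"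
        using c0 S0 by (simp add: norm_mult abs_mult mult.commute)
    qed
  qed measurable
  define N where "N = (\<integral>\<^sup>+\<omega>. ennreal ((norm (H \<omega>) * m \<omega>)\<^sup>2) \<partial>M)"
  let ?B = "\<lambda>\<omega> \<omega>'. ennreal (c0 * (norm (H \<omega>') * (norm (H \<omega>) * E \<omega> \<omega>')))"
  let ?B1 = "\<lambda>\<omega> \<omega>'. ennreal (c0 / 2 * (norm (H \<omega>) * m \<omega>)\<^sup>2) * ennreal (E \<omega> \<omega>' / (m \<omega>')\<^sup>2)"
  have B_le: "?B \<omega> \<omega>' \<le> ?B1 \<omega> \<omega>' + ?B1 \<omega>' \<omega>" for \<omega> \<omega>'
  proof -
    \<comment> \<open>The weights are placed crosswise: x y is |H(\<omega>)| |H(\<omega>')|, while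
      x^2 carries 1 / m(\<omega>')^2 and y^2 carries 1 / m(\<omega>)^2. In each of the two resulting
      terms the Schur integral runs over the variable in which H does not occur.\<close>
    define x y where "x = norm (H \<omega>) * m \<omega> / m \<omega>'" and "y = norm (H \<omega>') * m \<omega>' / m \<omega>"
    have "2 * (x * y) \<le> x\<^sup>2 + y\<^sup>2" using sum_squares_bound[of x y] by (simp add: mult.assoc)
    moreover have "x * y = norm (H \<omega>) * norm (H \<omega>')" using m_pos[of \<omega>] m_pos[of \<omega>'] by (simp add: x_def y_def)
    ultimately have "c0 / 2 * E \<omega> \<omega>' * (2 * (norm (H \<omega>) * norm (H \<omega>'))) \<le> c0 / 2 * E \<omega> \<omega>' * (x\<^sup>2 + y\<^sup>2)"
      using c0 E(1)[of \<omega> \<omega>'] by (intro mult_left_mono) auto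
    then have "c0 * (norm (H \<omega>') * (norm (H \<omega>) * E \<omega> \<omega>')) \<le>
       c0 / 2 * (norm (H \<omega>) * m \<omega>)\<^sup>2 * (E \<omega> \<omega>' / (m \<omega>')\<^sup>2) + c0 / 2 * (norm (H \<omega>') * m \<omega>')\<^sup>2 * (E \<omega>' \<omega> / (m \<omega>)\<^sup>2)"
      using E(3)[of \<omega> \<omega>'] by (simp add: x_def y_def power_divide algebra_simps)
    then have "?B \<omega> \<omega>' \<le> ennreal (c0 / 2 * (norm (H \<omega>) * m \<omega>)\<^sup>2 * (E \<omega> \<omega>' / (m \<omega>')\<^sup>2) + c0 / 2 * (norm (H \<omega>') * m \<omega>')\<^sup>2 * (E \<omega>' \<omega> / (m \<omega>)\<^sup>2))"
      by (rule ennreal_leI)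
    also have "\<dots> = ?B1 \<omega> \<omega>' + ?B1 \<omega>' \<omega>"
      using c0 E(1)[of \<omega> \<omega>'] E(1)[of \<omega>' \<omega>]
      by (subst ennreal_plus) (auto simp: ennreal_mult[symmetric] less_imp_le)
    finally show ?thesis .
  qed
  have B1_meas [measurable]: "(\<lambda>(\<omega>, \<omega>'). ?B1 \<omega> \<omega>') \<in> borel_measurable (M \<Otimes>\<^sub>M M)"
    unfolding E_def by measurable
  have B1_meas' [measurable]: "(\<lambda>(\<omega>, \<omega>'). ?B1 \<omega>' \<omega>) \<in> borel_measurable (M \<Otimes>\<^sub>M M)"
    unfolding E_def by measurable
  have B1_int: "(\<integral>\<^sup>+\<omega>. \<integral>\<^sup>+\<omega>'. ?B1 \<omega> \<omega>' \<partial>M \<partial>M) \<le> ennreal (c0 / 2) * (ennreal K * N)"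
  proof -
    have [measurable]: "(\<lambda>\<omega>'. E \<omega> \<omega>') \<in> borel_measurable M" for \<omega> unfolding E_def by measurable
    have "(\<integral>\<^sup>+\<omega>. \<integral>\<^sup>+\<omega>'. ?B1 \<omega> \<omega>' \<partial>M \<partial>M) = (\<integral>\<^sup>+\<omega>. ennreal (c0 / 2 * (norm (H \<omega>) * m \<omega>)\<^sup>2) * (\<integral>\<^sup>+\<omega>'. ennreal (E \<omega> \<omega>' / (m \<omega>')\<^sup>2) \<partial>M) \<partial>M)"
      by (intro nn_integral_cong nn_integral_cmult) measurable
    also have "\<dots> \<le> (\<integral>\<^sup>+\<omega>. ennreal (c0 / 2 * (norm (H \<omega>) * m \<omega>)\<^sup>2) * ennreal K \<partial>M)"
      using K unfolding E_def by (intro nn_integral_mono mult_left_mono) auto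
    also have "\<dots> = (\<integral>\<^sup>+\<omega>. (ennreal (c0 / 2) * ennreal K) * ennreal ((norm (H \<omega>) * m \<omega>)\<^sup>2) \<partial>M)"
      using c0 by (intro nn_integral_cong) (subst ennreal_mult', simp, simp only: mult_ac)
    also have "\<dots> = ennreal (c0 / 2) * (ennreal K * N)"
      unfolding N_def by (subst nn_integral_cmult) (auto simp: mult.assoc)
    finally show ?thesis .
  qed
  have "ennreal (Re (\<integral>\<omega>'. cnj (H \<omega>') * Z \<omega>' \<partial>M)) \<le> ennreal (norm (\<integral>\<omega>'. cnj (H \<omega>') * Z \<omega>' \<partial>M))"
    by (intro ennreal_leI complex_Re_le_cmod)
  also have "\<dots> \<le> (\<integral>\<^sup>+\<omega>'. ennreal (norm (cnj (H \<omega>') * Z \<omega>')) \<partial>M)"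
    by (rule integral_norm_bound_ennreal[OF HZi])
  also have "\<dots> \<le> (\<integral>\<^sup>+\<omega>'. ennreal (norm (H \<omega>')) * (\<integral>\<^sup>+\<omega>. ennreal (c0 * (norm (H \<omega>) * E \<omega> \<omega>')) \<partial>M) \<partial>M)"
    by (intro nn_integral_mono) (auto simp: norm_mult ennreal_mult' intro!: mult_left_mono Zn)
  also have "\<dots> = (\<integral>\<^sup>+\<omega>'. \<integral>\<^sup>+\<omega>. ?B \<omega> \<omega>' \<partial>M \<partial>M)"
  proof (intro nn_integral_cong)
    fix \<omega>'
    have [measurable]: "(\<lambda>\<omega>. E \<omega> \<omega>') \<in> borel_measurable M" unfolding E_def by measurable
    have "ennreal (norm (H \<omega>')) * (\<integral>\<^sup>+\<omega>. ennreal (c0 * (norm (H \<omega>) * E \<omega> \<omega>')) \<partial>M) =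
      (\<integral>\<^sup>+\<omega>. ennreal (norm (H \<omega>')) * ennreal (c0 * (norm (H \<omega>) * E \<omega> \<omega>')) \<partial>M)"
      by (rule nn_integral_cmult[symmetric]) measurable
    also have "\<dots> = (\<integral>\<^sup>+\<omega>. ?B \<omega> \<omega>' \<partial>M)"
      by (intro nn_integral_cong) (simp add: ennreal_mult'[symmetric] mult.left_commute)
    finally show "ennreal (norm (H \<omega>')) * (\<integral>\<^sup>+\<omega>. ennreal (c0 * (norm (H \<omega>) * E \<omega> \<omega>')) \<partial>M) = (\<integral>\<^sup>+\<omega>. ?B \<omega> \<omega>' \<partial>M)" .
  qed
  also have "\<dots> \<le> (\<integral>\<^sup>+\<omega>'. \<integral>\<^sup>+\<omega>. ?B1 \<omega> \<omega>' + ?B1 \<omega>' \<omega> \<partial>M \<partial>M)"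
    by (intro nn_integral_mono B_le)
  also have "\<dots> = (\<integral>\<^sup>+\<omega>'. (\<integral>\<^sup>+\<omega>. ?B1 \<omega> \<omega>' \<partial>M) + (\<integral>\<^sup>+\<omega>. ?B1 \<omega>' \<omega> \<partial>M) \<partial>M)"
    by (intro nn_integral_cong nn_integral_add) (unfold E_def, measurable)
  also have "\<dots> = (\<integral>\<^sup>+\<omega>'. \<integral>\<^sup>+\<omega>. ?B1 \<omega> \<omega>' \<partial>M \<partial>M) + (\<integral>\<^sup>+\<omega>'. \<integral>\<^sup>+\<omega>. ?B1 \<omega>' \<omega> \<partial>M \<partial>M)"
    by (intro nn_integral_add borel_measurable_nn_integral B1_meas B1_meas')
  also have "(\<integral>\<^sup>+\<omega>'. \<integral>\<^sup>+\<omega>. ?B1 \<omega> \<omega>' \<partial>M \<partial>M) = (\<integral>\<^sup>+\<omega>. \<integral>\<^sup>+\<omega>'. ?B1 \<omega> \<omega>' \<partial>M \<partial>M)"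
    by (rule pair_sigma_finite.Fubini'[OF pair(2) B1_meas])
  also have "\<dots> + (\<integral>\<^sup>+\<omega>'. \<integral>\<^sup>+\<omega>. ?B1 \<omega>' \<omega> \<partial>M \<partial>M) \<le> ennreal (c0 / 2) * (ennreal K * N) + ennreal (c0 / 2) * (ennreal K * N)"
    by (intro add_mono B1_int)
  also have "\<dots> = ennreal c0 * (ennreal K * N)"
    using c0 by (simp flip: distrib_right ennreal_plus)
  finally have main: "ennreal (\<integral>\<tau>. g \<tau> * (norm (A \<tau>))\<^sup>2 \<partial>lborel) \<le> ennreal c0 * (ennreal K * N)"
    unfolding eq .
  have "(\<integral>\<^sup>+\<tau>. (ennreal (norm (A \<tau>)))\<^sup>2 * indicator {0..T} \<tau> \<partial>lborel) \<le> (\<integral>\<^sup>+\<tau>. ennreal (exp (1 / 2)) * ennreal (g \<tau> * (norm (A \<tau>))\<^sup>2) \<partial>lborel)"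
  proof (rule nn_integral_mono)
    fix \<tau> :: real
    show "(ennreal (norm (A \<tau>)))\<^sup>2 * indicator {0..T} \<tau> \<le> ennreal (exp (1 / 2)) * ennreal (g \<tau> * (norm (A \<tau>))\<^sup>2)"
    proof (cases "\<tau> \<in> {0..T}")
      case True
      then have "\<tau>\<^sup>2 \<le> T\<^sup>2" by (intro power_mono) auto
      \<comment> \<open>On [0, T] the exponent of \<open>g\<close> is at least -1/2, which fixes the
        factor exp(1/2).\<close>
      then have "1 \<le> exp (1 / 2) * g \<tau>" using T by (simp add: g_def flip: exp_add)
      then have "1 * (norm (A \<tau>))\<^sup>2 \<le> exp (1 / 2) * g \<tau> * (norm (A \<tau>))\<^sup>2" by (intro mult_right_mono) auto
      then show ?thesis using True by (simp add: ennreal_power ennreal_mult'[symmetric] mult.assoc ennreal_leI)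
    qed simp
  qed
  also have "\<dots> = ennreal (exp (1 / 2)) * (\<integral>\<^sup>+\<tau>. ennreal (g \<tau> * (norm (A \<tau>))\<^sup>2) \<partial>lborel)"
    by (rule nn_integral_cmult) measurable
  also have "(\<integral>\<^sup>+\<tau>. ennreal (g \<tau> * (norm (A \<tau>))\<^sup>2) \<partial>lborel) = ennreal (\<integral>\<tau>. g \<tau> * (norm (A \<tau>))\<^sup>2 \<partial>lborel)"
    by (rule nn_integral_eq_integral[OF gA2i]) (use g in \<open>auto simp: less_imp_le\<close>)
  also have "ennreal (exp (1 / 2)) * \<dots> \<le> ennreal (exp (1 / 2)) * (ennreal c0 * (ennreal K * N))"
    by (intro mult_left_mono main) simp
  also have "\<dots> = ennreal (exp (1 / 2) * (T * sqrt (2 * pi))) * (ennreal K * N)"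
    using c0 by (simp add: c0_def ennreal_mult' mult.assoc)
  finally show ?thesis unfolding A_def N_def .
qed

subsection \<open>The weighted level-set estimate\<close>

lemma japanese_ge1: "1 \<le> japanese x"
  by (simp add: japanese_def)

lemma japanese_pos: "0 < japanese x"
  using japanese_ge1[of x] by linarith

lemma japanese_minus: "japanese (- x) = japanese x"
  by (simp add: japanese_def)

lemma japanese_add: "japanese (x + y) \<le> japanese x + japanese y"
proof -
  have "(japanese x + japanese y)\<^sup>2 = (1 + x\<^sup>2) + (1 + y\<^sup>2) + 2 * (japanese x * japanese y)"
    by (simp add: japanese_def power2_sum add_nonneg_nonneg)
  moreover have "\<bar>x\<bar> * \<bar>y\<bar> \<le> japanese x * japanese y"
    by (intro mult_mono) (auto simp: japanese_def intro!: real_le_rsqrt)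
  moreover have "x * y \<le> \<bar>x\<bar> * \<bar>y\<bar>" by (metis abs_ge_self abs_mult)
  ultimately have "1 + (x + y)\<^sup>2 \<le> (japanese x + japanese y)\<^sup>2"
    by (simp add: power2_sum)
  then show ?thesis
    unfolding japanese_def[of "x + y"] using japanese_pos[of x] japanese_pos[of y] by (intro real_le_lsqrt) auto
qed

lemma japanese_measurable [measurable]: "japanese \<in> borel_measurable borel"
  unfolding japanese_def[abs_def] by measurable

lemma isCont_japanese: "isCont japanese x"
  unfolding japanese_def[abs_def] by (intro continuous_intros)

text \<open>The tail |x|^(-1-\<theta>) has the explicit primitive -x^(-\<theta>) / \<theta>. Here
  \<theta> > 0, and with it \<epsilon> > 0, enters the positive result.\<close>

lemma nn_integral_japanese_finite:
  assumes \<theta>: "0 < (\<theta>::real)"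
  shows "(\<integral>\<^sup>+x. ennreal (japanese x powr (- 1 - \<theta>)) \<partial>lborel) < \<infinity>"
proof -
  let ?f = "\<lambda>x::real. x powr (- 1 - \<theta>)"
  have tail: "(\<integral>\<^sup>+x. ennreal (?f x) * indicator {1..} x \<partial>lborel) = ennreal (0 - (- (1 powr - \<theta>) / \<theta>))"
  proof (rule nn_integral_FTC_atLeast)
    show "((\<lambda>x. - (x powr - \<theta>) / \<theta>) has_real_derivative ?f x) (at x)" if "1 \<le> x" for x
      using that \<theta> by (auto intro!: derivative_eq_intros simp: powr_diff powr_minus field_simps)
    show "((\<lambda>x. - (x powr - \<theta>) / \<theta>) \<longlongrightarrow> 0) at_top"
    proof -
      have "((\<lambda>x::real. x powr - \<theta>) \<longlongrightarrow> 0) at_top"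
        using \<theta> by (intro tendsto_neg_powr filterlim_ident) auto
      from tendsto_divide[OF tendsto_minus[OF this] tendsto_const[of \<theta>]] show ?thesis using \<theta> by simp
    qed
  qed auto
  have "ennreal (japanese x powr (- 1 - \<theta>)) \<le> indicator {-1..1} x + (ennreal (?f x) * indicator {1..} x + ennreal (?f (0 + (- 1) * x)) * indicator {1..} (0 + (- 1) * x))" for x
  proof (cases "x \<in> {-1..1}")
    case True
    have "japanese x powr (- 1 - \<theta>) \<le> japanese x powr 0"
      using japanese_ge1[of x] \<theta> by (intro powr_mono) auto
    then have "ennreal (japanese x powr (- 1 - \<theta>)) \<le> 1" using japanese_pos[of x] by (simp add: ennreal_le_1)
    with True show ?thesis by (auto intro: add_increasing2)
  next
    case False
    have "\<bar>x\<bar> \<le> japanese x" by (auto simp: japanese_def intro!: real_le_rsqrt)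
    then have "japanese x powr (- 1 - \<theta>) \<le> \<bar>x\<bar> powr (- 1 - \<theta>)"
      using False \<theta> by (intro powr_mono2') auto
    then have 1: "ennreal (japanese x powr (- 1 - \<theta>)) \<le> ennreal (\<bar>x\<bar> powr (- 1 - \<theta>))" by (rule ennreal_leI)
    show ?thesis
    proof (cases "x \<ge> 1")
      case True
      then show ?thesis using 1 by (auto intro!: add_increasing2 add_increasing)
    next
      case F2: False
      then have "x < -1" using False by auto
      then show ?thesis using 1 by (auto intro!: add_increasing)
    qed
  qed
  then have "(\<integral>\<^sup>+x. ennreal (japanese x powr (- 1 - \<theta>)) \<partial>lborel) \<le>
     (\<integral>\<^sup>+x. indicator {-1..1} x + (ennreal (?f x) * indicator {1..} x + ennreal (?f (0 + (- 1) * x)) * indicator {1..} (0 + (- 1) * x)) \<partial>lborel)"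
    by (intro nn_integral_mono)
  also have "\<dots> = (\<integral>\<^sup>+x. indicator {-1..1::real} x \<partial>lborel) + ((\<integral>\<^sup>+x. ennreal (?f x) * indicator {1..} x \<partial>lborel) +
     (\<integral>\<^sup>+x. ennreal (?f (0 + (- 1) * x)) * indicator {1..} (0 + (- 1) * x) \<partial>lborel))"
    by (subst nn_integral_add, measurable, subst nn_integral_add, measurable)
  also have "(\<integral>\<^sup>+x. ennreal (?f (0 + (- 1) * x)) * indicator {1..} (0 + (- 1) * x) \<partial>lborel) = (\<integral>\<^sup>+x. ennreal (?f x) * indicator {1..} x \<partial>lborel)"
    by (subst nn_integral_real_affine[of "\<lambda>x. ennreal (?f x) * indicator {1..} x" "- 1" 0]) auto
  also have "(\<integral>\<^sup>+x. indicator {-1..1::real} x \<partial>lborel) = 2" by simp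
  finally show ?thesis unfolding tail using \<theta> by (auto simp: top_unique less_top[symmetric] ennreal_add_eq_top)
qed

text \<open>The substitution u = C + 2 p r has Jacobian 2 |r|. This is the gain 1 / |r| of the
  estimate, uniform in the offset C.\<close>

lemma nn_integral_gaussian_affine:
  fixes T r C :: real
  assumes T: "0 < T" and r: "r \<noteq> 0"
  shows "(\<integral>\<^sup>+p. ennreal (exp (- (T\<^sup>2 / 2) * (C + 2 * p * r)\<^sup>2)) \<partial>lborel) = ennreal (sqrt (2 * pi) / T / (2 * \<bar>r\<bar>))"
proof -
  have "ennreal (sqrt (2 * pi) / T) = ennreal (sqrt (pi / (T\<^sup>2 / 2)))"
    using T by (simp add: real_sqrt_divide mult.commute)
  also have "\<dots> = (\<integral>\<^sup>+u. ennreal (exp (- (T\<^sup>2 / 2) * u\<^sup>2)) \<partial>lborel)"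
    using T by (intro nn_integral_gaussian[symmetric]) simp
  also have "\<dots> = ennreal \<bar>2 * r\<bar> * (\<integral>\<^sup>+p. ennreal (exp (- (T\<^sup>2 / 2) * (C + (2 * r) * p)\<^sup>2)) \<partial>lborel)"
    using r by (subst nn_integral_real_affine[where c="2 * r" and t=C]) auto
  finally have *: "ennreal (2 * \<bar>r\<bar>) * (\<integral>\<^sup>+p. ennreal (exp (- (T\<^sup>2 / 2) * (C + 2 * p * r)\<^sup>2)) \<partial>lborel) = ennreal (sqrt (2 * pi) / T)"
    by (simp add: abs_mult mult_ac)
  have "(\<integral>\<^sup>+p. ennreal (exp (- (T\<^sup>2 / 2) * (C + 2 * p * r)\<^sup>2)) \<partial>lborel) =
     ennreal (1 / (2 * \<bar>r\<bar>)) * (ennreal (2 * \<bar>r\<bar>) * (\<integral>\<^sup>+p. ennreal (exp (- (T\<^sup>2 / 2) * (C + 2 * p * r)\<^sup>2)) \<partial>lborel))"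
    using r by (simp add: ennreal_mult'[symmetric] flip: mult.assoc)
  also have "\<dots> = ennreal (sqrt (2 * pi) / T / (2 * \<bar>r\<bar>))"
    unfolding * using T by (simp add: ennreal_mult'[symmetric])
  finally show ?thesis .
qed

text \<open>With a, b, g as below, n is a signed sum of the three frequencies, so the quotient is at
  most 1/(ab) + 1/(ag) + 1/(bg). Two terms contain 1/b; in the third, r is the difference of the
  frequencies in g and a, whence 2 a g is at least \<open>japanese r\<close>.\<close>

lemma weight_bound:
  assumes \<theta>: "0 \<le> \<theta>"
  shows "(japanese n / (japanese (n + p) * japanese (n + r) * japanese (n + p + r))) powr \<theta>
     \<le> 4 powr \<theta> * (japanese (n + r) powr - \<theta> + japanese r powr - \<theta>)"
proof -
  define a b g where "a = japanese (n + p)" and "b = japanese (n + r)" and "g = japanese (n + p + r)"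
  have ge1: "1 \<le> a" "1 \<le> b" "1 \<le> g" by (auto simp: a_def b_def g_def japanese_ge1)
  let ?r = "japanese r"
  have r1: "1 \<le> ?r" by (rule japanese_ge1)
  have "n = (n + p) + ((n + r) + - (n + p + r))" by simp
  then have "japanese n \<le> a + (b + g)"
    unfolding a_def b_def g_def by (metis add_left_mono japanese_add japanese_minus order.trans)
  moreover have "r = (n + p + r) + - (n + p)" by simp
  then have r: "?r \<le> g + a"
    unfolding a_def g_def by (metis japanese_add japanese_minus)
  ultimately have n: "japanese n \<le> a + (b + g)" by simp
  have "japanese n / (a * b * g) \<le> (a + (b + g)) / (a * b * g)"
    using n ge1 by (intro divide_right_mono) auto
  also have "\<dots> = inverse b * inverse g + inverse a * inverse g + inverse a * inverse b"
    using ge1 by (simp add: field_simps)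
  also have "\<dots> \<le> inverse b * 1 + 2 * inverse ?r + 1 * inverse b"
  proof -
    have "?r \<le> 2 * (a * g)"
    proof -
      have "(a - 1) * (g - 1) \<ge> 0" using ge1 by simp
      then have "a + g \<le> a * g + 1" by (simp add: algebra_simps)
      moreover have "1 \<le> a * g" using mult_mono[of 1 a 1 g] ge1 by simp
      ultimately show ?thesis using r by linarith
    qed
    then have "inverse (a * g) \<le> 2 * inverse ?r" using ge1 r1 by (simp add: field_simps)
    then have "inverse a * inverse g \<le> 2 * inverse ?r" by simp
    moreover have "inverse b * inverse g \<le> inverse b * 1" "inverse a * inverse b \<le> 1 * inverse b"
      using ge1 by (auto intro!: mult_left_mono mult_right_mono simp: inverse_le_1_iff)
    ultimately show ?thesis by linarith
  qed
  finally have "japanese n / (a * b * g) \<le> 2 * (inverse b + inverse ?r)" by simp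
  \<comment> \<open>A sum of two terms is at most twice their maximum, and the power \<theta> of a
    maximum is the maximum of the powers; the two factors 2 give the constant 4.\<close>
  also have "\<dots> \<le> 4 * max (inverse b) (inverse ?r)" by (auto simp: max_def)
  finally have "(japanese n / (a * b * g)) powr \<theta> \<le> (4 * max (inverse b) (inverse ?r)) powr \<theta>"
    using \<theta> ge1 japanese_pos[of n] by (intro powr_mono2) auto
  also have "\<dots> = 4 powr \<theta> * max (inverse b) (inverse ?r) powr \<theta>"
    by (rule powr_mult)
  also have "max (inverse b) (inverse ?r) powr \<theta> \<le> inverse b powr \<theta> + inverse ?r powr \<theta>"
    by (auto simp: max_def)
  also have "\<dots> = b powr - \<theta> + ?r powr - \<theta>"
    using ge1 r1 by (simp add: powr_minus inverse_powr)
  finally show ?thesis unfolding a_def b_def g_def by simp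
qed

definition kap :: "real \<Rightarrow> real" where
  "kap \<theta> = enn2real (\<integral>\<^sup>+x. ennreal (japanese x powr (- 1 - \<theta>)) \<partial>lborel)"

lemma kap: "0 < \<theta> \<Longrightarrow> (\<integral>\<^sup>+x. ennreal (japanese x powr (- 1 - \<theta>)) \<partial>lborel) = ennreal (kap \<theta>)"
  using nn_integral_japanese_finite[of \<theta>] by (simp add: kap_def less_top)

lemma kap_nonneg: "0 \<le> kap \<theta>"
  by (simp add: kap_def)

text \<open>For |r| \<ge> 1, 1 / |r| is at most 2 / \<open>japanese r\<close>, and a mixed product
  x^(-\<theta>) y^(-1) is at most x^(-1-\<theta>) + y^(-1-\<theta>) since either base may be
  replaced by the smaller one. The coefficients 2 and 4 of the two integrable terms add up to
  6.\<close>

lemma tail_bound: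
  assumes \<theta>: "0 < \<theta>"
  shows "(\<integral>\<^sup>+r. ennreal ((japanese (n + r) powr - \<theta> + japanese r powr - \<theta>) / \<bar>r\<bar>) * indicator {r. 1 \<le> \<bar>r\<bar>} r \<partial>lborel)
     \<le> ennreal (6 * kap \<theta>)"
proof -
  let ?j = "\<lambda>x. japanese x powr (- 1 - \<theta>)"
  have "ennreal ((japanese (n + r) powr - \<theta> + japanese r powr - \<theta>) / \<bar>r\<bar>) * indicator {r. 1 \<le> \<bar>r\<bar>} r
     \<le> ennreal 2 * ennreal (?j (n + 1 * r)) + ennreal 4 * ennreal (?j r)" for r
  proof (cases "1 \<le> \<bar>r\<bar>")
    case True
    define x y where "x = japanese (n + r)" and "y = japanese r"
    have xy: "1 \<le> x" "1 \<le> y" by (auto simp: x_def y_def japanese_ge1)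
    have "1 \<le> r\<^sup>2" using True by (metis one_le_power power2_abs)
    then have "y \<le> 2 * \<bar>r\<bar>"
      unfolding y_def japanese_def by (intro real_le_lsqrt) (auto simp: power_mult_distrib)
    then have "1 / \<bar>r\<bar> \<le> 2 * (1 / y)" using True xy by (simp add: field_simps)
    then have "(x powr - \<theta> + y powr - \<theta>) * (1 / \<bar>r\<bar>) \<le> (x powr - \<theta> + y powr - \<theta>) * (2 * (1 / y))"
      by (intro mult_left_mono) (auto intro: add_nonneg_nonneg)
    also have "\<dots> = 2 * (x powr - \<theta> * y powr - 1 + y powr - \<theta> * y powr - 1)"
      using xy by (simp add: powr_minus_divide field_simps)
    also have "\<dots> \<le> 2 * ((x powr (- 1 - \<theta>) + y powr (- 1 - \<theta>)) + y powr (- 1 - \<theta>))"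
    proof (intro mult_left_mono add_mono)
      have 1: "t powr - \<theta> * t powr - 1 = t powr (- 1 - \<theta>)" for t :: real
        by (subst powr_add[symmetric]) (simp add: algebra_simps)
      show "y powr - \<theta> * y powr - 1 \<le> y powr (- 1 - \<theta>)" by (simp only: 1 order.refl)
      show "x powr - \<theta> * y powr - 1 \<le> x powr (- 1 - \<theta>) + y powr (- 1 - \<theta>)"
      proof (cases "x \<le> y")
        case True
        then have "x powr - \<theta> * y powr - 1 \<le> x powr - \<theta> * x powr - 1"
          using xy by (intro mult_left_mono powr_mono2') auto
        then show ?thesis unfolding 1 using powr_ge_zero[of y "- 1 - \<theta>"] by linarith
      next
        case False
        then have "x powr - \<theta> * y powr - 1 \<le> y powr - \<theta> * y powr - 1"
          using xy \<theta> by (intro mult_right_mono powr_mono2') auto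
        then show ?thesis unfolding 1 using powr_ge_zero[of x "- 1 - \<theta>"] by linarith
      qed
    qed auto
    finally have "(x powr - \<theta> + y powr - \<theta>) / \<bar>r\<bar> \<le> 2 * x powr (- 1 - \<theta>) + 4 * y powr (- 1 - \<theta>)" by simp
    then have "ennreal ((x powr - \<theta> + y powr - \<theta>) / \<bar>r\<bar>) \<le> ennreal (2 * x powr (- 1 - \<theta>) + 4 * y powr (- 1 - \<theta>))"
      by (rule ennreal_leI)
    also have "\<dots> = ennreal 2 * ennreal (x powr (- 1 - \<theta>)) + ennreal 4 * ennreal (y powr (- 1 - \<theta>))"
      by (subst ennreal_plus) (auto simp: ennreal_mult'[symmetric] simp del: ennreal_numeral)
    finally show ?thesis using True by (simp add: x_def y_def)
  qed simp
  then have "(\<integral>\<^sup>+r. ennreal ((japanese (n + r) powr - \<theta> + japanese r powr - \<theta>) / \<bar>r\<bar>) * indicator {r. 1 \<le> \<bar>r\<bar>} r \<partial>lborel)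
    \<le> (\<integral>\<^sup>+r. ennreal 2 * ennreal (?j (n + 1 * r)) + ennreal 4 * ennreal (?j r) \<partial>lborel)"
    by (intro nn_integral_mono)
  also have "\<dots> = ennreal 2 * (\<integral>\<^sup>+r. ennreal (?j (n + 1 * r)) \<partial>lborel) + ennreal 4 * (\<integral>\<^sup>+r. ennreal (?j r) \<partial>lborel)"
    by (subst nn_integral_add, measurable, measurable) (simp add: nn_integral_cmult del: ennreal_numeral)
  also have "(\<integral>\<^sup>+r. ennreal (?j (n + 1 * r)) \<partial>lborel) = (\<integral>\<^sup>+r. ennreal (?j r) \<partial>lborel)"
    by (subst (2) nn_integral_real_affine[where c=1 and t=n]) auto
  also have "ennreal 2 * (\<integral>\<^sup>+r. ennreal (?j r) \<partial>lborel) + ennreal 4 * (\<integral>\<^sup>+r. ennreal (?j r) \<partial>lborel) = ennreal (6 * kap \<theta>)"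
    unfolding kap[OF \<theta>] using kap_nonneg[of \<theta>] by (simp add: ennreal_mult'[symmetric] ennreal_plus[symmetric] del: ennreal_numeral ennreal_plus)
  finally show ?thesis .
qed

text \<open>The power of 4 comes from \<open>weight_bound\<close>; the regions |r| \<ge> 1 and |p|
  \<ge> 1 contribute equally, hence the leading 2; and 8 is the bound 2 for the sum of weights times
  the area 4 of the central square.\<close>

definition level_const :: "real \<Rightarrow> real \<Rightarrow> real" where
  "level_const T \<theta> = 4 powr \<theta> * (2 * (sqrt (2 * pi) / T / 2 * (6 * kap \<theta>)) + 8)"

lemma half_plane_bound:
  assumes T: "0 < T" and \<theta>: "0 < \<theta>"
  shows "(\<integral>\<^sup>+r. \<integral>\<^sup>+p. ennreal ((japanese (n + r) powr - \<theta> + japanese r powr - \<theta>) * exp (- (T\<^sup>2 / 2) * (C + 2 * p * r)\<^sup>2)) * indicator {r. 1 \<le> \<bar>r\<bar>} r \<partial>lborel \<partial>lborel)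
    \<le> ennreal (sqrt (2 * pi) / T / 2 * (6 * kap \<theta>))"
proof -
  let ?G = "\<lambda>r. japanese (n + r) powr - \<theta> + japanese r powr - \<theta>"
  have "(\<integral>\<^sup>+p. ennreal (?G r * exp (- (T\<^sup>2 / 2) * (C + 2 * p * r)\<^sup>2)) * indicator {r. 1 \<le> \<bar>r\<bar>} r \<partial>lborel)
     = ennreal (sqrt (2 * pi) / T / 2) * (ennreal (?G r / \<bar>r\<bar>) * indicator {r. 1 \<le> \<bar>r\<bar>} r)" for r
  proof (cases "1 \<le> \<bar>r\<bar>")
    case True
    have G0: "0 \<le> ?G r" by (intro add_nonneg_nonneg) auto
    have "(\<integral>\<^sup>+p. ennreal (?G r * exp (- (T\<^sup>2 / 2) * (C + 2 * p * r)\<^sup>2)) * indicator {r. 1 \<le> \<bar>r\<bar>} r \<partial>lborel)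
       = (\<integral>\<^sup>+p. ennreal (?G r) * ennreal (exp (- (T\<^sup>2 / 2) * (C + 2 * p * r)\<^sup>2)) \<partial>lborel)"
      using True by (intro nn_integral_cong) (simp add: ennreal_mult'')
    also have "\<dots> = ennreal (?G r) * ennreal (sqrt (2 * pi) / T / (2 * \<bar>r\<bar>))"
    proof -
      have "r \<noteq> 0" using True by auto
      note g = nn_integral_gaussian_affine[OF T this, of C]
      show ?thesis by (subst nn_integral_cmult, measurable) (simp only: g)
    qed
    also have "\<dots> = ennreal (?G r * (sqrt (2 * pi) / T / (2 * \<bar>r\<bar>)))"
      by (rule ennreal_mult'[OF G0, symmetric])
    also have "?G r * (sqrt (2 * pi) / T / (2 * \<bar>r\<bar>)) = sqrt (2 * pi) / T / 2 * (?G r / \<bar>r\<bar>)"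
      by (simp add: mult_ac)
    also have "ennreal \<dots> = ennreal (sqrt (2 * pi) / T / 2) * ennreal (?G r / \<bar>r\<bar>)"
      using T by (intro ennreal_mult') auto
    finally show ?thesis using True by simp
  qed simp
  then have "(\<integral>\<^sup>+r. \<integral>\<^sup>+p. ennreal (?G r * exp (- (T\<^sup>2 / 2) * (C + 2 * p * r)\<^sup>2)) * indicator {r. 1 \<le> \<bar>r\<bar>} r \<partial>lborel \<partial>lborel)
    = ennreal (sqrt (2 * pi) / T / 2) * (\<integral>\<^sup>+r. ennreal (?G r / \<bar>r\<bar>) * indicator {r. 1 \<le> \<bar>r\<bar>} r \<partial>lborel)"
    by (simp add: nn_integral_cmult)
  also have "\<dots> \<le> ennreal (sqrt (2 * pi) / T / 2) * ennreal (6 * kap \<theta>)"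
    by (intro mult_left_mono tail_bound \<theta>) simp
  also have "\<dots> = ennreal (sqrt (2 * pi) / T / 2 * (6 * kap \<theta>))"
    using T by (intro ennreal_mult'[symmetric]) auto
  finally show ?thesis .
qed

lemma level_set_bound:
  assumes T: "0 < T" and \<theta>: "0 < \<theta>"
  shows "(\<integral>\<^sup>+r. \<integral>\<^sup>+p. ennreal (exp (- (T\<^sup>2 / 2) * (C + 2 * p * r)\<^sup>2) *
        (japanese n / (japanese (n + p) * japanese (n + r) * japanese (n + p + r))) powr \<theta>) \<partial>lborel \<partial>lborel)
    \<le> ennreal (level_const T \<theta>)"
proof -
  let ?W = "\<lambda>p r. (japanese n / (japanese (n + p) * japanese (n + r) * japanese (n + p + r))) powr \<theta>"
  let ?E = "\<lambda>p r. exp (- (T\<^sup>2 / 2) * (C + 2 * p * r)\<^sup>2)"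
  let ?G = "\<lambda>r. japanese (n + r) powr - \<theta> + japanese r powr - \<theta>"
  let ?D = "sqrt (2 * pi) / T / 2 * (6 * kap \<theta>)"
  let ?F1 = "\<lambda>r p. ennreal (?G r * ?E p r) * indicator {r. 1 \<le> \<bar>r\<bar>} r"
  let ?F2 = "\<lambda>r p. ennreal (?G p * ?E r p) * indicator {r. 1 \<le> \<bar>r\<bar>} p"
  let ?F3 = "\<lambda>(r::real) (p::real). 2 * (indicator {-1..1} r * indicator {-1..1} p) :: ennreal"
  have W: "?W p r \<le> 4 powr \<theta> * ?G r" "?W p r \<le> 4 powr \<theta> * ?G p" for p r
    using weight_bound[of \<theta> n p r] weight_bound[of \<theta> n r p] \<theta> by (auto simp: ac_simps)
  have G2: "?G r \<le> 2" for r
  proof -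
    have "japanese x powr - \<theta> \<le> japanese x powr 0" for x
      using japanese_ge1[of x] \<theta> by (intro powr_mono) auto
    from add_mono[OF this[of "n + r"] this[of r]] show ?thesis
      using japanese_pos[of "n + r"] japanese_pos[of r] by simp
  qed
  have D0: "0 \<le> ?D" using T kap_nonneg by simp
  have pw: "ennreal (?E p r * ?W p r) \<le> ennreal (4 powr \<theta>) * (?F1 r p + (?F2 r p + ?F3 r p))" for p r
  proof -
    consider "1 \<le> \<bar>r\<bar>" | "1 \<le> \<bar>p\<bar>" | "\<bar>r\<bar> < 1" "\<bar>p\<bar> < 1" by linarith
    then show ?thesis
    proof cases
      case 1
      have "?E p r * ?W p r \<le> ?E p r * (4 powr \<theta> * ?G r)" by (intro mult_left_mono W) simp
      then have "ennreal (?E p r * ?W p r) \<le> ennreal (4 powr \<theta>) * ennreal (?G r * ?E p r)"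
        by (subst ennreal_mult'[symmetric]) (auto simp: mult_ac intro: ennreal_leI)
      also have "\<dots> \<le> ennreal (4 powr \<theta>) * (?F1 r p + (?F2 r p + ?F3 r p))"
        using 1 by (intro mult_left_mono) (auto intro: add_increasing2)
      finally show ?thesis .
    next
      case 2
      have "?E p r * ?W p r \<le> ?E p r * (4 powr \<theta> * ?G p)" by (intro mult_left_mono W) simp
      then have "ennreal (?E p r * ?W p r) \<le> ennreal (4 powr \<theta>) * ennreal (?G p * ?E r p)"
        by (subst ennreal_mult'[symmetric]) (auto simp: mult_ac intro: ennreal_leI)
      also have "\<dots> \<le> ennreal (4 powr \<theta>) * (?F1 r p + (?F2 r p + ?F3 r p))"
        using 2 by (intro mult_left_mono) (auto intro!: add_increasing add_increasing2)
      finally show ?thesis .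
    next
      case 3
      have "?E p r * ?W p r \<le> 1 * (4 powr \<theta> * 2)"
        by (intro mult_mono order.trans[OF W(1)] mult_left_mono G2) (auto simp: mult_nonneg_nonneg)
      then have "ennreal (?E p r * ?W p r) \<le> ennreal (4 powr \<theta> * 2)" by (intro ennreal_leI) simp
      also have "\<dots> = ennreal (4 powr \<theta>) * 2" by (simp add: ennreal_mult')
      also have "\<dots> \<le> ennreal (4 powr \<theta>) * (?F1 r p + (?F2 r p + ?F3 r p))"
        using 3 by (intro mult_left_mono) (auto simp: indicator_def)
      finally show ?thesis .
    qed
  qed
  have i3: "(\<integral>\<^sup>+r. \<integral>\<^sup>+p. ?F3 r p \<partial>lborel \<partial>lborel) = 8"
  proof -
    have "(\<integral>\<^sup>+p. ?F3 r p \<partial>lborel) = 4 * indicator {-1..1::real} r" for r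
    proof -
      have "(\<integral>\<^sup>+p. ?F3 r p \<partial>lborel) = (\<integral>\<^sup>+p. (2 * indicator {-1..1} r) * indicator {-1..1::real} p \<partial>lborel)"
        by (simp add: mult.assoc)
      also have "\<dots> = (2 * indicator {-1..1} r) * 2" by (subst nn_integral_cmult_indicator) auto
      finally show ?thesis by (simp add: indicator_def split: if_splits)
    qed
    then have "(\<integral>\<^sup>+r. \<integral>\<^sup>+p. ?F3 r p \<partial>lborel \<partial>lborel) = (\<integral>\<^sup>+r. 4 * indicator {-1..1::real} r \<partial>lborel)" by simp
    also have "\<dots> = 8" by (subst nn_integral_cmult_indicator) auto
    finally show ?thesis .
  qed
  \<comment> \<open>\<open>?F2 r p\<close> equals \<open>?F1 p r\<close>, so the symmetry in p and r
    is an application of Fubini.\<close>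
  have i2: "(\<integral>\<^sup>+r. \<integral>\<^sup>+p. ?F2 r p \<partial>lborel \<partial>lborel) = (\<integral>\<^sup>+r. \<integral>\<^sup>+p. ?F1 r p \<partial>lborel \<partial>lborel)"
    by (rule pair_sigma_finite.Fubini'[OF lborel2_pair_sigma_finite]) measurable
  have "(\<integral>\<^sup>+r. \<integral>\<^sup>+p. ennreal (?E p r * ?W p r) \<partial>lborel \<partial>lborel) \<le> (\<integral>\<^sup>+r. \<integral>\<^sup>+p. ennreal (4 powr \<theta>) * (?F1 r p + (?F2 r p + ?F3 r p)) \<partial>lborel \<partial>lborel)"
    by (intro nn_integral_mono pw)
  also have "\<dots> = ennreal (4 powr \<theta>) * ((\<integral>\<^sup>+r. \<integral>\<^sup>+p. ?F1 r p \<partial>lborel \<partial>lborel) + ((\<integral>\<^sup>+r. \<integral>\<^sup>+p. ?F2 r p \<partial>lborel \<partial>lborel) + (\<integral>\<^sup>+r. \<integral>\<^sup>+p. ?F3 r p \<partial>lborel \<partial>lborel)))"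
    by (simp add: nn_integral_cmult nn_integral_add)
  also have "\<dots> \<le> ennreal (4 powr \<theta>) * (ennreal ?D + (ennreal ?D + 8))"
    unfolding i3 i2 by (intro mult_left_mono add_mono half_plane_bound T \<theta>) auto
  also have "\<dots> = ennreal (level_const T \<theta>)"
  proof -
    have "ennreal ?D + (ennreal ?D + 8) = ennreal (2 * ?D + 8)"
      using D0 by (simp add: ennreal_plus[symmetric] del: ennreal_plus flip: ennreal_numeral)
    then show ?thesis unfolding level_const_def by (simp add: ennreal_mult')
  qed
  finally show ?thesis .
qed

subsection \<open>Sobolev weights\<close>

definition jw :: "real \<Rightarrow> 'i set \<Rightarrow> ('i \<Rightarrow> real) \<Rightarrow> real" where
  "jw \<epsilon> I q = (\<Prod>i\<in>I. japanese (q i) powr \<epsilon>)"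

lemma jw_nonneg: "0 \<le> jw \<epsilon> I q"
  unfolding jw_def by (intro prod_nonneg) auto

lemma jw_ge1: "0 \<le> \<epsilon> \<Longrightarrow> 1 \<le> jw \<epsilon> I q"
  unfolding jw_def by (intro prod_ge_1) (auto simp: japanese_ge1 ge_one_powr_ge_zero)

lemma seqcont_jw: "seqcont I (\<lambda>q. complex_of_real (jw \<epsilon> I q))"
proof -
  have "isCont (\<lambda>t. complex_of_real (japanese t powr \<epsilon>)) y" for y
    using japanese_pos[of y] by (intro continuous_intros isCont_japanese) auto
  then have "seqcont I (\<lambda>q. \<Prod>i\<in>I. complex_of_real (japanese (q i) powr \<epsilon>))"
    by (intro seqcont_prod seqcont_compose[OF seqcont_coord, where g="\<lambda>t. complex_of_real (japanese t powr \<epsilon>)"])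
  then show ?thesis by (simp add: jw_def)
qed

lemma jw_measurable [measurable]: "jw \<epsilon> (I :: 'i::countable set) \<in> borel_measurable (leb I)"
  using measurable_compose[OF seqcont_measurable[OF seqcont_jw[of I \<epsilon>]] borel_measurable_Re] by simp

lemma jw_growth:
  assumes I: "finite I" and \<epsilon>: "0 \<le> \<epsilon>"
  shows "\<exists>M. \<forall>q. jw \<epsilon> I q \<le> wgt I q ^ M"
proof (intro exI allI)
  fix q
  have "jw \<epsilon> I q \<le> (\<Prod>i\<in>I. wgt I q powr \<epsilon>)"
    unfolding jw_def
  proof (intro prod_mono conjI powr_mono2 \<epsilon>)
    fix i assume "i \<in> I"
    then have "1 + (q i)\<^sup>2 \<le> wgt I q" by (rule coord_le_wgt[OF I])
    moreover have "sqrt (1 + (q i)\<^sup>2) \<le> 1 + (q i)\<^sup>2"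
      by (intro real_le_lsqrt self_le_power) auto
    ultimately show "japanese (q i) \<le> wgt I q" by (simp add: japanese_def)
  qed (auto simp: less_imp_le[OF japanese_pos])
  also have "\<dots> = wgt I q powr (\<epsilon> * card I)"
    by (simp add: powr_powr[symmetric] powr_realpow)
  also have "\<dots> \<le> wgt I q powr real (nat \<lceil>\<epsilon> * card I\<rceil>)"
    using wgt_ge1[of I q] by (intro powr_mono) linarith+
  also have "\<dots> = wgt I q ^ nat \<lceil>\<epsilon> * card I\<rceil>" by (simp add: powr_realpow)
  finally show "jw \<epsilon> I q \<le> wgt I q ^ nat \<lceil>\<epsilon> * card I\<rceil>" .
qed

lemma nice_jw_mult:
  fixes f :: "('i::countable \<Rightarrow> real) \<Rightarrow> complex"
  assumes I: "finite I" and \<epsilon>: "0 \<le> \<epsilon>" and f: "rapid I f" "seqcont I f"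
  shows "nice I (\<lambda>q. of_real (jw \<epsilon> I q) * f q)"
proof (rule rapid_nice[OF I])
  obtain M where M: "\<And>q. jw \<epsilon> I q \<le> wgt I q ^ M" using jw_growth[OF I \<epsilon>] by blast
  show "rapid I (\<lambda>q. of_real (jw \<epsilon> I q) * f q)"
    by (rule rapid_poly_bound[OF f(1), where B=1 and M=M])
       (auto simp: norm_mult jw_nonneg intro!: mult_right_mono M)
  show "seqcont I (\<lambda>q. of_real (jw \<epsilon> I q) * f q)"
    by (intro seqcont_mult seqcont_jw f)
qed

definition quad :: "'i set \<Rightarrow> ('i \<Rightarrow> real) \<Rightarrow> ('i \<Rightarrow> real) \<Rightarrow> real" where
  "quad I \<sigma> x = (\<Sum>i\<in>I. \<sigma> i * (x i)\<^sup>2)"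

lemma quad_measurable [measurable]: "quad I \<sigma> \<in> borel_measurable (leb I)"
  unfolding quad_def[abs_def]
  by (intro borel_measurable_sum borel_measurable_times borel_measurable_const borel_measurable_power leb_component_measurable)

lemma sch_propagate: "finite I \<Longrightarrow> sch I h \<Longrightarrow> sch I (\<lambda>x. cis (\<tau> * quad I \<sigma> x) * h x)"
  using sch_unimodular_quadratic[of I h "\<lambda>i. \<tau> * \<sigma> i"]
  by (simp add: quad_def sum_distrib_left mult.assoc)

text \<open>The prefactor of the Schur test times the level-set constant. The exponent is 2
  \<epsilon> because the Schur condition contains the square of the weight.\<close>

definition coll_const :: "real \<Rightarrow> real \<Rightarrow> real" where
  "coll_const T \<epsilon> = exp (1 / 2) * (T * sqrt (2 * pi)) * level_const T (2 * \<epsilon>)"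

lemma level_const_nonneg: "0 < T \<Longrightarrow> 0 \<le> level_const T \<theta>"
  unfolding level_const_def using kap_nonneg[of \<theta>] by (intro mult_nonneg_nonneg add_nonneg_nonneg) auto

lemma coll_const_nonneg: "0 < T \<Longrightarrow> 0 \<le> coll_const T \<epsilon>"
  unfolding coll_const_def using level_const_nonneg by simp

lemma weight_power:
  fixes x a b g :: real
  assumes "0 < x" "0 < a" "0 < b" "0 < g"
  shows "(x / (a * b * g)) powr (2 * \<epsilon>) = 1 / (a powr \<epsilon> * b powr \<epsilon> * g powr \<epsilon> / x powr \<epsilon>)\<^sup>2"
proof -
  have "(x / (a * b * g)) powr (2 * \<epsilon>) = ((x / (a * b * g)) powr \<epsilon>)\<^sup>2"
    by (simp add: power2_eq_square flip: powr_add)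
  also have "(x / (a * b * g)) powr \<epsilon> = x powr \<epsilon> / (a powr \<epsilon> * b powr \<epsilon> * g powr \<epsilon>)"
    using assms by (simp add: powr_divide powr_mult)
  finally show ?thesis by (simp add: power_divide)
qed

context contraction
begin

text \<open>The terms depending on q alone cancel in the difference, and the sign
  \<open>\<sigma> c\<close> disappears on squaring. Hence both contractions, whose signs are
  opposite, lead to the same kernel.\<close>

lemma phase_diff:
  assumes "\<sigma> d = \<sigma> c" "\<sigma> e = - \<sigma> c" "(\<sigma> c)\<^sup>2 = 1"
  shows "(quad J \<sigma> (shear (q, z)) - quad J \<sigma> (shear (q, z')))\<^sup>2 =
    (2 * ((fst z + snd z) * (fst z - q c)) + 2 * ((- fst z' - snd z') * (fst z' - q c)))\<^sup>2"
proof -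
  have Q: "quad J \<sigma> (shear (q, z)) = \<sigma> c * ((q c)\<^sup>2 + 2 * ((fst z + snd z) * (fst z - q c))) + (\<Sum>i\<in>I - {c}. \<sigma> i * (q i)\<^sup>2)" for z
    using sum_J_shear[of "\<lambda>i t. \<sigma> i * t\<^sup>2" q z] assms
    by (simp add: quad_def power2_eq_square algebra_simps)
  have "quad J \<sigma> (shear (q, z)) - quad J \<sigma> (shear (q, z')) =
    \<sigma> c * (2 * ((fst z + snd z) * (fst z - q c)) + 2 * ((- fst z' - snd z') * (fst z' - q c)))"
    unfolding Q by (simp add: algebra_simps)
  then show ?thesis using assms(3) by (simp add: power_mult_distrib)
qed

text \<open>The substitution \<open>fst z = n + r\<close>, \<open>snd z = - (n + r) - p\<close> has
  unit Jacobian and, \<open>japanese\<close> being even, turns the integrand into that of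
  \<open>level_set_bound\<close>.\<close>

lemma coll_schur_kernel:
  assumes T: "0 < T" and \<epsilon>: "0 < \<epsilon>"
  shows "(\<integral>\<^sup>+z. ennreal (exp (- (T\<^sup>2 / 2) * (C + 2 * ((- fst z - snd z) * (fst z - n)))\<^sup>2) /
       (japanese (n - fst z - snd z) powr \<epsilon> * japanese (fst z) powr \<epsilon> * japanese (snd z) powr \<epsilon> / japanese n powr \<epsilon>)\<^sup>2) \<partial>lborel2)
    \<le> ennreal (level_const T (2 * \<epsilon>))"
proof -
  let ?F = "\<lambda>z. ennreal (exp (- (T\<^sup>2 / 2) * (C + 2 * ((- fst z - snd z) * (fst z - n)))\<^sup>2) /
       (japanese (n - fst z - snd z) powr \<epsilon> * japanese (fst z) powr \<epsilon> * japanese (snd z) powr \<epsilon> / japanese n powr \<epsilon>)\<^sup>2)"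
  have F: "?F (n + 1 * r, - (n + 1 * r) + (- 1) * p) = ennreal (exp (- (T\<^sup>2 / 2) * (C + 2 * p * r)\<^sup>2) *
        (japanese n / (japanese (n + p) * japanese (n + r) * japanese (n + p + r))) powr (2 * \<epsilon>))" for p r
  proof -
    have 1: "japanese (- n - (p + r)) = japanese (n + (p + r))"
      using japanese_minus[of "n + (p + r)"] by (simp add: algebra_simps)
    show ?thesis
      by (simp only: fst_conv snd_conv weight_power[OF japanese_pos japanese_pos japanese_pos japanese_pos])
         (simp add: 1 algebra_simps)
  qed
  have Fm: "?F \<in> borel_measurable lborel2" by measurable
  have "(\<integral>\<^sup>+z. ?F z \<partial>lborel2) = (\<integral>\<^sup>+a. \<integral>\<^sup>+b. ?F (a, b) \<partial>lborel \<partial>lborel)"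
    by (rule lborel.nn_integral_fst[OF Fm, symmetric])
  also have "\<dots> = (\<integral>\<^sup>+a. \<integral>\<^sup>+p. ?F (a, - a + (- 1) * p) \<partial>lborel \<partial>lborel)"
  proof (rule nn_integral_cong)
    fix a :: real
    have "(\<lambda>b. (a, b)) \<in> borel \<rightarrow>\<^sub>M lborel2" by measurable
    from measurable_compose[OF this Fm]
    have "(\<lambda>b. ?F (a, b)) \<in> borel_measurable borel" .
    from nn_integral_real_affine[OF this, of "- 1" "- a"]
    show "(\<integral>\<^sup>+b. ?F (a, b) \<partial>lborel) = (\<integral>\<^sup>+p. ?F (a, - a + (- 1) * p) \<partial>lborel)" by simp
  qed
  also have "\<dots> = (\<integral>\<^sup>+r. \<integral>\<^sup>+p. ?F (n + 1 * r, - (n + 1 * r) + (- 1) * p) \<partial>lborel \<partial>lborel)"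
  proof -
    have "(\<lambda>w. (fst w, - fst w + (- 1) * snd w)) \<in> borel \<Otimes>\<^sub>M lborel \<rightarrow>\<^sub>M lborel2"
      by measurable
    from measurable_compose[OF this Fm]
    have "(\<lambda>(a, p). ?F (a, - a + (- 1) * p)) \<in> borel_measurable (borel \<Otimes>\<^sub>M lborel)"
      unfolding split_def .
    from lborel.borel_measurable_nn_integral[OF this]
    have "(\<lambda>a. \<integral>\<^sup>+p. ?F (a, - a + (- 1) * p) \<partial>lborel) \<in> borel_measurable borel" .
    from nn_integral_real_affine[OF this, of 1 n] show ?thesis
      by (simp only: abs_one ennreal_1 mult_1 zero_neq_one[symmetric] not_False_eq_True simp_thms)
  qed
  also have "\<dots> \<le> ennreal (level_const T (2 * \<epsilon>))"
    unfolding F by (rule level_set_bound) (use T \<epsilon> in auto)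
  finally show ?thesis .
qed

lemma coll_propagate_measurable:
  assumes [measurable]: "h \<in> borel_measurable (leb J)"
  shows "(\<lambda>(\<tau>, q). coll (\<lambda>x. cis (\<tau> * quad J \<sigma> x) * h x) q) \<in> borel_measurable (lborel \<Otimes>\<^sub>M leb I)"
proof -
  have s [measurable]: "(\<lambda>w. shear (snd (fst w), snd w)) \<in> (lborel \<Otimes>\<^sub>M leb I) \<Otimes>\<^sub>M lborel2 \<rightarrow>\<^sub>M leb J"
    by (rule measurable_compose[OF _ shear_measurable]) measurable
  have [measurable]: "(\<lambda>w. quad J \<sigma> (shear (snd (fst w), snd w))) \<in> borel_measurable ((lborel \<Otimes>\<^sub>M leb I) \<Otimes>\<^sub>M lborel2)"
    "(\<lambda>w. h (shear (snd (fst w), snd w))) \<in> borel_measurable ((lborel \<Otimes>\<^sub>M leb I) \<Otimes>\<^sub>M lborel2)"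
    by (rule measurable_compose[OF s], measurable)+
  have "(\<lambda>w. cis (fst (fst w) * quad J \<sigma> (shear (snd (fst w), snd w))) * h (shear (snd (fst w), snd w)))
     \<in> borel_measurable ((lborel \<Otimes>\<^sub>M leb I) \<Otimes>\<^sub>M lborel2)" by measurable
  then have "(\<lambda>(v, z). cis (fst v * quad J \<sigma> (shear (snd v, z))) * h (shear (snd v, z)))
     \<in> borel_measurable ((lborel \<Otimes>\<^sub>M leb I) \<Otimes>\<^sub>M lborel2)" by (simp add: split_def)
  from sigma_finite_measure.borel_measurable_lebesgue_integral[OF sigma_finite_lborel2 this]
  show ?thesis unfolding coll_def by (simp add: split_def)
qed

text \<open>For fixed q the fibre integral falls under the Schur test, with m the product of the
  weights of the three contracted frequencies divided by that of \<open>q c\<close>. Integration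
  over q then reassembles the fibres, because the shear preserves measure.\<close>

theorem coll_estimate:
  assumes T: "0 < T" and \<epsilon>: "0 < \<epsilon>" and h: "rapid J h" and hm [measurable]: "h \<in> borel_measurable (leb J)"
    and \<sigma>: "\<sigma> d = \<sigma> c" "\<sigma> e = - \<sigma> c" "(\<sigma> c)\<^sup>2 = 1"
  shows "(\<integral>\<^sup>+\<tau>. (\<integral>\<^sup>+q. (ennreal (jw \<epsilon> I q * norm (coll (\<lambda>x. cis (\<tau> * quad J \<sigma> x) * h x) q)))\<^sup>2 \<partial>leb I) * indicator {0..T} \<tau> \<partial>lborel)
    \<le> ennreal (coll_const T \<epsilon>) * (\<integral>\<^sup>+x. (ennreal (jw \<epsilon> J x * norm (h x)))\<^sup>2 \<partial>leb J)"
proof -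
  let ?A = "\<lambda>\<tau> q. coll (\<lambda>x. cis (\<tau> * quad J \<sigma> x) * h x) q"
  define c1 where "c1 = exp (1 / 2) * (T * sqrt (2 * pi))"
  have c1: "0 \<le> c1" using T by (simp add: c1_def)
  have pair: "pair_sigma_finite (leb I) (lborel :: real measure)"
    by (simp add: pair_sigma_finite_def leb_sigma_finite I sigma_finite_lborel)
  note Am [measurable] = coll_propagate_measurable[OF hm, of \<sigma>]
  have Am': "(\<lambda>(q, \<tau>). ?A \<tau> q) \<in> borel_measurable (leb I \<Otimes>\<^sub>M lborel)"
    using measurable_compose[OF measurable_pair_swap' Am] by (simp add: split_def)
  have fib: "(\<integral>\<^sup>+\<tau>. (ennreal (jw \<epsilon> I q * norm (?A \<tau> q)))\<^sup>2 * indicator {0..T} \<tau> \<partial>lborel) \<le>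
     ennreal (coll_const T \<epsilon>) * (\<integral>\<^sup>+z. (ennreal (jw \<epsilon> J (shear (q, z)) * norm (h (shear (q, z)))))\<^sup>2 \<partial>lborel2)"
    if q: "q \<in> space (leb I)" for q
  proof -
    note sm [measurable] = shear_measurable2[OF q]
    define m where "m z = japanese (q c - fst z - snd z) powr \<epsilon> * japanese (fst z) powr \<epsilon> * japanese (snd z) powr \<epsilon> / japanese (q c) powr \<epsilon>" for z :: "real \<times> real"
    have mpos: "0 < m z" for z 
      unfolding m_def using less_imp_neq[OF japanese_pos, THEN not_sym] by (intro divide_pos_pos mult_pos_pos) auto
    have Pm [measurable]: "(\<lambda>z. quad J \<sigma> (shear (q, z))) \<in> borel_measurable lborel2"
      by (rule measurable_compose[OF sm]) measurable
    have Hm [measurable]: "(\<lambda>z. h (shear (q, z))) \<in> borel_measurable lborel2"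
      by (rule measurable_compose[OF sm]) measurable
    have mm [measurable]: "m \<in> borel_measurable lborel2" unfolding m_def by measurable
    have K: "(\<integral>\<^sup>+z'. ennreal (exp (- (T\<^sup>2 / 2) * (quad J \<sigma> (shear (q, z)) - quad J \<sigma> (shear (q, z')))\<^sup>2) / (m z')\<^sup>2) \<partial>lborel2)
      \<le> ennreal (level_const T (2 * \<epsilon>))" for z
      unfolding phase_diff[OF \<sigma>] m_def by (rule coll_schur_kernel[OF T \<epsilon>])
    have S: "(\<integral>\<^sup>+\<tau>. (ennreal (norm (\<integral>z. cis (\<tau> * quad J \<sigma> (shear (q, z))) * h (shear (q, z)) \<partial>lborel2)))\<^sup>2 * indicator {0..T} \<tau> \<partial>lborel)
      \<le> ennreal c1 * (ennreal (level_const T (2 * \<epsilon>)) * (\<integral>\<^sup>+z. ennreal ((norm (h (shear (q, z))) * m z)\<^sup>2) \<partial>lborel2))"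
      unfolding c1_def
      by (rule schur_oscillatory[OF sigma_finite_lborel2 T shear_integrable[OF h hm] Pm mm mpos K])
         (use q in \<open>simp add: space_leb\<close>)
    \<comment> \<open>Variables other than c enter both weights with the same factor; therefore the
      constant is independent of the number of variables.\<close>
    have jwm: "jw \<epsilon> I q * m z = jw \<epsilon> J (shear (q, z))" for z
    proof -
      have "jw \<epsilon> I q = japanese (q c) powr \<epsilon> * (\<Prod>i\<in>I - {c}. japanese (q i) powr \<epsilon>)"
        using I c by (simp add: jw_def prod.remove)
      moreover have "jw \<epsilon> J (shear (q, z)) = japanese (fst z) powr \<epsilon> * japanese (snd z) powr \<epsilon> * japanese (q c - fst z - snd z) powr \<epsilon> * (\<Prod>i\<in>I - {c}. japanese (q i) powr \<epsilon>)"
        unfolding jw_def using prod_J_shear[of "\<lambda>i t. japanese t powr \<epsilon>" q z] by simp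
      ultimately show ?thesis using japanese_pos[of "q c"] by (simp add: m_def)
    qed
    have "(\<integral>\<^sup>+\<tau>. (ennreal (jw \<epsilon> I q * norm (?A \<tau> q)))\<^sup>2 * indicator {0..T} \<tau> \<partial>lborel) =
      (\<integral>\<^sup>+\<tau>. (ennreal (jw \<epsilon> I q))\<^sup>2 * ((ennreal (norm (?A \<tau> q)))\<^sup>2 * indicator {0..T} \<tau>) \<partial>lborel)"
      by (intro nn_integral_cong) (simp add: ennreal_mult' jw_nonneg power_mult_distrib mult.assoc)
    also have "\<dots> = (ennreal (jw \<epsilon> I q))\<^sup>2 * (\<integral>\<^sup>+\<tau>. (ennreal (norm (?A \<tau> q)))\<^sup>2 * indicator {0..T} \<tau> \<partial>lborel)"
    proof (rule nn_integral_cmult)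
      have "(\<lambda>\<tau>. ?A \<tau> q) \<in> borel_measurable lborel" using measurable_Pair2[OF Am' q] by simp
      then show "(\<lambda>\<tau>. (ennreal (norm (?A \<tau> q)))\<^sup>2 * indicator {0..T} \<tau>) \<in> borel_measurable lborel" by measurable
    qed
    also have "\<dots> \<le> (ennreal (jw \<epsilon> I q))\<^sup>2 * (ennreal c1 * (ennreal (level_const T (2 * \<epsilon>)) * (\<integral>\<^sup>+z. ennreal ((norm (h (shear (q, z))) * m z)\<^sup>2) \<partial>lborel2)))"
      using S unfolding coll_def by (intro mult_left_mono) auto
    also have "\<dots> = ennreal (coll_const T \<epsilon>) * ((ennreal (jw \<epsilon> I q))\<^sup>2 * (\<integral>\<^sup>+z. ennreal ((norm (h (shear (q, z))) * m z)\<^sup>2) \<partial>lborel2))"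
    proof -
      have "ennreal (coll_const T \<epsilon>) = ennreal c1 * ennreal (level_const T (2 * \<epsilon>))"
        by (simp only: coll_const_def c1_def[symmetric] ennreal_mult'[OF c1])
      then show ?thesis by (simp only: mult_ac)
    qed
    also have "(ennreal (jw \<epsilon> I q))\<^sup>2 * (\<integral>\<^sup>+z. ennreal ((norm (h (shear (q, z))) * m z)\<^sup>2) \<partial>lborel2) =
        (\<integral>\<^sup>+z. (ennreal (jw \<epsilon> I q))\<^sup>2 * ennreal ((norm (h (shear (q, z))) * m z)\<^sup>2) \<partial>lborel2)"
      by (rule nn_integral_cmult[symmetric]) measurable
    also have "\<dots> = (\<integral>\<^sup>+z. (ennreal (jw \<epsilon> J (shear (q, z)) * norm (h (shear (q, z)))))\<^sup>2 \<partial>lborel2)"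
    proof (rule nn_integral_cong)
      fix z :: "real \<times> real"
      show "(ennreal (jw \<epsilon> I q))\<^sup>2 * ennreal ((norm (h (shear (q, z))) * m z)\<^sup>2) = (ennreal (jw \<epsilon> J (shear (q, z)) * norm (h (shear (q, z)))))\<^sup>2"
        using jw_nonneg[of \<epsilon> I q] mpos[of z] unfolding jwm[symmetric]
        by (simp add: ennreal_power ennreal_mult'[symmetric] power_mult_distrib mult_ac less_imp_le)
    qed
    finally show ?thesis .
  qed
  have "(\<integral>\<^sup>+\<tau>. (\<integral>\<^sup>+q. (ennreal (jw \<epsilon> I q * norm (?A \<tau> q)))\<^sup>2 \<partial>leb I) * indicator {0..T} \<tau> \<partial>lborel) =
     (\<integral>\<^sup>+\<tau>. \<integral>\<^sup>+q. (ennreal (jw \<epsilon> I q * norm (?A \<tau> q)))\<^sup>2 * indicator {0..T} \<tau> \<partial>leb I \<partial>lborel)"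
  proof (intro nn_integral_cong nn_integral_multc[symmetric])
    fix \<tau> :: real
    have "(\<lambda>q. ?A \<tau> q) \<in> borel_measurable (leb I)" using measurable_Pair2[OF Am, of \<tau>] by simp
    then show "(\<lambda>q. (ennreal (jw \<epsilon> I q * norm (?A \<tau> q)))\<^sup>2) \<in> borel_measurable (leb I)" by measurable
  qed
  also have "\<dots> = (\<integral>\<^sup>+q. \<integral>\<^sup>+\<tau>. (ennreal (jw \<epsilon> I q * norm (?A \<tau> q)))\<^sup>2 * indicator {0..T} \<tau> \<partial>lborel \<partial>leb I)"
  proof (rule pair_sigma_finite.Fubini'[OF pair])
    note [measurable] = Am'
    show "(\<lambda>(q, \<tau>). (ennreal (jw \<epsilon> I q * norm (?A \<tau> q)))\<^sup>2 * indicator {0..T} \<tau>) \<in> borel_measurable (leb I \<Otimes>\<^sub>M lborel)"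
      by measurable
  qed
  also have "\<dots> \<le> (\<integral>\<^sup>+q. ennreal (coll_const T \<epsilon>) * (\<integral>\<^sup>+z. (ennreal (jw \<epsilon> J (shear (q, z)) * norm (h (shear (q, z)))))\<^sup>2 \<partial>lborel2) \<partial>leb I)"
    by (intro nn_integral_mono fib)
  also have "\<dots> = ennreal (coll_const T \<epsilon>) * (\<integral>\<^sup>+q. (\<integral>\<^sup>+z. (ennreal (jw \<epsilon> J (shear (q, z)) * norm (h (shear (q, z)))))\<^sup>2 \<partial>lborel2) \<partial>leb I)"
  proof (rule nn_integral_cmult)
    have m: "(\<lambda>x. (ennreal (jw \<epsilon> J x * norm (h x)))\<^sup>2) \<in> borel_measurable (leb J)" by measurable
    show "(\<lambda>q. \<integral>\<^sup>+z. (ennreal (jw \<epsilon> J (shear (q, z)) * norm (h (shear (q, z)))))\<^sup>2 \<partial>lborel2) \<in> borel_measurable (leb I)"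
      by (rule sigma_finite_measure.borel_measurable_nn_integral[OF sigma_finite_lborel2])
         (use measurable_compose[OF shear_measurable m] in \<open>simp add: split_def\<close>)
  qed
  also have "(\<integral>\<^sup>+q. (\<integral>\<^sup>+z. (ennreal (jw \<epsilon> J (shear (q, z)) * norm (h (shear (q, z)))))\<^sup>2 \<partial>lborel2) \<partial>leb I) = (\<integral>\<^sup>+x. (ennreal (jw \<epsilon> J x * norm (h x)))\<^sup>2 \<partial>leb J)"
    by (rule nn_integral_shear) measurable
  finally show ?thesis .
qed

end

section \<open>Transfer to kernels of particle configurations\<close>

subsection \<open>Particle configurations as functions on one index set\<close>

text \<open>Primed and unprimed variables share one index set, so that the transform in all
  variables is a single transform on a finite product.\<close>

definition idx :: "nat \<Rightarrow> (nat + nat) set" where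
  "idx n = {1..n} <+> {1..n}"

definition pack :: "nat \<Rightarrow> point \<Rightarrow> nat + nat \<Rightarrow> real" where
  "pack n p = (\<lambda>c\<in>idx n. coord c p)"

definition unpack :: "nat \<Rightarrow> (nat + nat \<Rightarrow> real) \<Rightarrow> point" where
  "unpack n x = (\<lambda>i\<in>{1..n}. x (Inl i), \<lambda>i\<in>{1..n}. x (Inr i))"

lemma finite_idx: "finite (idx n)"
  by (simp add: idx_def)

lemma card_idx: "card (idx n) = 2 * n"
  by (simp add: idx_def card_Plus)

lemma idx_simps: "Inl i \<in> idx n \<longleftrightarrow> i \<in> {1..n}" "Inr i \<in> idx n \<longleftrightarrow> i \<in> {1..n}"
  by (auto simp: idx_def)

lemma space_config: "space (config n) = extensional {1..n} \<times> extensional {1..n}"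
  by (simp add: config_def space_pair_measure space_leb)

lemma unpack_space: "unpack n x \<in> space (config n)"
  by (auto simp: unpack_def space_config)

lemma pack_extensional: "pack n p \<in> extensional (idx n)"
  by (simp add: pack_def)

lemma unpack_pack: "p \<in> space (config n) \<Longrightarrow> unpack n (pack n p) = p"
  by (cases p) (auto simp: unpack_def pack_def space_config idx_simps fun_eq_iff extensional_def)

lemma coord_unpack: "c \<in> idx n \<Longrightarrow> coord c (unpack n x) = x c"
  by (cases c) (auto simp: unpack_def idx_simps)

lemma upd_unpack: "c \<in> idx n \<Longrightarrow> upd c t (unpack n x) = unpack n (x(c := t))"
  by (cases c) (auto simp: unpack_def idx_simps fun_eq_iff)

lemma pack_upd: "c \<in> idx n \<Longrightarrow> pack n (upd c t p) = (pack n p)(c := t)"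
proof -
  assume c: "c \<in> idx n"
  obtain y y' where p: "p = (y, y')" by fastforce
  have "coord a (upd c t p) = (if a = c then t else coord a p)" for a
    unfolding p by (cases a; cases c) auto
  then show ?thesis using c by (auto simp: pack_def)
qed

lemma upd_space: "c \<in> idx n \<Longrightarrow> p \<in> space (config n) \<Longrightarrow> upd c t p \<in> space (config n)"
  by (metis upd_unpack unpack_pack unpack_space)

lemma pack_measurable [measurable]: "pack n \<in> config n \<rightarrow>\<^sub>M leb (idx n)"
  unfolding pack_def
proof (rule measurable_restrict)
  fix c assume c: "c \<in> idx n"
  show "coord c \<in> config n \<rightarrow>\<^sub>M lborel"
  proof (cases c)
    case (Inl i)
    then have "(\<lambda>p. fst p i) \<in> borel_measurable (config n)"
      using c unfolding config_def by (intro measurable_compose[OF measurable_fst leb_component_measurable]) (auto simp: idx_simps)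
    moreover have "coord c = (\<lambda>p. fst p i)" unfolding Inl by (rule ext) (case_tac p, simp)
    ultimately show ?thesis by simp
  next
    case (Inr i)
    then have "(\<lambda>p. snd p i) \<in> borel_measurable (config n)"
      using c unfolding config_def by (intro measurable_compose[OF measurable_snd leb_component_measurable]) (auto simp: idx_simps)
    moreover have "coord c = (\<lambda>p. snd p i)" unfolding Inr by (rule ext) (case_tac p, simp)
    ultimately show ?thesis by simp
  qed
qed

lemma unpack_measurable [measurable]: "unpack n \<in> leb (idx n) \<rightarrow>\<^sub>M config n"
  unfolding unpack_def config_def
  by (intro measurable_Pair measurable_restrict) (auto simp: leb_component_measurable idx_simps)

lemma distr_pack: "distr (config n) (leb (idx n)) (pack n) = leb (idx n)"
proof (rule leb.PiM_eqI[OF finite_idx])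
  interpret L: sigma_finite_measure "leb {1..n}" by (rule leb_sigma_finite) simp
  fix A :: "nat + nat \<Rightarrow> real set" assume A: "\<And>i. i \<in> idx n \<Longrightarrow> A i \<in> sets lborel"
  let ?l = "Pi\<^sub>E {1..n} (\<lambda>i. A (Inl i))" and ?r = "Pi\<^sub>E {1..n} (\<lambda>i. A (Inr i))"
  have lr: "?l \<in> sets (leb {1..n})" "?r \<in> sets (leb {1..n})"
    using A by (auto intro!: sets_PiM_I_finite simp: idx_simps)
  have "pack n -` Pi\<^sub>E (idx n) A \<inter> space (config n) = ?l \<times> ?r"
  proof (intro set_eqI)
    fix p :: point
    obtain y y' where p: "p = (y, y')" by fastforce
    have "p \<in> pack n -` Pi\<^sub>E (idx n) A \<longleftrightarrow> (\<forall>c\<in>idx n. coord c p \<in> A c)"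
      by (auto simp: pack_def PiE_iff)
    also have "\<dots> \<longleftrightarrow> (\<forall>i\<in>{1..n}. y i \<in> A (Inl i)) \<and> (\<forall>i\<in>{1..n}. y' i \<in> A (Inr i))"
      unfolding p idx_def by (simp add: Plus_def ball_Un)
    finally show "p \<in> pack n -` Pi\<^sub>E (idx n) A \<inter> space (config n) \<longleftrightarrow> p \<in> ?l \<times> ?r"
      unfolding p by (auto simp: space_config PiE_iff)
  qed
  moreover have "Pi\<^sub>E (idx n) A \<in> sets (leb (idx n))" using A by (intro sets_PiM_I_finite finite_idx) auto
  ultimately have "emeasure (distr (config n) (leb (idx n)) (pack n)) (Pi\<^sub>E (idx n) A) = emeasure (config n) (?l \<times> ?r)"
    by (simp add: emeasure_distr)
  also have "\<dots> = emeasure (leb {1..n}) ?l * emeasure (leb {1..n}) ?r"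
    unfolding config_def using lr by (rule L.emeasure_pair_measure_Times)
  also have "\<dots> = (\<Prod>i\<in>{1..n}. emeasure lborel (A (Inl i))) * (\<Prod>i\<in>{1..n}. emeasure lborel (A (Inr i)))"
    using A by (subst (1 2) leb.emeasure_PiM) (auto simp: idx_simps)
  also have "\<dots> = (\<Prod>i\<in>idx n. emeasure lborel (A i))"
    by (simp add: idx_def prod.Plus)
  finally show "emeasure (distr (config n) (leb (idx n)) (pack n)) (Pi\<^sub>E (idx n) A) = (\<Prod>i\<in>idx n. emeasure lborel (A i))" .
qed simp

lemma distr_unpack: "distr (leb (idx n)) (config n) (unpack n) = config n"
proof -
  have "distr (leb (idx n)) (config n) (unpack n) = distr (config n) (config n) (unpack n \<circ> pack n)"
    by (subst distr_pack[symmetric], subst distr_distr) auto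
  also have "\<dots> = distr (config n) (config n) (\<lambda>x. x)"
    by (rule distr_cong) (auto simp: unpack_pack)
  finally show ?thesis by simp
qed

lemma config_measurable_iff: "f \<in> borel_measurable (config n) \<longleftrightarrow> (\<lambda>x. f (unpack n x)) \<in> borel_measurable (leb (idx n))"
proof
  assume "(\<lambda>x. f (unpack n x)) \<in> borel_measurable (leb (idx n))"
  from measurable_compose[OF pack_measurable this]
  have "(\<lambda>p. f (unpack n (pack n p))) \<in> borel_measurable (config n)" .
  then show "f \<in> borel_measurable (config n)"
    by (subst (asm) measurable_cong[where g=f]) (auto simp: unpack_pack)
qed (rule measurable_compose[OF unpack_measurable])

lemma nn_integral_config:
  "f \<in> borel_measurable (config n) \<Longrightarrow> (\<integral>\<^sup>+p. f p \<partial>config n) = (\<integral>\<^sup>+x. f (unpack n x) \<partial>leb (idx n))"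
  by (subst distr_unpack[symmetric]) (simp add: nn_integral_distr)

text \<open>Measurability passes both ways through \<open>unpack\<close>. For a nonmeasurable f both
  integrals are the default value 0, so the operators can be rewritten for arbitrary kernels without
  side conditions.\<close>

lemma integral_config:
  fixes f :: "point \<Rightarrow> complex"
  shows "(\<integral>p. f p \<partial>config n) = (\<integral>x. f (unpack n x) \<partial>leb (idx n))"
proof (cases "f \<in> borel_measurable (config n)")
  case True
  then show ?thesis by (subst distr_unpack[symmetric]) (simp add: integral_distr)
next
  case False
  then have "\<not> integrable (config n) f" "\<not> integrable (leb (idx n)) (\<lambda>x. f (unpack n x))"
    using config_measurable_iff borel_measurable_integrable by blast+
  then show ?thesis by (simp add: not_integrable_integral_eq)
qed

lemma sum_idx: "(\<Sum>c\<in>idx n. f c) = (\<Sum>i=1..n. f (Inl i)) + (\<Sum>i=1..n. f (Inr i))"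
  by (simp add: idx_def sum.Plus)

lemma pairing_unpack: "pairing n (unpack n q) (unpack n x) = ip (idx n) q x"
  by (simp add: unpack_def ip_def sum_idx)

lemma fourier_unpack: "fourier n \<phi> (unpack n q) = ft (idx n) (\<lambda>x. \<phi> (unpack n x)) q"
  unfolding fourier_def ft_def integral_config pairing_unpack ..

lemma inverse_fourier_unpack:
  "inverse_fourier n h (unpack n x) = of_real (1 / (2 * pi) ^ (2 * n)) * ift (idx n) (\<lambda>q. h (unpack n q)) x"
  unfolding inverse_fourier_def ift_def integral_config pairing_unpack ..

lemma multiplier_unpack:
  "multiplier n m \<phi> (unpack n x) =
    of_real (1 / (2 * pi) ^ (2 * n)) * ift (idx n) (\<lambda>q. m (unpack n q) * ft (idx n) (\<lambda>x. \<phi> (unpack n x)) q) x"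
  unfolding multiplier_def inverse_fourier_unpack fourier_unpack ..

definition dsign :: "nat + nat \<Rightarrow> real" where
  "dsign = case_sum (\<lambda>_. - 1) (\<lambda>_. 1)"

lemma U_symbol_unpack: "U_symbol n \<tau> (unpack n q) = cis (\<tau> * quad (idx n) dsign q)"
  by (simp add: unpack_def quad_def sum_idx dsign_def prod.distrib distrib_left sum_distrib_left flip: cis_sum cis_mult sum_negf)

lemma R_symbol_unpack: "R_symbol n \<epsilon> (unpack n q) = of_real (jw \<epsilon> (idx n) q)"
  by (simp add: unpack_def jw_def idx_def prod.Plus prod.distrib)

text \<open>\<open>foldr\<close> applies the last entry of the list first, so a further innermost
  derivative is appended at the end.\<close>

lemma schwartz_partial_deriv:
  assumes "schwartz n \<psi>" "c \<in> idx n"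
  shows "schwartz n (partial_deriv c \<psi>)"
  unfolding schwartz_def
proof
  fix cs assume "cs \<in> lists ({1..n} <+> {1..n})"
  then have "cs @ [c] \<in> lists ({1..n} <+> {1..n})" using assms(2) by (simp add: idx_def)
  from assms(1)[unfolded schwartz_def, rule_format, OF this]
  show "(\<forall>a \<in> {1..n} <+> {1..n}. \<forall>p \<in> space (config n).
           (\<lambda>t. foldr partial_deriv cs (partial_deriv c \<psi>) (upd a t p)) differentiable at (coord a p)) \<and>
        (\<forall>N::nat. \<exists>A::real. \<forall>p \<in> space (config n).
           (1 + (\<Sum>c \<in> {1..n} <+> {1..n}. (coord c p)\<^sup>2)) ^ N * norm (foldr partial_deriv cs (partial_deriv c \<psi>) p) \<le> A)"
    by simp
qed

lemma wgt_idx: "wgt (idx n) x = 1 + (\<Sum>c \<in> {1..n} <+> {1..n}. (coord c (unpack n x))\<^sup>2)"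
  unfolding wgt_def idx_def[symmetric] using coord_unpack by simp

lemma schwartz_imp_sch:
  assumes "schwartz n \<phi>"
  shows "sch (idx n) (\<lambda>x. \<phi> (unpack n x))"
proof (rule sch_coinduct[where P="\<lambda>f. \<exists>\<psi>. schwartz n \<psi> \<and> f = (\<lambda>x. \<psi> (unpack n x))"])
  show "\<exists>\<psi>. schwartz n \<psi> \<and> (\<lambda>x. \<phi> (unpack n x)) = (\<lambda>x. \<psi> (unpack n x))" using assms by blast
next
  fix f assume "\<exists>\<psi>. schwartz n \<psi> \<and> f = (\<lambda>x. \<psi> (unpack n x))"
  then obtain \<psi> where \<psi>: "schwartz n \<psi>" and f: "f = (\<lambda>x. \<psi> (unpack n x))" by blast
  have S: "(\<forall>c \<in> {1..n} <+> {1..n}. \<forall>p \<in> space (config n). (\<lambda>t. \<psi> (upd c t p)) differentiable at (coord c p)) \<and>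
    (\<forall>N::nat. \<exists>A::real. \<forall>p \<in> space (config n). (1 + (\<Sum>c \<in> {1..n} <+> {1..n}. (coord c p)\<^sup>2)) ^ N * norm (\<psi> p) \<le> A)"
    using bspec[OF \<psi>[unfolded schwartz_def], of "[]"] by (simp del: One_nat_def)
  show "rapid (idx n) f"
    unfolding rapid_def f wgt_idx using conjunct2[OF S] unpack_space by meson
  fix c assume c: "c \<in> idx n"
  have "pder (idx n) c f (\<lambda>x. partial_deriv c \<psi> (unpack n x))"
    unfolding pder_def
  proof
    fix x :: "nat + nat \<Rightarrow> real"
    have "(\<lambda>t. \<psi> (upd c t (unpack n x))) differentiable at (coord c (unpack n x))"
      using conjunct1[OF S] c unpack_space[of n x] unfolding idx_def by blast
    then show "((\<lambda>t. f (x(c := t))) has_vector_derivative partial_deriv c \<psi> (unpack n x)) (at (x c))"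
      unfolding vector_derivative_works partial_deriv_def f by (simp add: upd_unpack[OF c] coord_unpack[OF c])
  qed
  then show "\<exists>g. (\<exists>\<psi>. schwartz n \<psi> \<and> g = (\<lambda>x. \<psi> (unpack n x))) \<and> pder (idx n) c f g"
    using schwartz_partial_deriv[OF \<psi> c] by blast
qed

text \<open>Coordinate updates stay inside \<open>space (config n)\<close>, so agreement with f
  there determines all iterated partial derivatives there.\<close>

lemma sch_imp_schwartz:
  assumes f: "sch (idx n) f" and eq: "\<And>p. p \<in> space (config n) \<Longrightarrow> \<phi> p = f (pack n p)"
  shows "schwartz n \<phi>"
proof -
  have step: "((\<lambda>t. u (upd c t p)) has_vector_derivative g' (pack n p)) (at (coord c p))"
    if "\<And>p. p \<in> space (config n) \<Longrightarrow> u p = g (pack n p)" "pder (idx n) c g g'" "c \<in> idx n" "p \<in> space (config n)" for u g g' c p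
  proof -
    have "(\<lambda>t. u (upd c t p)) = (\<lambda>t. g ((pack n p)(c := t)))"
      using that upd_space pack_upd by auto
    moreover have "coord c p = pack n p c" using that(3) by (simp add: pack_def)
    ultimately show ?thesis using that(2) pack_extensional by (simp add: pder_def)
  qed
  have main: "\<exists>g. sch (idx n) g \<and> (\<forall>p\<in>space (config n). foldr partial_deriv cs \<phi> p = g (pack n p))"
    if "cs \<in> lists (idx n)" for cs
    using that
  proof (induction cs)
    case Nil
    then show ?case using f eq by auto
  next
    case (Cons c cs)
    then obtain g where g: "sch (idx n) g" "\<And>p. p \<in> space (config n) \<Longrightarrow> foldr partial_deriv cs \<phi> p = g (pack n p)" by auto
    have c: "c \<in> idx n" using Cons by simp
    obtain g' where g': "sch (idx n) g'" "pder (idx n) c g g'" by (rule sch_pder[OF g(1) c])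
    have "foldr partial_deriv (c # cs) \<phi> p = g' (pack n p)" if "p \<in> space (config n)" for p
      using vector_derivative_at[OF step[OF g(2) g'(2) c that]] by (simp add: partial_deriv_def)
    then show ?case using g'(1) by blast
  qed
  show ?thesis
    unfolding schwartz_def
  proof (intro ballI conjI allI)
    fix cs assume "cs \<in> lists ({1..n} <+> {1..n})"
    then have "cs \<in> lists (idx n)" by (simp only: idx_def)
    from main[OF this] obtain g where g: "sch (idx n) g" "\<And>p. p \<in> space (config n) \<Longrightarrow> foldr partial_deriv cs \<phi> p = g (pack n p)"
      by blast
    {
      fix c p assume "c \<in> {1..n} <+> {1..n}" and p: "p \<in> space (config n)"
      then have c: "c \<in> idx n" by (simp add: idx_def)
      obtain g' where g': "sch (idx n) g'" "pder (idx n) c g g'" by (rule sch_pder[OF g(1) c])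
      show "(\<lambda>t. foldr partial_deriv cs \<phi> (upd c t p)) differentiable at (coord c p)"
        by (rule differentiableI_vector[OF step[OF g(2) g'(2) c p]])
    next
      fix N
      obtain A where A: "\<And>x. x \<in> extensional (idx n) \<Longrightarrow> wgt (idx n) x ^ N * norm (g x) \<le> A"
        using rapidE[OF sch_rapid[OF g(1)], of N] by metis
      show "\<exists>A::real. \<forall>p \<in> space (config n).
           (1 + (\<Sum>c \<in> {1..n} <+> {1..n}. (coord c p)\<^sup>2)) ^ N * norm (foldr partial_deriv cs \<phi> p) \<le> A"
        using A[OF pack_extensional] unfolding wgt_idx
        by (intro exI[of _ A] ballI) (metis g(2) unpack_pack)
    }
  qed
qed

subsection \<open>The operators on the Fourier side\<close>

lemma R_unpack:
  "R n \<epsilon> \<phi> (unpack n x) = of_real (1 / (2 * pi) ^ (2 * n)) *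
     ift (idx n) (\<lambda>q. of_real (jw \<epsilon> (idx n) q) * ft (idx n) (\<lambda>x. \<phi> (unpack n x)) q) x"
  unfolding R_def multiplier_unpack R_symbol_unpack ..

text \<open>The two contractions adjoin the same pair of variables in opposite order; each form
  matches the index set \<open>J\<close> of one of them.\<close>

lemma idx_Suc:
  "idx (Suc k) = insert (Inl (Suc k)) (insert (Inr (Suc k)) (idx k))"
  "idx (Suc k) = insert (Inr (Suc k)) (insert (Inl (Suc k)) (idx k))"
proof -
  have "{1..Suc k} = insert (Suc k) {1..k}" by auto
  then show "idx (Suc k) = insert (Inl (Suc k)) (insert (Inr (Suc k)) (idx k))"
    "idx (Suc k) = insert (Inr (Suc k)) (insert (Inl (Suc k)) (idx k))"
    unfolding idx_def by auto
qed

lemma ft_linear_diff: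
  assumes "integrable (leb I) f" "integrable (leb I) g"
  shows "ft I (\<lambda>x. a * f x - a * g x) q = a * ft I f q - a * ft I g q"
proof -
  have "integrable (leb I) (\<lambda>x. cis (- ip I q x) * f x)" "integrable (leb I) (\<lambda>x. cis (- ip I q x) * g x)"
    by (rule integrable_cis_mult, fact, measurable)+
  then show ?thesis by (simp add: ft_def right_diff_distrib mult.left_commute)
qed

text \<open>The two contractions are the two terms of the collision operator: at \<open>y\<^sub>j\<close> and at \<open>y'\<^sub>j\<close>.\<close>

locale particle =
  fixes j k :: nat
  assumes jk: "1 \<le> j" "j \<le> k"
begin

sublocale A: contraction "idx k" "Inl j" "Inl (Suc k)" "Inr (Suc k)"
  using jk by unfold_locales (auto simp: idx_simps finite_idx)

sublocale B: contraction "idx k" "Inr j" "Inr (Suc k)" "Inl (Suc k)"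
  using jk by unfold_locales (auto simp: idx_simps finite_idx)

lemma collision_unpack: "collision j k u (unpack k x) = u (unpack (Suc k) (A.diag x)) - u (unpack (Suc k) (B.diag x))"
proof -
  have 1: "unpack (Suc k) (A.diag x) = ((\<lambda>i\<in>{1..k}. x (Inl i))(Suc k := x (Inl j)), (\<lambda>i\<in>{1..k}. x (Inr i))(Suc k := x (Inl j)))"
    unfolding unpack_def A.diag_def by (auto simp: fun_eq_iff)
  have 2: "unpack (Suc k) (B.diag x) = ((\<lambda>i\<in>{1..k}. x (Inl i))(Suc k := x (Inr j)), (\<lambda>i\<in>{1..k}. x (Inr i))(Suc k := x (Inr j)))"
    unfolding unpack_def B.diag_def by (auto simp: fun_eq_iff)
  show ?thesis unfolding 1 2 using jk by (simp add: unpack_def)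
qed

definition propag :: "kernel \<Rightarrow> real \<Rightarrow> (nat + nat \<Rightarrow> real) \<Rightarrow> complex" where
  "propag \<phi> \<tau> q = cis (\<tau> * quad (idx (Suc k)) dsign q) * ft (idx (Suc k)) (\<lambda>x. \<phi> (unpack (Suc k) x)) q"

text \<open>Up to the factor (2\<pi>)^(-2), the Fourier transform of the collision term at time
  \<tau>.\<close>

definition bhat :: "kernel \<Rightarrow> real \<Rightarrow> (nat + nat \<Rightarrow> real) \<Rightarrow> complex" where
  "bhat \<phi> \<tau> q = A.coll (propag \<phi> \<tau>) q - B.coll (propag \<phi> \<tau>) q"

lemma sch_propag: "schwartz (Suc k) \<phi> \<Longrightarrow> sch (idx (Suc k)) (propag \<phi> \<tau>)"
  unfolding propag_def by (intro sch_propagate sch_ft schwartz_imp_sch finite_idx)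

lemma U_unpack: "U (Suc k) \<tau> \<phi> (unpack (Suc k) x) = of_real (1 / (2 * pi) ^ (2 * Suc k)) * ift (idx (Suc k)) (propag \<phi> \<tau>) x"
  unfolding U_def multiplier_unpack U_symbol_unpack propag_def ..

lemma rapid_bhat: "schwartz (Suc k) \<phi> \<Longrightarrow> rapid (idx k) (bhat \<phi> \<tau>)"
  and seqcont_bhat: "schwartz (Suc k) \<phi> \<Longrightarrow> seqcont (idx k) (bhat \<phi> \<tau>)"
proof -
  assume \<phi>: "schwartz (Suc k) \<phi>"
  note s = sch_propag[OF \<phi>, of \<tau>]
  have r: "rapid (idx (Suc k)) (propag \<phi> \<tau>)" "propag \<phi> \<tau> \<in> borel_measurable (leb (idx (Suc k)))" "seqcont (idx (Suc k)) (propag \<phi> \<tau>)"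
    using s by (auto intro: sch_rapid sch_measurable sch_seqcont finite_idx)
  have 1: "rapid (idx k) (\<lambda>q. (- 1) * B.coll (propag \<phi> \<tau>) q)"
    by (rule rapid_poly_bound[OF B.rapid_coll[OF r(1,2)[unfolded idx_Suc(2)]], where B=1 and M=0]) (simp add: norm_mult)
  show "rapid (idx k) (bhat \<phi> \<tau>)"
    using rapid_add[OF A.rapid_coll[OF r(1,2)[unfolded idx_Suc(1)]] 1] unfolding bhat_def[abs_def] by simp
  show "seqcont (idx k) (bhat \<phi> \<tau>)"
    unfolding bhat_def[abs_def]
    by (intro seqcont_diff A.seqcont_coll[OF r(1,3)[unfolded idx_Suc(1)]] B.seqcont_coll[OF r(1,3)[unfolded idx_Suc(2)]])
qed

text \<open>The factor (2\<pi>)^(-2) is what remains of the normalisation (2\<pi>)^(-2(k+1)) for k +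
  1 particles after inversion in \<open>ft_diag\<close> has returned (2\<pi>)^(2k).\<close>

lemma fourier_collision:
  assumes \<phi>: "schwartz (Suc k) \<phi>" and q: "q \<in> extensional (idx k)"
  shows "fourier k (collision j k (U (Suc k) \<tau> \<phi>)) (unpack k q) = of_real (1 / (2 * pi)\<^sup>2) * bhat \<phi> \<tau> q"
proof -
  note s = sch_propag[OF \<phi>, of \<tau>]
  let ?c = "complex_of_real (1 / (2 * pi) ^ (2 * Suc k))"
  let ?a = "\<lambda>x. ift (idx (Suc k)) (propag \<phi> \<tau>) (A.diag x)" and ?b = "\<lambda>x. ift (idx (Suc k)) (propag \<phi> \<tau>) (B.diag x)"
  have si: "sch (idx (Suc k)) (ift (idx (Suc k)) (propag \<phi> \<tau>))" by (rule sch_ift[OF finite_idx s])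
  have "nice (idx k) ?a" "nice (idx k) ?b"
    using rapid_nice[OF finite_idx A.sch_diag[OF si[unfolded idx_Suc(1)]]] rapid_nice[OF finite_idx B.sch_diag[OF si[unfolded idx_Suc(2)]]]
    by (simp_all only: idx_Suc(1)[symmetric] idx_Suc(2)[symmetric])
  then have ni: "integrable (leb (idx k)) ?a" "integrable (leb (idx k)) ?b" by (simp_all only: nice_def)
  have ftA: "ft (idx k) ?a q = of_real ((2 * pi) ^ (2 * k)) * A.coll (propag \<phi> \<tau>) q"
    using A.ft_diag[OF s[unfolded idx_Suc(1)] q] by (simp only: idx_Suc(1)[symmetric] card_idx)
  have ftB: "ft (idx k) ?b q = of_real ((2 * pi) ^ (2 * k)) * B.coll (propag \<phi> \<tau>) q"
    using B.ft_diag[OF s[unfolded idx_Suc(2)] q] by (simp only: idx_Suc(2)[symmetric] card_idx)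
  have "fourier k (collision j k (U (Suc k) \<tau> \<phi>)) (unpack k q) = ft (idx k) (\<lambda>x. ?c * ?a x - ?c * ?b x) q"
    unfolding fourier_unpack collision_unpack U_unpack ..
  also have "\<dots> = ?c * ft (idx k) ?a q - ?c * ft (idx k) ?b q"
    by (rule ft_linear_diff[OF ni])
  also have "\<dots> = (?c * of_real ((2 * pi) ^ (2 * k))) * bhat \<phi> \<tau> q"
    unfolding ftA ftB bhat_def by (simp only: right_diff_distrib mult.assoc)
  also have "?c * of_real ((2 * pi) ^ (2 * k)) = of_real (1 / (2 * pi)\<^sup>2)"
    by (simp only: of_real_mult[symmetric]) (simp add: power_add power2_eq_square)
  finally show ?thesis .
qed

lemma RBU_unpack:
  assumes \<phi>: "schwartz (Suc k) \<phi>"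
  shows "RBU \<epsilon> j k \<phi> \<tau> (unpack k x) =
    of_real (1 / (2 * pi) ^ (2 * k + 2)) * ift (idx k) (\<lambda>q. of_real (jw \<epsilon> (idx k) q) * bhat \<phi> \<tau> q) x"
proof -
  let ?c = "complex_of_real (1 / (2 * pi)\<^sup>2)"
  have "RBU \<epsilon> j k \<phi> \<tau> (unpack k x) = of_real (1 / (2 * pi) ^ (2 * k)) *
     ift (idx k) (\<lambda>q. of_real (jw \<epsilon> (idx k) q) * fourier k (collision j k (U (Suc k) \<tau> \<phi>)) (unpack k q)) x"
    unfolding RBU_def R_unpack fourier_unpack ..
  \<comment> \<open>\<open>fourier_collision\<close> is available at extensional frequencies, which
    are all the points of the measure space.\<close>
  also have "ift (idx k) (\<lambda>q. of_real (jw \<epsilon> (idx k) q) * fourier k (collision j k (U (Suc k) \<tau> \<phi>)) (unpack k q)) x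
    = ift (idx k) (\<lambda>q. ?c * (of_real (jw \<epsilon> (idx k) q) * bhat \<phi> \<tau> q)) x"
    unfolding ift_def
    by (intro Bochner_Integration.integral_cong refl) (simp only: space_leb fourier_collision[OF \<phi>] mult.left_commute)
  also have "\<dots> = ?c * ift (idx k) (\<lambda>q. of_real (jw \<epsilon> (idx k) q) * bhat \<phi> \<tau> q) x"
    unfolding ift_def by (simp only: mult.left_commute[of _ ?c] integral_mult_right_zero)
  finally show ?thesis
    by (simp add: power_add power2_eq_square mult.assoc)
qed

end

section \<open>Squared norms and the estimate for Schwartz data\<close>

subsection \<open>Square roots in the extended nonnegative reals\<close>

lemma ennsqrt_power2: "(ennsqrt x)\<^sup>2 = x"
proof (cases "x = \<infinity>")
  case True
  then show ?thesis by (simp add: ennsqrt_def power2_eq_square)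
next
  case False
  then have "(ennsqrt x)\<^sup>2 = ennreal ((sqrt (enn2real x))\<^sup>2)"
    by (simp only: ennsqrt_def if_False ennreal_power real_sqrt_ge_zero enn2real_nonneg)
  also have "\<dots> = x" using False by (simp add: less_top)
  finally show ?thesis .
qed

lemma power2_mono_iff: "a\<^sup>2 \<le> b\<^sup>2 \<longleftrightarrow> a \<le> b" for a b :: ennreal
proof
  assume le: "a\<^sup>2 \<le> b\<^sup>2"
  show "a \<le> b"
  proof (cases a; cases b)
    fix x y :: real assume "a = ennreal x" "0 \<le> x" "b = ennreal y" "0 \<le> y"
    then show ?thesis using le by (simp add: ennreal_power ennreal_le_iff power_mono_iff)
  next
    fix y assume "a = \<top>" "b = ennreal y" "0 \<le> y"
    then show ?thesis using le by (simp add: ennreal_power power2_eq_square top_unique ennreal_mult_eq_top_iff)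
  qed auto
qed (simp add: power_mono)

lemma ennsqrt_le_mult: "0 \<le> C \<Longrightarrow> a \<le> ennreal (C\<^sup>2) * b \<Longrightarrow> ennsqrt a \<le> ennreal C * ennsqrt b"
  by (subst power2_mono_iff[symmetric]) (simp add: ennsqrt_power2 power_mult_distrib ennreal_power)

lemma ennsqrt_less_top: "ennsqrt a < \<infinity> \<longleftrightarrow> a < \<infinity>"
  by (auto simp: ennsqrt_def less_top)

text \<open>Thresholds are written as e^2 so that convergence to 0 passes through the square
  root.\<close>

lemma tendsto_ennreal_zero_iff:
  fixes f :: "nat \<Rightarrow> ennreal"
  shows "f \<longlonglongrightarrow> 0 \<longleftrightarrow> (\<forall>e>0. eventually (\<lambda>m. f m \<le> ennreal (e\<^sup>2)) sequentially)"
proof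
  assume f: "f \<longlonglongrightarrow> 0"
  show "\<forall>e>0. eventually (\<lambda>m. f m \<le> ennreal (e\<^sup>2)) sequentially"
  proof (intro allI impI)
    fix e :: real assume "0 < e"
    then have "eventually (\<lambda>m. f m < ennreal (e\<^sup>2)) sequentially"
      by (intro order_tendstoD(2)[OF f]) simp
    then show "eventually (\<lambda>m. f m \<le> ennreal (e\<^sup>2)) sequentially"
      by (rule eventually_mono) simp
  qed
next
  assume *: "\<forall>e>0. eventually (\<lambda>m. f m \<le> ennreal (e\<^sup>2)) sequentially"
  show "f \<longlonglongrightarrow> 0"
  proof (rule order_tendstoI)
    fix u :: ennreal assume "0 < u"
    then obtain z :: ennreal where z: "0 < z" "z < u" using dense by blast
    then obtain r where r: "z = ennreal r" "0 < r" by (cases z) auto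
    have "eventually (\<lambda>m. f m \<le> ennreal ((sqrt r)\<^sup>2)) sequentially" using *[rule_format, of "sqrt r"] r by simp
    then show "eventually (\<lambda>m. f m < u) sequentially"
      by (rule eventually_mono) (use r z in auto)
  qed simp
qed

lemma tendsto_ennsqrt_zero_iff: "(\<lambda>m. ennsqrt (f m)) \<longlonglongrightarrow> 0 \<longleftrightarrow> f \<longlonglongrightarrow> 0"
proof -
  have eq: "ennsqrt a \<le> ennreal e \<longleftrightarrow> a \<le> ennreal (e\<^sup>2)" if "0 < e" for a e
    using that by (subst power2_mono_iff[symmetric]) (simp add: ennsqrt_power2 ennreal_power)
  have "(\<lambda>m. ennsqrt (f m)) \<longlonglongrightarrow> 0 \<longleftrightarrow> (\<forall>e>0. eventually (\<lambda>m. f m \<le> ennreal ((e\<^sup>2)\<^sup>2)) sequentially)"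
    unfolding tendsto_ennreal_zero_iff by (simp add: eq)
  also have "\<dots> \<longleftrightarrow> f \<longlonglongrightarrow> 0"
    unfolding tendsto_ennreal_zero_iff
  proof (intro iffI allI impI)
    fix e :: real assume *: "\<forall>e>0. eventually (\<lambda>m. f m \<le> ennreal ((e\<^sup>2)\<^sup>2)) sequentially" and "0 < e"
    then show "eventually (\<lambda>m. f m \<le> ennreal (e\<^sup>2)) sequentially"
      using *[rule_format, of "sqrt e"] by simp
  next
    fix e :: real assume *: "\<forall>e>0. eventually (\<lambda>m. f m \<le> ennreal (e\<^sup>2)) sequentially" and "0 < e"
    then show "eventually (\<lambda>m. f m \<le> ennreal ((e\<^sup>2)\<^sup>2)) sequentially"
      using *[rule_format, of "e\<^sup>2"] by simp
  qed
  finally show ?thesis .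
qed

subsection \<open>Square integrals\<close>

text \<open>Squared norms are plain integrals, on which Plancherel and Tonelli act directly; roots
  return only when norms are compared.\<close>

definition sq2 :: "nat \<Rightarrow> kernel \<Rightarrow> ennreal" where
  "sq2 n f = (\<integral>\<^sup>+p. (ennreal (norm (f p)))\<^sup>2 \<partial>config n)"

definition tsq2 :: "ereal \<Rightarrow> nat \<Rightarrow> (real \<Rightarrow> kernel) \<Rightarrow> ennreal" where
  "tsq2 T n F = (\<integral>\<^sup>+\<tau>\<in>{\<tau>. 0 \<le> \<tau> \<and> ereal \<tau> \<le> T}. sq2 n (F \<tau>) \<partial>lborel)"

lemma L2norm_eq: "L2norm n f = ennsqrt (sq2 n f)"
  by (simp add: L2norm_def sq2_def)

lemma L2L2norm_eq: "L2L2norm T n F = ennsqrt (tsq2 T n F)"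
  by (simp add: L2L2norm_def tsq2_def L2norm_eq ennsqrt_power2)

lemma sq2_cong: "(\<And>p. p \<in> space (config n) \<Longrightarrow> f p = g p) \<Longrightarrow> sq2 n f = sq2 n g"
  unfolding sq2_def by (intro nn_integral_cong) simp

lemma norm_diff_power2_le: "(ennreal (norm (a - b)))\<^sup>2 \<le> 2 * (ennreal (norm a))\<^sup>2 + 2 * (ennreal (norm b))\<^sup>2"
  for a b :: complex
proof -
  have "(norm (a - b))\<^sup>2 \<le> (norm a + norm b)\<^sup>2" by (intro power_mono norm_triangle_ineq4) simp
  also have "\<dots> \<le> 2 * (norm a)\<^sup>2 + 2 * (norm b)\<^sup>2"
    using zero_le_power2[of "norm a - norm b"] by (simp add: power2_eq_square algebra_simps)
  finally have "ennreal ((norm (a - b))\<^sup>2) \<le> ennreal (2 * (norm a)\<^sup>2 + 2 * (norm b)\<^sup>2)" by (rule ennreal_leI)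
  also have "\<dots> = 2 * (ennreal (norm a))\<^sup>2 + 2 * (ennreal (norm b))\<^sup>2"
    by (simp add: ennreal_power ennreal_mult')
  finally show ?thesis by (simp add: ennreal_power)
qed

lemma sq2_diff_le:
  assumes [measurable]: "f \<in> borel_measurable (config n)" "g \<in> borel_measurable (config n)"
  shows "sq2 n (\<lambda>p. f p - g p) \<le> 2 * sq2 n f + 2 * sq2 n g"
proof -
  have "sq2 n (\<lambda>p. f p - g p) \<le> (\<integral>\<^sup>+p. 2 * (ennreal (norm (f p)))\<^sup>2 + 2 * (ennreal (norm (g p)))\<^sup>2 \<partial>config n)"
    unfolding sq2_def by (intro nn_integral_mono norm_diff_power2_le)
  also have "\<dots> = 2 * sq2 n f + 2 * sq2 n g"
    unfolding sq2_def by (simp add: nn_integral_add nn_integral_cmult)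
  finally show ?thesis .
qed

lemma ift_sq2:
  assumes eq: "\<And>x. F (unpack n x) = of_real c * ift (idx n) w x" and c: "0 \<le> c" and w: "nice (idx n) w"
  shows "F \<in> borel_measurable (config n)"
    and "sq2 n F = ennreal (c\<^sup>2 * (2 * pi) ^ (2 * n)) * (\<integral>\<^sup>+q. (ennreal (norm (w q)))\<^sup>2 \<partial>leb (idx n))"
proof -
  have wm: "w \<in> borel_measurable (leb (idx n))" using w by (auto simp: nice_def)
  note [measurable] = ift_measurable[OF finite_idx wm]
  show m [measurable]: "F \<in> borel_measurable (config n)"
    unfolding config_measurable_iff eq by measurable
  have "sq2 n F = (\<integral>\<^sup>+x. (ennreal (norm (F (unpack n x))))\<^sup>2 \<partial>leb (idx n))"
    unfolding sq2_def by (rule nn_integral_config) measurable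
  also have "\<dots> = (\<integral>\<^sup>+x. ennreal (c\<^sup>2) * (ennreal (norm (ift (idx n) w x)))\<^sup>2 \<partial>leb (idx n))"
    unfolding eq using c by (simp add: norm_mult ennreal_mult' power_mult_distrib ennreal_power)
  also have "\<dots> = ennreal (c\<^sup>2) * (\<integral>\<^sup>+x. (ennreal (norm (ift (idx n) w x)))\<^sup>2 \<partial>leb (idx n))"
    by (rule nn_integral_cmult) measurable
  also have "\<dots> = ennreal (c\<^sup>2 * (2 * pi) ^ (2 * n)) * (\<integral>\<^sup>+q. (ennreal (norm (w q)))\<^sup>2 \<partial>leb (idx n))"
    unfolding plancherel[OF finite_idx w] card_idx by (simp add: ennreal_mult' mult.assoc)
  finally show "sq2 n F = ennreal (c\<^sup>2 * (2 * pi) ^ (2 * n)) * (\<integral>\<^sup>+q. (ennreal (norm (w q)))\<^sup>2 \<partial>leb (idx n))" .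
qed

definition hat :: "nat \<Rightarrow> kernel \<Rightarrow> (nat + nat \<Rightarrow> real) \<Rightarrow> complex" where
  "hat n \<phi> = ft (idx n) (\<lambda>x. \<phi> (unpack n x))"

lemma sch_hat: "schwartz n \<phi> \<Longrightarrow> sch (idx n) (hat n \<phi>)"
  unfolding hat_def by (intro sch_ft finite_idx schwartz_imp_sch)

lemma R_sq2:
  assumes "schwartz n \<phi>" "0 \<le> \<epsilon>"
  shows "R n \<epsilon> \<phi> \<in> borel_measurable (config n)"
    and "sq2 n (R n \<epsilon> \<phi>) = ennreal (1 / (2 * pi) ^ (2 * n)) * (\<integral>\<^sup>+q. (ennreal (jw \<epsilon> (idx n) q * norm (hat n \<phi> q)))\<^sup>2 \<partial>leb (idx n))"
proof -
  have n: "nice (idx n) (\<lambda>q. of_real (jw \<epsilon> (idx n) q) * hat n \<phi> q)"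
    using assms by (intro nice_jw_mult finite_idx sch_rapid sch_seqcont sch_hat)
  have eq: "R n \<epsilon> \<phi> (unpack n x) = of_real (1 / (2 * pi) ^ (2 * n)) * ift (idx n) (\<lambda>q. of_real (jw \<epsilon> (idx n) q) * hat n \<phi> q) x" for x
    unfolding R_unpack hat_def ..
  show "R n \<epsilon> \<phi> \<in> borel_measurable (config n)" by (rule ift_sq2(1)[OF eq _ n]) simp
  have c: "(1 / (2 * pi) ^ (2 * n))\<^sup>2 * (2 * pi) ^ (2 * n) = 1 / (2 * pi) ^ (2 * n)"
    by (simp add: power2_eq_square)
  show "sq2 n (R n \<epsilon> \<phi>) = ennreal (1 / (2 * pi) ^ (2 * n)) * (\<integral>\<^sup>+q. (ennreal (jw \<epsilon> (idx n) q * norm (hat n \<phi> q)))\<^sup>2 \<partial>leb (idx n))"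
    using ift_sq2(2)[OF eq _ n] unfolding c by (simp add: norm_mult jw_nonneg)
qed

lemma hat_diff:
  assumes "schwartz n f" "schwartz n g"
  shows "hat n (\<lambda>p. f p - g p) q = hat n f q - hat n g q"
  unfolding hat_def
  using ft_linear_diff[OF sch_integrable[OF finite_idx schwartz_imp_sch[OF assms(1)]] sch_integrable[OF finite_idx schwartz_imp_sch[OF assms(2)]], of 1 q]
  by simp

lemma schwartz_diff: "schwartz n f \<Longrightarrow> schwartz n g \<Longrightarrow> schwartz n (\<lambda>p. f p - g p)"
  by (rule sch_imp_schwartz[OF sch_diff[OF schwartz_imp_sch schwartz_imp_sch]]) (auto simp: unpack_pack)

lemma ift_diff:
  assumes "integrable (leb I) f" "integrable (leb I) g"
  shows "ift I (\<lambda>x. f x - g x) q = ift I f q - ift I g q"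
proof -
  have "integrable (leb I) (\<lambda>x. cis (ip I x q) * f x)" "integrable (leb I) (\<lambda>x. cis (ip I x q) * g x)"
    by (rule integrable_cis_mult, fact, measurable)+
  then show ?thesis by (simp add: ift_def right_diff_distrib)
qed

lemma R_diff:
  assumes f: "schwartz n f" and g: "schwartz n g" and \<epsilon>: "0 \<le> \<epsilon>" and p: "p \<in> space (config n)"
  shows "R n \<epsilon> (\<lambda>p. f p - g p) p = R n \<epsilon> f p - R n \<epsilon> g p"
proof -
  have i: "integrable (leb (idx n)) (\<lambda>q. of_real (jw \<epsilon> (idx n) q) * hat n u q)" if "schwartz n u" for u
    using nice_jw_mult[OF finite_idx \<epsilon> sch_rapid[OF sch_hat[OF that]] sch_seqcont[OF finite_idx sch_hat[OF that]]]
    by (simp add: nice_def)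
  have eq: "R n \<epsilon> u p = of_real (1 / (2 * pi) ^ (2 * n)) * ift (idx n) (\<lambda>q. of_real (jw \<epsilon> (idx n) q) * hat n u q) (pack n p)" for u
    using R_unpack[of n \<epsilon> u "pack n p"] unfolding unpack_pack[OF p] hat_def .
  show ?thesis
    unfolding eq hat_diff[OF f g] right_diff_distrib ift_diff[OF i[OF f] i[OF g]] by (simp only: right_diff_distrib)
qed

text \<open>Each of the two collision terms contributes 2, through |a - b|^2 \<le> 2|a|^2 + 2|b|^2.
  The divisor is the quotient of the Plancherel factors (2\<pi>)^(2k+4) and (2\<pi>)^(2k+2), in
  which k cancels.\<close>

definition est_const :: "real \<Rightarrow> real \<Rightarrow> real" where
  "est_const T \<epsilon> = 4 * coll_const T \<epsilon> / (2 * pi)\<^sup>2"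

context particle
begin

lemma propag_hat: "propag \<phi> \<tau> = (\<lambda>q. cis (\<tau> * quad (idx (Suc k)) dsign q) * hat (Suc k) \<phi> q)"
  unfolding propag_def[abs_def] hat_def ..

lemma RBU_sq2:
  assumes "schwartz (Suc k) \<phi>" "0 \<le> \<epsilon>"
  shows "RBU \<epsilon> j k \<phi> \<tau> \<in> borel_measurable (config k)"
    and "sq2 k (RBU \<epsilon> j k \<phi> \<tau>) = ennreal (1 / (2 * pi) ^ (2 * k + 4)) * (\<integral>\<^sup>+q. (ennreal (jw \<epsilon> (idx k) q * norm (bhat \<phi> \<tau> q)))\<^sup>2 \<partial>leb (idx k))"
proof -
  have n: "nice (idx k) (\<lambda>q. of_real (jw \<epsilon> (idx k) q) * bhat \<phi> \<tau> q)"
    using assms by (intro nice_jw_mult finite_idx rapid_bhat seqcont_bhat)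
  note eq = RBU_unpack[OF assms(1)]
  show "RBU \<epsilon> j k \<phi> \<tau> \<in> borel_measurable (config k)" by (rule ift_sq2(1)[OF eq _ n]) simp
  have c: "(1 / (2 * pi) ^ (2 * k + 2))\<^sup>2 * (2 * pi) ^ (2 * k) = 1 / (2 * pi) ^ (2 * k + 4)"
    by (simp add: power2_eq_square power_add eval_nat_numeral)
  show "sq2 k (RBU \<epsilon> j k \<phi> \<tau>) = ennreal (1 / (2 * pi) ^ (2 * k + 4)) * (\<integral>\<^sup>+q. (ennreal (jw \<epsilon> (idx k) q * norm (bhat \<phi> \<tau> q)))\<^sup>2 \<partial>leb (idx k))"
    using ift_sq2(2)[OF eq _ n] unfolding c by (simp add: norm_mult jw_nonneg)
qed

lemma bhat_diff:
  assumes f: "schwartz (Suc k) f" and g: "schwartz (Suc k) g" and q: "q \<in> extensional (idx k)"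
  shows "bhat (\<lambda>p. f p - g p) \<tau> q = bhat f \<tau> q - bhat g \<tau> q"
proof -
  have p: "propag (\<lambda>p. f p - g p) \<tau> = (\<lambda>x. propag f \<tau> x - propag g \<tau> x)"
    unfolding propag_hat hat_diff[OF f g] right_diff_distrib ..
  have s: "rapid (idx (Suc k)) (propag u \<tau>)" "propag u \<tau> \<in> borel_measurable (leb (idx (Suc k)))" if "schwartz (Suc k) u" for u
    using sch_propag[OF that, of \<tau>] by (auto intro: sch_rapid sch_measurable finite_idx)
  have "A.coll (propag (\<lambda>p. f p - g p) \<tau>) q = A.coll (propag f \<tau>) q - A.coll (propag g \<tau>) q"
    unfolding p by (rule A.coll_diff) (use s[OF f] s[OF g] q in \<open>simp_all add: idx_Suc(1)[symmetric]\<close>)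
  moreover have "B.coll (propag (\<lambda>p. f p - g p) \<tau>) q = B.coll (propag f \<tau>) q - B.coll (propag g \<tau>) q"
    unfolding p by (rule B.coll_diff) (use s[OF f] s[OF g] q in \<open>simp_all add: idx_Suc(2)[symmetric]\<close>)
  ultimately show ?thesis by (simp add: bhat_def)
qed

lemma RBU_diff:
  assumes f: "schwartz (Suc k) f" and g: "schwartz (Suc k) g" and \<epsilon>: "0 \<le> \<epsilon>" and p: "p \<in> space (config k)"
  shows "RBU \<epsilon> j k (\<lambda>p. f p - g p) \<tau> p = RBU \<epsilon> j k f \<tau> p - RBU \<epsilon> j k g \<tau> p"
proof -
  let ?w = "\<lambda>u q. of_real (jw \<epsilon> (idx k) q) * bhat u \<tau> q"
  have i: "integrable (leb (idx k)) (?w u)" if "schwartz (Suc k) u" for u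
    using nice_jw_mult[OF finite_idx \<epsilon> rapid_bhat[OF that] seqcont_bhat[OF that]] by (simp add: nice_def)
  have eq: "RBU \<epsilon> j k u \<tau> p = of_real (1 / (2 * pi) ^ (2 * k + 2)) * ift (idx k) (?w u) (pack k p)" if "schwartz (Suc k) u" for u
    using RBU_unpack[OF that, of \<epsilon> \<tau> "pack k p"] unfolding unpack_pack[OF p] .
  have "ift (idx k) (?w (\<lambda>p. f p - g p)) x = ift (idx k) (\<lambda>q. ?w f q - ?w g q) x" for x
    unfolding ift_def
    by (intro Bochner_Integration.integral_cong refl) (simp only: space_leb bhat_diff[OF f g] right_diff_distrib)
  then show ?thesis
    unfolding eq[OF f] eq[OF g] eq[OF schwartz_diff[OF f g]] ift_diff[OF i[OF f] i[OF g]] by (simp only: right_diff_distrib)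
qed

lemma bhat_measurable:
  assumes \<phi>: "schwartz (Suc k) \<phi>"
  shows "(\<lambda>(\<tau>, q). bhat \<phi> \<tau> q) \<in> borel_measurable (lborel \<Otimes>\<^sub>M leb (idx k))"
proof -
  have h: "hat (Suc k) \<phi> \<in> borel_measurable (leb (idx (Suc k)))"
    by (intro sch_measurable finite_idx sch_hat \<phi>)
  have "(\<lambda>(\<tau>, q). A.coll (propag \<phi> \<tau>) q) \<in> borel_measurable (lborel \<Otimes>\<^sub>M leb (idx k))"
    using A.coll_propagate_measurable[OF h[unfolded idx_Suc(1)], of dsign] by (simp only: propag_hat idx_Suc(1)[symmetric])
  moreover have "(\<lambda>(\<tau>, q). B.coll (propag \<phi> \<tau>) q) \<in> borel_measurable (lborel \<Otimes>\<^sub>M leb (idx k))"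
    using B.coll_propagate_measurable[OF h[unfolded idx_Suc(2)], of dsign] by (simp only: propag_hat idx_Suc(2)[symmetric])
  ultimately show ?thesis unfolding bhat_def by measurable
qed

lemma RBU_measurable:
  assumes \<phi>: "schwartz (Suc k) \<phi>"
  shows "(\<lambda>(\<tau>, p). RBU \<epsilon> j k \<phi> \<tau> p) \<in> borel_measurable (lborel \<Otimes>\<^sub>M config k)"
proof -
  note [measurable] = bhat_measurable[OF \<phi>]
  interpret sigma_finite_measure "leb (idx k)" by (rule leb_sigma_finite[OF finite_idx])
  have m1: "(\<lambda>w. ip (idx k) (snd w) (snd (fst w))) \<in> borel_measurable ((lborel \<Otimes>\<^sub>M leb (idx k)) \<Otimes>\<^sub>M leb (idx k))"
    using measurable_compose[OF _ ip_measurable(3)[of "idx k"], of "\<lambda>w. (snd w, snd (fst w))" "(lborel \<Otimes>\<^sub>M leb (idx k)) \<Otimes>\<^sub>M leb (idx k)"]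
    by (simp add: split_def)
  have m2: "(\<lambda>w. bhat \<phi> (fst (fst w)) (snd w)) \<in> borel_measurable ((lborel \<Otimes>\<^sub>M leb (idx k)) \<Otimes>\<^sub>M leb (idx k))"
    using measurable_compose[OF _ bhat_measurable[OF \<phi>], of "\<lambda>w. (fst (fst w), snd w)" "(lborel \<Otimes>\<^sub>M leb (idx k)) \<Otimes>\<^sub>M leb (idx k)"]
    by (simp add: split_def)
  have m3: "(\<lambda>w. jw \<epsilon> (idx k) (snd w)) \<in> borel_measurable ((lborel \<Otimes>\<^sub>M leb (idx k)) \<Otimes>\<^sub>M leb (idx k))"
    by (rule measurable_compose[OF measurable_snd jw_measurable])
  note [measurable] = m1 m2 m3
  have "(\<lambda>w. cis (ip (idx k) (snd w) (snd (fst w))) * (of_real (jw \<epsilon> (idx k) (snd w)) * bhat \<phi> (fst (fst w)) (snd w)))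
      \<in> borel_measurable ((lborel \<Otimes>\<^sub>M leb (idx k)) \<Otimes>\<^sub>M leb (idx k))" by measurable
  then have "(\<lambda>v. \<integral>q. cis (ip (idx k) q (snd v)) * (of_real (jw \<epsilon> (idx k) q) * bhat \<phi> (fst v) q) \<partial>leb (idx k))
      \<in> borel_measurable (lborel \<Otimes>\<^sub>M leb (idx k))"
    by (intro borel_measurable_lebesgue_integral) (simp add: split_def)
  then have F: "(\<lambda>v. of_real (1 / (2 * pi) ^ (2 * k + 2)) * ift (idx k) (\<lambda>q. of_real (jw \<epsilon> (idx k) q) * bhat \<phi> (fst v) q) (snd v))
      \<in> borel_measurable (lborel \<Otimes>\<^sub>M leb (idx k))"
    unfolding ift_def by (intro borel_measurable_times borel_measurable_const)
  have "(\<lambda>w. (fst w, pack k (snd w))) \<in> lborel \<Otimes>\<^sub>M config k \<rightarrow>\<^sub>M lborel \<Otimes>\<^sub>M leb (idx k)"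
    by measurable
  from measurable_compose[OF this F]
  have "(\<lambda>w. RBU \<epsilon> j k \<phi> (fst w) (unpack k (pack k (snd w)))) \<in> borel_measurable (lborel \<Otimes>\<^sub>M config k)"
    unfolding RBU_unpack[OF \<phi>] by simp
  then show ?thesis
    by (subst measurable_cong[where g="\<lambda>w. RBU \<epsilon> j k \<phi> (fst w) (unpack k (pack k (snd w)))"])
       (auto simp: space_pair_measure unpack_pack)
qed

text \<open>Plancherel at both ends reduces the claim to \<open>coll_estimate\<close>, applied to
  each contraction separately; cancellation between the two is not exploited.\<close>

theorem smoothing_sq2:
  assumes T: "0 < T" and \<epsilon>: "0 < \<epsilon>" and \<phi>: "schwartz (Suc k) \<phi>"
  shows "tsq2 (ereal T) k (RBU \<epsilon> j k \<phi>) \<le> ennreal (est_const T \<epsilon>) * sq2 (Suc k) (R (Suc k) \<epsilon> \<phi>)"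
proof -
  define h where "h = hat (Suc k) \<phi>"
  define N where "N = (\<integral>\<^sup>+x. (ennreal (jw \<epsilon> (idx (Suc k)) x * norm (h x)))\<^sup>2 \<partial>leb (idx (Suc k)))"
  define kc where "kc = 1 / (2 * pi) ^ (2 * k + 4)"
  have h: "rapid (idx (Suc k)) h" and hm: "h \<in> borel_measurable (leb (idx (Suc k)))"
    unfolding h_def by (auto intro!: sch_rapid sch_measurable finite_idx sch_hat \<phi>)
  let ?EA = "\<lambda>\<tau>. \<integral>\<^sup>+q. (ennreal (jw \<epsilon> (idx k) q * norm (A.coll (propag \<phi> \<tau>) q)))\<^sup>2 \<partial>leb (idx k)"
  let ?EB = "\<lambda>\<tau>. \<integral>\<^sup>+q. (ennreal (jw \<epsilon> (idx k) q * norm (B.coll (propag \<phi> \<tau>) q)))\<^sup>2 \<partial>leb (idx k)"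
  have EA: "(\<integral>\<^sup>+\<tau>. ?EA \<tau> * indicator {0..T} \<tau> \<partial>lborel) \<le> ennreal (coll_const T \<epsilon>) * N"
    using A.coll_estimate[OF T \<epsilon> h[unfolded idx_Suc(1)] hm[unfolded idx_Suc(1)], of dsign]
    unfolding idx_Suc(1)[symmetric] propag_hat h_def N_def by (simp add: dsign_def)
  have EB: "(\<integral>\<^sup>+\<tau>. ?EB \<tau> * indicator {0..T} \<tau> \<partial>lborel) \<le> ennreal (coll_const T \<epsilon>) * N"
    using B.coll_estimate[OF T \<epsilon> h[unfolded idx_Suc(2)] hm[unfolded idx_Suc(2)], of dsign]
    unfolding idx_Suc(2)[symmetric] propag_hat h_def N_def by (simp add: dsign_def)
  have mA: "(\<lambda>(\<tau>, q). A.coll (propag \<phi> \<tau>) q) \<in> borel_measurable (lborel \<Otimes>\<^sub>M leb (idx k))"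
    using A.coll_propagate_measurable[OF hm[unfolded idx_Suc(1)], of dsign] by (simp only: propag_hat h_def idx_Suc(1)[symmetric])
  have mB: "(\<lambda>(\<tau>, q). B.coll (propag \<phi> \<tau>) q) \<in> borel_measurable (lborel \<Otimes>\<^sub>M leb (idx k))"
    using B.coll_propagate_measurable[OF hm[unfolded idx_Suc(2)], of dsign] by (simp only: propag_hat h_def idx_Suc(2)[symmetric])
  interpret sigma_finite_measure "leb (idx k)" by (rule leb_sigma_finite[OF finite_idx])
  have m3: "(\<lambda>w. jw \<epsilon> (idx k) (snd w)) \<in> borel_measurable (lborel \<Otimes>\<^sub>M leb (idx k))"
    by (rule measurable_compose[OF measurable_snd jw_measurable])
  note [measurable] = mA mB m3
  have [measurable]: "?EA \<in> borel_measurable lborel" "?EB \<in> borel_measurable lborel"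
    by (rule borel_measurable_nn_integral; measurable)+
  have pw: "sq2 k (RBU \<epsilon> j k \<phi> \<tau>) \<le> ennreal kc * (2 * ?EA \<tau> + 2 * ?EB \<tau>)" for \<tau>
  proof -
    have [measurable]: "(\<lambda>q. A.coll (propag \<phi> \<tau>) q) \<in> borel_measurable (leb (idx k))" "(\<lambda>q. B.coll (propag \<phi> \<tau>) q) \<in> borel_measurable (leb (idx k))"
      using measurable_Pair2[OF mA, of \<tau>] measurable_Pair2[OF mB, of \<tau>] by simp_all
    have "(\<integral>\<^sup>+q. (ennreal (jw \<epsilon> (idx k) q * norm (bhat \<phi> \<tau> q)))\<^sup>2 \<partial>leb (idx k)) \<le>
      (\<integral>\<^sup>+q. 2 * (ennreal (jw \<epsilon> (idx k) q * norm (A.coll (propag \<phi> \<tau>) q)))\<^sup>2 + 2 * (ennreal (jw \<epsilon> (idx k) q * norm (B.coll (propag \<phi> \<tau>) q)))\<^sup>2 \<partial>leb (idx k))"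
    proof (intro nn_integral_mono)
      fix q :: "nat + nat \<Rightarrow> real"
      let ?J = "complex_of_real (jw \<epsilon> (idx k) q)"
      have e: "jw \<epsilon> (idx k) q * norm z = norm (?J * z)" for z
        by (simp add: norm_mult jw_nonneg)
      show "(ennreal (jw \<epsilon> (idx k) q * norm (bhat \<phi> \<tau> q)))\<^sup>2 \<le> 2 * (ennreal (jw \<epsilon> (idx k) q * norm (A.coll (propag \<phi> \<tau>) q)))\<^sup>2 + 2 * (ennreal (jw \<epsilon> (idx k) q * norm (B.coll (propag \<phi> \<tau>) q)))\<^sup>2"
        unfolding e bhat_def right_diff_distrib by (rule norm_diff_power2_le)
    qed
    also have "\<dots> = 2 * ?EA \<tau> + 2 * ?EB \<tau>"
      by (simp add: nn_integral_add nn_integral_cmult)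
    finally show ?thesis
      unfolding RBU_sq2(2)[OF \<phi> less_imp_le[OF \<epsilon>]] kc_def by (rule mult_left_mono) simp
  qed
  have S: "{\<tau>. 0 \<le> \<tau> \<and> ereal \<tau> \<le> ereal T} = {0..T}" by auto
  have "tsq2 (ereal T) k (RBU \<epsilon> j k \<phi>) \<le> (\<integral>\<^sup>+\<tau>. ennreal kc * (2 * (?EA \<tau> * indicator {0..T} \<tau>) + 2 * (?EB \<tau> * indicator {0..T} \<tau>)) \<partial>lborel)"
    unfolding tsq2_def S
  proof (intro nn_integral_mono)
    fix \<tau>
    show "sq2 k (RBU \<epsilon> j k \<phi> \<tau>) * indicator {0..T} \<tau> \<le> ennreal kc * (2 * (?EA \<tau> * indicator {0..T} \<tau>) + 2 * (?EB \<tau> * indicator {0..T} \<tau>))"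
      using pw[of \<tau>] by (cases "\<tau> \<in> {0..T}") auto
  qed
  also have "\<dots> = ennreal kc * (2 * (\<integral>\<^sup>+\<tau>. ?EA \<tau> * indicator {0..T} \<tau> \<partial>lborel) + 2 * (\<integral>\<^sup>+\<tau>. ?EB \<tau> * indicator {0..T} \<tau> \<partial>lborel))"
    by (simp add: nn_integral_cmult nn_integral_add)
  also have "\<dots> \<le> ennreal kc * (2 * (ennreal (coll_const T \<epsilon>) * N) + 2 * (ennreal (coll_const T \<epsilon>) * N))"
    by (intro mult_left_mono add_mono EA EB) auto
  also have "\<dots> = ennreal (est_const T \<epsilon>) * sq2 (Suc k) (R (Suc k) \<epsilon> \<phi>)"
  proof -
    define D where "D = coll_const T \<epsilon>"
    have D: "0 \<le> D" unfolding D_def by (rule coll_const_nonneg[OF T])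
    have "ennreal kc * (2 * (ennreal D * N) + 2 * (ennreal D * N)) = ennreal kc * (4 * (ennreal D * N))"
      by (simp flip: distrib_right)
    also have "\<dots> = ennreal (kc * (4 * D)) * N"
    proof -
      have "0 \<le> kc" by (simp add: kc_def)
      then have "ennreal (kc * (4 * D)) = ennreal kc * (ennreal 4 * ennreal D)"
        by (simp only: ennreal_mult' zero_le_numeral)
      then show ?thesis by (simp add: mult.assoc)
    qed
    also have "kc * (4 * D) = est_const T \<epsilon> * (1 / (2 * pi) ^ (2 * Suc k))"
      by (simp add: kc_def est_const_def D_def power_add power2_eq_square eval_nat_numeral)
    also have "ennreal \<dots> * N = ennreal (est_const T \<epsilon>) * sq2 (Suc k) (R (Suc k) \<epsilon> \<phi>)"
      unfolding R_sq2(2)[OF \<phi> less_imp_le[OF \<epsilon>]] N_def h_def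
      by (subst ennreal_mult'') (auto simp: mult.assoc)
    finally show ?thesis unfolding D_def .
  qed
  finally show ?thesis .
qed

end

section \<open>Closure of the operator on general data\<close>

subsection \<open>Extension by density\<close>

text \<open>The argument of Riesz and Fischer, giving an almost everywhere limit. Along a
  subsequence with b at most 8^(-i), the squared increments weighted by 2^i have a summable
  integral; where the weighted sum is finite, the increments are bounded by a geometric sequence of
  ratio 1 / sqrt 2.\<close>

lemma L2_cauchy_subsequence:
  fixes G :: "nat \<Rightarrow> 'a \<Rightarrow> complex"
  assumes G [measurable]: "\<And>m. G m \<in> borel_measurable M"
    and b: "\<And>m l. (\<integral>\<^sup>+x. (ennreal (norm (G m x - G l x)))\<^sup>2 \<partial>M) \<le> b m + b l" "b \<longlonglongrightarrow> 0"
  shows "\<exists>r F. strict_mono r \<and> F \<in> borel_measurable M \<and> (AE x in M. (\<lambda>i. G (r i) x) \<longlonglongrightarrow> F x)"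
proof -
  have "\<exists>K. \<forall>m\<ge>K. b m \<le> ennreal ((1 / 8) ^ i)" for i :: nat
  proof -
    have "eventually (\<lambda>m. b m < ennreal ((1 / 8) ^ i)) sequentially"
      by (rule order_tendstoD(2)[OF b(2)]) simp
    then show ?thesis unfolding eventually_sequentially by (meson less_imp_le)
  qed
  then obtain K where K: "\<And>i m. K i \<le> m \<Longrightarrow> b m \<le> ennreal ((1 / 8) ^ i)" by metis
  \<comment> \<open>The sum of thresholds puts \<open>r i\<close> above \<open>K i\<close>, and the
    added i makes the sequence strictly increasing.\<close>
  define r where "r i = (\<Sum>l\<le>i. K l) + i" for i
  have r: "strict_mono r" unfolding strict_mono_Suc_iff by (simp add: r_def)
  have rK: "b (r i) \<le> ennreal ((1 / 8) ^ i)" for i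
    by (rule K) (simp add: r_def sum_up_index_split member_le_sum trans_le_add1)
  define \<Delta> where "\<Delta> i x = G (r (Suc i)) x - G (r i) x" for i x
  have [measurable]: "\<Delta> i \<in> borel_measurable M" for i unfolding \<Delta>_def by measurable
  have "(\<integral>\<^sup>+x. (\<Sum>i. ennreal (2 ^ i) * (ennreal (norm (\<Delta> i x)))\<^sup>2) \<partial>M) = (\<Sum>i. \<integral>\<^sup>+x. ennreal (2 ^ i) * (ennreal (norm (\<Delta> i x)))\<^sup>2 \<partial>M)"
    by (rule nn_integral_suminf) measurable
  also have "\<dots> \<le> (\<Sum>i. ennreal (2 * (1 / 4) ^ i))"
  proof (rule suminf_le)
    fix i
    have "(\<integral>\<^sup>+x. ennreal (2 ^ i) * (ennreal (norm (\<Delta> i x)))\<^sup>2 \<partial>M) = ennreal (2 ^ i) * (\<integral>\<^sup>+x. (ennreal (norm (\<Delta> i x)))\<^sup>2 \<partial>M)"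
      by (rule nn_integral_cmult) measurable
    also have "\<dots> \<le> ennreal (2 ^ i) * (b (r (Suc i)) + b (r i))"
      unfolding \<Delta>_def by (intro mult_left_mono b) simp
    also have "\<dots> \<le> ennreal (2 ^ i) * (ennreal ((1 / 8) ^ i) + ennreal ((1 / 8) ^ i))"
    proof (intro mult_left_mono add_mono rK order.trans[OF rK] ennreal_leI)
      show "(1 / 8 :: real) ^ Suc i \<le> (1 / 8) ^ i" by (intro power_decreasing) auto
    qed simp
    also have "\<dots> = ennreal (2 ^ i * (2 * (1 / 8) ^ i))"
      by (simp add: ennreal_mult' flip: ennreal_plus)
    also have "(2::real) ^ i * (2 * (1 / 8) ^ i) = 2 * (1 / 4) ^ i"
      by (simp add: mult.left_commute flip: power_mult_distrib)
    finally show "(\<integral>\<^sup>+x. ennreal (2 ^ i) * (ennreal (norm (\<Delta> i x)))\<^sup>2 \<partial>M) \<le> ennreal (2 * (1 / 4) ^ i)" .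
  qed auto
  also have "\<dots> < \<infinity>"
  proof -
    have "summable (\<lambda>i. 2 * (1 / 4 :: real) ^ i)" by (intro summable_mult summable_geometric) simp
    then show ?thesis by (simp add: suminf_ennreal2 less_top[symmetric])
  qed
  finally have "(\<integral>\<^sup>+x. (\<Sum>i. ennreal (2 ^ i) * (ennreal (norm (\<Delta> i x)))\<^sup>2) \<partial>M) \<noteq> \<infinity>" by simp
  then have "AE x in M. (\<Sum>i. ennreal (2 ^ i) * (ennreal (norm (\<Delta> i x)))\<^sup>2) \<noteq> \<infinity>"
    by (intro nn_integral_noteq_infinite) measurable
  then have conv: "AE x in M. convergent (\<lambda>i. G (r i) x)"
  proof (rule AE_mp, intro AE_I2 impI)
    fix x assume fin: "(\<Sum>i. ennreal (2 ^ i) * (ennreal (norm (\<Delta> i x)))\<^sup>2) \<noteq> \<infinity>"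
    define C where "C = enn2real (\<Sum>i. ennreal (2 ^ i) * (ennreal (norm (\<Delta> i x)))\<^sup>2)"
    have bd: "norm (\<Delta> i x) \<le> sqrt C * (1 / sqrt 2) ^ i" for i
    proof -
      have "ennreal (2 ^ i * (norm (\<Delta> i x))\<^sup>2) = ennreal (2 ^ i) * (ennreal (norm (\<Delta> i x)))\<^sup>2"
        by (simp add: ennreal_mult' ennreal_power)
      also have "\<dots> \<le> (\<Sum>i. ennreal (2 ^ i) * (ennreal (norm (\<Delta> i x)))\<^sup>2)"
        using sum_le_suminf[of "\<lambda>i. ennreal (2 ^ i) * (ennreal (norm (\<Delta> i x)))\<^sup>2" "{i}"] by simp
      also have "\<dots> = ennreal C" using fin by (simp add: C_def less_top)
      finally have "2 ^ i * (norm (\<Delta> i x))\<^sup>2 \<le> C" by (simp add: C_def)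
      then have "sqrt (2 ^ i * (norm (\<Delta> i x))\<^sup>2) \<le> sqrt C" by (rule real_sqrt_le_mono)
      then have "(sqrt 2) ^ i * norm (\<Delta> i x) \<le> sqrt C" by (simp add: real_sqrt_mult real_sqrt_power)
      then show ?thesis by (simp add: power_one_over field_simps)
    qed
    have "summable (\<lambda>i. \<Delta> i x)"
    proof (rule summable_comparison_test')
      show "summable (\<lambda>i. sqrt C * (1 / sqrt 2) ^ i)"
        by (intro summable_mult summable_geometric) simp
    qed (use bd in auto)
    then have "convergent (\<lambda>n. \<Sum>i<n. \<Delta> i x)" by (simp add: summable_iff_convergent)
    then have "convergent (\<lambda>n. G (r 0) x + (\<Sum>i<n. \<Delta> i x))" by (intro convergent_add convergent_const)
    moreover have "G (r 0) x + (\<Sum>i<n. \<Delta> i x) = G (r n) x" for n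
      using sum_lessThan_telescope[of "\<lambda>i. G (r i) x" n] by (simp add: \<Delta>_def)
    ultimately show "convergent (\<lambda>i. G (r i) x)" by simp
  qed
  define F where "F x = lim (\<lambda>i. G (r i) x)" for x
  have "F \<in> borel_measurable M" unfolding F_def by (rule borel_measurable_lim_metric) measurable
  moreover have "AE x in M. (\<lambda>i. G (r i) x) \<longlonglongrightarrow> F x"
    using conv by (rule AE_mp) (auto simp: F_def convergent_LIMSEQ_iff)
  ultimately show ?thesis using r by blast
qed

lemma fatou_le:
  fixes h :: "nat \<Rightarrow> 'a \<Rightarrow> ennreal"
  assumes [measurable]: "\<And>i. h i \<in> borel_measurable M" "g \<in> borel_measurable M"
    and lim: "AE x in M. (\<lambda>i. h i x) \<longlonglongrightarrow> g x" and c: "\<And>i. (\<integral>\<^sup>+x. h i x \<partial>M) \<le> c i" "c \<longlonglongrightarrow> d"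
  shows "(\<integral>\<^sup>+x. g x \<partial>M) \<le> d"
proof -
  have "(\<integral>\<^sup>+x. g x \<partial>M) = (\<integral>\<^sup>+x. liminf (\<lambda>i. h i x) \<partial>M)"
    by (rule nn_integral_cong_AE, rule AE_mp[OF lim])
       (auto intro!: AE_I2 lim_imp_Liminf[symmetric])
  also have "\<dots> \<le> liminf (\<lambda>i. \<integral>\<^sup>+x. h i x \<partial>M)"
    by (rule nn_integral_liminf) measurable
  also have "\<dots> \<le> liminf c" by (intro Liminf_mono always_eventually allI c)
  also have "\<dots> = d" using c(2) by (intro lim_imp_Liminf) auto
  finally show ?thesis .
qed

lemma config_sigma_finite: "sigma_finite_measure (config n)"
proof -
  interpret L: sigma_finite_measure "leb {1..n} :: (nat \<Rightarrow> real) measure" by (rule leb_sigma_finite) simp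
  show ?thesis unfolding config_def by (rule sigma_finite_pair_measure) (rule L.sigma_finite_measure_axioms)+
qed

text \<open>With the time cutoff as a density, the mixed norm on [0, T] is an L^2 norm for a single
  measure, to which completeness applies.\<close>

definition slab :: "real \<Rightarrow> nat \<Rightarrow> (real \<times> point) measure" where
  "slab T n = density (lborel \<Otimes>\<^sub>M config n) (\<lambda>w. indicator {0..T} (fst w))"

lemma sets_slab [measurable_cong]: "sets (slab T n) = sets (lborel \<Otimes>\<^sub>M config n)"
  by (simp add: slab_def)

lemma tsq2_slab:
  assumes [measurable]: "(\<lambda>(\<tau>, p). F \<tau> p) \<in> borel_measurable (lborel \<Otimes>\<^sub>M config n)"
  shows "tsq2 (ereal T) n F = (\<integral>\<^sup>+w. (ennreal (norm (F (fst w) (snd w))))\<^sup>2 \<partial>slab T n)"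
proof -
  interpret sigma_finite_measure "config n" by (rule config_sigma_finite)
  have S: "{\<tau>. 0 \<le> \<tau> \<and> ereal \<tau> \<le> ereal T} = {0..T}" by auto
  have m: "(\<lambda>w. F (fst w) (snd w)) \<in> borel_measurable (lborel \<Otimes>\<^sub>M config n)"
    using assms by (simp add: split_def)
  note [measurable] = m
  have "(\<integral>\<^sup>+w. (ennreal (norm (F (fst w) (snd w))))\<^sup>2 \<partial>slab T n) =
     (\<integral>\<^sup>+w. indicator {0..T} (fst w) * (ennreal (norm (F (fst w) (snd w))))\<^sup>2 \<partial>(lborel \<Otimes>\<^sub>M config n))"
    unfolding slab_def by (rule nn_integral_density) measurable
  also have "\<dots> = (\<integral>\<^sup>+\<tau>. \<integral>\<^sup>+p. indicator {0..T} \<tau> * (ennreal (norm (F \<tau> p)))\<^sup>2 \<partial>config n \<partial>lborel)"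
  proof -
    have "(\<lambda>w. indicator {0..T} (fst w) * (ennreal (norm (F (fst w) (snd w))))\<^sup>2) \<in> borel_measurable (lborel \<Otimes>\<^sub>M config n)"
      by measurable
    from nn_integral_fst[OF this] show ?thesis by simp
  qed
  also have "\<dots> = (\<integral>\<^sup>+\<tau>. sq2 n (F \<tau>) * indicator {0..T} \<tau> \<partial>lborel)"
  proof (intro nn_integral_cong)
    fix \<tau> :: real
    show "(\<integral>\<^sup>+p. indicator {0..T} \<tau> * (ennreal (norm (F \<tau> p)))\<^sup>2 \<partial>config n) = sq2 n (F \<tau>) * indicator {0..T} \<tau>"
      by (cases "\<tau> \<in> {0..T}") (auto simp: sq2_def)
  qed
  finally show ?thesis unfolding tsq2_def S by simp
qed

context particle
begin

text \<open>F is the almost everywhere limit along a subsequence of one approximating sequence. Its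
  distance to the image of any Schwartz u is controlled by \<open>a u\<close> alone, so every
  approximating sequence converges to the same F. The factor 2 comes from splitting squares of
  differences.\<close>

theorem RBU_extension:
  assumes T: "0 < T" and \<epsilon>: "0 < \<epsilon>" and rel: "R_rel \<epsilon> (Suc k) \<phi> g"
  shows "\<exists>F. RBU_rel (ereal T) \<epsilon> j k \<phi> g F \<and> tsq2 (ereal T) k F \<le> ennreal (2 * est_const T \<epsilon>) * sq2 (Suc k) g"
proof -
  have \<epsilon>0: "0 \<le> \<epsilon>" using \<epsilon> by simp
  obtain f where f: "approximates \<epsilon> (Suc k) f \<phi> g" and g: "square_integrable (Suc k) g"
    using rel by (auto simp: R_rel_def)
  have gm [measurable]: "g \<in> borel_measurable (config (Suc k))" and gfin: "sq2 (Suc k) g < \<infinity>"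
    using g by (auto simp: square_integrable_def L2norm_eq ennsqrt_less_top[unfolded infinity_ennreal_def])
  define E where "E = est_const T \<epsilon>"
  have E: "0 \<le> E" unfolding E_def est_const_def using coll_const_nonneg[OF T] by simp
  have E2: "ennreal (2 * E) = 2 * ennreal E" using E by (simp add: ennreal_mult')
  let ?G = "\<lambda>u (w :: real \<times> point). RBU \<epsilon> j k u (fst w) (snd w)"
  define a where "a u = sq2 (Suc k) (\<lambda>p. R (Suc k) \<epsilon> u p - g p)" for u
  have approx: "schwartz (Suc k) (u m)" "(\<lambda>m. a (u m)) \<longlonglongrightarrow> 0" if "approximates \<epsilon> (Suc k) u \<phi> g" for u m
    using that by (auto simp: approximates_def L2norm_eq tendsto_ennsqrt_zero_iff a_def)
  have Gm [measurable]: "?G u \<in> borel_measurable (lborel \<Otimes>\<^sub>M config k)" if "schwartz (Suc k) u" for u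
    using RBU_measurable[OF that, of \<epsilon>] by (simp add: split_def)
  have Rm [measurable]: "R (Suc k) \<epsilon> u \<in> borel_measurable (config (Suc k))" if "schwartz (Suc k) u" for u
    using R_sq2(1)[OF that \<epsilon>0] .
  \<comment> \<open>By linearity the difference of two images is the image of the difference;
    inserting g then separates the two approximation errors.\<close>
  have diff: "(\<integral>\<^sup>+w. (ennreal (norm (?G u w - ?G v w)))\<^sup>2 \<partial>slab T k) \<le> ennreal (2 * E) * a u + ennreal (2 * E) * a v"
    if u: "schwartz (Suc k) u" and v: "schwartz (Suc k) v" for u v
  proof -
    have "(\<integral>\<^sup>+w. (ennreal (norm (?G u w - ?G v w)))\<^sup>2 \<partial>slab T k) = (\<integral>\<^sup>+w. (ennreal (norm (?G (\<lambda>p. u p - v p) w)))\<^sup>2 \<partial>slab T k)"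
      by (intro nn_integral_cong) (auto simp: slab_def space_pair_measure RBU_diff[OF u v \<epsilon>0])
    also have "\<dots> = tsq2 (ereal T) k (RBU \<epsilon> j k (\<lambda>p. u p - v p))"
      by (rule tsq2_slab[symmetric]) (rule RBU_measurable[OF schwartz_diff[OF u v]])
    also have "\<dots> \<le> ennreal E * sq2 (Suc k) (R (Suc k) \<epsilon> (\<lambda>p. u p - v p))"
      unfolding E_def by (rule smoothing_sq2[OF T \<epsilon> schwartz_diff[OF u v]])
    also have "sq2 (Suc k) (R (Suc k) \<epsilon> (\<lambda>p. u p - v p)) = sq2 (Suc k) (\<lambda>p. (R (Suc k) \<epsilon> u p - g p) - (R (Suc k) \<epsilon> v p - g p))"
      by (intro sq2_cong) (simp add: R_diff[OF u v \<epsilon>0])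
    also have "ennreal E * \<dots> \<le> ennreal E * (2 * a u + 2 * a v)"
      unfolding a_def using u v by (intro mult_left_mono sq2_diff_le) measurable
    also have "\<dots> = ennreal (2 * E) * a u + ennreal (2 * E) * a v"
      unfolding E2 by (simp only: distrib_left mult_ac)
    finally show ?thesis .
  qed
  note fs = approx(1)[OF f] and fa = approx(2)[OF f]
  have ztend: "(\<lambda>m. ennreal (2 * E) * a (f m)) \<longlonglongrightarrow> 0"
    using ennreal_tendsto_cmult[OF _ fa, of "ennreal (2 * E)"] by simp
  have Gms: "?G u \<in> borel_measurable (slab T k)" if "schwartz (Suc k) u" for u
    using Gm[OF that] measurable_cong_sets[OF sets_slab refl] by blast
  obtain r F0 where r: "strict_mono r" and F0: "F0 \<in> borel_measurable (slab T k)"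
    and lim: "AE w in slab T k. (\<lambda>i. ?G (f (r i)) w) \<longlonglongrightarrow> F0 w"
    using L2_cauchy_subsequence[OF Gms[OF fs] diff[OF fs fs] ztend] by blast
  have F0' [measurable]: "F0 \<in> borel_measurable (lborel \<Otimes>\<^sub>M config k)"
    using F0 measurable_cong_sets[OF sets_slab refl] by blast
  define F where "F \<tau> p = F0 (\<tau>, p)" for \<tau> p
  have Fm: "(\<lambda>(\<tau>, p). F \<tau> p) \<in> borel_measurable (lborel \<Otimes>\<^sub>M config k)" by (simp add: F_def split_def)
  have far: "(\<lambda>i. a (f (r i))) \<longlonglongrightarrow> 0" using LIMSEQ_subseq_LIMSEQ[OF fa r] by (simp add: comp_def)
  \<comment> \<open>u stays fixed while the other argument runs along the subsequence; Fatou
    replaces its image by \<open>F0\<close> and its error by 0.\<close>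
  have close: "tsq2 (ereal T) k (\<lambda>\<tau> p. RBU \<epsilon> j k u \<tau> p - F \<tau> p) \<le> ennreal (2 * E) * a u" if u: "schwartz (Suc k) u" for u
  proof -
    note [measurable] = Gm[OF u] Gms[OF u] Gms[OF fs] F0
    have "tsq2 (ereal T) k (\<lambda>\<tau> p. RBU \<epsilon> j k u \<tau> p - F \<tau> p) = (\<integral>\<^sup>+w. (ennreal (norm (?G u w - F0 w)))\<^sup>2 \<partial>slab T k)"
      by (subst tsq2_slab) (auto simp: F_def split_def)
    also have "\<dots> \<le> ennreal (2 * E) * a u + ennreal (2 * E) * 0"
    proof (rule fatou_le[where h="\<lambda>i w. (ennreal (norm (?G u w - ?G (f (r i)) w)))\<^sup>2" and c="\<lambda>i. ennreal (2 * E) * a u + ennreal (2 * E) * a (f (r i))"])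
      show "AE w in slab T k. (\<lambda>i. (ennreal (norm (?G u w - ?G (f (r i)) w)))\<^sup>2) \<longlonglongrightarrow> (ennreal (norm (?G u w - F0 w)))\<^sup>2"
        using lim
      proof (rule AE_mp, intro AE_I2 impI)
        fix w assume "(\<lambda>i. ?G (f (r i)) w) \<longlonglongrightarrow> F0 w"
        then have "(\<lambda>i. ennreal ((norm (?G u w - ?G (f (r i)) w))\<^sup>2)) \<longlonglongrightarrow> ennreal ((norm (?G u w - F0 w))\<^sup>2)"
          by (intro tendsto_ennrealI tendsto_intros)
        then show "(\<lambda>i. (ennreal (norm (?G u w - ?G (f (r i)) w)))\<^sup>2) \<longlonglongrightarrow> (ennreal (norm (?G u w - F0 w)))\<^sup>2"
          by (simp add: ennreal_power)
      qed
      show "(\<lambda>i. ennreal (2 * E) * a u + ennreal (2 * E) * a (f (r i))) \<longlonglongrightarrow> ennreal (2 * E) * a u + ennreal (2 * E) * 0"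
        by (intro tendsto_add tendsto_const ennreal_tendsto_cmult far) simp
      show "(\<integral>\<^sup>+w. (ennreal (norm (?G u w - ?G (f (r i)) w)))\<^sup>2 \<partial>slab T k) \<le> ennreal (2 * E) * a u + ennreal (2 * E) * a (f (r i))" for i
        by (rule diff[OF u fs])
      show "(\<lambda>w. (ennreal (norm (?G u w - ?G (f (r i)) w)))\<^sup>2) \<in> borel_measurable (slab T k)" for i
        using Gms[OF u] Gms[OF fs, of "r i"] by measurable
      show "(\<lambda>w. (ennreal (norm (?G u w - F0 w)))\<^sup>2) \<in> borel_measurable (slab T k)"
        using Gms[OF u] F0 by measurable
    qed
    finally show ?thesis by simp
  qed
  have Fb: "tsq2 (ereal T) k F \<le> ennreal (2 * E) * sq2 (Suc k) g"
  proof -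
    note [measurable] = Gms[OF fs] F0
    have "tsq2 (ereal T) k F = (\<integral>\<^sup>+w. (ennreal (norm (F0 w)))\<^sup>2 \<partial>slab T k)"
      by (subst tsq2_slab[OF Fm]) (simp add: F_def)
    also have "\<dots> \<le> ennreal E * (2 * 0 + 2 * sq2 (Suc k) g)"
    proof (rule fatou_le[where h="\<lambda>i w. (ennreal (norm (?G (f (r i)) w)))\<^sup>2" and c="\<lambda>i. ennreal E * (2 * a (f (r i)) + 2 * sq2 (Suc k) g)"])
      show "AE w in slab T k. (\<lambda>i. (ennreal (norm (?G (f (r i)) w)))\<^sup>2) \<longlonglongrightarrow> (ennreal (norm (F0 w)))\<^sup>2"
        using lim
      proof (rule AE_mp, intro AE_I2 impI)
        fix w assume "(\<lambda>i. ?G (f (r i)) w) \<longlonglongrightarrow> F0 w"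
        then have "(\<lambda>i. ennreal ((norm (?G (f (r i)) w))\<^sup>2)) \<longlonglongrightarrow> ennreal ((norm (F0 w))\<^sup>2)"
          by (intro tendsto_ennrealI tendsto_intros)
        then show "(\<lambda>i. (ennreal (norm (?G (f (r i)) w)))\<^sup>2) \<longlonglongrightarrow> (ennreal (norm (F0 w)))\<^sup>2"
          by (simp add: ennreal_power)
      qed
      show "(\<lambda>i. ennreal E * (2 * a (f (r i)) + 2 * sq2 (Suc k) g)) \<longlonglongrightarrow> ennreal E * (2 * 0 + 2 * sq2 (Suc k) g)"
        by (intro tendsto_add tendsto_const ennreal_tendsto_cmult far) simp_all
      show "(\<integral>\<^sup>+w. (ennreal (norm (?G (f (r i)) w)))\<^sup>2 \<partial>slab T k) \<le> ennreal E * (2 * a (f (r i)) + 2 * sq2 (Suc k) g)" for i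
      proof -
        let ?u = "f (r i)"
        have "(\<integral>\<^sup>+w. (ennreal (norm (?G ?u w)))\<^sup>2 \<partial>slab T k) = tsq2 (ereal T) k (RBU \<epsilon> j k ?u)"
          by (rule tsq2_slab[symmetric]) (rule RBU_measurable[OF fs])
        also have "\<dots> \<le> ennreal E * sq2 (Suc k) (R (Suc k) \<epsilon> ?u)"
          unfolding E_def by (rule smoothing_sq2[OF T \<epsilon> fs])
        \<comment> \<open>Written as the difference of the error and \<open>- g\<close>, the square
          splits into a part tending to 0 and the norm of g.\<close>
        also have "sq2 (Suc k) (R (Suc k) \<epsilon> ?u) = sq2 (Suc k) (\<lambda>p. (R (Suc k) \<epsilon> ?u p - g p) - - g p)" by simp
        also have "\<dots> \<le> 2 * a ?u + 2 * sq2 (Suc k) (\<lambda>p. - g p)"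
          unfolding a_def by (intro sq2_diff_le borel_measurable_diff borel_measurable_uminus Rm fs gm)
        also have "sq2 (Suc k) (\<lambda>p. - g p) = sq2 (Suc k) g" by (simp add: sq2_def)
        finally show ?thesis by (simp add: mult_left_mono)
      qed
    qed measurable
    also have "\<dots> = ennreal (2 * E) * sq2 (Suc k) g" unfolding E2 by (simp add: mult_ac)
    finally show ?thesis .
  qed
  have "RBU_rel (ereal T) \<epsilon> j k \<phi> g F"
    unfolding RBU_rel_def
  proof (intro conjI allI impI Fm)
    have "ennreal (2 * E) * sq2 (Suc k) g < \<infinity>" using gfin by (simp add: ennreal_mult_less_top)
    with Fb have "tsq2 (ereal T) k F < \<infinity>" by (rule order.strict_trans1)
    then show "L2L2norm (ereal T) k F < \<infinity>" by (simp only: L2L2norm_eq ennsqrt_less_top)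
    fix u assume u: "approximates \<epsilon> (Suc k) u \<phi> g"
    note us = approx(1)[OF u] and ua = approx(2)[OF u]
    show "(\<lambda>m. L2L2norm (ereal T) k (\<lambda>\<tau> p. RBU \<epsilon> j k (u m) \<tau> p - F \<tau> p)) \<longlonglongrightarrow> 0"
      unfolding L2L2norm_eq tendsto_ennsqrt_zero_iff
    proof (rule tendsto_sandwich[OF _ _ tendsto_const])
      show "(\<lambda>m. ennreal (2 * E) * a (u m)) \<longlonglongrightarrow> 0"
        using ennreal_tendsto_cmult[OF _ ua, of "ennreal (2 * E)"] by simp
    qed (auto intro!: always_eventually close us)
  qed
  then show ?thesis using Fb unfolding E_def by blast
qed

end

section \<open>Counterexamples at the endpoints\<close>

subsection \<open>Planar Gaussian integrals\<close>

text \<open>Integration in the second variable turns the phase into an additional Gaussian weight in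
  the first. The value depends on \<alpha> and \<beta> only through their product, which expresses
  the invariance under hyperbolic scaling.\<close>

lemma gaussian2:
  fixes \<alpha> \<beta> t m n :: real
  assumes \<alpha>: "0 < \<alpha>" and \<beta>: "0 < \<beta>"
  shows "has_bochner_integral lborel2
     (\<lambda>z. cis (t * ((fst z + snd z - m) * (fst z - n))) * of_real (exp (- \<alpha> * (fst z + snd z - m)\<^sup>2) * exp (- \<beta> * (fst z - n)\<^sup>2)))
     (of_real (pi / sqrt (\<alpha> * \<beta> + t\<^sup>2 / 4)))"
proof -
  let ?f = "\<lambda>z. cis (t * ((fst z + snd z - m) * (fst z - n))) * of_real (exp (- \<alpha> * (fst z + snd z - m)\<^sup>2) * exp (- \<beta> * (fst z - n)\<^sup>2))"
  have inner: "has_bochner_integral lborel (\<lambda>b. cis (\<theta> * ((a + b - m) * (a - n))) * of_real (exp (- \<alpha> * (a + b - m)\<^sup>2) * exp (- \<beta> * (a - n)\<^sup>2)))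
     (of_real (sqrt (pi / \<alpha>) * exp (- (\<beta> + \<theta>\<^sup>2 / (4 * \<alpha>)) * (a - n)\<^sup>2)))" for a \<theta>
  proof -
    have "has_bochner_integral lborel (\<lambda>p. cis (\<theta> * (a - n) * p) * of_real (exp (- \<alpha> * p\<^sup>2)))
       (of_real (sqrt (pi / \<alpha>) * exp (- (\<theta> * (a - n))\<^sup>2 / (4 * \<alpha>))))"
      by (rule gaussian_fourier[OF \<alpha>])
    then have "has_bochner_integral lborel (\<lambda>b. cis (\<theta> * (a - n) * ((a - m) + 1 * b)) * of_real (exp (- \<alpha> * ((a - m) + 1 * b)\<^sup>2)))
       (of_real (sqrt (pi / \<alpha>) * exp (- (\<theta> * (a - n))\<^sup>2 / (4 * \<alpha>))) /\<^sub>R \<bar>1\<bar>)"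
      by (subst (asm) lborel_has_bochner_integral_real_affine_iff[of 1 _ _ "a - m"]) auto
    from has_bochner_integral_mult_left[OF this, of "of_real (exp (- \<beta> * (a - n)\<^sup>2))"]
    have h: "has_bochner_integral lborel (\<lambda>b. cis (\<theta> * (a - n) * ((a - m) + 1 * b)) * of_real (exp (- \<alpha> * ((a - m) + 1 * b)\<^sup>2)) * of_real (exp (- \<beta> * (a - n)\<^sup>2)))
       ((of_real (sqrt (pi / \<alpha>) * exp (- (\<theta> * (a - n))\<^sup>2 / (4 * \<alpha>))) /\<^sub>R \<bar>1\<bar>) * of_real (exp (- \<beta> * (a - n)\<^sup>2)))" by simp
    have 1: "cis (\<theta> * (a - n) * ((a - m) + 1 * b)) * of_real (exp (- \<alpha> * ((a - m) + 1 * b)\<^sup>2)) * of_real (exp (- \<beta> * (a - n)\<^sup>2)) =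
       cis (\<theta> * ((a + b - m) * (a - n))) * of_real (exp (- \<alpha> * (a + b - m)\<^sup>2) * exp (- \<beta> * (a - n)\<^sup>2))" for b
      by (simp add: algebra_simps)
    have expeq: "exp (- (\<theta> * (a - n))\<^sup>2 / (4 * \<alpha>)) * exp (- \<beta> * (a - n)\<^sup>2) = exp (- (\<beta> + \<theta>\<^sup>2 / (4 * \<alpha>)) * (a - n)\<^sup>2)"
    proof -
      define X where "X = (a - n)\<^sup>2"
      have "- (\<theta> * (a - n))\<^sup>2 / (4 * \<alpha>) + - \<beta> * X = - (\<beta> + \<theta>\<^sup>2 / (4 * \<alpha>)) * X"
        unfolding power_mult_distrib X_def[symmetric] by (simp add: algebra_simps)
      then show ?thesis by (simp only: X_def[symmetric] exp_add[symmetric])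
    qed
    have 2: "(of_real (sqrt (pi / \<alpha>) * exp (- (\<theta> * (a - n))\<^sup>2 / (4 * \<alpha>))) /\<^sub>R \<bar>1\<bar>) * of_real (exp (- \<beta> * (a - n)\<^sup>2)) =
       complex_of_real (sqrt (pi / \<alpha>) * exp (- (\<beta> + \<theta>\<^sup>2 / (4 * \<alpha>)) * (a - n)\<^sup>2))"
      by (simp only: expeq[symmetric]) simp
    show ?thesis using h unfolding 1 2 .
  qed
  have outer: "has_bochner_integral lborel (\<lambda>a. exp (- \<gamma> * (a - n)\<^sup>2)) (sqrt (pi / \<gamma>))" if "0 < \<gamma>" for \<gamma>
    using gaussian_integral[OF that] by (subst (asm) lborel_has_bochner_integral_real_affine_iff[of 1 _ _ "- n"]) auto
  have fm: "?f \<in> borel_measurable lborel2" by measurable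
  have fi: "integrable lborel2 ?f"
  proof (rule lborel_pair.Fubini_integrable[OF fm])
    have "(\<integral>b. norm (?f (a, b)) \<partial>lborel) = sqrt (pi / \<alpha>) * exp (- \<beta> * (a - n)\<^sup>2)" for a
    proof -
      have "(\<integral>b. norm (?f (a, b)) \<partial>lborel) = (\<integral>b. exp (- \<alpha> * (a + b - m)\<^sup>2) * exp (- \<beta> * (a - n)\<^sup>2) \<partial>lborel)"
        by (simp add: norm_mult)
      also have "\<dots> = sqrt (pi / \<alpha>) * exp (- \<beta> * (a - n)\<^sup>2)"
        using has_bochner_integral_Re[OF inner[of 0 a]] by (simp add: has_bochner_integral_iff)
      finally show ?thesis .
    qed
    then show "integrable lborel (\<lambda>a. \<integral>b. norm (?f (a, b)) \<partial>lborel)"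
      using outer[OF \<beta>] by (simp add: has_bochner_integral_iff)
    show "AE a in lborel. integrable lborel (\<lambda>b. ?f (a, b))"
      using inner[of t] by (auto simp: has_bochner_integral_iff)
  qed
  have \<gamma>: "0 < \<beta> + t\<^sup>2 / (4 * \<alpha>)" using \<alpha> \<beta> by (simp add: add_pos_nonneg)
  have "integral\<^sup>L lborel2 ?f = (\<integral>a. \<integral>b. ?f (a, b) \<partial>lborel \<partial>lborel)"
    by (rule lborel_pair.integral_fst'[OF fi, symmetric])
  also have "\<dots> = (\<integral>a. complex_of_real (sqrt (pi / \<alpha>) * exp (- (\<beta> + t\<^sup>2 / (4 * \<alpha>)) * (a - n)\<^sup>2)) \<partial>lborel)"
    using inner[of t] by (intro Bochner_Integration.integral_cong refl) (simp only: fst_conv snd_conv has_bochner_integral_iff)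
  also have "\<dots> = of_real (sqrt (pi / \<alpha>) * sqrt (pi / (\<beta> + t\<^sup>2 / (4 * \<alpha>))))"
    using outer[OF \<gamma>] unfolding integral_complex_of_real by (simp add: has_bochner_integral_iff)
  also have "sqrt (pi / \<alpha>) * sqrt (pi / (\<beta> + t\<^sup>2 / (4 * \<alpha>))) = pi / sqrt (\<alpha> * \<beta> + t\<^sup>2 / 4)"
  proof -
    have "sqrt (pi / \<alpha>) * sqrt (pi / (\<beta> + t\<^sup>2 / (4 * \<alpha>))) = sqrt (pi\<^sup>2 / (\<alpha> * (\<beta> + t\<^sup>2 / (4 * \<alpha>))))"
      by (simp add: power2_eq_square flip: real_sqrt_mult)
    also have "\<alpha> * (\<beta> + t\<^sup>2 / (4 * \<alpha>)) = \<alpha> * \<beta> + t\<^sup>2 / 4" using \<alpha> by (simp add: distrib_left)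
    finally show ?thesis by (simp add: real_sqrt_divide)
  qed
  finally show ?thesis using fi by (simp add: has_bochner_integral_iff)
qed

lemma gaussian2_real:
  fixes \<alpha> \<beta> m n :: real
  assumes "0 < \<alpha>" "0 < \<beta>"
  shows "has_bochner_integral lborel2 (\<lambda>z. exp (- \<alpha> * (fst z + snd z - m)\<^sup>2) * exp (- \<beta> * (fst z - n)\<^sup>2)) (pi / sqrt (\<alpha> * \<beta>))"
  using has_bochner_integral_Re[OF gaussian2[OF assms, of 0 m n]] by simp

lemma nn_integral_gaussian2:
  fixes \<alpha> \<beta> m n :: real
  assumes "0 < \<alpha>" "0 < \<beta>"
  shows "(\<integral>\<^sup>+z. ennreal (exp (- \<alpha> * (fst z + snd z - m)\<^sup>2) * exp (- \<beta> * (fst z - n)\<^sup>2)) \<partial>lborel2) = ennreal (pi / sqrt (\<alpha> * \<beta>))"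
  using gaussian2_real[OF assms, of m n] by (simp add: nn_integral_eq_integral has_bochner_integral_iff)

lemma sum_half_power_le:
  assumes "finite A" "inj_on g A"
  shows "(\<Sum>l\<in>A. (1 / 2 :: real) ^ g l) \<le> 2"
proof -
  have "(\<Sum>l\<in>A. (1 / 2 :: real) ^ g l) = (\<Sum>m\<in>g ` A. (1 / 2) ^ m)"
    by (simp add: sum.reindex[OF assms(2)])
  also have "\<dots> \<le> (\<Sum>m. (1 / 2) ^ m)" using assms(1) by (intro sum_le_suminf) auto
  also have "\<dots> = 2" by (simp add: suminf_geometric)
  finally show ?thesis .
qed

text \<open>With u = 2^i and v = 2^l the radicand is the square of (S / 2) (u / v + v / u), so the
  overlap of the Gaussians i and l decays like 2^(-|i - l|).\<close>

lemma dyadic_overlap: "pi / sqrt ((S / 2 * (1 / 4 ^ i + 1 / 4 ^ l)) * (S / 2 * (4 ^ i + 4 ^ l))) \<le> 2 * pi / S * (1 / 2) ^ (if l \<le> i then i - l else l - i)"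
  if S: "0 < S" for S :: real
proof -
  define u v :: real where "u = 2 ^ i" and "v = 2 ^ l"
  have uv: "0 < u" "0 < v" by (auto simp: u_def v_def)
  have p4: "(4::real) ^ i = u\<^sup>2" "(4::real) ^ l = v\<^sup>2"
    by (simp_all add: u_def v_def power2_eq_square flip: power_mult_distrib)
  have "(S / 2 * (1 / 4 ^ i + 1 / 4 ^ l)) * (S / 2 * (4 ^ i + 4 ^ l)) = (S / 2 * (u / v + v / u))\<^sup>2"
    unfolding p4 using uv by (simp add: field_simps power2_eq_square)
  then have "sqrt ((S / 2 * (1 / 4 ^ i + 1 / 4 ^ l)) * (S / 2 * (4 ^ i + 4 ^ l))) = S / 2 * (u / v + v / u)"
    using S uv by (simp add: add_nonneg_nonneg)
  moreover have "pi / (S / 2 * (u / v + v / u)) \<le> 2 * pi / S * (1 / 2) ^ (if l \<le> i then i - l else l - i)"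
  proof (cases "l \<le> i")
    case True
    then have "u = v * 2 ^ (i - l)" by (simp add: u_def v_def flip: power_add)
    then have "2 ^ (i - l) = u / v" using uv by simp
    then have "S / 2 * 2 ^ (i - l) \<le> S / 2 * (u / v + v / u)" using uv S by (intro mult_left_mono) auto
    then have "pi / (S / 2 * (u / v + v / u)) \<le> pi / (S / 2 * 2 ^ (i - l))"
      using S uv by (intro divide_left_mono mult_pos_pos add_pos_pos divide_pos_pos) auto
    then show ?thesis using True by (simp add: power_one_over field_simps)
  next
    case False
    then have "v = u * 2 ^ (l - i)" by (simp add: u_def v_def flip: power_add)
    then have "2 ^ (l - i) = v / u" using uv by simp
    then have "S / 2 * 2 ^ (l - i) \<le> S / 2 * (u / v + v / u)" using uv S by (intro mult_left_mono) auto
    then have "pi / (S / 2 * (u / v + v / u)) \<le> pi / (S / 2 * 2 ^ (l - i))"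
      using S uv by (intro divide_left_mono mult_pos_pos add_pos_pos divide_pos_pos) auto
    then show ?thesis using False by (simp add: power_one_over field_simps)
  qed
  ultimately show ?thesis by (simp only:)
qed

text \<open>Two geometric series, one on each side of l = i, each at most 2: the rows of the overlap
  matrix have sums bounded independently of L.\<close>

lemma dyadic_sum: "(\<Sum>l<L. (1 / 2 :: real) ^ (if l \<le> i then i - l else l - i)) \<le> 4"
proof -
  have "(\<Sum>l<L. (1 / 2 :: real) ^ (if l \<le> i then i - l else l - i)) =
     (\<Sum>l\<in>{..<L} \<inter> {l. l \<le> i}. (1 / 2 :: real) ^ (i - l)) + (\<Sum>l\<in>{..<L} \<inter> - {l. l \<le> i}. (1 / 2) ^ (l - i))"
    by (subst sum.If_cases[symmetric]) (auto intro!: sum.cong)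
  also have "\<dots> \<le> 2 + 2"
    by (intro add_mono sum_half_power_le) (auto simp: inj_on_def)
  finally show ?thesis by simp
qed

lemma sch_sum:
  assumes "sch I (\<lambda>_. 0)" "\<And>i. i < L \<Longrightarrow> sch I (f i)"
  shows "sch I (\<lambda>x. \<Sum>i<(L::nat). f i x)"
  using assms(2) by (induction L) (auto intro: sch_add assms(1))

lemma nn_integral_gaussian_leb:
  fixes S :: real
  assumes I: "finite I" and S: "0 < S"
  shows "(\<integral>\<^sup>+q. ennreal (exp (- S * (\<Sum>i\<in>I. (q i)\<^sup>2))) \<partial>leb I) = ennreal (sqrt (pi / S) ^ card I)"
proof -
  have "ennreal (exp (- S * (\<Sum>i\<in>I. (q i)\<^sup>2))) = (\<Prod>i\<in>I. ennreal (exp (- S * (q i)\<^sup>2)))" for q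
    using I by (simp add: sum_distrib_left exp_sum prod_ennreal flip: sum_negf)
  then have "(\<integral>\<^sup>+q. ennreal (exp (- S * (\<Sum>i\<in>I. (q i)\<^sup>2))) \<partial>leb I) = (\<Prod>i\<in>I. \<integral>\<^sup>+t. ennreal (exp (- S * t\<^sup>2)) \<partial>lborel)"
    using leb.product_nn_integral_prod[OF I, of "\<lambda>_ t. ennreal (exp (- S * t\<^sup>2))"] by simp
  also have "\<dots> = ennreal (sqrt (pi / S) ^ card I)"
    unfolding nn_integral_gaussian[OF S] using S by (simp add: ennreal_power)
  finally show ?thesis .
qed

subsection \<open>Failure of the estimate at the endpoints\<close>

text \<open>From 1 + t^2 \<le> exp(t^2) in each variable. A Sobolev weight can thereby be absorbed
  into the exponent of a Gaussian whose coefficient dominates \<epsilon>.\<close>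

lemma jw_le_exp:
  assumes I: "finite I" and \<epsilon>: "0 \<le> \<epsilon>"
  shows "(jw \<epsilon> I q)\<^sup>2 \<le> exp (\<epsilon> * (\<Sum>i\<in>I. (q i)\<^sup>2))"
proof -
  have 1: "japanese t powr \<epsilon> \<le> exp (\<epsilon> * t\<^sup>2 / 2)" for t
  proof -
    have "japanese t \<le> sqrt (exp (t\<^sup>2))"
      unfolding japanese_def by (intro real_sqrt_le_mono exp_ge_add_one_self)
    also have "\<dots> = exp (t\<^sup>2 / 2)"
      by (rule real_sqrt_unique) (auto simp: power2_eq_square simp flip: exp_add)
    finally have "japanese t powr \<epsilon> \<le> exp (t\<^sup>2 / 2) powr \<epsilon>"
      using japanese_pos[of t] \<epsilon> by (intro powr_mono2) auto
    then show ?thesis by (simp add: powr_def)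
  qed
  have "jw \<epsilon> I q \<le> (\<Prod>i\<in>I. exp (\<epsilon> * (q i)\<^sup>2 / 2))"
    unfolding jw_def by (intro prod_mono conjI 1) auto
  also have "\<dots> = exp (\<epsilon> * (\<Sum>i\<in>I. (q i)\<^sup>2) / 2)"
    using I by (simp add: exp_sum sum_distrib_left sum_divide_distrib)
  finally have "(jw \<epsilon> I q)\<^sup>2 \<le> (exp (\<epsilon> * (\<Sum>i\<in>I. (q i)\<^sup>2) / 2))\<^sup>2"
    by (intro power_mono jw_nonneg)
  then show ?thesis by (simp add: power2_eq_square flip: exp_add)
qed

text \<open>If n is the output frequency, then n - p, n - r and, up to sign, n - p - r are the
  frequencies of the three interacting variables. The difference of the two sides is a sum of
  squares.\<close>

lemma three_squares_le: "(n - p)\<^sup>2 + (n - r)\<^sup>2 + (n - p - r)\<^sup>2 \<le> 7 * n\<^sup>2 + 5 * p\<^sup>2 + 5 * r\<^sup>2" for n p r :: real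
proof -
  have "7 * n\<^sup>2 + 5 * p\<^sup>2 + 5 * r\<^sup>2 - ((n - p)\<^sup>2 + (n - r)\<^sup>2 + (n - p - r)\<^sup>2) =
     2 * (n + p)\<^sup>2 + 2 * (n + r)\<^sup>2 + (p - r)\<^sup>2"
    by (simp add: power2_eq_square algebra_simps)
  moreover have "0 \<le> 2 * (n + p)\<^sup>2 + 2 * (n + r)\<^sup>2 + (p - r)\<^sup>2" by simp
  ultimately show ?thesis by linarith
qed

context particle
begin

text \<open>
  With \<open>n = q\<^sub>c + q\<^sub>d + q\<^sub>e\<close>, \<open>p = - (q\<^sub>d + q\<^sub>e)\<close>, \<open>r = - (q\<^sub>c + q\<^sub>e)\<close> the phase of the first contraction is
  \<open>n\<^sup>2 - 2 p r\<close>, which is invariant under \<open>(p, r) \<mapsto> (2\<^sup>i p, 2\<^sup>-\<^sup>i r)\<close>.  The Gaussians \<open>exp (- Qf S i)\<close>,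
  \<open>i < L\<close>, are images of each other under this scaling: they are almost orthogonal, but their
  contractions coincide.
\<close>

definition Qf :: "real \<Rightarrow> nat \<Rightarrow> (nat + nat \<Rightarrow> real) \<Rightarrow> real" where
  "Qf S i q = S * ((q (Inl j) + q (Inl (Suc k)) + q (Inr (Suc k)))\<^sup>2 + (q (Inl (Suc k)) + q (Inr (Suc k)))\<^sup>2 / 4 ^ i
     + 4 ^ i * (q (Inl j) + q (Inr (Suc k)))\<^sup>2 + (\<Sum>x\<in>idx k - {Inl j}. (q x)\<^sup>2))"

definition hL :: "real \<Rightarrow> nat \<Rightarrow> (nat + nat \<Rightarrow> real) \<Rightarrow> complex" where
  "hL S L q = (\<Sum>i<L. of_real (exp (- Qf S i q)))"

definition phiL :: "real \<Rightarrow> nat \<Rightarrow> kernel" where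
  "phiL S L p = of_real (1 / (2 * pi) ^ card (idx (Suc k))) * ift (idx (Suc k)) (hL S L) (pack (Suc k) p)"

lemma Qf_shear_A:
  "Qf S i (A.shear (q, z)) = S * (\<Sum>x\<in>idx k. (q x)\<^sup>2) + S / 4 ^ i * (fst z + snd z - 0)\<^sup>2 + S * 4 ^ i * (fst z - q (Inl j))\<^sup>2"
proof -
  have "(\<Sum>x\<in>idx k - {Inl j}. (A.shear (q, z) x)\<^sup>2) = (\<Sum>x\<in>idx k - {Inl j}. (q x)\<^sup>2)"
    by (intro sum.cong refl) (auto simp: A.shear_other)
  moreover have "(\<Sum>x\<in>idx k. (q x)\<^sup>2) = (q (Inl j))\<^sup>2 + (\<Sum>x\<in>idx k - {Inl j}. (q x)\<^sup>2)"
    using A.I A.c by (simp add: sum.remove)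
  moreover have "q (Inl j) - fst z - snd z + snd z = - (fst z - q (Inl j))" by simp
  ultimately show ?thesis
    unfolding Qf_def A.shear_simps by (simp add: power2_commute algebra_simps)
qed

text \<open>In the second contraction \<open>Inl j\<close> is a spectator and \<open>Inr j\<close>
  takes part. Two squares of \<open>Qf\<close> are dropped; the coefficients S and S 4^i of the two
  fibre squares that remain have a product growing with i, in contrast to the first
  contraction.\<close>

lemma Qf_shear_B:
  assumes S: "0 < S"
  shows "S * (\<Sum>x\<in>idx k - {Inl j, Inr j}. (q x)\<^sup>2) + S * (fst z + snd z - q (Inr j))\<^sup>2 + S * 4 ^ i * (fst z - - q (Inl j))\<^sup>2
    \<le> Qf S i (B.shear (q, z))"
proof -
  have j: "Inr j \<in> idx k - {Inl j}" using B.c by simp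
  have "(\<Sum>x\<in>idx k - {Inl j}. (B.shear (q, z) x)\<^sup>2) = (B.shear (q, z) (Inr j))\<^sup>2 + (\<Sum>x\<in>idx k - {Inl j} - {Inr j}. (B.shear (q, z) x)\<^sup>2)"
    using A.I j by (intro sum.remove) auto
  also have "idx k - {Inl j} - {Inr j} = idx k - {Inl j, Inr j}" by auto
  also have "(\<Sum>x\<in>idx k - {Inl j, Inr j}. (B.shear (q, z) x)\<^sup>2) = (\<Sum>x\<in>idx k - {Inl j, Inr j}. (q x)\<^sup>2)"
    by (intro sum.cong refl) (auto simp: B.shear_other)
  finally have 1: "(\<Sum>x\<in>idx k - {Inl j}. (B.shear (q, z) x)\<^sup>2) = (fst z + snd z - q (Inr j))\<^sup>2 + (\<Sum>x\<in>idx k - {Inl j, Inr j}. (q x)\<^sup>2)"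
    by (simp add: B.shear_simps power2_commute algebra_simps)
  have 2: "B.shear (q, z) (Inl j) = q (Inl j)" using jk by (intro B.shear_simps(4)) auto
  have "S * ((\<Sum>x\<in>idx k - {Inl j, Inr j}. (q x)\<^sup>2) + (fst z + snd z - q (Inr j))\<^sup>2 + 4 ^ i * (q (Inl j) + fst z)\<^sup>2) \<le> Qf S i (B.shear (q, z))"
    unfolding Qf_def 1 2 B.shear_simps using S by (intro mult_left_mono) auto
  then show ?thesis by (simp add: algebra_simps)
qed

lemma sum_squares_J:
  fixes q :: "nat + nat \<Rightarrow> real"
  shows "(\<Sum>x\<in>idx (Suc k). (q x)\<^sup>2) \<le> 7 * (q (Inl j) + q (Inl (Suc k)) + q (Inr (Suc k)))\<^sup>2 + 5 * (q (Inl (Suc k)) + q (Inr (Suc k)))\<^sup>2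
     + 5 * (q (Inl j) + q (Inr (Suc k)))\<^sup>2 + (\<Sum>x\<in>idx k - {Inl j}. (q x)\<^sup>2)"
proof -
  have J: "(\<Sum>x\<in>idx (Suc k). (q x)\<^sup>2) = (q (Inl (Suc k)))\<^sup>2 + (q (Inr (Suc k)))\<^sup>2 + (q (Inl j))\<^sup>2 + (\<Sum>x\<in>idx k - {Inl j}. (q x)\<^sup>2)"
    using A.sum_J[of "\<lambda>x. (q x)\<^sup>2"] by (simp add: idx_Suc(1))
  show ?thesis
    using three_squares_le[of "q (Inl j) + q (Inl (Suc k)) + q (Inr (Suc k))" "q (Inl (Suc k)) + q (Inr (Suc k))" "q (Inl j) + q (Inr (Suc k))"]
    unfolding J by simp
qed

text \<open>After multiplication by 4^i every square in \<open>Qf\<close> has coefficient at least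
  S, and 7 is the largest coefficient in \<open>sum_squares_J\<close>. The loss in i is harmless, as
  coercivity only serves to make the data Schwartz.\<close>

lemma Qf_coercive:
  assumes S: "0 < S"
  shows "S / (7 * 4 ^ i) * (\<Sum>x\<in>idx (Suc k). (q x)\<^sup>2) \<le> Qf S i q"
proof -
  define n p r where "n = (q (Inl j) + q (Inl (Suc k)) + q (Inr (Suc k)))\<^sup>2" and "p = (q (Inl (Suc k)) + q (Inr (Suc k)))\<^sup>2" and "r = (q (Inl j) + q (Inr (Suc k)))\<^sup>2"
  define W where "W = (\<Sum>x\<in>idx k - {Inl j}. (q x)\<^sup>2)"
  define X :: real where "X = 4 ^ i"
  have nn: "0 \<le> n" "0 \<le> p" "0 \<le> r" "0 \<le> W" by (auto simp: n_def p_def r_def W_def sum_nonneg)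
  have X: "1 \<le> X" by (simp add: X_def)
  have "n \<le> X * n" "W \<le> X * W" "r \<le> X * (X * r)"
    using nn X mult_right_mono[of 1 X n] mult_right_mono[of 1 X W] mult_mono[of 1 "X * X" r r] mult_mono[of 1 X 1 X]
    by (auto simp: mult.assoc)
  moreover have "(\<Sum>x\<in>idx (Suc k). (q x)\<^sup>2) \<le> 7 * n + 5 * p + 5 * r + W"
    using sum_squares_J unfolding n_def p_def r_def W_def .
  moreover define n' W' r' T where "n' = X * n" and "W' = X * W" and "r' = X * (X * r)" and "T = (\<Sum>x\<in>idx (Suc k). (q x)\<^sup>2)"
  ultimately have "n \<le> n'" "W \<le> W'" "r \<le> r'" "T \<le> 7 * n + 5 * p + 5 * r + W" by simp_all
  moreover have "5 * p \<le> 7 * p" "5 * r' \<le> 7 * r'" "W' \<le> 7 * W'"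
    using nn \<open>r \<le> r'\<close> \<open>W \<le> W'\<close> by auto
  ultimately have "T \<le> 7 * n' + 7 * p + 7 * r' + 7 * W'"
    by linarith
  then have "T \<le> 7 * (n' + p + r' + W')" by simp
  then have "(\<Sum>x\<in>idx (Suc k). (q x)\<^sup>2) \<le> 7 * (X * n + p + X * (X * r) + X * W)"
    by (simp only: n'_def W'_def r'_def T_def)
  also have "\<dots> = 7 * X * (n + p / X + X * r + W)" using X by (simp add: field_simps)
  finally have "S / (7 * X) * (\<Sum>x\<in>idx (Suc k). (q x)\<^sup>2) \<le> S / (7 * X) * (7 * X * (n + p / X + X * r + W))"
    using S X by (intro mult_left_mono) auto
  also have "\<dots> = Qf S i q" using X by (simp add: Qf_def n_def p_def r_def W_def X_def)
  finally show ?thesis by (simp add: X_def)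
qed

lemma sch_hL:
  assumes S: "0 < S"
  shows "sch (idx (Suc k)) (hL S L)"
proof -
  have mem: "Inl j \<in> idx (Suc k)" "Inl (Suc k) \<in> idx (Suc k)" "Inr (Suc k) \<in> idx (Suc k)"
    using jk by (auto simp: idx_simps)
  have sub: "x \<in> idx k - {Inl j} \<Longrightarrow> x \<in> idx (Suc k)" for x by (simp add: idx_Suc(1))
  have G: "sch (idx (Suc k)) (\<lambda>q. of_real (exp (- Qf S i q)))" for i
  proof -
    have "polyfun (idx (Suc k)) (\<lambda>q. of_real S * ((of_real (q (Inl j)) + of_real (q (Inl (Suc k))) + of_real (q (Inr (Suc k))))\<^sup>2
        + (of_real (q (Inl (Suc k))) + of_real (q (Inr (Suc k))))\<^sup>2 * of_real (1 / 4 ^ i)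
        + of_real (4 ^ i) * (of_real (q (Inl j)) + of_real (q (Inr (Suc k))))\<^sup>2 + (\<Sum>x\<in>idx k - {Inl j}. (of_real (q x))\<^sup>2)))"
      by (intro polyfun_mult polyfun_const polyfun_add polyfun_power2 polyfun_sum polyfun_coord mem sub)
    then have P: "polyfun (idx (Suc k)) (\<lambda>q. of_real (Qf S i q))" by (simp add: Qf_def)
    have "sch (idx (Suc k)) (\<lambda>q. exp (- complex_of_real (Qf S i q)))"
    proof (rule sch_gaussian[OF finite_idx P, where \<kappa>="S / (7 * 4 ^ i)"])
      show "S / (7 * 4 ^ i) * (\<Sum>x\<in>idx (Suc k). (q x)\<^sup>2) \<le> Re (of_real (Qf S i q))" for q
        unfolding Re_complex_of_real by (rule Qf_coercive[OF S])
    qed (use S in simp)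
    then show ?thesis by (simp add: exp_of_real[symmetric])
  qed
  have "sch (idx (Suc k)) (\<lambda>_. 0)" using sch_const_mult[OF G, of 0] by simp
  from sch_sum[OF this, of L "\<lambda>i q. of_real (exp (- Qf S i q))"] G show ?thesis
    unfolding hL_def[abs_def] by blast
qed

lemma schwartz_phiL: "0 < S \<Longrightarrow> schwartz (Suc k) (phiL S L)"
  by (rule sch_imp_schwartz[OF sch_const_mult[OF sch_ift[OF finite_idx sch_hL]]]) (assumption, rule phiL_def)

lemma hat_phiL:
  assumes S: "0 < S" and q: "q \<in> extensional (idx (Suc k))"
  shows "hat (Suc k) (phiL S L) q = hL S L q"
proof -
  let ?J = "idx (Suc k)"
  let ?c = "complex_of_real (1 / (2 * pi) ^ card ?J)"
  have pu: "pack (Suc k) (unpack (Suc k) x) = x" if "x \<in> extensional ?J" for x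
    using that by (auto simp: pack_def coord_unpack fun_eq_iff extensional_def)
  have "hat (Suc k) (phiL S L) q = ft ?J (\<lambda>x. ?c * ift ?J (hL S L) x) q"
    unfolding hat_def phiL_def ft_def
    by (intro Bochner_Integration.integral_cong refl) (simp only: space_leb pu)
  also have "\<dots> = ?c * ft ?J (ift ?J (hL S L)) q" by (rule ft_const_mult)
  also have "ft ?J (ift ?J (hL S L)) q = of_real ((2 * pi) ^ card ?J) * hL S L q"
    by (intro fourier_inversion finite_idx sch_nice sch_hL S q sch_integrable sch_ift)
  finally show ?thesis by (simp add: card_idx del: of_real_power)
qed

text \<open>The coefficients S / 4^i and S 4^i have product S^2 for every i, so by
  \<open>gaussian2\<close> all L summands have the same value and add coherently. The part
  \<open>base\<close> of the phase depends on q alone and has no effect on the modulus.\<close>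

lemma norm_coll_A:
  assumes S: "0 < S" and q: "q \<in> extensional (idx k)"
  shows "norm (A.coll (propag (phiL S L) \<tau>) q) = exp (- S * (\<Sum>x\<in>idx k. (q x)\<^sup>2)) * (real L * (pi / sqrt (S\<^sup>2 + \<tau>\<^sup>2)))"
proof -
  let ?n = "q (Inl j)"
  define base where "base = - ?n\<^sup>2 + (\<Sum>x\<in>idx k - {Inl j}. dsign x * (q x)\<^sup>2)"
  define w where "w = exp (- S * (\<Sum>x\<in>idx k. (q x)\<^sup>2))"
  let ?g = "\<lambda>i z. cis (- 2 * \<tau> * ((fst z + snd z - 0) * (fst z - ?n))) * of_real (exp (- (S / 4 ^ i) * (fst z + snd z - 0)\<^sup>2) * exp (- (S * 4 ^ i) * (fst z - ?n)\<^sup>2))"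
  have quad: "quad (idx (Suc k)) dsign (A.shear (q, z)) = base + - 2 * ((fst z + snd z - 0) * (fst z - ?n))" for z
  proof -
    have "quad (idx (Suc k)) dsign (A.shear (q, z)) = - (fst z)\<^sup>2 + (snd z)\<^sup>2 - (?n - fst z - snd z)\<^sup>2 + (\<Sum>x\<in>idx k - {Inl j}. dsign x * (q x)\<^sup>2)"
      unfolding quad_def idx_Suc(1) using A.sum_J_shear[of "\<lambda>i t. dsign i * t\<^sup>2" q z] by (simp add: dsign_def)
    then show ?thesis by (simp add: base_def power2_eq_square algebra_simps)
  qed
  have ext: "A.shear (q, z) \<in> extensional (idx (Suc k))" for z
    using A.shear_extensional[OF q] by (simp only: idx_Suc(1)[symmetric])
  have prp: "propag (phiL S L) \<tau> (A.shear (q, z)) = (cis (\<tau> * base) * of_real w) * (\<Sum>i<L. ?g i z)" for z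
  proof -
    have "exp (- Qf S i (A.shear (q, z))) = w * (exp (- (S / 4 ^ i) * (fst z + snd z - 0)\<^sup>2) * exp (- (S * 4 ^ i) * (fst z - ?n)\<^sup>2))" for i
      unfolding Qf_shear_A w_def by (simp add: algebra_simps flip: exp_add)
    then have "hL S L (A.shear (q, z)) = of_real w * (\<Sum>i<L. of_real (exp (- (S / 4 ^ i) * (fst z + snd z - 0)\<^sup>2) * exp (- (S * 4 ^ i) * (fst z - ?n)\<^sup>2)))"
      unfolding hL_def by (simp only: of_real_mult sum_distrib_left)
    moreover have "cis (\<tau> * quad (idx (Suc k)) dsign (A.shear (q, z))) = cis (\<tau> * base) * cis (- 2 * \<tau> * ((fst z + snd z - 0) * (fst z - ?n)))"
      unfolding quad cis_mult by (simp add: algebra_simps)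
    ultimately show ?thesis
      unfolding propag_hat hat_phiL[OF S ext] by (simp only: sum_distrib_left mult_ac)
  qed
  have g: "has_bochner_integral lborel2 (?g i) (of_real (pi / sqrt (S\<^sup>2 + \<tau>\<^sup>2)))" for i
  proof -
    have "S / 4 ^ i * (S * 4 ^ i) + (- 2 * \<tau>)\<^sup>2 / 4 = S\<^sup>2 + \<tau>\<^sup>2" by (simp add: power2_eq_square)
    then show ?thesis using gaussian2[of "S / 4 ^ i" "S * 4 ^ i" "- 2 * \<tau>" 0 ?n] S by simp
  qed
  have "has_bochner_integral lborel2 (\<lambda>z. \<Sum>i<L. ?g i z) (\<Sum>i<L. of_real (pi / sqrt (S\<^sup>2 + \<tau>\<^sup>2)))"
    by (rule has_bochner_integral_sum) (rule g)
  then have "A.coll (propag (phiL S L) \<tau>) q = (cis (\<tau> * base) * of_real w) * (\<Sum>i<L. of_real (pi / sqrt (S\<^sup>2 + \<tau>\<^sup>2)))"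
    unfolding A.coll_def prp integral_mult_right_zero by (simp only: has_bochner_integral_iff)
  then show ?thesis by (simp add: norm_mult norm_divide w_def)
qed

text \<open>Absolute values suffice: the planar Gaussian with coefficients S and S 4^i has integral
  (\<pi> / S) 2^(-i), and the geometric series gives a bound uniform in L and \<tau>. The variables
  of particle j enter only as the centre of these Gaussians.\<close>

lemma norm_coll_B:
  assumes S: "0 < S" and q: "q \<in> extensional (idx k)"
  shows "norm (B.coll (propag (phiL S L) \<tau>) q) \<le> exp (- S * (\<Sum>x\<in>idx k - {Inl j, Inr j}. (q x)\<^sup>2)) * (2 * pi / S)"
proof -
  let ?m = "q (Inr j)" and ?n = "- q (Inl j)"
  define w where "w = exp (- S * (\<Sum>x\<in>idx k - {Inl j, Inr j}. (q x)\<^sup>2))"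
  let ?g = "\<lambda>i z. exp (- S * (fst z + snd z - ?m)\<^sup>2) * exp (- (S * 4 ^ i) * (fst z - ?n)\<^sup>2)"
  have ext: "B.shear (q, z) \<in> extensional (idx (Suc k))" for z
    using B.shear_extensional[OF q] by (simp only: idx_Suc(2)[symmetric])
  have s: "sch (idx (Suc k)) (propag (phiL S L) \<tau>)" by (intro sch_propag schwartz_phiL S)
  have int: "integrable lborel2 (\<lambda>z. propag (phiL S L) \<tau> (B.shear (q, z)))"
    by (rule B.shear_integrable[OF _ _ q]) (use s in \<open>auto simp: idx_Suc(2)[symmetric] intro: sch_rapid sch_measurable finite_idx\<close>)
  have bd: "norm (propag (phiL S L) \<tau> (B.shear (q, z))) \<le> w * (\<Sum>i<L. ?g i z)" for z
  proof -
    have "norm (propag (phiL S L) \<tau> (B.shear (q, z))) \<le> (\<Sum>i<L. norm (complex_of_real (exp (- Qf S i (B.shear (q, z))))))"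
      unfolding propag_hat hat_phiL[OF S ext] norm_mult norm_cis mult_1 hL_def by (rule norm_sum)
    also have "\<dots> \<le> (\<Sum>i<L. w * ?g i z)"
    proof (rule sum_mono)
      fix i
      have "- Qf S i (B.shear (q, z)) \<le> - S * (\<Sum>x\<in>idx k - {Inl j, Inr j}. (q x)\<^sup>2) + (- S * (fst z + snd z - ?m)\<^sup>2 + - (S * 4 ^ i) * (fst z - ?n)\<^sup>2)"
        using Qf_shear_B[OF S, of q z i] by simp
      then show "norm (complex_of_real (exp (- Qf S i (B.shear (q, z))))) \<le> w * ?g i z"
        unfolding w_def exp_add[symmetric] by simp
    qed
    finally show ?thesis by (simp add: sum_distrib_left)
  qed
  have g: "has_bochner_integral lborel2 (?g i) (pi / S * (1 / 2) ^ i)" for i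
  proof -
    have "(S * 2 ^ i)\<^sup>2 = S * (S * 4 ^ i)"
      by (simp add: power2_eq_square mult_ac flip: power_mult_distrib)
    then have "sqrt (S * (S * 4 ^ i)) = S * 2 ^ i" using S by (intro real_sqrt_unique) auto
    then have "pi / sqrt (S * (S * 4 ^ i)) = pi / S * (1 / 2) ^ i"
      using S by (simp add: power_one_over field_simps)
    then show ?thesis using gaussian2_real[of S "S * 4 ^ i" ?m ?n] S by simp
  qed
  have G: "has_bochner_integral lborel2 (\<lambda>z. w * (\<Sum>i<L. ?g i z)) (w * (\<Sum>i<L. pi / S * (1 / 2) ^ i))"
    by (intro has_bochner_integral_mult_right has_bochner_integral_sum g)
  have "norm (B.coll (propag (phiL S L) \<tau>) q) \<le> (\<integral>z. norm (propag (phiL S L) \<tau> (B.shear (q, z))) \<partial>lborel2)"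
    unfolding B.coll_def by (rule integral_norm_bound)
  also have "\<dots> \<le> (\<integral>z. w * (\<Sum>i<L. ?g i z) \<partial>lborel2)"
    using G by (intro Bochner_Integration.integral_mono integrable_norm int bd) (auto simp only: has_bochner_integral_iff)
  also have "\<dots> = w * (\<Sum>i<L. pi / S * (1 / 2) ^ i)" using G by (simp only: has_bochner_integral_iff)
  also have "\<dots> \<le> w * (pi / S * 2)"
    unfolding sum_distrib_left[symmetric] using S sum_half_power_le[of "{..<L}" "\<lambda>i. i"]
    by (intro mult_left_mono) (auto simp: w_def)
  finally show ?thesis by (simp add: w_def mult_ac)
qed

text \<open>Relative to the common decay in the other variables, the first contraction is at least
  (\<pi> / S)(L / 18) and the second at most 2 \<pi> / S; from L = 72 on, half of the former covers
  the latter. Confining the two variables of particle j, in which the bound for the second term has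
  no decay, costs exp(-2) \<ge> 1/9.\<close>

lemma norm_bhat_lower:
  assumes S: "0 < S" and L: "72 \<le> L" and \<tau>: "0 \<le> \<tau>" "\<tau> \<le> S" and q: "q \<in> extensional (idx k)"
    and qj: "q (Inl j) \<in> {0..1 / sqrt S}" "q (Inr j) \<in> {0..1 / sqrt S}"
  shows "pi / S * (real L / 36) * exp (- S * (\<Sum>x\<in>idx k - {Inl j, Inr j}. (q x)\<^sup>2)) \<le> norm (bhat (phiL S L) \<tau> q)"
proof -
  define W where "W = (\<Sum>x\<in>idx k - {Inl j, Inr j}. (q x)\<^sup>2)"
  have "(\<Sum>x\<in>idx k. (q x)\<^sup>2) = (q (Inl j))\<^sup>2 + (\<Sum>x\<in>idx k - {Inl j}. (q x)\<^sup>2)"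
    using A.I A.c by (intro sum.remove) auto
  also have "(\<Sum>x\<in>idx k - {Inl j}. (q x)\<^sup>2) = (q (Inr j))\<^sup>2 + (\<Sum>x\<in>idx k - {Inl j} - {Inr j}. (q x)\<^sup>2)"
    using A.I B.c by (intro sum.remove) auto
  also have "idx k - {Inl j} - {Inr j} = idx k - {Inl j, Inr j}" by auto
  finally have sum: "(\<Sum>x\<in>idx k. (q x)\<^sup>2) = (q (Inl j))\<^sup>2 + ((q (Inr j))\<^sup>2 + W)" by (simp add: W_def)
  have sq: "S * t\<^sup>2 \<le> 1" if "t \<in> {0..1 / sqrt S}" for t
  proof -
    have "t\<^sup>2 \<le> (1 / sqrt S)\<^sup>2" using that by (intro power_mono) auto
    then show ?thesis using S by (simp add: power_divide field_simps)
  qed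
  have "- 2 + - S * W \<le> - S * (\<Sum>x\<in>idx k. (q x)\<^sup>2)"
    unfolding sum using sq[OF qj(1)] sq[OF qj(2)] by (simp add: algebra_simps)
  then have e1: "exp (- 2) * exp (- S * W) \<le> exp (- S * (\<Sum>x\<in>idx k. (q x)\<^sup>2))"
    by (simp only: exp_add[symmetric] exp_le_cancel_iff)
  have "exp (2::real) \<le> 9"
    using mult_mono[OF exp_le exp_le] by (simp flip: exp_add)
  then have e2: "1 / 9 \<le> exp (- 2 :: real)" by (simp add: exp_minus field_simps)
  \<comment> \<open>For times up to S, dispersion costs at most a factor 2.\<close>
  have "sqrt (S\<^sup>2 + \<tau>\<^sup>2) \<le> 2 * S"
  proof (rule real_le_lsqrt)
    have "\<tau>\<^sup>2 \<le> S\<^sup>2" using \<tau> by (intro power_mono) auto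
    moreover have "(2 * S)\<^sup>2 = 4 * S\<^sup>2" by (simp add: power_mult_distrib)
    ultimately show "S\<^sup>2 + \<tau>\<^sup>2 \<le> (2 * S)\<^sup>2" using zero_le_power2[of S] by linarith
  qed (use S in auto)
  moreover have "0 < sqrt (S\<^sup>2 + \<tau>\<^sup>2)" using S by (simp add: add_pos_nonneg)
  ultimately have "pi / (2 * S) \<le> pi / sqrt (S\<^sup>2 + \<tau>\<^sup>2)" using S by (intro divide_left_mono) auto
  then have "exp (- 2) * exp (- S * W) * (real L * (pi / (2 * S))) \<le> norm (A.coll (propag (phiL S L) \<tau>) q)"
    unfolding norm_coll_A[OF S q] using e1 S by (intro mult_mono) auto
  moreover have "1 / 9 * exp (- S * W) * (real L * (pi / (2 * S))) \<le> exp (- 2) * exp (- S * W) * (real L * (pi / (2 * S)))"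
    using e2 S by (intro mult_right_mono) auto
  moreover have "norm (B.coll (propag (phiL S L) \<tau>) q) \<le> exp (- S * W) * (2 * pi / S)"
    using norm_coll_B[OF S q] by (simp add: W_def)
  moreover have "norm (A.coll (propag (phiL S L) \<tau>) q) - norm (B.coll (propag (phiL S L) \<tau>) q) \<le> norm (bhat (phiL S L) \<tau> q)"
    unfolding bhat_def by (rule norm_triangle_ineq2)
  moreover have "pi / S * (real L / 36) * exp (- S * W) \<le> 1 / 9 * exp (- S * W) * (real L * (pi / (2 * S))) - exp (- S * W) * (2 * pi / S)"
  proof -
    have "0 \<le> exp (- S * W) * (pi / S) * (real L / 36 - 2)" using S L by (intro mult_nonneg_nonneg) auto
    also have "\<dots> = 1 / 9 * exp (- S * W) * (real L * (pi / (2 * S))) - exp (- S * W) * (2 * pi / S) - pi / S * (real L / 36) * exp (- S * W)"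
      using S by (simp add: field_simps)
    finally show ?thesis by (simp only: diff_ge_0_iff_ge)
  qed
  ultimately show ?thesis unfolding W_def by linarith
qed

text \<open>The Sobolev weight is bounded below by 1, and the pointwise lower bound holds at every
  time up to t0 \<le> S; integration in time therefore contributes the factor t0.\<close>

lemma tsq2_lower:
  assumes S: "0 < S" and L: "72 \<le> L" and \<epsilon>: "0 \<le> \<epsilon>" and t0: "0 < t0" "t0 \<le> S" "ereal t0 \<le> T"
  shows "ennreal (1 / (2 * pi) ^ (2 * k + 4) * (t0 * ((pi / S * (real L / 36))\<^sup>2 * (1 / S * (pi / (2 * S)) ^ (k - 1))))) \<le> tsq2 T k (RBU \<epsilon> j k (phiL S L))"
proof -
  let ?K = "pi / S * (real L / 36)"
  let ?kc = "1 / (2 * pi) ^ (2 * k + 4)"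
  \<comment> \<open>A minorant of product form, so that its integral factorises: indicators in the
    two variables of particle j, squared Gaussians in the 2 (k - 1) others.\<close>
  let ?g = "\<lambda>x t. if x = Inl j \<or> x = Inr j then indicator {0..1 / sqrt S} t else ennreal (exp (- (2 * S) * t\<^sup>2))"
  have g_int: "(\<integral>\<^sup>+q. (\<Prod>x\<in>idx k. ?g x (q x)) \<partial>leb (idx k)) = ennreal (1 / S * (pi / (2 * S)) ^ (k - 1))"
  proof -
    have j: "Inr j \<in> idx k - {Inl j}" using B.c by simp
    let ?v = "\<lambda>x. \<integral>\<^sup>+t. ?g x t \<partial>lborel"
    have "(\<integral>\<^sup>+q. (\<Prod>x\<in>idx k. ?g x (q x)) \<partial>leb (idx k)) = (\<Prod>x\<in>idx k. ?v x)"
      by (rule leb.product_nn_integral_prod[OF finite_idx]) auto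
    also have "\<dots> = ?v (Inl j) * (\<Prod>x\<in>idx k - {Inl j}. ?v x)"
      using A.I A.c by (intro prod.remove) auto
    also have "(\<Prod>x\<in>idx k - {Inl j}. ?v x) = ?v (Inr j) * (\<Prod>x\<in>idx k - {Inl j} - {Inr j}. ?v x)"
      using A.I j by (intro prod.remove) auto
    also have "(\<Prod>x\<in>idx k - {Inl j} - {Inr j}. ?v x) = (\<Prod>x\<in>idx k - {Inl j} - {Inr j}. ennreal (sqrt (pi / (2 * S))))"
    proof (rule prod.cong[OF refl])
      fix x assume "x \<in> idx k - {Inl j} - {Inr j}"
      then show "?v x = ennreal (sqrt (pi / (2 * S)))" using nn_integral_gaussian[of "2 * S"] S by simp
    qed
    also have "\<dots> = ennreal (sqrt (pi / (2 * S)) ^ (2 * (k - 1)))"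
    proof -
      have "card (idx k - {Inl j} - {Inr j}) = 2 * (k - 1)"
        using A.I A.c B.c by (simp add: card_idx)
      then show ?thesis using S by (simp add: ennreal_power)
    qed
    also have "sqrt (pi / (2 * S)) ^ (2 * (k - 1)) = (pi / (2 * S)) ^ (k - 1)"
      using S by (simp add: power_mult)
    also have "?v (Inl j) = ennreal (1 / sqrt S)" using S by simp
    also have "?v (Inr j) = ennreal (1 / sqrt S)" using S by simp
    also have "ennreal (1 / sqrt S) * (ennreal (1 / sqrt S) * ennreal ((pi / (2 * S)) ^ (k - 1))) = ennreal (1 / S * (pi / (2 * S)) ^ (k - 1))"
    proof -
      have "1 / sqrt S * (1 / sqrt S * (pi / (2 * S)) ^ (k - 1)) = 1 / S * (pi / (2 * S)) ^ (k - 1)"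
        using S by simp
      then show ?thesis using S by (simp only: ennreal_mult'[symmetric] divide_nonneg_nonneg real_sqrt_ge_zero less_imp_le zero_le_one)
    qed
    finally show ?thesis .
  qed
  have gm: "(\<lambda>q. \<Prod>x\<in>idx k. ?g x (q x)) \<in> borel_measurable (leb (idx k))"
  proof (rule borel_measurable_prod_ennreal)
    fix x assume "x \<in> idx k"
    from measurable_compose[OF leb_component_measurable[OF this], of "?g x" borel]
    show "(\<lambda>q. ?g x (q x)) \<in> borel_measurable (leb (idx k))" by simp
  qed
  have pw: "ennreal (?K\<^sup>2) * (\<Prod>x\<in>idx k. ?g x (q x)) \<le> (ennreal (jw \<epsilon> (idx k) q * norm (bhat (phiL S L) \<tau> q)))\<^sup>2"
    if q: "q \<in> space (leb (idx k))" and \<tau>: "0 \<le> \<tau>" "\<tau> \<le> t0" for q \<tau>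
  proof (cases "q (Inl j) \<in> {0..1 / sqrt S} \<and> q (Inr j) \<in> {0..1 / sqrt S}")
    case False
    then have "\<exists>x\<in>idx k. ?g x (q x) = 0"
      using A.c B.c by (auto simp del: atLeastAtMost_iff intro: bexI[of _ "Inl j"] bexI[of _ "Inr j"])
    from prod_zero[OF finite_idx this] show ?thesis by (simp only: mult_zero_right zero_le)
  next
    case True
    define W where "W = (\<Sum>x\<in>idx k - {Inl j, Inr j}. (q x)\<^sup>2)"
    have "(\<Prod>x\<in>idx k. ?g x (q x)) = (\<Prod>x\<in>idx k - {Inl j, Inr j}. ?g x (q x))"
      using True by (intro prod.mono_neutral_right finite_idx) auto
    also have "\<dots> = (\<Prod>x\<in>idx k - {Inl j, Inr j}. ennreal (exp (- (2 * S) * (q x)\<^sup>2)))"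
      by (intro prod.cong refl) auto
    also have "\<dots> = ennreal ((exp (- S * W))\<^sup>2)"
    proof -
      have "(\<Prod>x\<in>idx k - {Inl j, Inr j}. exp (- (2 * S) * (q x)\<^sup>2)) = exp (- (2 * S) * W)"
        using finite_idx by (simp add: W_def sum_distrib_left exp_sum flip: sum_negf)
      also have "\<dots> = (exp (- S * W))\<^sup>2" by (simp add: power2_eq_square flip: exp_add)
      finally show ?thesis by (simp only: prod_ennreal exp_ge_zero)
    qed
    finally have "ennreal (?K\<^sup>2) * (\<Prod>x\<in>idx k. ?g x (q x)) = ennreal ((?K * exp (- S * W))\<^sup>2)"
      by (simp only: power_mult_distrib[of ?K] ennreal_mult'[OF zero_le_power2])
    also have "\<dots> \<le> ennreal ((jw \<epsilon> (idx k) q * norm (bhat (phiL S L) \<tau> q))\<^sup>2)"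
    proof (intro ennreal_leI power_mono)
      have "?K * exp (- S * W) \<le> norm (bhat (phiL S L) \<tau> q)"
        unfolding W_def using True q \<tau> t0 by (intro norm_bhat_lower S L) (auto simp: space_leb)
      also have "\<dots> \<le> jw \<epsilon> (idx k) q * norm (bhat (phiL S L) \<tau> q)"
        using mult_right_mono[OF jw_ge1[OF \<epsilon>], of "norm (bhat (phiL S L) \<tau> q)" "idx k" q] by simp
      finally show "?K * exp (- S * W) \<le> jw \<epsilon> (idx k) q * norm (bhat (phiL S L) \<tau> q)" .
    qed (use S in auto)
    finally show ?thesis by (simp add: ennreal_power jw_nonneg)
  qed
  have sq: "ennreal (?kc * (?K\<^sup>2 * (1 / S * (pi / (2 * S)) ^ (k - 1)))) \<le> sq2 k (RBU \<epsilon> j k (phiL S L) \<tau>)" if \<tau>: "0 \<le> \<tau>" "\<tau> \<le> t0" for \<tau>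
  proof -
    have "ennreal (?K\<^sup>2 * (1 / S * (pi / (2 * S)) ^ (k - 1))) = ennreal (?K\<^sup>2) * (\<integral>\<^sup>+q. (\<Prod>x\<in>idx k. ?g x (q x)) \<partial>leb (idx k))"
      unfolding g_int by (rule ennreal_mult') simp
    also have "\<dots> = (\<integral>\<^sup>+q. ennreal (?K\<^sup>2) * (\<Prod>x\<in>idx k. ?g x (q x)) \<partial>leb (idx k))"
      by (rule nn_integral_cmult[OF gm, symmetric])
    also have "\<dots> \<le> (\<integral>\<^sup>+q. (ennreal (jw \<epsilon> (idx k) q * norm (bhat (phiL S L) \<tau> q)))\<^sup>2 \<partial>leb (idx k))"
      by (intro nn_integral_mono pw \<tau>)
    finally have "ennreal ?kc * ennreal (?K\<^sup>2 * (1 / S * (pi / (2 * S)) ^ (k - 1))) \<le> sq2 k (RBU \<epsilon> j k (phiL S L) \<tau>)"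
      unfolding RBU_sq2(2)[OF schwartz_phiL[OF S] \<epsilon>] by (rule mult_left_mono) simp
    then show ?thesis by (subst ennreal_mult') auto
  qed
  have "ennreal (?kc * (t0 * (?K\<^sup>2 * (1 / S * (pi / (2 * S)) ^ (k - 1))))) = ennreal (t0 * (?kc * (?K\<^sup>2 * (1 / S * (pi / (2 * S)) ^ (k - 1)))))"
    by (simp only: mult.left_commute)
  also have "\<dots> = ennreal (?kc * (?K\<^sup>2 * (1 / S * (pi / (2 * S)) ^ (k - 1)))) * emeasure lborel {0..t0}"
    using t0 by (subst ennreal_mult') (simp_all add: mult.commute)
  also have "\<dots> = (\<integral>\<^sup>+\<tau>. ennreal (?kc * (?K\<^sup>2 * (1 / S * (pi / (2 * S)) ^ (k - 1)))) * indicator {0..t0} \<tau> \<partial>lborel)"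
    by (rule nn_integral_cmult_indicator[symmetric]) simp
  also have "\<dots> \<le> tsq2 T k (RBU \<epsilon> j k (phiL S L))"
    unfolding tsq2_def
  proof (intro nn_integral_mono)
    fix \<tau> :: real
    show "ennreal (?kc * (?K\<^sup>2 * (1 / S * (pi / (2 * S)) ^ (k - 1)))) * indicator {0..t0} \<tau> \<le> sq2 k (RBU \<epsilon> j k (phiL S L) \<tau>) * indicator {\<tau>. 0 \<le> \<tau> \<and> ereal \<tau> \<le> T} \<tau>"
    proof (cases "\<tau> \<in> {0..t0}")
      case True
      then have "ereal \<tau> \<le> T" using t0(3) by (intro order.trans[of "ereal \<tau>" "ereal t0" T]) auto
      then show ?thesis using sq[of \<tau>] True by simp
    qed simp
  qed
  finally show ?thesis .
qed

text \<open>Almost orthogonality: the square of the sum is expanded into pairwise overlaps, and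
  since the rows of the overlap matrix have bounded sums, a single power of L remains. The smallness
  condition keeps the Sobolev weight below the smallest Gaussian coefficient.\<close>

lemma R_sq2_upper:
  assumes S: "0 < S" and \<epsilon>: "0 \<le> \<epsilon>" and small: "7 * \<epsilon> \<le> S / 4 ^ L"
  shows "sq2 (Suc k) (R (Suc k) \<epsilon> (phiL S L)) \<le> ennreal (1 / (2 * pi) ^ (2 * Suc k) * (real L * 4 * (2 * pi / S) * (pi / S) ^ k))"
proof -
  let ?J = "idx (Suc k)"
  let ?F = "\<lambda>x. (ennreal (jw \<epsilon> ?J x * norm (hat (Suc k) (phiL S L) x)))\<^sup>2"
  let ?G = "\<lambda>i l z. exp (- (S / 2 * (1 / 4 ^ i + 1 / 4 ^ l)) * (fst z + snd z - 0)\<^sup>2)"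
  let ?H = "\<lambda>i l n z. exp (- (S / 2 * (4 ^ i + 4 ^ l)) * (fst z - n)\<^sup>2)"
  let ?w = "\<lambda>q. exp (- S * (\<Sum>x\<in>idx k. (q x)\<^sup>2))"
  have hm: "hat (Suc k) (phiL S L) \<in> borel_measurable (leb ?J)"
    by (intro sch_measurable finite_idx sch_hat schwartz_phiL S)
  then have Fm: "?F \<in> borel_measurable (leb ?J)" by measurable
  have pw: "?F (A.shear (q, z)) \<le> ennreal (?w q) * (\<Sum>i<L. \<Sum>l<L. ennreal (?G i l z * ?H i l (q (Inl j)) z))"
    if q: "q \<in> space (leb (idx k))" for q z
  proof -
    have ext: "A.shear (q, z) \<in> extensional ?J"
      using A.shear_extensional[of q z] q by (simp only: idx_Suc(1)[symmetric] space_leb)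
    define N P X where "N = (\<Sum>x\<in>idx k. (q x)\<^sup>2)" and "P = (fst z + snd z - 0)\<^sup>2" and "X = (fst z - q (Inl j))\<^sup>2"
    have nn: "0 \<le> N" "0 \<le> P" "0 \<le> X" by (auto simp: N_def P_def X_def sum_nonneg)
    have sumJ: "(\<Sum>x\<in>?J. (A.shear (q, z) x)\<^sup>2) \<le> 7 * N + 5 * P + 5 * X"
    proof -
      have "(\<Sum>x\<in>idx k - {Inl j}. (A.shear (q, z) x)\<^sup>2) = (\<Sum>x\<in>idx k - {Inl j}. (q x)\<^sup>2)"
        by (intro sum.cong refl) (auto simp: A.shear_other)
      moreover have "N = (q (Inl j))\<^sup>2 + (\<Sum>x\<in>idx k - {Inl j}. (q x)\<^sup>2)"
        unfolding N_def using A.I A.c by (intro sum.remove) auto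
      moreover have "0 \<le> (\<Sum>x\<in>idx k - {Inl j}. (q x)\<^sup>2)" by (simp add: sum_nonneg)
      moreover have "(q (Inl j) - fst z - snd z + snd z)\<^sup>2 = X" by (simp add: X_def power2_commute)
      moreover have "q (Inl j) - fst z - snd z + fst z + snd z = q (Inl j)" by simp
      ultimately show ?thesis
        using sum_squares_J[of "A.shear (q, z)"] unfolding A.shear_simps P_def by simp
    qed
    \<comment> \<open>Half of the combined exponent of the Gaussians i and l absorbs exp(\<epsilon>
      |x|^2) from \<open>jw_le_exp\<close>, the 7 in \<open>small\<close> being the largest
      coefficient in \<open>sumJ\<close>; the other half is the stated bound.\<close>
    have ex: "(jw \<epsilon> ?J (A.shear (q, z)))\<^sup>2 * (exp (- Qf S i (A.shear (q, z))) * exp (- Qf S l (A.shear (q, z)))) \<le> ?w q * (?G i l z * ?H i l (q (Inl j)) z)"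
      if il: "i < L" "l < L" for i l
    proof -
      have X1: "1 / 4 ^ L \<le> 1 / (4::real) ^ i" "1 / 4 ^ L \<le> 1 / (4::real) ^ l" using il by (auto intro!: divide_left_mono power_increasing)
      have X2: "1 / (4::real) ^ L \<le> 4 ^ i" "1 / (4::real) ^ L \<le> 4 ^ l"
        using order.trans[of "1 / (4::real) ^ L" 1] by auto
      have "\<epsilon> * (7 * N) \<le> S * N"
      proof -
        have "S / 4 ^ L \<le> S" using S by (simp add: field_simps)
        then show ?thesis using mult_right_mono[OF order.trans[OF small] nn(1), of S] by (simp add: mult_ac)
      qed
      moreover have "\<epsilon> * (5 * P) \<le> S / 2 * (1 / 4 ^ i + 1 / 4 ^ l) * P"
      proof -
        have "\<epsilon> * 5 \<le> S / 4 ^ L" using small \<epsilon> by linarith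
        also have "\<dots> = S / 2 * (1 / 4 ^ L + 1 / 4 ^ L)" by simp
        also have "\<dots> \<le> S / 2 * (1 / 4 ^ i + 1 / 4 ^ l)" using S X1 by (intro mult_left_mono add_mono) auto
        finally show ?thesis using mult_right_mono[OF _ nn(2)] by (simp add: mult.assoc[symmetric])
      qed
      moreover have "\<epsilon> * (5 * X) \<le> S / 2 * (4 ^ i + 4 ^ l) * X"
      proof -
        have "\<epsilon> * 5 \<le> S / 4 ^ L" using small \<epsilon> by linarith
        also have "\<dots> = S / 2 * (1 / 4 ^ L + 1 / 4 ^ L)" by simp
        also have "\<dots> \<le> S / 2 * (4 ^ i + 4 ^ l)" using S X2 by (intro mult_left_mono add_mono) auto
        finally show ?thesis using mult_right_mono[OF _ nn(3)] by (simp add: mult.assoc[symmetric])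
      qed
      moreover have "\<epsilon> * (\<Sum>x\<in>?J. (A.shear (q, z) x)\<^sup>2) \<le> \<epsilon> * (7 * N) + \<epsilon> * (5 * P) + \<epsilon> * (5 * X)"
        using mult_left_mono[OF sumJ \<epsilon>] by (simp add: distrib_left)
      moreover have "Qf S i (A.shear (q, z)) = S * N + S / 4 ^ i * P + S * 4 ^ i * X" "Qf S l (A.shear (q, z)) = S * N + S / 4 ^ l * P + S * 4 ^ l * X"
        unfolding Qf_shear_A N_def P_def X_def by simp_all
      moreover have "S / 2 * (1 / 4 ^ i + 1 / 4 ^ l) * P = S / 4 ^ i * P / 2 + S / 4 ^ l * P / 2" "S / 2 * (4 ^ i + 4 ^ l) * X = S * 4 ^ i * X / 2 + S * 4 ^ l * X / 2"
        by (simp_all add: algebra_simps add_divide_distrib)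
      ultimately have "\<epsilon> * (\<Sum>x\<in>?J. (A.shear (q, z) x)\<^sup>2) + (- Qf S i (A.shear (q, z)) + - Qf S l (A.shear (q, z))) \<le>
         - (S * N) + (- (S / 2 * (1 / 4 ^ i + 1 / 4 ^ l) * P) + - (S / 2 * (4 ^ i + 4 ^ l) * X))"
        by linarith
      then have "\<epsilon> * (\<Sum>x\<in>?J. (A.shear (q, z) x)\<^sup>2) + (- Qf S i (A.shear (q, z)) + - Qf S l (A.shear (q, z))) \<le>
         - S * N + (- (S / 2 * (1 / 4 ^ i + 1 / 4 ^ l)) * P + - (S / 2 * (4 ^ i + 4 ^ l)) * X)"
        by (simp only: minus_mult_left)
      then have "exp (\<epsilon> * (\<Sum>x\<in>?J. (A.shear (q, z) x)\<^sup>2)) * (exp (- Qf S i (A.shear (q, z))) * exp (- Qf S l (A.shear (q, z)))) \<le> ?w q * (?G i l z * ?H i l (q (Inl j)) z)"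
        unfolding exp_add[symmetric] exp_le_cancel_iff N_def[symmetric] P_def[symmetric] X_def[symmetric] .
      moreover have "(jw \<epsilon> ?J (A.shear (q, z)))\<^sup>2 * (exp (- Qf S i (A.shear (q, z))) * exp (- Qf S l (A.shear (q, z)))) \<le>
         exp (\<epsilon> * (\<Sum>x\<in>?J. (A.shear (q, z) x)\<^sup>2)) * (exp (- Qf S i (A.shear (q, z))) * exp (- Qf S l (A.shear (q, z))))"
        by (intro mult_right_mono jw_le_exp finite_idx \<epsilon>) auto
      ultimately show ?thesis by linarith
    qed
    have "norm (hat (Suc k) (phiL S L) (A.shear (q, z))) = (\<Sum>i<L. exp (- Qf S i (A.shear (q, z))))"
      unfolding hat_phiL[OF S ext] hL_def of_real_sum[symmetric] norm_of_real by (simp add: sum_nonneg)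
    then have "?F (A.shear (q, z)) = ennreal ((jw \<epsilon> ?J (A.shear (q, z)) * (\<Sum>i<L. exp (- Qf S i (A.shear (q, z)))))\<^sup>2)"
      by (simp add: ennreal_power jw_nonneg sum_nonneg)
    also have "(jw \<epsilon> ?J (A.shear (q, z)) * (\<Sum>i<L. exp (- Qf S i (A.shear (q, z)))))\<^sup>2 =
       (\<Sum>i<L. \<Sum>l<L. (jw \<epsilon> ?J (A.shear (q, z)))\<^sup>2 * (exp (- Qf S i (A.shear (q, z))) * exp (- Qf S l (A.shear (q, z)))))"
    proof -
      have "(a * u)\<^sup>2 = a\<^sup>2 * (u * u)" for a u :: real by (simp add: power2_eq_square)
      then show ?thesis by (simp only: sum_product) (simp only: sum_distrib_left)
    qed
    also have "ennreal \<dots> \<le> ennreal (\<Sum>i<L. \<Sum>l<L. ?w q * (?G i l z * ?H i l (q (Inl j)) z))"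
      by (intro ennreal_leI sum_mono ex) auto
    also have "(\<Sum>i<L. \<Sum>l<L. ?w q * (?G i l z * ?H i l (q (Inl j)) z)) = ?w q * (\<Sum>i<L. \<Sum>l<L. ?G i l z * ?H i l (q (Inl j)) z)"
      by (simp only: sum_distrib_left)
    also have "ennreal \<dots> = ennreal (?w q) * (\<Sum>i<L. \<Sum>l<L. ennreal (?G i l z * ?H i l (q (Inl j)) z))"
      by (subst ennreal_mult') (simp_all add: sum_nonneg flip: sum_ennreal)
    finally show ?thesis .
  qed
  have dbl: "(\<Sum>i<L. \<Sum>l<L. pi / sqrt ((S / 2 * (1 / 4 ^ i + 1 / 4 ^ l)) * (S / 2 * (4 ^ i + 4 ^ l)))) \<le> real L * 4 * (2 * pi / S)"
  proof -
    have "(\<Sum>i<L. \<Sum>l<L. pi / sqrt ((S / 2 * (1 / 4 ^ i + 1 / 4 ^ l)) * (S / 2 * (4 ^ i + 4 ^ l)))) \<le>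
      (\<Sum>i<L. \<Sum>l<L. 2 * pi / S * (1 / 2) ^ (if l \<le> i then i - l else l - i))"
      by (intro sum_mono dyadic_overlap S)
    also have "\<dots> = (\<Sum>i<L. 2 * pi / S * (\<Sum>l<L. (1 / 2) ^ (if l \<le> i then i - l else l - i)))"
      by (simp only: sum_distrib_left)
    also have "\<dots> \<le> (\<Sum>i<L. 2 * pi / S * 4)"
      using S by (intro sum_mono mult_left_mono dyadic_sum) auto
    finally show ?thesis by (simp add: mult_ac)
  qed
  have inner: "(\<integral>\<^sup>+z. ?F (A.shear (q, z)) \<partial>lborel2) \<le> ennreal (real L * 4 * (2 * pi / S)) * ennreal (?w q)"
    if q: "q \<in> space (leb (idx k))" for q
  proof -
    have "(\<Sum>i<L. \<Sum>l<L. \<integral>\<^sup>+z. ennreal (?G i l z * ?H i l (q (Inl j)) z) \<partial>lborel2) =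
       (\<Sum>i<L. \<Sum>l<L. ennreal (pi / sqrt ((S / 2 * (1 / 4 ^ i + 1 / 4 ^ l)) * (S / 2 * (4 ^ i + 4 ^ l)))))"
      using S by (intro sum.cong refl nn_integral_gaussian2) (auto intro!: mult_pos_pos add_pos_pos)
    also have "\<dots> = ennreal (\<Sum>i<L. \<Sum>l<L. pi / sqrt ((S / 2 * (1 / 4 ^ i + 1 / 4 ^ l)) * (S / 2 * (4 ^ i + 4 ^ l))))"
      using S by (simp add: sum_nonneg flip: sum_ennreal)
    also have "\<dots> \<le> ennreal (real L * 4 * (2 * pi / S))" by (rule ennreal_leI[OF dbl])
    finally have dbl': "(\<Sum>i<L. \<Sum>l<L. \<integral>\<^sup>+z. ennreal (?G i l z * ?H i l (q (Inl j)) z) \<partial>lborel2) \<le> ennreal (real L * 4 * (2 * pi / S))" .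
    have "(\<integral>\<^sup>+z. ?F (A.shear (q, z)) \<partial>lborel2) \<le> (\<integral>\<^sup>+z. ennreal (?w q) * (\<Sum>i<L. \<Sum>l<L. ennreal (?G i l z * ?H i l (q (Inl j)) z)) \<partial>lborel2)"
      by (intro nn_integral_mono pw q)
    also have "\<dots> = ennreal (?w q) * (\<Sum>i<L. \<Sum>l<L. \<integral>\<^sup>+z. ennreal (?G i l z * ?H i l (q (Inl j)) z) \<partial>lborel2)"
      by (subst nn_integral_cmult, measurable) (subst nn_integral_sum, measurable, subst nn_integral_sum, measurable)
    also have "\<dots> \<le> ennreal (?w q) * ennreal (real L * 4 * (2 * pi / S))"
      by (intro mult_left_mono dbl') simp
    finally show ?thesis by (simp only: mult.commute)
  qed
  \<comment> \<open>In shear coordinates each overlap is a planar Gaussian on the fibre times a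
    Gaussian in q.\<close>
  have "(\<integral>\<^sup>+x. ?F x \<partial>leb ?J) = (\<integral>\<^sup>+q. \<integral>\<^sup>+z. ?F (A.shear (q, z)) \<partial>lborel2 \<partial>leb (idx k))"
    using A.nn_integral_shear[OF Fm[unfolded idx_Suc(1)]] by (simp only: idx_Suc(1)[symmetric])
  also have "\<dots> \<le> (\<integral>\<^sup>+q. ennreal (real L * 4 * (2 * pi / S)) * ennreal (?w q) \<partial>leb (idx k))"
    by (intro nn_integral_mono inner)
  also have "\<dots> = ennreal (real L * 4 * (2 * pi / S)) * (\<integral>\<^sup>+q. ennreal (?w q) \<partial>leb (idx k))"
  proof (rule nn_integral_cmult)
    have "(\<lambda>q. \<Sum>x\<in>idx k. (q x)\<^sup>2) \<in> borel_measurable (leb (idx k))"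
      by (intro borel_measurable_sum borel_measurable_power leb_component_measurable)
    then show "(\<lambda>q. ennreal (?w q)) \<in> borel_measurable (leb (idx k))" by measurable
  qed
  also have "\<dots> = ennreal (real L * 4 * (2 * pi / S) * (pi / S) ^ k)"
    unfolding nn_integral_gaussian_leb[OF finite_idx S] card_idx power_mult
    using S by (subst ennreal_mult') auto
  finally have "(\<integral>\<^sup>+x. ?F x \<partial>leb ?J) \<le> ennreal (real L * 4 * (2 * pi / S) * (pi / S) ^ k)" .
  then have "ennreal (1 / (2 * pi) ^ (2 * Suc k)) * (\<integral>\<^sup>+x. ?F x \<partial>leb ?J) \<le> ennreal (1 / (2 * pi) ^ (2 * Suc k)) * ennreal (real L * 4 * (2 * pi / S) * (pi / S) ^ k)"
    by (rule mult_left_mono) simp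
  also have "\<dots> = ennreal (1 / (2 * pi) ^ (2 * Suc k) * (real L * 4 * (2 * pi / S) * (pi / S) ^ k))"
    by (rule ennreal_mult'[symmetric]) simp
  finally show ?thesis unfolding R_sq2(2)[OF schwartz_phiL[OF S] \<epsilon>] .
qed

end

context particle
begin

text \<open>The right-hand side is the bound of \<open>R_sq2_upper\<close> times the quotient of the
  two bounds: 41472 is 4 * 36^2 * 8, from (2\<pi>)^2, from the square of L / 36, and from the
  factors 4 and 2 of the upper bound. S cancels, so the quotient grows linearly in L whatever scale
  is chosen.\<close>

lemma ratio_identity:
  fixes S t :: real
  assumes S: "0 < S"
  shows "1 / (2 * pi) ^ (2 * k + 4) * (\<eta> * S * ((pi / S * (real L / 36))\<^sup>2 * (1 / S * (pi / (2 * S)) ^ (k - 1)))) =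
    1 / (2 * pi) ^ (2 * Suc k) * (real L * 4 * (2 * pi / S) * (pi / S) ^ k) * (\<eta> * real L * (1 / (41472 * pi\<^sup>2 * 2 ^ (k - 1))))"
proof -
  define x w P where "x = (pi / S) ^ (k - 1)" and "w = (2::real) ^ (k - 1)" and "P = (2 * pi) ^ (2 * Suc k)"
  have 1: "(pi / (2 * S)) ^ (k - 1) = x / w"
    by (simp add: x_def w_def power_divide power_mult_distrib)
  have 2: "(pi / S) ^ k = pi / S * x"
    using jk by (cases k) (auto simp: x_def)
  have 3: "(2 * pi) ^ (2 * k + 4) = P * (4 * pi\<^sup>2)"
    by (simp add: P_def power_add power2_eq_square eval_nat_numeral)
  have "0 < w" "0 < P" by (auto simp: w_def P_def)
  then show ?thesis
    unfolding 1 2 3 P_def[symmetric] w_def[symmetric] using S by (simp add: power2_eq_square field_simps)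
qed

text \<open>Two demands compete as L grows: for positive \<epsilon> the weights force S above 7
  \<epsilon> 4^L, and the time window of length \<eta> S has to fit into the given interval. Each
  critical case reconciles them, by infinite time or by the fixed scale S = 1.\<close>

theorem unbounded:
  assumes T: "0 < T" and \<epsilon>: "0 \<le> \<epsilon>" and crit: "T = \<infinity> \<or> \<epsilon> = 0"
  shows "\<not> (\<exists>C::real. \<forall>\<phi>. schwartz (Suc k) \<phi> \<longrightarrow>
              L2L2norm T k (RBU \<epsilon> j k \<phi>) \<le> ennreal C * L2norm (Suc k) (R (Suc k) \<epsilon> \<phi>))"
proof
  assume "\<exists>C::real. \<forall>\<phi>. schwartz (Suc k) \<phi> \<longrightarrow>
              L2L2norm T k (RBU \<epsilon> j k \<phi>) \<le> ennreal C * L2norm (Suc k) (R (Suc k) \<epsilon> \<phi>)"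
  then obtain C where C: "\<And>\<phi>. schwartz (Suc k) \<phi> \<Longrightarrow> L2L2norm T k (RBU \<epsilon> j k \<phi>) \<le> ennreal C * L2norm (Suc k) (R (Suc k) \<epsilon> \<phi>)" by blast
  \<comment> \<open>\<open>ennreal\<close> sends negative reals to 0, so a negative C may be
    replaced by 0.\<close>
  define C0 where "C0 = max 0 C"
  have C0: "ennreal C = ennreal C0" "0 \<le> C0" by (auto simp: C0_def max_def ennreal_neg)
  obtain \<eta> where \<eta>: "0 < \<eta>" "\<eta> \<le> 1" "ereal \<eta> \<le> T"
  proof (cases T)
    case (real t)
    then show ?thesis using T by (intro that[of "min 1 t"]) auto
  next
    case PInf
    then show ?thesis by (intro that[of 1]) auto
  qed (use T in auto)
  define D where "D = 1 / (41472 * pi\<^sup>2 * 2 ^ (k - 1))"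
  have D: "0 < D" by (simp add: D_def)
  obtain L0 :: nat where L0: "C0\<^sup>2 / (\<eta> * D) < real L0" using reals_Archimedean2 by blast
  define L where "L = max 72 L0"
  have L: "72 \<le> L" "C0\<^sup>2 / (\<eta> * D) < real L" using L0 by (auto simp: L_def)
  \<comment> \<open>For \<epsilon> = 0 the scale 1 keeps the window inside a finite T, by the choice
    of \<eta>. Otherwise T = \<infinity>; the summand 1 gives positivity and 7 \<epsilon> matches
    \<open>R_sq2_upper\<close>.\<close>
  define S where "S = (if \<epsilon> = 0 then 1 else (1 + 7 * \<epsilon>) * 4 ^ L)"
  have S: "0 < S" using \<epsilon> by (simp add: S_def add_pos_nonneg)
  have small: "7 * \<epsilon> \<le> S / 4 ^ L" using \<epsilon> by (simp add: S_def)
  have t0: "0 < \<eta> * S" "\<eta> * S \<le> S" using \<eta> S by (auto intro: mult_left_le_one_le)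
  have t0T: "ereal (\<eta> * S) \<le> T" using crit \<eta> by (auto simp: S_def)
  let ?Y = "1 / (2 * pi) ^ (2 * Suc k) * (real L * 4 * (2 * pi / S) * (pi / S) ^ k)"
  have Y: "0 < ?Y" using S L by simp
  have "ennreal (?Y * (\<eta> * real L * D)) \<le> tsq2 T k (RBU \<epsilon> j k (phiL S L))"
    using tsq2_lower[OF S L(1) \<epsilon> t0 t0T] unfolding ratio_identity[OF S] D_def .
  also have "\<dots> = (L2L2norm T k (RBU \<epsilon> j k (phiL S L)))\<^sup>2" by (simp only: L2L2norm_eq ennsqrt_power2)
  also have "\<dots> \<le> (ennreal C0 * L2norm (Suc k) (R (Suc k) \<epsilon> (phiL S L)))\<^sup>2"
    using C[OF schwartz_phiL[OF S]] unfolding C0(1) by (rule power_mono) simp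
  also have "\<dots> = ennreal (C0\<^sup>2) * sq2 (Suc k) (R (Suc k) \<epsilon> (phiL S L))"
    using C0(2) by (simp only: L2norm_eq power_mult_distrib ennsqrt_power2 ennreal_power)
  also have "\<dots> \<le> ennreal (C0\<^sup>2) * ennreal ?Y"
    by (intro mult_left_mono R_sq2_upper S \<epsilon> small) simp
  also have "\<dots> = ennreal (?Y * C0\<^sup>2)"
    by (simp only: ennreal_mult'[OF zero_le_power2, symmetric] mult.commute)
  finally have le: "ennreal (?Y * (\<eta> * real L * D)) \<le> ennreal (?Y * C0\<^sup>2)" .
  have "0 \<le> ?Y * C0\<^sup>2" by (intro mult_nonneg_nonneg less_imp_le[OF Y] zero_le_power2)
  from ennreal_le_iff[OF this] le have "?Y * (\<eta> * real L * D) \<le> ?Y * C0\<^sup>2" by blast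
  then have "\<eta> * real L * D \<le> C0\<^sup>2" using Y by (rule mult_left_le_imp_le)
  moreover have "C0\<^sup>2 < \<eta> * real L * D"
    using L(2) \<eta>(1) D by (simp add: pos_divide_less_eq mult_ac)
  ultimately show False by simp
qed

end

theorem theorem1p3:
  shows
    "(\<forall>T::real. \<forall>\<epsilon>::real. 0 < T \<longrightarrow> 0 < \<epsilon> \<longrightarrow>
       (\<exists>C::real. 0 < C \<and>
         (\<forall>k j::nat. 1 \<le> k \<longrightarrow> 1 \<le> j \<longrightarrow> j \<le> k \<longrightarrow>
           (\<forall>\<phi>. schwartz (Suc k) \<phi> \<longrightarrow>
              L2L2norm (ereal T) k (RBU \<epsilon> j k \<phi>) \<le> ennreal C * L2norm (Suc k) (R (Suc k) \<epsilon> \<phi>)) \<and>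
           (\<forall>\<phi> g. R_rel \<epsilon> (Suc k) \<phi> g \<longrightarrow>
              (\<exists>F. RBU_rel (ereal T) \<epsilon> j k \<phi> g F \<and>
                   L2L2norm (ereal T) k F \<le> ennreal C * L2norm (Suc k) g)))))
     \<and>
     (\<forall>T::ereal. \<forall>\<epsilon>::real. 0 < T \<longrightarrow> 0 \<le> \<epsilon> \<longrightarrow> T = \<infinity> \<or> \<epsilon> = 0 \<longrightarrow>
       (\<forall>k j::nat. 1 \<le> k \<longrightarrow> 1 \<le> j \<longrightarrow> j \<le> k \<longrightarrow>
         \<not> (\<exists>C::real. \<forall>\<phi>. schwartz (Suc k) \<phi> \<longrightarrow>
              L2L2norm T k (RBU \<epsilon> j k \<phi>) \<le> ennreal C * L2norm (Suc k) (R (Suc k) \<epsilon> \<phi>))))"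
proof (rule conjI)
  show "\<forall>T::real. \<forall>\<epsilon>::real. 0 < T \<longrightarrow> 0 < \<epsilon> \<longrightarrow>
       (\<exists>C::real. 0 < C \<and>
         (\<forall>k j::nat. 1 \<le> k \<longrightarrow> 1 \<le> j \<longrightarrow> j \<le> k \<longrightarrow>
           (\<forall>\<phi>. schwartz (Suc k) \<phi> \<longrightarrow>
              L2L2norm (ereal T) k (RBU \<epsilon> j k \<phi>) \<le> ennreal C * L2norm (Suc k) (R (Suc k) \<epsilon> \<phi>)) \<and>
           (\<forall>\<phi> g. R_rel \<epsilon> (Suc k) \<phi> g \<longrightarrow>
              (\<exists>F. RBU_rel (ereal T) \<epsilon> j k \<phi> g F \<and>
                   L2L2norm (ereal T) k F \<le> ennreal C * L2norm (Suc k) g))))"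
  proof (intro allI impI)
    fix T \<epsilon> :: real assume T: "0 < T" and \<epsilon>: "0 < \<epsilon>"
    define E where "E = est_const T \<epsilon>"
    have E: "0 \<le> E" unfolding E_def est_const_def using coll_const_nonneg[OF T] by simp
    \<comment> \<open>\<open>2 * E\<close> is the constant of the extension, the larger of the two
      requirements on the square of C; adding 1 ensures positivity, as E is only known to be
      nonnegative.\<close>
    define C where "C = sqrt (2 * E) + 1"
    have C: "0 < C" "0 \<le> C" using E by (auto simp: C_def add_nonneg_pos)
    have "(sqrt (2 * E))\<^sup>2 \<le> C\<^sup>2" unfolding C_def using E by (intro power_mono) auto
    then have CE: "2 * E \<le> C\<^sup>2" "E \<le> C\<^sup>2" using E by auto
    show "\<exists>C::real. 0 < C \<and>
         (\<forall>k j::nat. 1 \<le> k \<longrightarrow> 1 \<le> j \<longrightarrow> j \<le> k \<longrightarrow>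
           (\<forall>\<phi>. schwartz (Suc k) \<phi> \<longrightarrow>
              L2L2norm (ereal T) k (RBU \<epsilon> j k \<phi>) \<le> ennreal C * L2norm (Suc k) (R (Suc k) \<epsilon> \<phi>)) \<and>
           (\<forall>\<phi> g. R_rel \<epsilon> (Suc k) \<phi> g \<longrightarrow>
              (\<exists>F. RBU_rel (ereal T) \<epsilon> j k \<phi> g F \<and>
                   L2L2norm (ereal T) k F \<le> ennreal C * L2norm (Suc k) g)))"
    proof (intro exI[of _ C] conjI allI impI)
      fix k j :: nat assume "1 \<le> k" "1 \<le> j" "j \<le> k"
      then interpret particle j k by unfold_locales
      {
        fix \<phi> assume \<phi>: "schwartz (Suc k) \<phi>"
        have "tsq2 (ereal T) k (RBU \<epsilon> j k \<phi>) \<le> ennreal (C\<^sup>2) * sq2 (Suc k) (R (Suc k) \<epsilon> \<phi>)"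
          using smoothing_sq2[OF T \<epsilon> \<phi>] CE(2) unfolding E_def
          by (meson ennreal_leI mult_right_mono order.trans zero_le)
        then show "L2L2norm (ereal T) k (RBU \<epsilon> j k \<phi>) \<le> ennreal C * L2norm (Suc k) (R (Suc k) \<epsilon> \<phi>)"
          unfolding L2L2norm_eq L2norm_eq by (rule ennsqrt_le_mult[OF C(2)])
      next
        fix \<phi> g assume "R_rel \<epsilon> (Suc k) \<phi> g"
        then obtain F where F: "RBU_rel (ereal T) \<epsilon> j k \<phi> g F" "tsq2 (ereal T) k F \<le> ennreal (2 * est_const T \<epsilon>) * sq2 (Suc k) g"
          using RBU_extension[OF T \<epsilon>] by blast
        have "tsq2 (ereal T) k F \<le> ennreal (C\<^sup>2) * sq2 (Suc k) g"
          using F(2) CE(1) unfolding E_def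
          by (meson ennreal_leI mult_right_mono order.trans zero_le)
        then have "L2L2norm (ereal T) k F \<le> ennreal C * L2norm (Suc k) g"
          unfolding L2L2norm_eq L2norm_eq by (rule ennsqrt_le_mult[OF C(2)])
        with F(1) show "\<exists>F. RBU_rel (ereal T) \<epsilon> j k \<phi> g F \<and> L2L2norm (ereal T) k F \<le> ennreal C * L2norm (Suc k) g"
          by blast
      }
    qed (rule C(1))
  qed
  show "\<forall>T::ereal. \<forall>\<epsilon>::real. 0 < T \<longrightarrow> 0 \<le> \<epsilon> \<longrightarrow> T = \<infinity> \<or> \<epsilon> = 0 \<longrightarrow>
       (\<forall>k j::nat. 1 \<le> k \<longrightarrow> 1 \<le> j \<longrightarrow> j \<le> k \<longrightarrow>
         \<not> (\<exists>C::real. \<forall>\<phi>. schwartz (Suc k) \<phi> \<longrightarrow>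
              L2L2norm T k (RBU \<epsilon> j k \<phi>) \<le> ennreal C * L2norm (Suc k) (R (Suc k) \<epsilon> \<phi>)))"
  proof (intro allI impI)
    fix T :: ereal and \<epsilon> :: real and k j :: nat
    assume *: "0 < T" "0 \<le> \<epsilon>" "T = \<infinity> \<or> \<epsilon> = 0" and "1 \<le> k" "1 \<le> j" "j \<le> k"
    then interpret particle j k by unfold_locales
    show "\<not> (\<exists>C::real. \<forall>\<phi>. schwartz (Suc k) \<phi> \<longrightarrow>
              L2L2norm T k (RBU \<epsilon> j k \<phi>) \<le> ennreal C * L2norm (Suc k) (R (Suc k) \<epsilon> \<phi>))"
      by (rule unbounded[OF *])
  qed
qed

end
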